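(* Consider the specialization $d=\widetilde d=4$, $t_2=\widetilde t_2$, $t_4=\widetilde t_4$, $t_3=\widetilde t_3=0$ (symmetric Ising quadrangulations). Let $\gamma,\alpha_1,\alpha_3$ be the algebraic functions of $c,t_2,t_4,t$ determined by \[ t_4=\frac{c\alpha_3}{\gamma^3},\qquad t_2=c\alpha_1\frac{\gamma-3\alpha_3}{\gamma^2},\qquad t=c(\gamma^2-\alpha_1^2-3\alpha_3^2). \] Then the pair $(\omega,\widehat f(\omega))$ admits the following explicit rational parametrization in terms of a formal variable $h$, i.e. the algebraic curve on which $(\omega,\widehat f(\omega))$ lies is the image of $h\mapsto(\omega_{\mathrm{sym}}(h),\widehat f_{\mathrm{sym}}(h))$: \[ \omega_{\mathrm{sym}}(h)=\frac{(\alpha_3h+\gamma)^2\gamma^3h}{(\gamma h+\alpha_3)^2\alpha_3},\qquad \widehat f_{\mathrm{sym}}(h)=-c\,\frac{\big(\alpha_3\gamma h^2+h(\alpha_1^2-2\alpha_3\gamma)+\alpha_3\gamma\big)(\gamma h+\alpha_3)^3}{(\alpha_3h+\gamma)\gamma^4(h-1)^2h^2}. \]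
   Context: A hypermap with a boundary is a planar map (connected multigraph embedded in the sphere, up to deformation) with a distinguished face, the boundary, carrying a distinguished corner (the root); every other (inner) face is colored black or white so that inner faces sharing an edge have different colors. Fix integers $d,\widetilde d\ge 2$; white inner faces have degree in $\{2,\dots,d\}$ and black inner faces degree in $\{2,\dots,\widetilde d\}$. For a word $P=P_1\cdots P_\ell$ over $\{A,B\}$, a hypermap with boundary condition $P$ has a boundary of length $\ell$ such that, walking clockwise from the root, the $i$-th visited boundary edge-side is either incident to an inner face which is black if $P_i=A$ and white if $P_i=B$, or is one side of a bridge incident to the boundary on both sides, visited at steps $i,j$ with $\{P_i,P_j\}=\{A,B\}$. Define $\langle P\rangle=\sum t^{\#\text{vertices}}c^{-\#\text{edges}}\prod_i t_i^{\#\text{white faces of degree } i}\prod_j\widetilde t_j^{\#\text{black faces of degree }j}$, summed over hypermaps with boundary condition $P$, with $\langle 1\rangle=t$ for the empty word (vertex map); extend linearly to formal series in the non-commuting letters $A,B$, e.g. $(\omega-BA)^{-1}=\sum_{k\ge0}\omega^{-k-1}(BA)^k$. The main series is $\widehat f(\omega)=\langle(\omega-BA)^{-1}\rangle-c$, the generating function of hypermaps with alternating boundary (shifted by $-c$). Here $\gamma$ is the formal power series branch with $\gamma^2=ct/(c^2-t_2^2)+O(t^2)$. *)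

theory Defs
  imports "HOL-Computational_Algebra.Computational_Algebra" "HOL-Combinatorics.Orbits"
begin

section \<open>Planar hypermaps with a boundary\<close>

text \<open>
  A rooted map with at least one edge is encoded as a combinatorial map. A dart is an edge-side,
  oriented so as to have its incident face on its left. The involution \<open>edge_inv\<close> exchanges the two
  sides of an edge, and \<open>face_perm\<close> sends a dart to the next one along the contour of its face, so
  that \<open>face_perm \<circ> edge_inv\<close> permutes the darts having a given origin. The root corner is
  represented by the dart that follows it along the boundary face. When the boundary is drawn as
  the unbounded face, following \<open>face_perm\<close> along it keeps that face on the left, which is walking
  clockwise. The colouring is given by the set of black inner faces.
\<close>

record hypermap =
  num_edges :: nat
  edge_inv :: "nat \<Rightarrow> nat"
  face_perm :: "nat \<Rightarrow> nat"
  root_dart :: nat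
  black_faces :: "nat set set"

definition darts :: "hypermap \<Rightarrow> nat set" where
  "darts M = {..<2 * num_edges M}"

definition vertices_of :: "hypermap \<Rightarrow> nat set set" where
  "vertices_of M = orbit (face_perm M \<circ> edge_inv M) ` darts M"

definition faces_of :: "hypermap \<Rightarrow> nat set set" where
  "faces_of M = orbit (face_perm M) ` darts M"

definition boundary :: "hypermap \<Rightarrow> nat set" where
  "boundary M = orbit (face_perm M) (root_dart M)"

definition white_faces :: "hypermap \<Rightarrow> nat set set" where
  "white_faces M = faces_of M - {boundary M} - black_faces M"

definition planar_rooted_map :: "hypermap \<Rightarrow> bool" where
  "planar_rooted_map M \<longleftrightarrow>
     edge_inv M permutes darts M \<and>
     (\<forall>x\<in>darts M. edge_inv M x \<noteq> x \<and> edge_inv M (edge_inv M x) = x) \<and>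
     face_perm M permutes darts M \<and>
     root_dart M \<in> darts M \<and>
     (\<forall>x\<in>darts M. \<forall>y\<in>darts M.
        (x, y) \<in> ({(z, edge_inv M z) | z. z \<in> darts M} \<union> {(z, face_perm M z) | z. z \<in> darts M})\<^sup>*) \<and>
     card (vertices_of M) + card (faces_of M) = num_edges M + 2"

text \<open>
  The colour condition is imposed on the two sides of every edge not incident to the boundary; in
  particular no inner face is incident to both sides of the same edge.
\<close>

definition properly_coloured :: "hypermap \<Rightarrow> bool" where
  "properly_coloured M \<longleftrightarrow>
     black_faces M \<subseteq> faces_of M - {boundary M} \<and>
     (\<forall>x\<in>darts M. x \<notin> boundary M \<longrightarrow> edge_inv M x \<notin> boundary M \<longrightarrow>
        (orbit (face_perm M) x \<in> black_faces M) \<noteq>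
        (orbit (face_perm M) (edge_inv M x) \<in> black_faces M))"

datatype letter = LetA | LetB

definition boundary_dart :: "hypermap \<Rightarrow> nat \<Rightarrow> nat" where
  "boundary_dart M i = (face_perm M ^^ i) (root_dart M)"

definition has_boundary_condition :: "hypermap \<Rightarrow> letter list \<Rightarrow> bool" where
  "has_boundary_condition M P \<longleftrightarrow>
     card (boundary M) = length P \<and>
     (\<forall>i<length P. let y = edge_inv M (boundary_dart M i) in
        if y \<in> boundary M
        then \<exists>j<length P. y = boundary_dart M j \<and> {P ! i, P ! j} = {LetA, LetB}
        else orbit (face_perm M) y \<in> (case P ! i of LetA \<Rightarrow> black_faces M | LetB \<Rightarrow> white_faces M))"

definition hypermaps :: "nat \<Rightarrow> nat \<Rightarrow> letter list \<Rightarrow> hypermap set" where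
  "hypermaps d d' P = {M. planar_rooted_map M \<and> properly_coloured M \<and>
     (\<forall>F\<in>white_faces M. card F \<in> {2..d}) \<and> (\<forall>F\<in>black_faces M. card F \<in> {2..d'}) \<and>
     has_boundary_condition M P}"

text \<open>
  Maps are considered up to deformation of the sphere, that is, up to relabelling of the darts.
\<close>

definition hypermap_iso :: "(hypermap \<times> hypermap) set" where
  "hypermap_iso = {(M, N). num_edges N = num_edges M \<and>
     (\<exists>p. p permutes darts M \<and>
        edge_inv N = p \<circ> edge_inv M \<circ> inv p \<and>
        face_perm N = p \<circ> face_perm M \<circ> inv p \<and>
        root_dart N = p (root_dart M) \<and>
        black_faces N = (`) p ` black_faces M)}"


section \<open>Generating functions\<close>

definition face_weight ::
  "nat \<Rightarrow> nat \<Rightarrow> (nat \<Rightarrow> 'a) \<Rightarrow> (nat \<Rightarrow> 'a) \<Rightarrow> hypermap \<Rightarrow> 'a::comm_ring_1" where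
  "face_weight d d' tw tb M =
     (\<Prod>i=2..d. tw i ^ card {F \<in> white_faces M. card F = i}) *
     (\<Prod>j=2..d'. tb j ^ card {F \<in> black_faces M. card F = j})"

text \<open>The coefficient of \<open>t ^ v * c powi (- e)\<close> in the generating function of a nonempty word.\<close>

definition bracket_coeff ::
  "nat \<Rightarrow> nat \<Rightarrow> (nat \<Rightarrow> 'a) \<Rightarrow> (nat \<Rightarrow> 'a) \<Rightarrow> letter list \<Rightarrow> nat \<Rightarrow> nat \<Rightarrow> 'a::comm_ring_1" where
  "bracket_coeff d d' tw tb P v e =
     (\<Sum>C \<in> {M \<in> hypermaps d d' P. card (vertices_of M) = v \<and> num_edges M = e} // hypermap_iso.
        face_weight d d' tw tb (SOME M. M \<in> C))"

text \<open>
  Because of faces of degree 2, infinitely many maps share the same number of vertices, and the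
  coefficient of a power of \<open>t\<close> is a series in \<open>1/c\<close>. As the leading term of \<open>\<gamma>\<close> is a square root of
  \<open>c t / (c\<^sup>2 - t\<^sub>2\<^sup>2)\<close>, square roots of \<open>t\<close> and of \<open>1/c\<close> have to be adjoined: the field of coefficients
  is \<open>'a fls fls\<close>, where the outer variable is \<open>t\<close> to the power 1/2 and the inner one is \<open>c\<close> to the
  power -1/2.
\<close>

definition c_var :: "'a::field fls fls" where
  "c_var = fls_const (fls_X_inv ^ 2)"

definition t_var :: "'a::field fls fls" where
  "t_var = fls_X ^ 2"

definition scal :: "'a::field \<Rightarrow> 'a fls fls" where
  "scal a = fls_const (fls_const a)"

definition bracket ::
  "nat \<Rightarrow> nat \<Rightarrow> (nat \<Rightarrow> 'a) \<Rightarrow> (nat \<Rightarrow> 'a) \<Rightarrow> letter list \<Rightarrow> 'a::field fls fls" where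
  "bracket d d' tw tb P =
     (if P = [] then t_var
      else fls_compose_power (fps_to_fls (Abs_fps (\<lambda>v.
             fls_compose_power (fps_to_fls (Abs_fps (bracket_coeff d d' tw tb P v))) 2))) 2)"

text \<open>
  Series in \<open>1/\<omega>\<close> are elements of \<open>'a fls fls fls\<close>, whose outermost variable is \<open>1/\<omega>\<close>.
\<close>

definition omega_var :: "'a::field fls fls fls" where
  "omega_var = fls_X_inv"

definition fhat :: "nat \<Rightarrow> nat \<Rightarrow> (nat \<Rightarrow> 'a) \<Rightarrow> (nat \<Rightarrow> 'a) \<Rightarrow> 'a::field fls fls fls" where
  "fhat d d' tw tb =
     fls_X * fps_to_fls (Abs_fps (\<lambda>k. bracket d d' tw tb (concat (replicate k [LetB, LetA]))))
     - fls_const c_var"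

definition ising_weights :: "'a \<Rightarrow> 'a \<Rightarrow> nat \<Rightarrow> 'a::zero" where
  "ising_weights t2 t4 i = (if i = 2 then t2 else if i = 4 then t4 else 0)"


section \<open>The rational parametrization\<close>

definition omega_sym :: "'k \<Rightarrow> 'k \<Rightarrow> 'k \<Rightarrow> 'k::field" where
  "omega_sym \<gamma> \<alpha>3 h = ((\<alpha>3 * h + \<gamma>)^2 * \<gamma>^3 * h) / ((\<gamma> * h + \<alpha>3)^2 * \<alpha>3)"

definition fhat_sym :: "'k \<Rightarrow> 'k \<Rightarrow> 'k \<Rightarrow> 'k \<Rightarrow> 'k \<Rightarrow> 'k::field" where
  "fhat_sym c \<gamma> \<alpha>1 \<alpha>3 h =
     - c * (((\<alpha>3 * \<gamma> * h^2 + h * (\<alpha>1^2 - 2 * \<alpha>3 * \<gamma>) + \<alpha>3 * \<gamma>) * (\<gamma> * h + \<alpha>3)^3) /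
            ((\<alpha>3 * h + \<gamma>) * \<gamma>^4 * (h - 1)^2 * h^2))"

text \<open>
  The ideal of the Zariski closure, over \<open>'k\<close>, of a point \<open>(x, y)\<close> with coordinates in an extension
  \<open>'l\<close> of \<open>'k\<close>; in \<open>Q :: 'k poly poly\<close> the inner variable is \<open>x\<close> and the outer one is \<open>y\<close>.
\<close>

definition vanishing_ideal ::
  "('k::comm_ring_1 \<Rightarrow> 'l::comm_ring_1) \<Rightarrow> 'l \<Rightarrow> 'l \<Rightarrow> 'k poly poly set" where
  "vanishing_ideal emb x y = {Q. poly (map_poly (\<lambda>q. poly (map_poly emb q) x) Q) y = 0}"

definition const_ratfun :: "'k::field \<Rightarrow> 'k poly fract" where
  "const_ratfun a = to_fract [:a:]"

definition h_var :: "'k::field poly fract" where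
  "h_var = to_fract [:0, 1:]"

end

theory Submission
  imports Defs "HOL-Combinatorics.Cycles"
begin

text \<open>
  Peeling the root edge of a hypermap, either by removing the inner face behind it or by cutting a
  bridge, gives Tutte's equation \<open>c <L P> = \<Sum>\<^sub>j t\<^sub>j <L'\<^sup>j\<^sup>-\<^sup>1 P> + \<Sum> <P\<^sub>1> <P\<^sub>2>\<close>, where \<open>L'\<close> is the letter opposite
  to \<open>L\<close> and the last sum runs over the decompositions \<open>P = P\<^sub>1 L' P\<^sub>2\<close>. It is proved for labelled
  maps, encoded by permutations, and transferred to isomorphism classes because rooted maps have no
  automorphisms; planarity is multiplicative under cutting thanks to the Euler inequality.

  For the words \<open>A\<^sup>p B\<^sup>q\<close> with \<open>q \<le> 3\<close> and for the words \<open>(BA)\<^sup>k A\<^sup>p\<close> the equations close up, and each system has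
  a unique solution. The first is solved by the parametrization \<open>x = \<gamma> z + \<alpha>\<^sub>1 / z + \<alpha>\<^sub>3 / z\<^sup>3\<close> of the monochromatic
  disk function. The second becomes a kernel equation for a series in \<open>x\<close> with coefficients in the
  series in \<open>1/\<omega>\<close>. With \<open>h = 1 / (\<rho> j)\<close> and \<open>\<rho> = \<alpha>\<^sub>3 / \<gamma>\<close>, its kernel is a product of two quadratic polynomials, which gives
  \<open>\<omega>\<close> and the alternating series as rational functions of \<open>j\<close>. Finally \<open>h\<close> is transcendental over the field of coefficients, so the
  point \<open>(\<omega>, f)\<close> satisfies the same polynomial equations as the generic point of the curve.
\<close>
section \<open>Permutations, cycles and the Euler inequality\<close>

text \<open>Neither system is solved directly. Each peeling step removes an edge, so the disk
  equations are contractions in \<open>1/c\<close>, and the alternating ones in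
  \<open>1/\<omega>\<close>; a candidate that satisfies them is therefore the solution, and checking
  it comes down to polynomial identities. The obstacle is that removing the part polynomial in
  \<open>x\<close> brings in a few low coefficients that are not known beforehand. They are
  identified by comparing the lowest orders of an identity divisible by a power of the variable,
  which works because \<open>t4\<close> is nonzero. The words \<open>A^p B^q\<close> stop at
  \<open>q = 3\<close> because a square behind the root edge replaces one letter by three opposite
  ones. Equal weights for both colours allow all inner faces to be kept as the cycles of one
  permutation, weighted by degree alone. In the kernel equation one quadratic factor is an
  invertible series and the other is not; the two roots of the latter impose two conditions, enough
  for the alternating series and the one unknown coefficient on the right-hand side. The sign of
  \<open>\<gamma>\<close> remains free throughout: only \<open>\<gamma>^2\<close>,
  \<open>\<alpha>1 / \<gamma>\<close> and \<open>\<alpha>3 / \<gamma>\<close> matter.\<close>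

definition ncyc :: "('a \<Rightarrow> 'a) \<Rightarrow> 'a set \<Rightarrow> nat" where
  "ncyc f D = card (orbit f ` D)"

text \<open>For a bijection \<open>f\<close> this erases \<open>x\<close> from its cycle: the
  predecessor of \<open>x\<close> is sent to \<open>f x\<close>, and \<open>x\<close> becomes a
  fixed point.\<close>

definition skip :: "'a \<Rightarrow> ('a \<Rightarrow> 'a) \<Rightarrow> 'a \<Rightarrow> 'a" where
  "skip x f = transpose x (f x) \<circ> f"

section \<open>Cycles of a permutation multiplied by a transposition\<close>

lemma perm_self_in_orbit:
  assumes "f permutes D" "finite D" shows "x \<in> orbit f x"
  by (rule permutation_self_in_orbit) (use assms permutation_permutes in blast)

lemma perm_orbit_eq:
  assumes "f permutes D" "finite D" "y \<in> orbit f x" shows "orbit f y = orbit f x"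
  by (rule orbit_cyclic_eq3[OF cyclic_on_orbit[OF assms(1,2)] assms(3)])

lemma orbit_subset_closed:
  assumes "f ` S \<subseteq> S" "x \<in> S" shows "orbit f x \<subseteq> S"
proof
  fix y assume "y \<in> orbit f x"
  then show "y \<in> S" by induct (use assms in auto)
qed

lemma orbit_closed: "f ` orbit f x \<subseteq> orbit f x"
  by (auto intro: orbit.step)

lemma closed_complement:
  assumes "f permutes D" "finite D" "S \<subseteq> D" "f ` S \<subseteq> S"
  shows "f ` (D - S) \<subseteq> D - S"
proof -
  have "f ` S = S"
    using assms by (meson endo_inj_surj finite_subset inj_on_subset permutes_inj_on subset_UNIV)
  then show ?thesis
    using assms(1) by (metis image_set_diff permutes_image permutes_inj subset_refl)
qed

text \<open>A set containing both or neither of \<open>x\<close> and \<open>y\<close> is closed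
  under \<open>g\<close> exactly when it is closed under \<open>f\<close>. Everything follows from
  this once \<open>x\<close> and \<open>y\<close> are known to lie on one cycle of
  \<open>g\<close>.\<close>

lemma orbit_transpose_merge:
  assumes f: "f permutes D" "finite D" and xy: "x \<in> D" "y \<in> D" "y \<notin> orbit f x"
  defines "g \<equiv> f \<circ> transpose x y"
  shows "z \<in> orbit f x \<union> orbit f y \<Longrightarrow> orbit g z = orbit f x \<union> orbit f y"
    and "z \<notin> orbit f x \<union> orbit f y \<Longrightarrow> orbit g z = orbit f z"
proof -
  have g: "g permutes D"
    unfolding g_def using f(1) permutes_swap_id[OF xy(1,2)] permutes_compose by blast
  note self = perm_self_in_orbit[OF f] perm_self_in_orbit[OF g f(2)]
  note eq = perm_orbit_eq[OF f] perm_orbit_eq[OF g f(2)]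
  have cl: "g ` S \<subseteq> S \<longleftrightarrow> f ` S \<subseteq> S" if "x \<in> S \<longleftrightarrow> y \<in> S" for S
  proof -
    have "transpose x y ` S = S"
      using that by (simp add: transpose_image_eq)
    then show ?thesis by (metis g_def image_comp)
  qed
  have disj: "orbit f x \<inter> orbit f y = {}"
    using eq(1) self(1) xy(3) by (metis disjoint_iff)
  \<comment> \<open>Otherwise \<open>f\<close> and \<open>g\<close> agree on the part of
    \<open>orbit g x\<close> inside \<open>orbit f y\<close>. This part contains
    \<open>g x = f y\<close>, so it is closed under \<open>f\<close> and contains the whole cycle of
    \<open>y\<close>.\<close>
  have "y \<in> orbit g x"
  proof (rule ccontr)
    assume ny: "y \<notin> orbit g x"
    let ?S = "orbit g x \<inter> orbit f y"
    have gx: "g x = f y" by (simp add: g_def)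
    have "f y \<in> ?S" using gx by (metis IntI orbit.base)
    moreover have "f ` ?S \<subseteq> ?S"
    proof (rule image_subsetI)
      fix z assume z: "z \<in> ?S"
      then have "z \<noteq> y" "z \<noteq> x" using ny disj self(1) by auto
      then have "g z = f z" by (simp add: g_def)
      then show "f z \<in> ?S" using z by (metis IntD1 IntD2 IntI orbit.step)
    qed
    ultimately have "orbit f (f y) \<subseteq> ?S" by (rule orbit_subset_closed[rotated])
    moreover have "orbit f (f y) = orbit f y" by (simp add: eq(1) orbit.base)
    ultimately show False using self(1)[of y] ny by blast
  qed
  then have y: "x \<in> orbit g x" "y \<in> orbit g x" using self(2) by auto
  then have "f ` orbit g x \<subseteq> orbit g x" using cl[of "orbit g x"] orbit_closed[of g x] by simp
  then have sub: "orbit f x \<union> orbit f y \<subseteq> orbit g x"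
    using y by (simp add: orbit_subset_closed)
  have "g ` (orbit f x \<union> orbit f y) \<subseteq> orbit f x \<union> orbit f y"
    by (subst cl) (use self(1)[of x] self(1)[of y] in \<open>auto intro: orbit.step\<close>)
  then have gx: "orbit g x = orbit f x \<union> orbit f y"
    using sub self(1) by (intro antisym orbit_subset_closed) auto
  show "orbit g z = orbit f x \<union> orbit f y" if "z \<in> orbit f x \<union> orbit f y"
    using that gx eq(2) by blast
  show "orbit g z = orbit f z" if z: "z \<notin> orbit f x \<union> orbit f y"
  proof (rule antisym)
    have "x \<notin> orbit f z" "y \<notin> orbit f z"
      using z eq(1) self(1) by blast+
    then have "g ` orbit f z \<subseteq> orbit f z" using cl[of "orbit f z"] orbit_closed[of f z] by simp
    then show "orbit g z \<subseteq> orbit f z" using self(1) orbit_subset_closed by metis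
    then have "x \<notin> orbit g z" "y \<notin> orbit g z"
      using \<open>x \<notin> orbit f z\<close> \<open>y \<notin> orbit f z\<close> by auto
    then have "f ` orbit g z \<subseteq> orbit g z" using cl[of "orbit g z"] orbit_closed[of g z] by simp
    then show "orbit f z \<subseteq> orbit g z" using self(2) orbit_subset_closed by metis
  qed
qed

lemma ncyc_transpose_merge:
  assumes f: "f permutes D" "finite D" and xy: "x \<in> D" "y \<in> D" "y \<notin> orbit f x"
  shows "ncyc (f \<circ> transpose x y) D + 1 = ncyc f D"
proof -
  let ?g = "f \<circ> transpose x y"
  let ?R = "orbit f ` (D - (orbit f x \<union> orbit f y))"
  note self = perm_self_in_orbit[OF f]
  note eq = perm_orbit_eq[OF f]
  have sub: "orbit f x \<subseteq> D" "orbit f y \<subseteq> D" using permutes_orbit_subset f xy by metis+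
  have nin: "orbit f z \<notin> {orbit f x, orbit f y, orbit f x \<union> orbit f y}"
    if "z \<notin> orbit f x \<union> orbit f y" for z
    using that self by blast
  have ne: "orbit f x \<noteq> orbit f y" using self xy by blast
  have D: "D = (orbit f x \<union> orbit f y) \<union> (D - (orbit f x \<union> orbit f y))" using sub by blast
  have "orbit f ` (orbit f x \<union> orbit f y) = {orbit f x, orbit f y}"
    using self[of x] self[of y] by (intro antisym image_subsetI) (auto dest: eq intro!: image_eqI[of _ _ x] image_eqI[of _ _ y])
  then have 1: "orbit f ` D = insert (orbit f x) (insert (orbit f y) ?R)"
    by (subst D) (simp only: image_Un, auto)
  have "orbit ?g ` (orbit f x \<union> orbit f y) = {orbit f x \<union> orbit f y}"
    using orbit_transpose_merge(1)[OF assms] self[of x] by (intro antisym image_subsetI) (auto intro!: image_eqI[of _ _ x])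
  moreover have "orbit ?g ` (D - (orbit f x \<union> orbit f y)) = ?R"
    using orbit_transpose_merge(2)[OF assms] by (intro image_cong) auto
  ultimately have 2: "orbit ?g ` D = insert (orbit f x \<union> orbit f y) ?R"
    by (subst D) (simp only: image_Un, auto)
  have fin: "finite ?R" using f(2) by simp
  have "orbit f x \<notin> insert (orbit f y) ?R" "orbit f y \<notin> ?R" "orbit f x \<union> orbit f y \<notin> ?R"
    using nin ne by (fastforce, fastforce, fastforce)
  then show ?thesis unfolding ncyc_def 1 2 using fin by simp
qed

text \<open>The arc from \<open>f x\<close> to \<open>y\<close> along the cycle of \<open>f\<close>
  becomes closed, because \<open>y\<close> is now sent to \<open>f x\<close>; this arc does not meet
  \<open>x\<close>.\<close>

lemma orbit_transpose_split:
  assumes f: "f permutes D" "finite D" and xy: "x \<in> D" "y \<in> D" "x \<noteq> y" "y \<in> orbit f x"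
  shows "x \<notin> orbit (f \<circ> transpose x y) y"
proof -
  let ?g = "f \<circ> transpose x y"
  define k where "k = (LEAST n. 0 < n \<and> (f ^^ n) x = y)"
  have ex: "\<exists>n. 0 < n \<and> (f ^^ n) x = y" using xy(4) by (auto simp: orbit_altdef)
  have k: "0 < k" "(f ^^ k) x = y" using LeastI_ex[OF ex] by (auto simp: k_def)
  have least: "k \<le> n" if "0 < n" "(f ^^ n) x = y" for n
    using that by (auto simp: k_def intro: Least_le)
  let ?S = "(\<lambda>i. (f ^^ i) x) ` {1..k}"
  have nx: "(f ^^ i) x \<noteq> x" if "i \<in> {1..k}" for i
  proof
    assume e: "(f ^^ i) x = x"
    show False
    proof (cases "i = k")
      case True then show False using e k xy(3) by simp
    next
      case False
      then have i: "0 < i" "i < k" using that by auto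
      have "(f ^^ (k - i)) ((f ^^ i) x) = y"
        using k(2) i by (metis add_diff_inverse_nat comp_apply funpow_add add.commute less_imp_not_less)
      then have "k \<le> k - i" using least[of "k - i"] i e by simp
      then show False using i by simp
    qed
  qed
  have "?g ` ?S \<subseteq> ?S"
  proof (rule image_subsetI)
    fix z assume "z \<in> ?S"
    then obtain i where i: "i \<in> {1..k}" "z = (f ^^ i) x" by blast
    show "?g z \<in> ?S"
    proof (cases "i = k")
      case True
      then have "?g z = (f ^^ 1) x" using i k by simp
      then show ?thesis using k(1) by (intro image_eqI[of _ _ 1]) auto
    next
      case False
      then have "z \<noteq> y" using least[of i] i by auto
      moreover have "z \<noteq> x" using nx i by auto
      ultimately have "?g z = (f ^^ Suc i) x" using i by simp
      then show ?thesis using False i by (intro image_eqI[of _ _ "Suc i"]) auto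
    qed
  qed
  moreover have "y \<in> ?S" using k by (intro image_eqI[of _ _ k]) auto
  ultimately have "orbit ?g y \<subseteq> ?S" by (rule orbit_subset_closed)
  moreover have "x \<notin> ?S"
  proof
    assume "x \<in> ?S"
    then obtain i where "i \<in> {1..k}" "x = (f ^^ i) x" by blast
    then show False using nx[of i] by simp
  qed
  ultimately show ?thesis by blast
qed

text \<open>Multiplying once more by the same transposition gives back \<open>f\<close>, so this is
  the merging count read backwards.\<close>

lemma ncyc_transpose_split:
  assumes f: "f permutes D" "finite D" and xy: "x \<in> D" "y \<in> D" "x \<noteq> y" "y \<in> orbit f x"
  shows "ncyc (f \<circ> transpose x y) D = ncyc f D + 1"
proof -
  let ?g = "f \<circ> transpose x y"
  have g: "?g permutes D"
    using f(1) permutes_swap_id[OF xy(1,2)] permutes_compose by blast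
  have "ncyc (?g \<circ> transpose y x) D + 1 = ncyc ?g D"
    by (rule ncyc_transpose_merge[OF g f(2) xy(2,1)]) (rule orbit_transpose_split[OF assms])
  moreover have "?g \<circ> transpose y x = f" by (simp add: transpose_commute comp_assoc)
  ultimately show ?thesis by simp
qed

lemma skip_fixes: "inj f \<Longrightarrow> skip x f x = x"
  by (auto simp: skip_def transpose_def)

lemma skip_permutes:
  assumes "f permutes D" "x \<in> D" shows "skip x f permutes D - {x}"
proof -
  have "skip x f permutes D"
    unfolding skip_def using assms by (metis permutes_compose permutes_in_image permutes_swap_id)
  then show ?thesis
    by (rule permutes_superset) (use skip_fixes assms permutes_inj in \<open>auto simp: skip_fixes permutes_inj\<close>)
qed

lemma orbit_fixpoint: "f x = x \<Longrightarrow> orbit f x = {x}"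
  by (simp add: orbit_eq_singleton_iff)

lemma ncyc_insert_fixpoint:
  assumes "f permutes D" "finite D" "x \<notin> D"
  shows "ncyc f (insert x D) = ncyc f D + 1"
proof -
  have "f x = x" using assms permutes_not_in by metis
  then have o: "orbit f x = {x}" by (rule orbit_fixpoint)
  have "{x} \<notin> orbit f ` D"
    using permutes_orbit_subset[OF assms(1)] assms(3) by (metis imageE insert_subset)
  then show ?thesis using assms(2) by (simp add: ncyc_def o)
qed

text \<open>Away from the trivial case \<open>skip x f\<close> is
  \<open>f \<circ> transpose (inv f x) x\<close>, which splits \<open>x\<close> off as a fixed
  point. Taking this point out of the domain compensates for the additional cycle; only a point that
  was already a cycle by itself is lost.\<close>

lemma ncyc_skip:
  assumes f: "f permutes D" "finite D" "x \<in> D"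
  shows "ncyc (skip x f) (D - {x}) + of_bool (f x = x) = ncyc f D"
proof (cases "f x = x")
  case True
  then have s: "skip x f = f" by (simp add: skip_def)
  then have "f permutes D - {x}" using skip_permutes[OF f(1,3)] by simp
  then have "ncyc f (insert x (D - {x})) = ncyc f (D - {x}) + 1"
    using f(2) by (intro ncyc_insert_fixpoint) auto
  then show ?thesis using f(3) by (simp add: insert_absorb s True)
next
  case False
  let ?w = "inv f x"
  have w: "f ?w = x" using f(1) permutes_inverses(1) by metis
  then have wx: "?w \<noteq> x" "?w \<in> D" using False f by (metis, metis permutes_in_image)
  have s: "skip x f = f \<circ> transpose ?w x"
  proof
    fix z
    have i: "f z = f u \<longleftrightarrow> z = u" for u using f(1) by (meson injD permutes_inj)
    show "skip x f z = (f \<circ> transpose ?w x) z"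
      using w wx i[of ?w] i[of x] by (auto simp: skip_def transpose_def)
  qed
  have "x \<in> orbit f ?w" using w orbit.base by metis
  then have "ncyc (skip x f) D = ncyc f D + 1"
    unfolding s by (intro ncyc_transpose_split f wx)
  moreover have "ncyc (skip x f) (insert x (D - {x})) = ncyc (skip x f) (D - {x}) + 1"
    using f skip_permutes[OF f(1,3)] by (intro ncyc_insert_fixpoint) auto
  ultimately show ?thesis using f(3) False by (simp add: insert_absorb)
qed

lemma ncyc_disjoint_comp:
  assumes f: "f permutes A" "finite A" and g: "g permutes B" "finite B" and "A \<inter> B = {}"
  shows "orbit (f \<circ> g) ` (A \<union> B) = orbit f ` A \<union> orbit g ` B"
    and "orbit f ` A \<inter> orbit g ` B = {}"
    and "ncyc (f \<circ> g) (A \<union> B) = ncyc f A + ncyc g B"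
proof -
  have a: "orbit (f \<circ> g) x = orbit f x" if "x \<in> A" for x
  proof (rule orbit_cong0[symmetric, OF that])
    show "f \<in> A \<rightarrow> A" using f(1) by (auto simp: permutes_in_image)
    show "f y = (f \<circ> g) y" if "y \<in> A" for y
      using that assms(5) permutes_not_in[OF g(1), of y] by (auto simp: disjoint_iff)
  qed
  have b: "orbit (f \<circ> g) x = orbit g x" if "x \<in> B" for x
  proof (rule orbit_cong0[symmetric, OF that])
    show "g \<in> B \<rightarrow> B" using g(1) by (auto simp: permutes_in_image)
    show "g y = (f \<circ> g) y" if "y \<in> B" for y
      using that assms(5) permutes_in_image[OF g(1), of y] permutes_not_in[OF f(1), of "g y"]
      by (metis comp_apply disjoint_iff)
  qed
  show 1: "orbit (f \<circ> g) ` (A \<union> B) = orbit f ` A \<union> orbit g ` B"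
    using a b by (auto simp: image_Un)
  show 2: "orbit f ` A \<inter> orbit g ` B = {}"
  proof (rule ccontr)
    assume "orbit f ` A \<inter> orbit g ` B \<noteq> {}"
    then obtain x y where "x \<in> A" "y \<in> B" "orbit f x = orbit g y" by auto
    then show False
      using permutes_orbit_subset[OF f(1), of x] permutes_orbit_subset[OF g(1), of y] assms(5)
        perm_self_in_orbit[OF f, of x] by blast
  qed
  show "ncyc (f \<circ> g) (A \<union> B) = ncyc f A + ncyc g B"
    unfolding ncyc_def 1 using f g 2 by (simp add: card_Un_disjoint)
qed

section \<open>Cyclic permutations given by lists\<close>

lemma cycle_of_list_rotate1:
  assumes "distinct cs" shows "cycle_of_list (rotate1 cs) = cycle_of_list cs"
proof -
  let ?p = "cycle_of_list cs"
  have b: "bij ?p" using cycle_permutes permutes_bij by blast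
  have "?p \<circ> ?p \<circ> inv ?p = cycle_of_list (map ?p cs)"
    by (rule conjugation_of_cycle[OF assms b])
  moreover have "?p \<circ> ?p \<circ> inv ?p = ?p"
    using b by (simp add: comp_assoc surj_iff[THEN iffD1] bij_is_surj)
  moreover have "map ?p cs = rotate1 cs"
    using cyclic_rotation[OF assms, of 1] by simp
  ultimately show ?thesis by simp
qed

lemma cycle_of_list_hd:
  "x \<notin> set xs \<Longrightarrow> cycle_of_list (x # xs) x = (if xs = [] then x else hd xs)"
  by (cases xs) (auto simp: id_outside_supp)

lemma skip_cycle_of_list:
  assumes "x \<notin> set xs" shows "skip x (cycle_of_list (x # xs)) = cycle_of_list xs"
proof (cases xs)
  case Nil then show ?thesis by (auto simp: skip_def)
next
  case (Cons y ys)
  then have "cycle_of_list (x # xs) x = y" using assms by (simp add: cycle_of_list_hd del: cycle_of_list.simps)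
  then show ?thesis using Cons by (simp add: skip_def comp_assoc[symmetric])
qed

lemma cycle_of_list_append:
  "cycle_of_list (xs @ y # ys) = cycle_of_list (xs @ [y]) \<circ> cycle_of_list (y # ys)"
proof (induction xs)
  case (Cons x xs) then show ?case by (cases xs) (auto simp: comp_assoc)
qed simp

text \<open>This moves the transposition of the root edge between the edge involution and the face
  permutation. For an edge beside an inner face the two short cycles are that face and the boundary;
  for a bridge the long cycle is the boundary.\<close>

lemma cycle_of_list_glue:
  assumes "distinct (r # xs @ r' # ys)"
  shows "cycle_of_list (r' # xs) \<circ> cycle_of_list (r # ys) \<circ> transpose r r'
    = cycle_of_list (r # xs @ r' # ys)"
proof -
  let ?t = "transpose r r'"
  have b: "bij ?t" and i: "inv ?t = ?t" by auto
  have m: "map ?t (r' # ys) = r # ys" "map ?t (r # xs) = r' # xs"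
    using assms by (auto intro!: map_idI simp: transpose_def)
  have "distinct (r' # ys)" "distinct (r # xs)" using assms by auto
  then have 1: "?t \<circ> cycle_of_list (r' # ys) \<circ> ?t = cycle_of_list (r # ys)"
    "?t \<circ> cycle_of_list (r # xs) \<circ> ?t = cycle_of_list (r' # xs)"
    using conjugation_of_cycle[OF _ b] m i by metis+
  have tt: "?t \<circ> ?t = id" by simp
  have "cycle_of_list (r' # xs) \<circ> cycle_of_list (r # ys) \<circ> ?t
      = ?t \<circ> cycle_of_list (r # xs) \<circ> (?t \<circ> ?t) \<circ> cycle_of_list (r' # ys) \<circ> (?t \<circ> ?t)"
    unfolding 1[symmetric] by (simp only: comp_assoc)
  also have "\<dots> = (?t \<circ> cycle_of_list (r # xs)) \<circ> cycle_of_list (r' # ys)"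
    by (simp only: tt comp_id id_comp comp_assoc)
  also have "?t \<circ> cycle_of_list (r # xs) = cycle_of_list (r' # r # xs)"
    by (simp add: transpose_commute)
  also have "\<dots> = cycle_of_list (rotate1 (r' # r # xs))"
    by (rule cycle_of_list_rotate1[symmetric]) (use assms in auto)
  also have "\<dots> \<circ> cycle_of_list (r' # ys) = cycle_of_list (r # xs @ r' # ys)"
    using cycle_of_list_append[of "r # xs" r' ys] by simp
  finally show ?thesis .
qed

section \<open>Products of transpositions and Euler's inequality\<close>

primrec transpositions :: "('a \<times> 'a) list \<Rightarrow> 'a \<Rightarrow> 'a" where
  "transpositions [] = id"
| "transpositions (p # ps) = transpositions ps \<circ> transpose (fst p) (snd p)"

lemma involution_transpositions:
  assumes "finite D" "\<alpha> permutes D" "\<And>x. x \<in> D \<Longrightarrow> \<alpha> x \<noteq> x \<and> \<alpha> (\<alpha> x) = x"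
  shows "\<exists>ps. \<alpha> = transpositions ps \<and> 2 * length ps = card D \<and> set ps \<subseteq> D \<times> D \<and> (\<forall>(x,y)\<in>set ps. x \<noteq> y)"
  using assms
proof (induction "card D" arbitrary: D \<alpha> rule: less_induct)
  case less
  show ?case
  proof (cases "D = {}")
    case True
    then show ?thesis using less by (intro exI[of _ "[]"]) auto
  next
    case False
    then obtain x where x: "x \<in> D" by blast
    let ?y = "\<alpha> x"
    have y: "?y \<in> D" "?y \<noteq> x" "\<alpha> ?y = x" using x less by (auto simp: permutes_in_image)
    let ?D = "D - {x, ?y}"
    let ?\<beta> = "\<alpha> \<circ> transpose x ?y"
    have "card ?D = card D - card {x, ?y}"
      using x y less(2) by (intro card_Diff_subset) auto
    moreover have "card {x, ?y} \<le> card D" using x y less(2) by (intro card_mono) auto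
    moreover have "card {x, ?y} = 2" using y(2) by simp
    ultimately have c: "card D = card ?D + 2" "card ?D < card D" by linarith+
    have "?\<beta> permutes D" using permutes_compose[OF permutes_swap_id[OF x y(1)] less(3)] .
    then have p: "?\<beta> permutes ?D" by (rule permutes_superset) (use y in auto)
    have "?\<beta> z = \<alpha> z" if "z \<in> ?D" for z using that by (auto simp: transpose_def)
    moreover have "\<alpha> z \<in> ?D" if "z \<in> ?D" for z
      using that y less(3,4) by (metis DiffD1 DiffD2 DiffI insert_iff permutes_in_image singletonD)
    ultimately have "?\<beta> z \<noteq> z \<and> ?\<beta> (?\<beta> z) = z" if "z \<in> ?D" for z using that less(4) by auto
    then obtain ps where ps: "?\<beta> = transpositions ps" "2 * length ps = card ?D" "set ps \<subseteq> ?D \<times> ?D"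
      "\<forall>(x,y)\<in>set ps. x \<noteq> y"
      using less(1)[OF c(2) _ p] less(2) by blast
    have "\<alpha> = ?\<beta> \<circ> transpose x ?y" by (simp add: comp_assoc)
    then have "\<alpha> = transpositions ((x, ?y) # ps)" using ps(1) by simp
    moreover have "2 * length ((x, ?y) # ps) = card D" using ps(2) c by simp
    moreover have "set ((x, ?y) # ps) \<subseteq> D \<times> D" using ps(3) x y by auto
    moreover have "\<forall>(u,v)\<in>set ((x, ?y) # ps). u \<noteq> v" using ps(4) y by auto
    ultimately show ?thesis by blast
  qed
qed

text \<open>The cycles of \<open>\<rho>\<close> are the connected components: a transposition that joins two of them also
  merges two cycles of the running product, any other one splits at most one cycle.\<close>

lemma euler_inequality_transpositions:
  assumes "finite D" "\<phi> permutes D" "set ps \<subseteq> D \<times> D" "\<forall>(x,y)\<in>set ps. x \<noteq> y"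
  shows "\<exists>\<rho>. \<rho> permutes D \<and> (\<forall>z\<in>D. \<phi> z \<in> orbit \<rho> z) \<and>
    (\<forall>z\<in>D. (\<phi> \<circ> transpositions ps) z \<in> orbit \<rho> z) \<and> \<phi> \<circ> transpositions ps permutes D \<and>
    ncyc (\<phi> \<circ> transpositions ps) D + ncyc \<phi> D \<le> length ps + 2 * ncyc \<rho> D"
  using assms(3,4)
proof (induction ps)
  case Nil
  then show ?case using assms(2) by (intro exI[of _ \<phi>]) (auto intro: orbit.base)
next
  case (Cons p ps)
  obtain x y where p: "p = (x, y)" by force
  have xy: "x \<in> D" "y \<in> D" "x \<noteq> y" using Cons p by auto
  let ?\<psi> = "\<phi> \<circ> transpositions ps" and ?t = "transpose x y"
  have "set ps \<subseteq> D \<times> D" "\<forall>(x,y)\<in>set ps. x \<noteq> y" using Cons.prems by auto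
  from Cons.IH[OF this] obtain \<rho> where \<rho>0: "\<rho> permutes D" "\<forall>z\<in>D. \<phi> z \<in> orbit \<rho> z"
    "\<forall>z\<in>D. ?\<psi> z \<in> orbit \<rho> z" "?\<psi> permutes D"
    "ncyc ?\<psi> D + ncyc \<phi> D \<le> length ps + 2 * ncyc \<rho> D"
    by (elim exE conjE)
  note \<rho> = \<rho>0(1) \<rho>0(2)[rule_format] \<rho>0(3)[rule_format] \<rho>0(4,5)
  have eq: "\<phi> \<circ> transpositions (p # ps) = ?\<psi> \<circ> ?t" by (simp add: p comp_assoc)
  have perm: "?\<psi> \<circ> ?t permutes D"
    using permutes_compose[OF permutes_swap_id[OF xy(1,2)] \<rho>(4)] .
  have tD: "?t z \<in> D" if "z \<in> D" for z using that xy by (auto simp: transpose_def)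
  note oeq = perm_orbit_eq[OF \<rho>(1) assms(1)]
  note self = perm_self_in_orbit[OF \<rho>(1) assms(1)]
  show ?case
  proof (cases "y \<in> orbit \<rho> x")
    case True
    have "?t z \<in> orbit \<rho> z" for z
      using True self oeq by (metis transpose_def)
    then have 1: "(?\<psi> \<circ> ?t) z \<in> orbit \<rho> z" if "z \<in> D" for z
      using \<rho>(3)[OF tD[OF that]] oeq by (metis comp_apply)
    have "ncyc (?\<psi> \<circ> ?t) D \<le> ncyc ?\<psi> D + 1"
      using ncyc_transpose_merge[OF \<rho>(4) assms(1) xy(1,2)] ncyc_transpose_split[OF \<rho>(4) assms(1) xy]
      by (cases "y \<in> orbit ?\<psi> x") auto
    then show ?thesis unfolding eq
      by (intro exI[of _ \<rho>] conjI) (use \<rho>(1,2,5) 1 perm in \<open>simp_all del: comp_apply\<close>)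
  next
    case False
    let ?\<rho> = "\<rho> \<circ> ?t"
    have \<rho>': "?\<rho> permutes D"
      using permutes_compose[OF permutes_swap_id[OF xy(1,2)] \<rho>(1)] .
    note m = orbit_transpose_merge[OF \<rho>(1) assms(1) xy(1,2) False]
    have sub: "orbit \<rho> z \<subseteq> orbit ?\<rho> z" for z
      using m[of z] oeq[of z] self[of z] by blast
    have "orbit ?\<psi> x \<subseteq> orbit \<rho> x"
    proof (rule subset_trans)
      show "orbit ?\<psi> x \<subseteq> orbit \<rho> x \<inter> D"
      proof (rule orbit_subset_closed)
        show "?\<psi> ` (orbit \<rho> x \<inter> D) \<subseteq> orbit \<rho> x \<inter> D"
        proof (rule image_subsetI)
          fix z assume z: "z \<in> orbit \<rho> x \<inter> D"
          then have "?\<psi> z \<in> orbit \<rho> x" using \<rho>(3)[of z] oeq[of z x] by blast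
          then show "?\<psi> z \<in> orbit \<rho> x \<inter> D" using z permutes_in_image[OF \<rho>(4)] by blast
        qed
        show "x \<in> orbit \<rho> x \<inter> D" using self[of x] xy(1) by blast
      qed
    qed auto
    then have n: "y \<notin> orbit ?\<psi> x" using False by blast
    have xyo: "x \<in> orbit ?\<rho> y" "y \<in> orbit ?\<rho> x" using m(1)[of x] m(1)[of y] self by auto
    note oeq' = perm_orbit_eq[OF \<rho>' assms(1)]
    have "?t z \<in> orbit ?\<rho> z" for z
      using xyo perm_self_in_orbit[OF \<rho>' assms(1)] by (metis transpose_def)
    then have "(?\<psi> \<circ> ?t) z \<in> orbit ?\<rho> z" if "z \<in> D" for z
      using \<rho>(3)[OF tD[OF that]] sub[of "?t z"] oeq' by (metis comp_apply subsetD)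
    moreover have "\<phi> z \<in> orbit ?\<rho> z" if "z \<in> D" for z using \<rho>(2)[OF that] sub by blast
    moreover have "ncyc (?\<psi> \<circ> ?t) D + 1 = ncyc ?\<psi> D"
      by (rule ncyc_transpose_merge[OF \<rho>(4) assms(1) xy(1,2) n])
    moreover have "ncyc ?\<rho> D + 1 = ncyc \<rho> D"
      by (rule ncyc_transpose_merge[OF \<rho>(1) assms(1) xy(1,2) False])
    ultimately show ?thesis unfolding eq
      by (intro exI[of _ ?\<rho>] conjI) (use \<rho>(5) \<rho>' perm in \<open>simp_all del: comp_apply\<close>)
  qed
qed

text \<open>This is \<open>V + F \<le> E + 2 C\<close>, doubled so that the number of darts replaces
  \<open>2 E\<close>. The components are represented by the cycles of a permutation
  \<open>\<rho>\<close>, which are closed under both \<open>\<phi>\<close> and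
  \<open>\<alpha>\<close>.\<close>

lemma euler_inequality:
  assumes "finite D" "\<phi> permutes D" "\<alpha> permutes D" "\<And>x. x \<in> D \<Longrightarrow> \<alpha> x \<noteq> x \<and> \<alpha> (\<alpha> x) = x"
  obtains \<rho> where "\<rho> permutes D" "\<And>z. z \<in> D \<Longrightarrow> \<phi> z \<in> orbit \<rho> z" "\<And>z. z \<in> D \<Longrightarrow> \<alpha> z \<in> orbit \<rho> z"
    "2 * (ncyc (\<phi> \<circ> \<alpha>) D + ncyc \<phi> D) \<le> card D + 4 * ncyc \<rho> D"
proof -
  obtain ps where ps: "\<alpha> = transpositions ps" "2 * length ps = card D" "set ps \<subseteq> D \<times> D"
    "\<forall>(x,y)\<in>set ps. x \<noteq> y"
    using involution_transpositions[OF assms(1,3,4)] by blast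
  obtain \<rho> where \<rho>: "\<rho> permutes D" "\<forall>z\<in>D. \<phi> z \<in> orbit \<rho> z" "\<forall>z\<in>D. \<phi> (\<alpha> z) \<in> orbit \<rho> z"
    "ncyc (\<phi> \<circ> \<alpha>) D + ncyc \<phi> D \<le> length ps + 2 * ncyc \<rho> D"
    using euler_inequality_transpositions[OF assms(1,2) ps(3,4)] ps(1) unfolding comp_apply by blast
  have "\<alpha> z \<in> orbit \<rho> z" if "z \<in> D" for z
  proof -
    have "\<alpha> z \<in> D" using assms(3) that by (simp add: permutes_in_image)
    then show ?thesis
      using \<rho> that perm_orbit_eq[OF \<rho>(1) assms(1)] perm_self_in_orbit[OF \<rho>(1) assms(1)] by metis
  qed
  then show ?thesis using that[of \<rho>] \<rho> ps(2) by auto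
qed

section \<open>Maps with a boundary\<close>

text \<open>A map on the set \<open>D\<close> of darts is given by its edge involution \<open>\<alpha>\<close>, the permutation \<open>\<phi>\<close> whose cycles
  are the inner faces, the list \<open>bs\<close> of the boundary darts from the root on, and the set \<open>\<chi>\<close> of black
  darts. Boundary darts are coloured too, opposite to the dart across the edge, which makes the
  bridge condition of the boundary word automatic. As the boundary is a single face, connectedness
  means that no nonempty set of inner darts is closed. The boundary is left out of the face count in
  Euler's formula, so \<open>D = {}\<close> is the vertex map.\<close>

definition bpre :: "nat \<Rightarrow> nat set \<Rightarrow> (nat \<Rightarrow> nat) \<Rightarrow> (nat \<Rightarrow> nat) \<Rightarrow> nat set \<Rightarrow> nat list \<Rightarrow> bool" where
  "bpre d D \<alpha> \<phi> \<chi> bs \<longleftrightarrow>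
     finite D \<and> \<alpha> permutes D \<and> (\<forall>x\<in>D. \<alpha> x \<noteq> x \<and> \<alpha> (\<alpha> x) = x) \<and>
     distinct bs \<and> set bs \<subseteq> D \<and> \<phi> permutes (D - set bs) \<and>
     \<chi> \<subseteq> D \<and> (\<forall>x\<in>D. \<alpha> x \<in> \<chi> \<longleftrightarrow> x \<notin> \<chi>) \<and> (\<forall>x\<in>D - set bs. \<phi> x \<in> \<chi> \<longleftrightarrow> x \<in> \<chi>) \<and>
     (\<forall>F\<in>orbit \<phi> ` (D - set bs). card F \<in> {2..d})"

definition bconn :: "nat set \<Rightarrow> (nat \<Rightarrow> nat) \<Rightarrow> (nat \<Rightarrow> nat) \<Rightarrow> nat list \<Rightarrow> bool" where
  "bconn D \<alpha> \<phi> bs \<longleftrightarrow> (\<forall>S\<subseteq>D - set bs. \<alpha> ` S \<subseteq> S \<longrightarrow> \<phi> ` S \<subseteq> S \<longrightarrow> S = {})"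

definition nverts :: "nat set \<Rightarrow> (nat \<Rightarrow> nat) \<Rightarrow> (nat \<Rightarrow> nat) \<Rightarrow> nat list \<Rightarrow> nat" where
  "nverts D \<alpha> \<phi> bs = (if D = {} then 1 else ncyc (\<phi> \<circ> cycle_of_list bs \<circ> \<alpha>) D)"

definition bmap :: "nat \<Rightarrow> nat set \<Rightarrow> (nat \<Rightarrow> nat) \<Rightarrow> (nat \<Rightarrow> nat) \<Rightarrow> nat set \<Rightarrow> nat list \<Rightarrow> bool" where
  "bmap d D \<alpha> \<phi> \<chi> bs \<longleftrightarrow> bpre d D \<alpha> \<phi> \<chi> bs \<and> bconn D \<alpha> \<phi> bs \<and>
     2 * (nverts D \<alpha> \<phi> bs + ncyc \<phi> (D - set bs)) = card D + 2"

section \<open>The vertex permutation when an edge is added\<close>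

lemma skip_comp_left:
  assumes "h x = x" "h (g x) = g x" "inj h"
  shows "skip x (h \<circ> g) = h \<circ> skip x g"
proof
  fix z
  have "h (g z) = x \<longleftrightarrow> g z = x" "h (g z) = g x \<longleftrightarrow> g z = g x"
    using assms by (metis injD)+
  then show "skip x (h \<circ> g) z = (h \<circ> skip x g) z"
    using assms by (auto simp: skip_def transpose_def)
qed

lemma skip_comp_right:
  assumes "h x = x" shows "skip x (g \<circ> h) = skip x g \<circ> h"
  using assms by (auto simp: skip_def)

lemma perm_comp_disjoint_apply:
  assumes "f permutes A" "g permutes B" "A \<inter> B = {}"
  shows "x \<in> A \<Longrightarrow> f (g x) = f x" "x \<in> B \<Longrightarrow> f (g x) = g x" "x \<notin> A \<Longrightarrow> f (g x) = g x"
proof -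
  show "x \<in> A \<Longrightarrow> f (g x) = f x" using assms by (metis disjoint_iff permutes_not_in)
  show 2: "x \<in> B \<Longrightarrow> f (g x) = g x" using assms by (metis disjoint_iff permutes_in_image permutes_not_in)
  show "x \<notin> A \<Longrightarrow> f (g x) = g x" using 2 assms by (metis permutes_not_in)
qed

lemma disjoint_perms_commute:
  assumes "f permutes A" "g permutes B" "A \<inter> B = {}" shows "f \<circ> g = g \<circ> f"
proof
  fix x
  have "B \<inter> A = {}" using assms(3) by blast
  note r = perm_comp_disjoint_apply[OF assms, of x] perm_comp_disjoint_apply[OF assms(2,1) this, of x]
  show "(f \<circ> g) x = (g \<circ> f) x"
    using r assms(3) permutes_not_in[OF assms(1), of x] permutes_not_in[OF assms(2), of x]
    by (cases "x \<in> A"; cases "x \<in> B") auto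
qed

text \<open>The case of an edge beside an inner face. Once its transposition has been absorbed by
  \<open>cycle_of_list_glue\<close>, the darts \<open>r\<close> and \<open>r'\<close> sit on a
  boundary cycle and are fixed by \<open>\<alpha>\<close>. Erasing them gives the vertex permutation
  of the smaller map, and no vertex disappears unless that map has an empty boundary.\<close>

lemma glue_vertex_perm:
  assumes "distinct (r # xs @ r' # ys)" "\<psi> permutes C" "C \<inter> set (r # xs @ r' # ys) = {}"
    "\<alpha> r = r" "\<alpha> r' = r'"
  defines "\<sigma> \<equiv> \<psi> \<circ> cycle_of_list (r # xs @ r' # ys) \<circ> \<alpha>"
  shows "skip r' (skip r \<sigma>) = \<psi> \<circ> cycle_of_list (xs @ ys) \<circ> \<alpha>"
    "\<sigma> r \<noteq> r" "skip r \<sigma> r' = r' \<longleftrightarrow> xs = [] \<and> ys = []"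
proof -
  let ?L = "r # xs @ r' # ys"
  have fix\<psi>: "\<psi> z = z" if "z \<in> set ?L" for z
    using assms(2,3) that by (metis disjoint_iff permutes_not_in)
  have inj: "inj \<psi>" using assms(2) permutes_inj by blast
  have cin: "cycle_of_list l z \<in> set l" if "z \<in> set l" for z and l
    using that cycle_permutes permutes_in_image by metis
  have 1: "skip r \<sigma> = \<psi> \<circ> cycle_of_list (xs @ r' # ys) \<circ> \<alpha>"
  proof -
    have "skip r \<sigma> = skip r (\<psi> \<circ> cycle_of_list ?L) \<circ> \<alpha>"
      unfolding \<sigma>_def by (rule skip_comp_right) (rule assms(4))
    also have "skip r (\<psi> \<circ> cycle_of_list ?L) = \<psi> \<circ> skip r (cycle_of_list ?L)"
      using fix\<psi>[of r] fix\<psi>[OF cin[of r ?L]] inj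
      by (intro skip_comp_left) (simp_all del: cycle_of_list.simps)
    also have "skip r (cycle_of_list ?L) = cycle_of_list (xs @ r' # ys)"
      by (rule skip_cycle_of_list) (use assms(1) in auto)
    finally show ?thesis .
  qed
  \<comment> \<open>The cycle is rotated until \<open>r'\<close> is its head, the position from
    which \<open>skip_cycle_of_list\<close> can erase it.\<close>
  have rot: "cycle_of_list (xs @ r' # ys) = cycle_of_list (r' # ys @ xs)"
    using assms(1)
  proof (induction xs arbitrary: ys)
    case (Cons x xs)
    have "cycle_of_list ((x # xs) @ r' # ys) = cycle_of_list (rotate1 ((x # xs) @ r' # ys))"
      by (rule cycle_of_list_rotate1[symmetric]) (use Cons.prems in auto)
    also have "\<dots> = cycle_of_list (xs @ r' # (ys @ [x]))" by simp
    also have "\<dots> = cycle_of_list (r' # (ys @ [x]) @ xs)"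
      by (rule Cons.IH) (use Cons.prems in auto)
    finally show ?case by simp
  qed simp
  have rot2: "cycle_of_list (ys @ xs) = cycle_of_list (xs @ ys)" using assms(1)
  proof (induction xs arbitrary: ys)
    case (Cons x xs)
    have "cycle_of_list ((x # xs) @ ys) = cycle_of_list (rotate1 ((x # xs) @ ys))"
      by (rule cycle_of_list_rotate1[symmetric]) (use Cons.prems in auto)
    also have "\<dots> = cycle_of_list (xs @ (ys @ [x]))" by simp
    also have "\<dots> = cycle_of_list ((ys @ [x]) @ xs)"
      by (rule Cons.IH[symmetric]) (use Cons.prems in auto)
    finally show ?case by simp
  qed simp
  have "skip r' (skip r \<sigma>) = skip r' (\<psi> \<circ> cycle_of_list (r' # ys @ xs)) \<circ> \<alpha>"
    unfolding 1 rot by (rule skip_comp_right) (rule assms(5))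
  also have "skip r' (\<psi> \<circ> cycle_of_list (r' # ys @ xs)) = \<psi> \<circ> skip r' (cycle_of_list (r' # ys @ xs))"
  proof (rule skip_comp_left)
    show "\<psi> (cycle_of_list (r' # ys @ xs) r') = cycle_of_list (r' # ys @ xs) r'"
      using fix\<psi>[of "cycle_of_list (r' # ys @ xs) r'"] cin[of r' "r' # ys @ xs"]
      by (auto simp del: cycle_of_list.simps)
  qed (use fix\<psi> inj in auto)
  also have "skip r' (cycle_of_list (r' # ys @ xs)) = cycle_of_list (xs @ ys)"
    using rot2 by (subst skip_cycle_of_list) (use assms(1) in auto)
  finally show "skip r' (skip r \<sigma>) = \<psi> \<circ> cycle_of_list (xs @ ys) \<circ> \<alpha>" .
  have "\<sigma> r = \<psi> (hd (xs @ [r']))"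
  proof -
    have "cycle_of_list (r # xs @ r' # ys) r = hd (xs @ r' # ys)"
      by (subst cycle_of_list_hd) (use assms(1) in auto)
    moreover have "hd (xs @ r' # ys) = hd (xs @ [r'])" by (cases xs) auto
    ultimately show ?thesis unfolding \<sigma>_def comp_apply assms(4) by (simp only:)
  qed
  moreover have "hd (xs @ [r']) \<in> set ?L" "hd (xs @ [r']) \<noteq> r"
    using assms(1) by (cases xs; auto)+
  ultimately show "\<sigma> r \<noteq> r" using fix\<psi>[of "hd (xs @ [r'])"] by simp
  have "skip r \<sigma> r' = \<psi> (cycle_of_list (r' # ys @ xs) r')"
    unfolding 1 rot by (simp add: assms(5) del: cycle_of_list.simps)
  also have "\<dots> = \<psi> (if ys @ xs = [] then r' else hd (ys @ xs))"
    by (subst cycle_of_list_hd) (use assms(1) in auto)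
  also have "\<dots> = (if ys @ xs = [] then r' else hd (ys @ xs))"
    using fix\<psi> hd_in_set[of "ys @ xs"] by (auto simp del: hd_append2)
  finally show "skip r \<sigma> r' = r' \<longleftrightarrow> xs = [] \<and> ys = []"
    using assms(1) hd_in_set[of "ys @ xs"] by (auto simp del: hd_append2 split: if_splits)
qed

text \<open>The same erasure for a bridge. A side with an empty boundary loses the vertex at its end
  of the bridge; this is the vertex that \<open>nverts\<close> assigns to the empty map.\<close>

lemma cut_vertex_perm:
  assumes "distinct (r # xs @ r' # ys)" "\<psi> permutes C" "C \<inter> set (r # xs @ r' # ys) = {}"
    "\<alpha> r = r" "\<alpha> r' = r'"
  defines "\<sigma> \<equiv> \<psi> \<circ> cycle_of_list (r' # xs) \<circ> cycle_of_list (r # ys) \<circ> \<alpha>"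
  shows "skip r' (skip r \<sigma>) = \<psi> \<circ> cycle_of_list xs \<circ> cycle_of_list ys \<circ> \<alpha>"
    "\<sigma> r = r \<longleftrightarrow> ys = []" "skip r \<sigma> r' = r' \<longleftrightarrow> xs = []"
proof -
  let ?L = "r # xs @ r' # ys"
  have fix\<psi>: "\<psi> z = z" if "z \<in> set ?L" for z
    using assms(2,3) that by (metis disjoint_iff permutes_not_in)
  have inj: "inj \<psi>" using assms(2) permutes_inj by blast
  have cinj: "inj (cycle_of_list l)" for l
    using cycle_permutes permutes_inj by blast
  have cin: "cycle_of_list l z \<in> set l" if "z \<in> set l" for z and l
    using that cycle_permutes permutes_in_image by metis
  have \<sigma>r: "cycle_of_list (r # ys) r = (if ys = [] then r else hd ys)"
    "cycle_of_list (r' # xs) r' = (if xs = [] then r' else hd xs)"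
    by (rule cycle_of_list_hd, use assms(1) in simp)+
  have fx: "\<psi> (cycle_of_list (r' # xs) z) = z" if "z \<in> set (r # ys)" for z
    using that fix\<psi>[of z] assms(1) by (subst id_outside_supp) auto
  have fy: "\<psi> (cycle_of_list ys z) = z" if "z \<in> set (r' # xs)" for z
    using that fix\<psi>[of z] assms(1) by (subst id_outside_supp) auto
  have com: "cycle_of_list (r' # xs) \<circ> cycle_of_list ys = cycle_of_list ys \<circ> cycle_of_list (r' # xs)"
    "cycle_of_list xs \<circ> cycle_of_list ys = cycle_of_list ys \<circ> cycle_of_list xs"
    by (rule disjoint_perms_commute[OF cycle_permutes cycle_permutes], use assms(1) in auto)+
  have 1: "skip r \<sigma> = \<psi> \<circ> cycle_of_list ys \<circ> cycle_of_list (r' # xs) \<circ> \<alpha>"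
  proof -
    have "skip r \<sigma> = skip r ((\<psi> \<circ> cycle_of_list (r' # xs)) \<circ> cycle_of_list (r # ys)) \<circ> \<alpha>"
      unfolding \<sigma>_def by (rule skip_comp_right) (rule assms(4))
    also have "skip r ((\<psi> \<circ> cycle_of_list (r' # xs)) \<circ> cycle_of_list (r # ys))
        = (\<psi> \<circ> cycle_of_list (r' # xs)) \<circ> skip r (cycle_of_list (r # ys))"
      by (rule skip_comp_left) (use fx[of r] fx[OF cin[of r "r # ys"]] inj cinj in
          \<open>auto simp del: cycle_of_list.simps intro!: inj_compose\<close>)
    also have "skip r (cycle_of_list (r # ys)) = cycle_of_list ys"
      by (rule skip_cycle_of_list) (use assms(1) in auto)
    finally show ?thesis using com(1) by (simp only: comp_assoc)
  qed
  have "skip r' (skip r \<sigma>) = skip r' ((\<psi> \<circ> cycle_of_list ys) \<circ> cycle_of_list (r' # xs)) \<circ> \<alpha>"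
    unfolding 1 by (rule skip_comp_right) (rule assms(5))
  also have "skip r' ((\<psi> \<circ> cycle_of_list ys) \<circ> cycle_of_list (r' # xs))
        = (\<psi> \<circ> cycle_of_list ys) \<circ> skip r' (cycle_of_list (r' # xs))"
    by (rule skip_comp_left) (use fy[of r'] fy[OF cin[of r' "r' # xs"]] inj cinj in
        \<open>auto simp del: cycle_of_list.simps intro!: inj_compose\<close>)
  also have "skip r' (cycle_of_list (r' # xs)) = cycle_of_list xs"
    by (rule skip_cycle_of_list) (use assms(1) in auto)
  finally show "skip r' (skip r \<sigma>) = \<psi> \<circ> cycle_of_list xs \<circ> cycle_of_list ys \<circ> \<alpha>"
    using com(2) by (simp only: comp_assoc)
  have "\<sigma> r = cycle_of_list (r # ys) r"
    unfolding \<sigma>_def using fx[OF cin[of r "r # ys"]] by (simp add: assms(4) del: cycle_of_list.simps)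
  then show "\<sigma> r = r \<longleftrightarrow> ys = []"
    unfolding \<sigma>r using assms(1) by (cases ys) auto
  have "skip r \<sigma> r' = cycle_of_list (r' # xs) r'"
    unfolding 1 using fy[OF cin[of r' "r' # xs"]] by (simp add: assms(5) del: cycle_of_list.simps)
  then show "skip r \<sigma> r' = r' \<longleftrightarrow> xs = []"
    unfolding \<sigma>r using assms(1) by (cases xs) auto
qed

lemma ncyc_skip2:
  assumes "f permutes D" "finite D" "r \<in> D" "r' \<in> D" "r \<noteq> r'"
  shows "ncyc (skip r' (skip r f)) (D - {r, r'}) + of_bool (f r = r) + of_bool (skip r f r' = r') = ncyc f D"
proof -
  have "skip r f permutes D - {r}" using assms by (intro skip_permutes) auto
  then have "ncyc (skip r' (skip r f)) (D - {r} - {r'}) + of_bool (skip r f r' = r') = ncyc (skip r f) (D - {r})"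
    using assms by (intro ncyc_skip) auto
  moreover have "D - {r} - {r'} = D - {r, r'}" by auto
  moreover have "ncyc (skip r f) (D - {r}) + of_bool (f r = r) = ncyc f D"
    using assms by (intro ncyc_skip) auto
  ultimately show ?thesis by simp
qed

section \<open>Adding an edge beside an inner face\<close>

lemma orbit_cycle_of_list:
  assumes "distinct cs" "x \<in> set cs" shows "orbit (cycle_of_list cs) x = set cs"
proof -
  let ?p = "cycle_of_list cs"
  have p: "?p permutes set cs" by (rule cycle_permutes)
  have ne: "cs \<noteq> []" using assms by auto
  have pow: "(?p ^^ n) (hd cs) = cs ! (n mod length cs)" for n
  proof -
    have "(?p ^^ n) (hd cs) = hd (map (?p ^^ n) cs)" using ne by (simp add: hd_map)
    also have "\<dots> = hd (rotate n cs)" using cyclic_rotation[OF assms(1)] by simp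
    also have "\<dots> = cs ! (n mod length cs)" by (rule hd_rotate_conv_nth[OF ne])
    finally show ?thesis .
  qed
  have self: "z \<in> orbit ?p z" for z using perm_self_in_orbit[OF p] by simp
  have "orbit ?p (hd cs) = set cs"
  proof
    show "orbit ?p (hd cs) \<subseteq> set cs" using permutes_orbit_subset[OF p] ne by simp
    show "set cs \<subseteq> orbit ?p (hd cs)"
    proof
      fix z assume "z \<in> set cs"
      then obtain n where "n < length cs" "z = cs ! n" by (metis in_set_conv_nth)
      then have "z = (?p ^^ n) (hd cs)" using pow by simp
      then show "z \<in> orbit ?p (hd cs)" using orbit_altdef_self_in[OF self] by blast
    qed
  qed
  then show ?thesis using assms(2) perm_orbit_eq[OF p, of x "hd cs"] by simp
qed

lemma ncyc_cycle_of_list: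
  assumes "distinct cs" "cs \<noteq> []"
  shows "orbit (cycle_of_list cs) ` set cs = {set cs}" "ncyc (cycle_of_list cs) (set cs) = 1"
proof -
  show "orbit (cycle_of_list cs) ` set cs = {set cs}"
    using assms(2) orbit_cycle_of_list[OF assms(1)] by (auto simp: image_iff ex_in_conv)
  then show "ncyc (cycle_of_list cs) (set cs) = 1" by (simp add: ncyc_def)
qed

text \<open>Here \<open>r\<close> is the new root dart, \<open>r'\<close> lies across it on the new
  face \<open>r' # fs\<close>, and \<open>fs\<close> is the initial piece of the old boundary
  covered by that face. Edges and inner faces each increase by one and the vertices stay the same,
  so Euler's relation holds for one map exactly when it holds for the other. \<open>K\<close>
  consists of the black one of the two new darts.\<close>

lemma bmap_glue_face:
  assumes fin: "finite D'" and r: "r \<notin> D'" "r' \<notin> D'" "r \<noteq> r'" and \<alpha>': "\<alpha>' permutes D'"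
    and \<psi>: "\<psi> permutes D' - set (fs @ bs)" and bs: "distinct (fs @ bs)" "set (fs @ bs) \<subseteq> D'" "fs \<noteq> []"
    and \<chi>': "\<chi>' \<subseteq> D'" and K: "K = {r} \<or> K = {r'}"
  defines "D \<equiv> insert r (insert r' D')" and "\<alpha> \<equiv> \<alpha>' \<circ> transpose r r'"
    and "\<phi> \<equiv> \<psi> \<circ> cycle_of_list (r' # fs)" and "\<chi> \<equiv> \<chi>' \<union> K"
  shows "bmap d D \<alpha> \<phi> \<chi> (r # bs) \<longleftrightarrow>
      bmap d D' \<alpha>' \<psi> \<chi>' (fs @ bs) \<and> (\<forall>x\<in>set fs. x \<in> \<chi>' \<longleftrightarrow> r' \<in> K) \<and> length fs < d"
    "nverts D \<alpha> \<phi> (r # bs) = nverts D' \<alpha>' \<psi> (fs @ bs)"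
    "orbit \<phi> ` (D - set (r # bs)) = insert (set (r' # fs)) (orbit \<psi> ` (D' - set (fs @ bs)))"
    "set (r' # fs) \<notin> orbit \<psi> ` (D' - set (fs @ bs))"
proof -
  let ?C = "D' - set (fs @ bs)" and ?F = "set (r' # fs)"
  have dist: "distinct (r # fs @ r' # bs)" using r bs by auto
  have CF: "?C \<inter> ?F = {}" "D - set (r # bs) = ?C \<union> ?F"
    using r bs dist by (auto simp: D_def)
  have cyc: "cycle_of_list (r' # fs) permutes ?F" by (rule cycle_permutes)
  have df: "distinct (r' # fs)" using dist by auto
  note orb = ncyc_disjoint_comp[OF \<psi> _ cyc _ CF(1)]
  note one = ncyc_cycle_of_list[OF df]
  show orb1: "orbit \<phi> ` (D - set (r # bs)) = insert ?F (orbit \<psi> ` ?C)"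
    unfolding CF(2) \<phi>_def using orb(1) fin one(1) by auto
  show orb2: "?F \<notin> orbit \<psi> ` ?C"
    using orb(2) fin one(1) by auto
  have F1: "ncyc \<phi> (D - set (r # bs)) = ncyc \<psi> ?C + 1"
    unfolding ncyc_def orb1 using orb2 fin by simp
  have cF: "card ?F = length fs + 1" using df by (simp add: distinct_card)
  have cD: "card D = card D' + 2" using r fin by (simp add: D_def)
  have \<alpha>r: "\<alpha> r = r'" "\<alpha> r' = r" "\<And>x. x \<in> D' \<Longrightarrow> \<alpha> x = \<alpha>' x"
    using r permutes_not_in[OF \<alpha>'] by (auto simp: \<alpha>_def transpose_def)
  have \<alpha>'in: "\<alpha>' x \<in> D' \<longleftrightarrow> x \<in> D'" for x using permutes_in_image[OF \<alpha>'] .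
  have \<alpha>D: "\<alpha> permutes D" unfolding \<alpha>_def D_def
    by (rule permutes_compose[OF permutes_swap_id permutes_subset[OF \<alpha>']]) auto
  have \<phi>D: "\<phi> permutes D - set (r # bs)" unfolding \<phi>_def CF(2)
    by (rule permutes_compose[OF permutes_subset[OF cyc] permutes_subset[OF \<psi>]]) auto
  have \<phi>C: "\<phi> x = \<psi> x" if "x \<in> ?C" for x
    unfolding \<phi>_def using perm_comp_disjoint_apply(1)[OF \<psi> cyc CF(1) that] by simp
  have \<phi>F: "\<phi> x = cycle_of_list (r' # fs) x" if "x \<in> ?F" for x
    unfolding \<phi>_def using perm_comp_disjoint_apply(2)[OF \<psi> cyc CF(1) that] by simp
  have \<psi>in: "\<psi> x \<in> ?C \<longleftrightarrow> x \<in> ?C" for x using permutes_in_image[OF \<psi>] .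
  have eqs: "\<phi> \<circ> cycle_of_list (r # bs) \<circ> \<alpha> = \<psi> \<circ> cycle_of_list (r # fs @ r' # bs) \<circ> \<alpha>'"
  proof -
    have "\<alpha> = transpose r r' \<circ> \<alpha>'" unfolding \<alpha>_def
      by (rule disjoint_perms_commute[OF \<alpha>' permutes_swap_id[of r "{r, r'}" r']]) (use r in auto)
    then have "\<phi> \<circ> cycle_of_list (r # bs) \<circ> \<alpha>
        = \<psi> \<circ> (cycle_of_list (r' # fs) \<circ> cycle_of_list (r # bs) \<circ> transpose r r') \<circ> \<alpha>'"
      by (simp only: \<phi>_def comp_assoc)
    then show ?thesis by (simp only: cycle_of_list_glue[OF dist])
  qed
  have L: "?C \<inter> set (r # fs @ r' # bs) = {}" using r bs by auto
  have \<alpha>'r: "\<alpha>' r = r" "\<alpha>' r' = r'" using r permutes_not_in[OF \<alpha>'] by auto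
  note g = glue_vertex_perm[OF dist \<psi> L \<alpha>'r]
  have perm: "\<psi> \<circ> cycle_of_list (r # fs @ r' # bs) \<circ> \<alpha>' permutes D"
  proof -
    have "cycle_of_list (r # fs @ r' # bs) permutes D"
      by (rule permutes_subset[OF cycle_permutes]) (use bs in \<open>auto simp: D_def\<close>)
    moreover have "\<psi> permutes D" "\<alpha>' permutes D"
      by (rule permutes_subset[OF \<psi>], auto simp: D_def) (rule permutes_subset[OF \<alpha>'], auto)
    ultimately show ?thesis by (intro permutes_compose)
  qed
  have DD: "D - {r, r'} = D'" using r by (auto simp: D_def)
  have "D' \<noteq> {}" using bs by auto
  then show nv: "nverts D \<alpha> \<phi> (r # bs) = nverts D' \<alpha>' \<psi> (fs @ bs)"
    using ncyc_skip2[OF perm, of r r'] g fin r bs(3)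
    unfolding nverts_def eqs by (simp add: DD D_def del: cycle_of_list.simps)
  have conn: "bconn D \<alpha> \<phi> (r # bs) \<longleftrightarrow> bconn D' \<alpha>' \<psi> (fs @ bs)"
  proof -
    have "(S \<subseteq> D - set (r # bs) \<and> \<alpha> ` S \<subseteq> S \<and> \<phi> ` S \<subseteq> S) \<longleftrightarrow> (S \<subseteq> ?C \<and> \<alpha>' ` S \<subseteq> S \<and> \<psi> ` S \<subseteq> S)"
      (is "?l \<longleftrightarrow> ?r") for S
    proof
      assume l: ?l
      \<comment> \<open>The partner of \<open>r'\<close> is the boundary dart \<open>r\<close>, so a
        closed set of inner darts misses \<open>r'\<close> and with it the whole new face.\<close>
      have "r' \<notin> S" using l \<alpha>r(2) r by auto
      have "S \<inter> ?F = {}"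
      proof (rule ccontr)
        assume "S \<inter> ?F \<noteq> {}"
        then obtain x where x: "x \<in> S" "x \<in> ?F" by blast
        have "cycle_of_list (r' # fs) ` (S \<inter> ?F) \<subseteq> S \<inter> ?F"
        proof (rule image_subsetI)
          fix z assume z: "z \<in> S \<inter> ?F"
          then have "\<phi> z \<in> S" using l by blast
          then show "cycle_of_list (r' # fs) z \<in> S \<inter> ?F"
            using z \<phi>F[of z] permutes_in_image[OF cyc, of z] by auto
        qed
        then have "orbit (cycle_of_list (r' # fs)) x \<subseteq> S \<inter> ?F"
          using x by (intro orbit_subset_closed) auto
        then show False using orbit_cycle_of_list[OF df x(2)] \<open>r' \<notin> S\<close> by auto
      qed
      then have SC: "S \<subseteq> ?C" using l CF by blast
      have "\<alpha> ` S = \<alpha>' ` S" "\<phi> ` S = \<psi> ` S"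
        using SC \<alpha>r(3) \<phi>C by (auto intro!: image_cong)
      then show ?r using SC l by simp
    next
      assume rr: ?r
      then have "\<alpha> ` S = \<alpha>' ` S" "\<phi> ` S = \<psi> ` S"
        using \<alpha>r(3) \<phi>C by (auto intro!: image_cong)
      then show ?l using rr CF(2) by auto
    qed
    moreover have "bconn D \<alpha> \<phi> bs \<longleftrightarrow> (\<forall>S. S \<subseteq> D - set bs \<and> \<alpha> ` S \<subseteq> S \<and> \<phi> ` S \<subseteq> S \<longrightarrow> S = {})" for D \<alpha> \<phi> bs
      unfolding bconn_def by blast
    ultimately show ?thesis by simp
  qed
  have pre: "bpre d D \<alpha> \<phi> \<chi> (r # bs) \<longleftrightarrow>
      bpre d D' \<alpha>' \<psi> \<chi>' (fs @ bs) \<and> (\<forall>x\<in>set fs. x \<in> \<chi>' \<longleftrightarrow> r' \<in> K) \<and> length fs < d"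
  proof -
    have a: "(\<forall>x\<in>D. \<alpha> x \<noteq> x \<and> \<alpha> (\<alpha> x) = x) \<longleftrightarrow> (\<forall>x\<in>D'. \<alpha>' x \<noteq> x \<and> \<alpha>' (\<alpha>' x) = x)"
      using \<alpha>r \<alpha>'in r by (auto simp: D_def)
    have b: "(\<forall>x\<in>D. \<alpha> x \<in> \<chi> \<longleftrightarrow> x \<notin> \<chi>) \<longleftrightarrow> (\<forall>x\<in>D'. \<alpha>' x \<in> \<chi>' \<longleftrightarrow> x \<notin> \<chi>')"
    proof -
      have "x \<in> \<chi> \<longleftrightarrow> x \<in> \<chi>'" if "x \<in> D'" for x using that K r by (auto simp: \<chi>_def)
      moreover have "(r \<in> \<chi>) \<noteq> (r' \<in> \<chi>)" using K r \<chi>' by (auto simp: \<chi>_def)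
      ultimately show ?thesis using \<alpha>r \<alpha>'in by (auto simp: D_def)
    qed
    have c: "(\<forall>x\<in>D - set (r # bs). \<phi> x \<in> \<chi> \<longleftrightarrow> x \<in> \<chi>) \<longleftrightarrow>
        (\<forall>x\<in>?C. \<psi> x \<in> \<chi>' \<longleftrightarrow> x \<in> \<chi>') \<and> (\<forall>x\<in>set fs. x \<in> \<chi>' \<longleftrightarrow> r' \<in> K)"
    proof -
      have e: "x \<in> \<chi> \<longleftrightarrow> x \<in> \<chi>'" if "x \<in> D'" for x using that K r by (auto simp: \<chi>_def)
      have 1: "(\<phi> x \<in> \<chi> \<longleftrightarrow> x \<in> \<chi>) \<longleftrightarrow> (\<psi> x \<in> \<chi>' \<longleftrightarrow> x \<in> \<chi>')" if "x \<in> ?C" for x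
        using e[of x] e[of "\<psi> x"] \<phi>C[OF that] \<psi>in[of x] that by auto
      have 2: "(\<forall>x\<in>?F. \<phi> x \<in> \<chi> \<longleftrightarrow> x \<in> \<chi>) \<longleftrightarrow> (\<forall>x\<in>?F. x \<in> \<chi> \<longleftrightarrow> r' \<in> \<chi>)" (is "?l \<longleftrightarrow> ?r")
      proof
        assume l: ?l
        have "y \<in> ?F \<and> (y \<in> \<chi> \<longleftrightarrow> r' \<in> \<chi>)" if "y \<in> orbit (cycle_of_list (r' # fs)) r'" for y
          using that
        proof induction
          case base
          have y: "r' \<in> ?F" by simp
          then have "\<phi> r' \<in> \<chi> \<longleftrightarrow> r' \<in> \<chi>" using l by blast
          then show ?case using y \<phi>F[OF y] permutes_in_image[OF cyc, of r']
            by (simp only: simp_thms)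
        next
          case (step y)
          then have y: "y \<in> ?F" "y \<in> \<chi> \<longleftrightarrow> r' \<in> \<chi>" by auto
          then have "\<phi> y \<in> \<chi> \<longleftrightarrow> r' \<in> \<chi>" using l by blast
          then show ?case using y \<phi>F[OF y(1)] permutes_in_image[OF cyc, of y]
            by (simp only: simp_thms)
        qed
        then show ?r unfolding orbit_cycle_of_list[OF df list.set_intros(1)] by blast
      next
        assume rr: ?r
        show ?l
        proof
          fix x assume x: "x \<in> ?F"
          then have "\<phi> x \<in> ?F" unfolding \<phi>F[OF x] permutes_in_image[OF cyc] .
          then show "\<phi> x \<in> \<chi> \<longleftrightarrow> x \<in> \<chi>" using rr x by blast
        qed
      qed
      have "(\<forall>x\<in>?F. x \<in> \<chi> \<longleftrightarrow> r' \<in> \<chi>) \<longleftrightarrow> (\<forall>x\<in>set fs. x \<in> \<chi>' \<longleftrightarrow> r' \<in> K)"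
      proof -
        have "r' \<in> \<chi> \<longleftrightarrow> r' \<in> K" using \<chi>' r by (auto simp: \<chi>_def)
        then show ?thesis using e bs(2) by auto
      qed
      moreover have "(\<forall>x\<in>?C. \<phi> x \<in> \<chi> \<longleftrightarrow> x \<in> \<chi>) \<longleftrightarrow> (\<forall>x\<in>?C. \<psi> x \<in> \<chi>' \<longleftrightarrow> x \<in> \<chi>')"
        using 1 by (rule ball_cong[OF refl])
      ultimately show ?thesis unfolding CF(2) ball_Un 2 by simp
    qed
    have e: "\<chi> \<subseteq> D" using \<chi>' K by (auto simp: \<chi>_def D_def)
    have f: "(\<forall>F\<in>orbit \<phi> ` (D - set (r # bs)). card F \<in> {2..d}) \<longleftrightarrow>
        (\<forall>F\<in>orbit \<psi> ` ?C. card F \<in> {2..d}) \<and> length fs < d"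
      using cF bs(3) unfolding orb1 ball_simps(7) cF by (simp add: Suc_le_eq conj_commute)
    have "finite D" "distinct (r # bs)" "set (r # bs) \<subseteq> D" using fin dist bs by (auto simp: D_def)
    then show ?thesis unfolding bpre_def a b c f
      using e fin \<alpha>D \<alpha>' \<phi>D \<psi> bs(1,2) \<chi>' by (simp only: simp_thms conj_ac)
  qed
  show "bmap d D \<alpha> \<phi> \<chi> (r # bs) \<longleftrightarrow>
      bmap d D' \<alpha>' \<psi> \<chi>' (fs @ bs) \<and> (\<forall>x\<in>set fs. x \<in> \<chi>' \<longleftrightarrow> r' \<in> K) \<and> length fs < d"
    unfolding bmap_def pre conn nv F1 cD by auto
qed

section \<open>Bridges, connectedness and planarity\<close>

lemma ncyc_bridge:
  assumes fin: "finite D'" and r: "r \<notin> D'" "r' \<notin> D'" "r \<noteq> r'" and \<alpha>': "\<alpha>' permutes D'"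
    and \<phi>: "\<phi> permutes D' - set (b @ c)" and bc: "distinct (b @ c)" "set (b @ c) \<subseteq> D'"
  shows "ncyc (\<phi> \<circ> cycle_of_list b \<circ> cycle_of_list c \<circ> \<alpha>') D' + of_bool (c = []) + of_bool (b = [])
    = ncyc (\<phi> \<circ> cycle_of_list (r # b @ r' # c) \<circ> (\<alpha>' \<circ> transpose r r')) (insert r (insert r' D'))"
proof -
  let ?D = "insert r (insert r' D')"
  let ?\<sigma> = "\<phi> \<circ> cycle_of_list (r' # b) \<circ> cycle_of_list (r # c) \<circ> \<alpha>'"
  have dist: "distinct (r # b @ r' # c)" using r bc by auto
  have com: "\<alpha>' \<circ> transpose r r' = transpose r r' \<circ> \<alpha>'"
    by (rule disjoint_perms_commute[OF \<alpha>' permutes_swap_id[of r "{r, r'}" r']]) (use r in auto)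
  have "\<phi> \<circ> cycle_of_list (r # b @ r' # c) \<circ> (\<alpha>' \<circ> transpose r r')
      = \<phi> \<circ> cycle_of_list (r' # b) \<circ> cycle_of_list (r # c) \<circ> (transpose r r' \<circ> transpose r r') \<circ> \<alpha>'"
    unfolding cycle_of_list_glue[OF dist, symmetric] com by (simp only: comp_assoc)
  then have eq: "\<phi> \<circ> cycle_of_list (r # b @ r' # c) \<circ> (\<alpha>' \<circ> transpose r r') = ?\<sigma>"
    by (simp del: cycle_of_list.simps)
  have L: "(D' - set (b @ c)) \<inter> set (r # b @ r' # c) = {}" using r by auto
  have \<alpha>'r: "\<alpha>' r = r" "\<alpha>' r' = r'" using r permutes_not_in[OF \<alpha>'] by auto
  note g = cut_vertex_perm[OF dist \<phi> L \<alpha>'r]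
  have sub: "f permutes ?D" if "f permutes A" "A \<subseteq> ?D" for f A
    using that permutes_subset by blast
  have "\<phi> permutes ?D" "\<alpha>' permutes ?D" "cycle_of_list (r' # b) permutes ?D" "cycle_of_list (r # c) permutes ?D"
    using sub[OF \<phi>] sub[OF \<alpha>'] sub[OF cycle_permutes, of "r' # b"] sub[OF cycle_permutes, of "r # c"] bc by auto
  then have perm: "?\<sigma> permutes ?D" by (intro permutes_compose)
  have DD: "?D - {r, r'} = D'" using r by auto
  show ?thesis
    unfolding eq using ncyc_skip2[OF perm, of r r'] fin r(3) unfolding g DD by simp
qed

lemma ncyc_add_boundary:
  assumes "finite D" "\<phi> permutes D - set bs" "distinct bs" "set bs \<subseteq> D"
  shows "\<phi> \<circ> cycle_of_list bs permutes D"
    "ncyc (\<phi> \<circ> cycle_of_list bs) D = ncyc \<phi> (D - set bs) + of_bool (bs \<noteq> [])"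
proof -
  have U: "D - set bs \<union> set bs = D" using assms(4) by auto
  show "\<phi> \<circ> cycle_of_list bs permutes D"
    by (rule permutes_compose[OF permutes_subset[OF cycle_permutes assms(4)] permutes_subset[OF assms(2)]]) auto
  have "ncyc (\<phi> \<circ> cycle_of_list bs) (D - set bs \<union> set bs) = ncyc \<phi> (D - set bs) + ncyc (cycle_of_list bs) (set bs)"
    by (rule ncyc_disjoint_comp(3)[OF assms(2) _ cycle_permutes]) (use assms(1) in auto)
  moreover have "ncyc (cycle_of_list bs) (set bs) = of_bool (bs \<noteq> [])"
    using ncyc_cycle_of_list(2)[OF assms(3)] by (cases "bs = []") (auto simp: ncyc_def)
  ultimately show "ncyc (\<phi> \<circ> cycle_of_list bs) D = ncyc \<phi> (D - set bs) + of_bool (bs \<noteq> [])"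
    unfolding U by (simp only:)
qed

lemma boundary_all_or_none:
  assumes "\<phi> permutes D - set bs" "distinct bs" "set bs \<subseteq> D" "(\<phi> \<circ> cycle_of_list bs) ` S \<subseteq> S" "S \<subseteq> D"
  shows "set bs \<subseteq> S \<or> set bs \<inter> S = {} \<and> \<phi> ` S \<subseteq> S"
proof (cases "set bs \<inter> S = {}")
  case True
  have "(\<phi> \<circ> cycle_of_list bs) ` S = \<phi> ` S"
  proof (intro image_cong refl)
    fix x assume "x \<in> S"
    then have "x \<notin> set bs" using True by blast
    then show "(\<phi> \<circ> cycle_of_list bs) x = \<phi> x" by (simp add: id_outside_supp)
  qed
  then show ?thesis using True assms(4) by simp
next
  case False
  then obtain x where x: "x \<in> set bs" "x \<in> S" by blast
  have "cycle_of_list bs ` (S \<inter> set bs) \<subseteq> S \<inter> set bs"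
  proof (rule image_subsetI)
    fix z assume z: "z \<in> S \<inter> set bs"
    have i: "cycle_of_list bs z \<in> set bs" using z permutes_in_image[OF cycle_permutes, of bs z] by simp
    then have "(\<phi> \<circ> cycle_of_list bs) z = cycle_of_list bs z"
      using permutes_not_in[OF assms(1), of "cycle_of_list bs z"] by simp
    moreover have "(\<phi> \<circ> cycle_of_list bs) z \<in> S" using z assms(4) by blast
    ultimately show "cycle_of_list bs z \<in> S \<inter> set bs" using i by simp
  qed
  then have "orbit (cycle_of_list bs) x \<subseteq> S \<inter> set bs"
    using x by (intro orbit_subset_closed) auto
  then show ?thesis using orbit_cycle_of_list[OF assms(2) x(1)] by auto
qed

text \<open>A cycle of \<open>\<rho>\<close> is a nonempty closed set, so connectedness makes it
  meet the boundary. The boundary is a single cycle, hence \<open>\<rho>\<close> has only one. The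
  boundary also counts as a face, which turns the 4 of \<open>euler_inequality\<close> into the 2
  here.\<close>

lemma euler_bconn:
  assumes pre: "bpre d D \<alpha> \<phi> \<chi> bs" and con: "bconn D \<alpha> \<phi> bs"
  shows "2 * (nverts D \<alpha> \<phi> bs + ncyc \<phi> (D - set bs)) \<le> card D + 2"
proof (cases "D = {}")
  case True
  then show ?thesis by (simp add: nverts_def ncyc_def)
next
  case False
  let ?\<Phi> = "\<phi> \<circ> cycle_of_list bs"
  have fin: "finite D" and \<alpha>: "\<alpha> permutes D" "\<And>x. x \<in> D \<Longrightarrow> \<alpha> x \<noteq> x \<and> \<alpha> (\<alpha> x) = x"
    and bs: "distinct bs" "set bs \<subseteq> D" and \<phi>: "\<phi> permutes D - set bs"
    using pre by (auto simp: bpre_def)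
  have ne: "bs \<noteq> []"
  proof
    assume "bs = []"
    then have "D \<subseteq> D - set bs" "\<alpha> ` D \<subseteq> D" "\<phi> ` D \<subseteq> D"
      using \<alpha> \<phi> by (auto simp: permutes_in_image)
    then show False using con False unfolding bconn_def by blast
  qed
  note b = ncyc_add_boundary[OF fin \<phi> bs]
  obtain \<rho> where \<rho>: "\<rho> permutes D" "\<And>z. z \<in> D \<Longrightarrow> ?\<Phi> z \<in> orbit \<rho> z" "\<And>z. z \<in> D \<Longrightarrow> \<alpha> z \<in> orbit \<rho> z"
    "2 * (ncyc (?\<Phi> \<circ> \<alpha>) D + ncyc ?\<Phi> D) \<le> card D + 4 * ncyc \<rho> D"
    using euler_inequality[OF fin b(1) \<alpha>] by blast
  note oeq = perm_orbit_eq[OF \<rho>(1) fin]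
  note self = perm_self_in_orbit[OF \<rho>(1) fin]
  have hd: "hd bs \<in> orbit \<rho> z" if z: "z \<in> D" for z
  proof -
    let ?S = "orbit \<rho> z"
    have SD: "?S \<subseteq> D" using permutes_orbit_subset[OF \<rho>(1) z] .
    have "f ` ?S \<subseteq> ?S" if "\<And>w. w \<in> D \<Longrightarrow> f w \<in> orbit \<rho> w" for f
      using that oeq SD by blast
    then have cl: "\<alpha> ` ?S \<subseteq> ?S" "?\<Phi> ` ?S \<subseteq> ?S" using \<rho>(2,3) by blast+
    have "?S \<noteq> {}" using self[of z] by blast
    then have "\<not> (?S \<subseteq> D - set bs \<and> \<phi> ` ?S \<subseteq> ?S)"
      using con[unfolded bconn_def, rule_format, of ?S] cl(1) by blast
    then have "\<not> (set bs \<inter> ?S = {} \<and> \<phi> ` ?S \<subseteq> ?S)" using SD by blast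
    then have "set bs \<subseteq> ?S" using boundary_all_or_none[OF \<phi> bs cl(2) SD] by blast
    then show ?thesis using ne by auto
  qed
  have "orbit \<rho> z = orbit \<rho> (hd bs)" if "z \<in> D" for z using oeq[OF hd[OF that]] by (rule sym)
  then have "orbit \<rho> ` D = (\<lambda>_. orbit \<rho> (hd bs)) ` D" by (rule image_cong[OF refl])
  then have "orbit \<rho> ` D = {orbit \<rho> (hd bs)}" using False by (simp only: image_constant_conv if_False)
  then have "ncyc \<rho> D = 1" by (simp add: ncyc_def)
  then show ?thesis using \<rho>(4) b(2) ne False by (simp add: nverts_def)
qed

lemma bconn_empty_iff:
  assumes "bpre d D \<alpha> \<phi> \<chi> bs" "bconn D \<alpha> \<phi> bs" shows "D = {} \<longleftrightarrow> bs = []"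
proof
  assume "bs = []"
  then have "D \<subseteq> D - set bs" "\<alpha> ` D \<subseteq> D" "\<phi> ` D \<subseteq> D"
    using assms(1) by (auto simp: permutes_in_image bpre_def)
  then show "D = {}" using assms(2) unfolding bconn_def by blast
qed (use assms(1) in \<open>auto simp: bpre_def\<close>)

text \<open>By \<open>euler_bconn\<close> the defect in Euler's relation has a definite sign on each
  side, and the defect of the whole is the sum of the two. Therefore the whole is planar exactly
  when both sides are.\<close>

lemma bmap_glue_bridge:
  assumes fin: "finite D1" "finite D2" and disj: "D1 \<inter> D2 = {}"
    and r: "r \<notin> D1 \<union> D2" "r' \<notin> D1 \<union> D2" "r \<noteq> r'"
    and \<alpha>1: "\<alpha>1 permutes D1" and \<alpha>2: "\<alpha>2 permutes D2"
    and \<phi>1: "\<phi>1 permutes D1 - set b" and \<phi>2: "\<phi>2 permutes D2 - set c"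
    and b: "distinct b" "set b \<subseteq> D1" and c: "distinct c" "set c \<subseteq> D2"
    and \<chi>: "\<chi>1 \<subseteq> D1" "\<chi>2 \<subseteq> D2" and K: "K = {r} \<or> K = {r'}"
  defines "D \<equiv> insert r (insert r' (D1 \<union> D2))" and "\<alpha> \<equiv> \<alpha>1 \<circ> \<alpha>2 \<circ> transpose r r'"
    and "\<phi> \<equiv> \<phi>1 \<circ> \<phi>2" and "\<chi> \<equiv> \<chi>1 \<union> \<chi>2 \<union> K"
  shows "bmap d D \<alpha> \<phi> \<chi> (r # b @ r' # c) \<longleftrightarrow> bmap d D1 \<alpha>1 \<phi>1 \<chi>1 b \<and> bmap d D2 \<alpha>2 \<phi>2 \<chi>2 c"
    "bmap d D \<alpha> \<phi> \<chi> (r # b @ r' # c) \<Longrightarrow>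
      nverts D \<alpha> \<phi> (r # b @ r' # c) = nverts D1 \<alpha>1 \<phi>1 b + nverts D2 \<alpha>2 \<phi>2 c"
    "orbit \<phi> ` (D - set (r # b @ r' # c)) = orbit \<phi>1 ` (D1 - set b) \<union> orbit \<phi>2 ` (D2 - set c)"
    "orbit \<phi>1 ` (D1 - set b) \<inter> orbit \<phi>2 ` (D2 - set c) = {}"
proof -
  let ?bs = "r # b @ r' # c"
  let ?D' = "D1 \<union> D2" and ?\<alpha>' = "\<alpha>1 \<circ> \<alpha>2"
  let ?C1 = "D1 - set b" and ?C2 = "D2 - set c"
  have CC: "?C1 \<inter> ?C2 = {}" "D - set ?bs = ?C1 \<union> ?C2"
    using r b c disj by (auto simp: D_def)
  note orb = ncyc_disjoint_comp[OF \<phi>1 _ \<phi>2 _ CC(1)]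
  show orb1: "orbit \<phi> ` (D - set ?bs) = orbit \<phi>1 ` ?C1 \<union> orbit \<phi>2 ` ?C2"
    unfolding CC(2) \<phi>_def by (rule orb(1)) (use fin in auto)
  show "orbit \<phi>1 ` ?C1 \<inter> orbit \<phi>2 ` ?C2 = {}"
    by (rule orb(2)) (use fin in auto)
  have F: "ncyc \<phi> (D - set ?bs) = ncyc \<phi>1 ?C1 + ncyc \<phi>2 ?C2"
    unfolding CC(2) \<phi>_def by (rule orb(3)) (use fin in auto)
  have cD: "card D = card D1 + card D2 + 2"
    using r fin disj by (simp add: D_def card_Un_disjoint)
  have \<alpha>': "?\<alpha>' permutes ?D'"
    by (rule permutes_compose[OF permutes_subset[OF \<alpha>2] permutes_subset[OF \<alpha>1]]) auto
  have \<alpha>D: "\<alpha> permutes D" unfolding \<alpha>_def D_def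
    by (rule permutes_compose[OF permutes_swap_id permutes_subset[OF \<alpha>']]) auto
  have \<phi>D: "\<phi> permutes D - set ?bs" unfolding \<phi>_def CC(2)
    by (rule permutes_compose[OF permutes_subset[OF \<phi>2] permutes_subset[OF \<phi>1]]) auto
  have bc: "distinct (b @ c)" "set (b @ c) \<subseteq> ?D'" using b c disj by auto
  have dist: "distinct ?bs" "set ?bs \<subseteq> D" using bc r by (auto simp: D_def)
  have \<phi>': "\<phi> permutes ?D' - set (b @ c)"
    using \<phi>D unfolding CC(2) by (rule back_subst[of "\<lambda>X. \<phi> permutes X"]) (use b c disj in auto)
  have a1: "\<alpha> x = \<alpha>1 x" if "x \<in> D1" for x
    using that r perm_comp_disjoint_apply(1)[OF \<alpha>1 \<alpha>2 disj that] by (auto simp: \<alpha>_def transpose_def)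
  have a2: "\<alpha> x = \<alpha>2 x" if "x \<in> D2" for x
    using that r perm_comp_disjoint_apply(2)[OF \<alpha>1 \<alpha>2 disj that] by (auto simp: \<alpha>_def transpose_def)
  have ar: "\<alpha> r = r'" "\<alpha> r' = r"
    using r permutes_not_in[OF \<alpha>'] by (auto simp: \<alpha>_def)
  have p1: "\<phi> x = \<phi>1 x" if "x \<in> ?C1" for x
    using perm_comp_disjoint_apply(1)[OF \<phi>1 \<phi>2 CC(1) that] by (simp add: \<phi>_def)
  have p2: "\<phi> x = \<phi>2 x" if "x \<in> ?C2" for x
    using perm_comp_disjoint_apply(2)[OF \<phi>1 \<phi>2 CC(1) that] by (simp add: \<phi>_def)
  note ain = permutes_in_image[OF \<alpha>1] permutes_in_image[OF \<alpha>2]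
  note pin = permutes_in_image[OF \<phi>1] permutes_in_image[OF \<phi>2]
  have conn: "bconn D \<alpha> \<phi> ?bs \<longleftrightarrow> bconn D1 \<alpha>1 \<phi>1 b \<and> bconn D2 \<alpha>2 \<phi>2 c"
  proof (intro iffI conjI)
    assume l: "bconn D \<alpha> \<phi> ?bs"
    have "S = {}" if "S \<subseteq> ?C1" "\<alpha>1 ` S \<subseteq> S" "\<phi>1 ` S \<subseteq> S" for S
    proof -
      have "\<alpha> ` S = \<alpha>1 ` S" "\<phi> ` S = \<phi>1 ` S" using that(1) a1 p1 by (auto intro!: image_cong)
      then show ?thesis using l that CC(2) unfolding bconn_def by (metis le_supI1)
    qed
    then show "bconn D1 \<alpha>1 \<phi>1 b" unfolding bconn_def by blast
    have "S = {}" if "S \<subseteq> ?C2" "\<alpha>2 ` S \<subseteq> S" "\<phi>2 ` S \<subseteq> S" for S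
    proof -
      have "\<alpha> ` S = \<alpha>2 ` S" "\<phi> ` S = \<phi>2 ` S" using that(1) a2 p2 by (auto intro!: image_cong)
      then show ?thesis using l that CC(2) unfolding bconn_def by (metis le_supI2)
    qed
    then show "bconn D2 \<alpha>2 \<phi>2 c" unfolding bconn_def by blast
  next
    assume l: "bconn D1 \<alpha>1 \<phi>1 b \<and> bconn D2 \<alpha>2 \<phi>2 c"
    have "S = {}" if S: "S \<subseteq> ?C1 \<union> ?C2" "\<alpha> ` S \<subseteq> S" "\<phi> ` S \<subseteq> S" for S
    proof -
      have "\<alpha>1 ` (S \<inter> ?C1) \<subseteq> S \<inter> ?C1"
      proof (rule image_subsetI)
        fix x assume x: "x \<in> S \<inter> ?C1"
        then have "\<alpha>1 x \<in> S" "\<alpha>1 x \<in> D1" using S(2) a1[of x] ain by auto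
        then show "\<alpha>1 x \<in> S \<inter> ?C1" using S(1) disj by blast
      qed
      moreover have "\<phi>1 ` (S \<inter> ?C1) \<subseteq> S \<inter> ?C1"
      proof (rule image_subsetI)
        fix x assume x: "x \<in> S \<inter> ?C1"
        then show "\<phi>1 x \<in> S \<inter> ?C1" using S(3) p1[of x] pin(1)[of x] by auto
      qed
      ultimately have 1: "S \<inter> ?C1 = {}" using l unfolding bconn_def by (meson inf_le2)
      have "\<alpha>2 ` (S \<inter> ?C2) \<subseteq> S \<inter> ?C2"
      proof (rule image_subsetI)
        fix x assume x: "x \<in> S \<inter> ?C2"
        then have "\<alpha>2 x \<in> S" "\<alpha>2 x \<in> D2" using S(2) a2[of x] ain by auto
        then show "\<alpha>2 x \<in> S \<inter> ?C2" using S(1) disj by blast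
      qed
      moreover have "\<phi>2 ` (S \<inter> ?C2) \<subseteq> S \<inter> ?C2"
      proof (rule image_subsetI)
        fix x assume x: "x \<in> S \<inter> ?C2"
        then show "\<phi>2 x \<in> S \<inter> ?C2" using S(3) p2[of x] pin(2)[of x] by auto
      qed
      ultimately have "S \<inter> ?C2 = {}" using l unfolding bconn_def by (meson inf_le2)
      then show ?thesis using 1 S(1) by blast
    qed
    then show "bconn D \<alpha> \<phi> ?bs" unfolding bconn_def CC(2) by blast
  qed
  have pre: "bpre d D \<alpha> \<phi> \<chi> ?bs \<longleftrightarrow> bpre d D1 \<alpha>1 \<phi>1 \<chi>1 b \<and> bpre d D2 \<alpha>2 \<phi>2 \<chi>2 c"
  proof -
    have a: "(\<forall>x\<in>D. \<alpha> x \<noteq> x \<and> \<alpha> (\<alpha> x) = x) \<longleftrightarrow>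
       (\<forall>x\<in>D1. \<alpha>1 x \<noteq> x \<and> \<alpha>1 (\<alpha>1 x) = x) \<and> (\<forall>x\<in>D2. \<alpha>2 x \<noteq> x \<and> \<alpha>2 (\<alpha>2 x) = x)"
    proof -
      have "(\<alpha> x \<noteq> x \<and> \<alpha> (\<alpha> x) = x) \<longleftrightarrow> (\<alpha>1 x \<noteq> x \<and> \<alpha>1 (\<alpha>1 x) = x)" if "x \<in> D1" for x
        using that a1[of x] a1[of "\<alpha>1 x"] ain(1)[of x] by simp
      moreover have "(\<alpha> x \<noteq> x \<and> \<alpha> (\<alpha> x) = x) \<longleftrightarrow> (\<alpha>2 x \<noteq> x \<and> \<alpha>2 (\<alpha>2 x) = x)" if "x \<in> D2" for x
        using that a2[of x] a2[of "\<alpha>2 x"] ain(2)[of x] by simp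
      ultimately have "(\<forall>x\<in>D1 \<union> D2. \<alpha> x \<noteq> x \<and> \<alpha> (\<alpha> x) = x) \<longleftrightarrow>
         (\<forall>x\<in>D1. \<alpha>1 x \<noteq> x \<and> \<alpha>1 (\<alpha>1 x) = x) \<and> (\<forall>x\<in>D2. \<alpha>2 x \<noteq> x \<and> \<alpha>2 (\<alpha>2 x) = x)"
        unfolding ball_Un by (rule arg_cong2[where f="(\<and>)", OF ball_cong[OF refl] ball_cong[OF refl]])
      then show ?thesis using ar r(3) unfolding D_def ball_simps(7) by simp
    qed
    have x1: "x \<in> \<chi> \<longleftrightarrow> x \<in> \<chi>1" if "x \<in> D1" for x using that K r \<chi> disj by (auto simp: \<chi>_def)
    have x2: "x \<in> \<chi> \<longleftrightarrow> x \<in> \<chi>2" if "x \<in> D2" for x using that K r \<chi> disj by (auto simp: \<chi>_def)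
    have xr: "(r \<in> \<chi>) \<noteq> (r' \<in> \<chi>)" using K r \<chi> by (auto simp: \<chi>_def)
    have b: "(\<forall>x\<in>D. \<alpha> x \<in> \<chi> \<longleftrightarrow> x \<notin> \<chi>) \<longleftrightarrow>
       (\<forall>x\<in>D1. \<alpha>1 x \<in> \<chi>1 \<longleftrightarrow> x \<notin> \<chi>1) \<and> (\<forall>x\<in>D2. \<alpha>2 x \<in> \<chi>2 \<longleftrightarrow> x \<notin> \<chi>2)"
    proof -
      have "(\<alpha> x \<in> \<chi> \<longleftrightarrow> x \<notin> \<chi>) \<longleftrightarrow> (\<alpha>1 x \<in> \<chi>1 \<longleftrightarrow> x \<notin> \<chi>1)" if "x \<in> D1" for x
        using that a1[of x] x1[of "\<alpha>1 x"] x1[of x] ain(1)[of x] by simp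
      moreover have "(\<alpha> x \<in> \<chi> \<longleftrightarrow> x \<notin> \<chi>) \<longleftrightarrow> (\<alpha>2 x \<in> \<chi>2 \<longleftrightarrow> x \<notin> \<chi>2)" if "x \<in> D2" for x
        using that a2[of x] x2[of "\<alpha>2 x"] x2[of x] ain(2)[of x] by simp
      ultimately have "(\<forall>x\<in>D1 \<union> D2. \<alpha> x \<in> \<chi> \<longleftrightarrow> x \<notin> \<chi>) \<longleftrightarrow>
         (\<forall>x\<in>D1. \<alpha>1 x \<in> \<chi>1 \<longleftrightarrow> x \<notin> \<chi>1) \<and> (\<forall>x\<in>D2. \<alpha>2 x \<in> \<chi>2 \<longleftrightarrow> x \<notin> \<chi>2)"
        unfolding ball_Un by (rule arg_cong2[where f="(\<and>)", OF ball_cong[OF refl] ball_cong[OF refl]])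
      then show ?thesis using ar xr unfolding D_def ball_simps(7) by simp
    qed
    have c: "(\<forall>x\<in>D - set ?bs. \<phi> x \<in> \<chi> \<longleftrightarrow> x \<in> \<chi>) \<longleftrightarrow>
       (\<forall>x\<in>?C1. \<phi>1 x \<in> \<chi>1 \<longleftrightarrow> x \<in> \<chi>1) \<and> (\<forall>x\<in>?C2. \<phi>2 x \<in> \<chi>2 \<longleftrightarrow> x \<in> \<chi>2)"
    proof -
      have "(\<phi> x \<in> \<chi> \<longleftrightarrow> x \<in> \<chi>) \<longleftrightarrow> (\<phi>1 x \<in> \<chi>1 \<longleftrightarrow> x \<in> \<chi>1)" if "x \<in> ?C1" for x
        using that p1[OF that] pin(1)[of x] x1[of x] x1[of "\<phi>1 x"] by auto
      moreover have "(\<phi> x \<in> \<chi> \<longleftrightarrow> x \<in> \<chi>) \<longleftrightarrow> (\<phi>2 x \<in> \<chi>2 \<longleftrightarrow> x \<in> \<chi>2)" if "x \<in> ?C2" for x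
        using that p2[OF that] pin(2)[of x] x2[of x] x2[of "\<phi>2 x"] by auto
      ultimately show ?thesis unfolding CC(2) ball_Un
        by (rule arg_cong2[where f="(\<and>)", OF ball_cong[OF refl] ball_cong[OF refl]])
    qed
    have f: "(\<forall>F\<in>orbit \<phi> ` (D - set ?bs). card F \<in> {2..d}) \<longleftrightarrow>
       (\<forall>F\<in>orbit \<phi>1 ` ?C1. card F \<in> {2..d}) \<and> (\<forall>F\<in>orbit \<phi>2 ` ?C2. card F \<in> {2..d})"
      unfolding orb1 ball_Un ..
    have e: "\<chi> \<subseteq> D" "finite D" using \<chi> K fin by (auto simp: \<chi>_def D_def)
    show ?thesis unfolding bpre_def a b c f
      using e fin \<alpha>D \<alpha>1 \<alpha>2 \<phi>D \<phi>1 \<phi>2 dist assms(11,12,13,14) \<chi> by (simp only: simp_thms conj_ac)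
  qed
  have nv: "nverts D \<alpha> \<phi> ?bs = nverts D1 \<alpha>1 \<phi>1 b + nverts D2 \<alpha>2 \<phi>2 c"
    if P: "bpre d D1 \<alpha>1 \<phi>1 \<chi>1 b" "bpre d D2 \<alpha>2 \<phi>2 \<chi>2 c"
      and C: "bconn D1 \<alpha>1 \<phi>1 b" "bconn D2 \<alpha>2 \<phi>2 c"
  proof -
    have e: "D1 = {} \<longleftrightarrow> b = []" "D2 = {} \<longleftrightarrow> c = []"
      using bconn_empty_iff[OF P(1) C(1)] bconn_empty_iff[OF P(2) C(2)] by auto
    let ?\<sigma>1 = "\<phi>1 \<circ> cycle_of_list b \<circ> \<alpha>1" and ?\<sigma>2 = "\<phi>2 \<circ> cycle_of_list c \<circ> \<alpha>2"
    have m1: "\<phi>1 \<circ> cycle_of_list b permutes D1" by (rule ncyc_add_boundary(1)[OF fin(1) \<phi>1 assms(11,12)])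
    have m2: "\<phi>2 \<circ> cycle_of_list c permutes D2" by (rule ncyc_add_boundary(1)[OF fin(2) \<phi>2 assms(13,14)])
    have s1: "?\<sigma>1 permutes D1" by (rule permutes_compose[OF \<alpha>1 m1])
    have s2: "?\<sigma>2 permutes D2" by (rule permutes_compose[OF \<alpha>2 m2])
    have c1: "\<phi>2 \<circ> cycle_of_list b = cycle_of_list b \<circ> \<phi>2"
      by (rule disjoint_perms_commute[OF \<phi>2 cycle_permutes]) (use assms(12) disj in auto)
    have c2: "(\<phi>2 \<circ> cycle_of_list c) \<circ> \<alpha>1 = \<alpha>1 \<circ> (\<phi>2 \<circ> cycle_of_list c)"
      by (rule disjoint_perms_commute[OF m2 \<alpha>1]) (use disj in auto)
    have "\<phi> \<circ> cycle_of_list b \<circ> cycle_of_list c \<circ> ?\<alpha>' = \<phi>1 \<circ> (\<phi>2 \<circ> cycle_of_list b) \<circ> cycle_of_list c \<circ> \<alpha>1 \<circ> \<alpha>2"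
      by (simp only: \<phi>_def comp_assoc)
    also have "\<dots> = \<phi>1 \<circ> cycle_of_list b \<circ> ((\<phi>2 \<circ> cycle_of_list c) \<circ> \<alpha>1) \<circ> \<alpha>2"
      unfolding c1 by (simp only: comp_assoc)
    also have "\<dots> = ?\<sigma>1 \<circ> ?\<sigma>2" unfolding c2 by (simp only: comp_assoc)
    finally have eq: "\<phi> \<circ> cycle_of_list b \<circ> cycle_of_list c \<circ> ?\<alpha>' = ?\<sigma>1 \<circ> ?\<sigma>2" .
    have n: "ncyc (?\<sigma>1 \<circ> ?\<sigma>2) ?D' = ncyc ?\<sigma>1 D1 + ncyc ?\<sigma>2 D2"
      by (rule ncyc_disjoint_comp(3)[OF s1 fin(1) s2 fin(2) disj])
    have fD: "finite ?D'" using fin by simp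
    have "nverts D \<alpha> \<phi> ?bs = ncyc ?\<sigma>1 D1 + ncyc ?\<sigma>2 D2 + of_bool (c = []) + of_bool (b = [])"
      using ncyc_bridge[OF fD r \<alpha>' \<phi>' bc] unfolding eq n
      by (simp only: nverts_def D_def \<alpha>_def insert_not_empty if_False)
    moreover have "ncyc ?\<sigma>1 D1 + of_bool (b = []) = nverts D1 \<alpha>1 \<phi>1 b"
      "ncyc ?\<sigma>2 D2 + of_bool (c = []) = nverts D2 \<alpha>2 \<phi>2 c"
      using e by (auto simp: nverts_def ncyc_def)
    ultimately show ?thesis by linarith
  qed
  show "bmap d D \<alpha> \<phi> \<chi> ?bs \<longleftrightarrow> bmap d D1 \<alpha>1 \<phi>1 \<chi>1 b \<and> bmap d D2 \<alpha>2 \<phi>2 \<chi>2 c"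
  proof -
    have "2 * (nverts D \<alpha> \<phi> ?bs + ncyc \<phi> (D - set ?bs)) = card D + 2 \<longleftrightarrow>
      2 * (nverts D1 \<alpha>1 \<phi>1 b + ncyc \<phi>1 ?C1) = card D1 + 2 \<and> 2 * (nverts D2 \<alpha>2 \<phi>2 c + ncyc \<phi>2 ?C2) = card D2 + 2"
      if P: "bpre d D1 \<alpha>1 \<phi>1 \<chi>1 b" "bpre d D2 \<alpha>2 \<phi>2 \<chi>2 c"
        and C: "bconn D1 \<alpha>1 \<phi>1 b" "bconn D2 \<alpha>2 \<phi>2 c"
      unfolding nv[OF that] F cD using euler_bconn[OF P(1) C(1)] euler_bconn[OF P(2) C(2)] by arith
    then show ?thesis unfolding bmap_def pre conn by blast
  qed
  show "nverts D \<alpha> \<phi> ?bs = nverts D1 \<alpha>1 \<phi>1 b + nverts D2 \<alpha>2 \<phi>2 c" if "bmap d D \<alpha> \<phi> \<chi> ?bs"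
    by (rule nv) (use that in \<open>auto simp only: bmap_def pre conn\<close>)
qed

lemma cycle_all_or_none:
  assumes "distinct l" "\<And>x. x \<in> set l \<Longrightarrow> f x = cycle_of_list l x" "f ` S \<subseteq> S"
  shows "set l \<subseteq> S \<or> set l \<inter> S = {}"
proof (rule ccontr)
  assume "\<not> ?thesis"
  then obtain x where x: "x \<in> set l" "x \<in> S" and n: "\<not> set l \<subseteq> S" by blast
  have "cycle_of_list l ` (S \<inter> set l) \<subseteq> S \<inter> set l"
  proof (rule image_subsetI)
    fix z assume z: "z \<in> S \<inter> set l"
    then have "f z \<in> S" using assms(3) by blast
    then show "cycle_of_list l z \<in> S \<inter> set l"
      using z assms(2)[of z] permutes_in_image[OF cycle_permutes, of l z] by simp
  qed
  then have "orbit (cycle_of_list l) x \<subseteq> S \<inter> set l"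
    using x by (intro orbit_subset_closed) auto
  then show False using orbit_cycle_of_list[OF assms(1) x(1)] n by auto
qed

lemma perm_restrict_closed_permutes:
  assumes "f permutes D" "finite A" "A \<subseteq> D" "\<And>x. x \<in> A \<Longrightarrow> f x \<in> A"
  shows "perm_restrict f A permutes A"
proof -
  have "inj_on f A" using assms(1) by (meson inj_on_subset permutes_inj subset_UNIV)
  then have "bij_betw f A A"
    using assms(2,4) by (metis bij_betw_def endo_inj_surj image_subset_iff)
  then have "bij_betw (perm_restrict f A) A A"
    by (rule bij_betw_cong[THEN iffD1, rotated]) (simp add: perm_restrict_def)
  then show ?thesis by (rule bij_imp_permutes) (simp add: perm_restrict_def)
qed

text \<open>In a planar map an edge with the boundary on both sides disconnects. Removing it splits
  the boundary into two cycles: when both are nonempty, one more face and one edge fewer for the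
  same number of vertices, which Euler's inequality permits only with at least two components. If
  \<open>b\<close> or \<open>c\<close> is empty, that side is the vertex map and the other one
  receives all remaining darts.\<close>

lemma bridge_split:
  assumes M: "bmap d D \<alpha> \<phi> \<chi> (r # b @ r' # c)" and ar: "\<alpha> r = r'"
  obtains D1 D2 where "D1 \<inter> D2 = {}" "D = insert r (insert r' (D1 \<union> D2))" "r \<notin> D1 \<union> D2" "r' \<notin> D1 \<union> D2"
    "set b \<subseteq> D1" "set c \<subseteq> D2"
    "\<And>x. x \<in> D1 \<Longrightarrow> \<alpha> x \<in> D1 \<and> \<phi> x \<in> D1" "\<And>x. x \<in> D2 \<Longrightarrow> \<alpha> x \<in> D2 \<and> \<phi> x \<in> D2"
proof -
  let ?bs = "r # b @ r' # c" and ?D' = "D - {r, r'}"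
  have fin: "finite D" and \<alpha>: "\<alpha> permutes D" "\<And>x. x \<in> D \<Longrightarrow> \<alpha> x \<noteq> x \<and> \<alpha> (\<alpha> x) = x"
    and bs: "distinct ?bs" "set ?bs \<subseteq> D" and \<phi>: "\<phi> permutes D - set ?bs"
    and con: "\<And>S. S \<subseteq> D - set ?bs \<Longrightarrow> \<alpha> ` S \<subseteq> S \<Longrightarrow> \<phi> ` S \<subseteq> S \<Longrightarrow> S = {}"
    and eul: "2 * (nverts D \<alpha> \<phi> ?bs + ncyc \<phi> (D - set ?bs)) = card D + 2"
    using M by (auto simp: bmap_def bpre_def bconn_def)
  have rD: "r \<in> D" "r' \<in> D" "r \<noteq> r'" using bs by auto
  have ar': "\<alpha> r' = r" using \<alpha>(2)[OF rD(1)] ar by auto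
  have D: "D = insert r (insert r' ?D')" using rD by auto
  let ?\<alpha>' = "\<alpha> \<circ> transpose r r'"
  have \<alpha>': "?\<alpha>' permutes ?D'"
  proof (rule permutes_superset)
    show "?\<alpha>' permutes D" by (rule permutes_compose[OF permutes_swap_id[OF rD(1,2)] \<alpha>(1)])
  qed (use ar ar' in auto)
  have \<alpha>eq: "?\<alpha>' x = \<alpha> x" if "x \<in> ?D'" for x using that by (auto simp: transpose_def)
  have \<alpha>in: "\<alpha> x \<in> ?D'" if "x \<in> ?D'" for x using that \<alpha>eq[OF that] permutes_in_image[OF \<alpha>', of x] by simp
  have Cset: "D - set ?bs = ?D' - set (b @ c)" by auto
  note \<phi>' = \<phi>[unfolded Cset]
  have \<phi>in: "\<phi> x \<in> ?D'" if "x \<in> ?D'" for x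
    using that permutes_in_image[OF \<phi>', of x] permutes_not_in[OF \<phi>', of x] by (cases "x \<in> set (b @ c)") auto
  have bc: "distinct (b @ c)" "set (b @ c) \<subseteq> ?D'" using bs by auto
  show ?thesis
  proof (cases "b = [] \<or> c = []")
    case True
    then show ?thesis
    proof
      assume "b = []"
      then show ?thesis using that[of "{}" ?D'] D \<alpha>in \<phi>in bc by auto
    next
      assume "c = []"
      then show ?thesis using that[of ?D' "{}"] D \<alpha>in \<phi>in bc by auto
    qed
  next
    case False
    let ?\<Phi> = "\<phi> \<circ> cycle_of_list b \<circ> cycle_of_list c"
    have fin': "finite ?D'" "finite (?D' - set c)" using fin by auto
    have p1: "\<phi> permutes (?D' - set c) - set b"
      using \<phi>' by (rule back_subst[of "\<lambda>X. \<phi> permutes X"]) auto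
    have b: "distinct b" "set b \<subseteq> ?D' - set c" "distinct c" "set c \<subseteq> ?D'" using bc by auto
    note n1 = ncyc_add_boundary[OF fin'(2) p1 b(1,2)]
    note n2 = ncyc_add_boundary[OF fin'(1) n1(1) b(3,4)]
    have nC: "ncyc ?\<Phi> ?D' = ncyc \<phi> (D - set ?bs) + 2"
    proof -
      have "?D' - set c - set b = D - set ?bs" by auto
      then show ?thesis using n1(2) n2(2) False by simp
    qed
    have ai: "?\<alpha>' x \<noteq> x \<and> ?\<alpha>' (?\<alpha>' x) = x" if "x \<in> ?D'" for x
      using \<alpha>eq[OF that] \<alpha>eq[OF \<alpha>in[OF that]] \<alpha>(2)[of x] that by (simp del: comp_apply)
    obtain \<rho> where \<rho>: "\<rho> permutes ?D'" "\<And>z. z \<in> ?D' \<Longrightarrow> ?\<Phi> z \<in> orbit \<rho> z"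
      "\<And>z. z \<in> ?D' \<Longrightarrow> ?\<alpha>' z \<in> orbit \<rho> z"
      "2 * (ncyc (?\<Phi> \<circ> ?\<alpha>') ?D' + ncyc ?\<Phi> ?D') \<le> card ?D' + 4 * ncyc \<rho> ?D'"
      using euler_inequality[OF fin'(1) n2(1) \<alpha>' ai] by blast
    have nv: "ncyc (?\<Phi> \<circ> ?\<alpha>') ?D' = nverts D \<alpha> \<phi> ?bs"
    proof -
      have "?\<alpha>' \<circ> transpose r r' = \<alpha>" by (simp add: comp_assoc)
      then have "ncyc (?\<Phi> \<circ> ?\<alpha>') ?D' = ncyc (\<phi> \<circ> cycle_of_list ?bs \<circ> \<alpha>) (insert r (insert r' ?D'))"
        using ncyc_bridge[OF fin'(1) _ _ rD(3) \<alpha>' \<phi>' bc] False by simp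
      then show ?thesis unfolding nverts_def D[symmetric] using rD(1) by auto
    qed
    have cD: "card D = card ?D' + 2"
      using rD fin by (subst D) simp
    have two: "2 \<le> ncyc \<rho> ?D'" using \<rho>(4) eul unfolding nv nC cD
      by (simp only: distrib_left)
    note oeq = perm_orbit_eq[OF \<rho>(1) fin'(1)]
    note self = perm_self_in_orbit[OF \<rho>(1) fin'(1)]
    have cl: "\<alpha> ` orbit \<rho> z \<subseteq> orbit \<rho> z" "?\<Phi> ` orbit \<rho> z \<subseteq> orbit \<rho> z" "orbit \<rho> z \<subseteq> ?D'"
      if z: "z \<in> ?D'" for z
    proof -
      show s: "orbit \<rho> z \<subseteq> ?D'" using permutes_orbit_subset[OF \<rho>(1) z] .
      have g: "f ` orbit \<rho> z \<subseteq> orbit \<rho> z" if "\<And>w. w \<in> ?D' \<Longrightarrow> f w \<in> orbit \<rho> w" for f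
      proof (rule image_subsetI)
        fix w assume w: "w \<in> orbit \<rho> z"
        then show "f w \<in> orbit \<rho> z" using that[of w] s oeq[OF w] by blast
      qed
      show "?\<Phi> ` orbit \<rho> z \<subseteq> orbit \<rho> z" by (rule g[OF \<rho>(2)])
      show "\<alpha> ` orbit \<rho> z \<subseteq> orbit \<rho> z" by (rule g) (use \<rho>(3) \<alpha>eq in metis)
    qed
    have \<Phi>b: "?\<Phi> x = cycle_of_list b x" if "x \<in> set b" for x
    proof -
      have "x \<notin> set c" "cycle_of_list b x \<in> set b"
        using that bc permutes_in_image[OF cycle_permutes, of b x] by auto
      then show ?thesis using permutes_not_in[OF \<phi>', of "cycle_of_list b x"]
        by (simp add: id_outside_supp)
    qed
    have \<Phi>c: "?\<Phi> x = cycle_of_list c x" if "x \<in> set c" for x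
    proof -
      have "cycle_of_list c x \<in> set c" using that permutes_in_image[OF cycle_permutes, of c x] by auto
      moreover then have "cycle_of_list c x \<notin> set b" using bc by auto
      ultimately show ?thesis using permutes_not_in[OF \<phi>', of "cycle_of_list c x"]
        by (simp add: id_outside_supp)
    qed
    have \<Phi>o: "?\<Phi> x = \<phi> x" if "x \<notin> set (b @ c)" for x using that by (simp add: id_outside_supp)
    have ab: "set b \<subseteq> S \<or> set b \<inter> S = {}" if "?\<Phi> ` S \<subseteq> S" for S
      by (rule cycle_all_or_none[OF b(1) _ that]) (rule \<Phi>b)
    have ac: "set c \<subseteq> S \<or> set c \<inter> S = {}" if "?\<Phi> ` S \<subseteq> S" for S
      by (rule cycle_all_or_none[OF b(3) _ that]) (rule \<Phi>c)
    let ?D1 = "orbit \<rho> (hd b)"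
    have hb': "hd b \<in> set b" "hd c \<in> set c" using False by auto
    then have hb: "hd b \<in> ?D'" "hd b \<in> set b" "hd c \<in> set c" using b(2) by blast+
    note cl1 = cl[OF hb(1)]
    have \<phi>cl: "\<phi> ` S \<subseteq> S" if "?\<Phi> ` S \<subseteq> S" "S \<subseteq> ?D'" for S
    proof (rule image_subsetI)
      fix x assume x: "x \<in> S"
      show "\<phi> x \<in> S"
      proof (cases "x \<in> set (b @ c)")
        case True
        then show ?thesis using x permutes_not_in[OF \<phi>', of x] by simp
      next
        case False
        then show ?thesis using \<Phi>o[OF False] x that(1) by (metis image_subset_iff)
      qed
    qed
    have bD1: "set b \<subseteq> ?D1" using ab[OF cl1(2)] self[of "hd b"] hb by blast
    \<comment> \<open>If \<open>c\<close> lay in the component of \<open>b\<close>, any other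
      component would be a nonempty closed set of inner darts. There would then be a single
      component, against the bound just obtained.\<close>
    have "set c \<inter> ?D1 = {}"
    proof (rule ccontr)
      assume "set c \<inter> ?D1 \<noteq> {}"
      then have cD1: "set c \<subseteq> ?D1" using ac[OF cl1(2)] by blast
      have "orbit \<rho> z = ?D1" if z: "z \<in> ?D'" for z
      proof (rule ccontr)
        assume ne: "orbit \<rho> z \<noteq> ?D1"
        then have "orbit \<rho> z \<inter> ?D1 = {}" using oeq by blast
        then have "orbit \<rho> z \<subseteq> D - set ?bs" using bD1 cD1 cl(3)[OF z] by auto
        then have "orbit \<rho> z = {}"
          by (rule con) (use cl[OF z] \<phi>cl[OF cl(2,3)[OF z]] in auto)
        then show False using self[of z] by blast
      qed
      then have "orbit \<rho> ` ?D' \<subseteq> {?D1}" by blast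
      then have "ncyc \<rho> ?D' \<le> 1" unfolding ncyc_def by (metis card_mono finite.emptyI finite_insert is_singletonI is_singleton_altdef)
      then show False using two by simp
    qed
    then have cD2: "set c \<subseteq> ?D' - ?D1" using bc by auto
    have \<phi>D': "\<phi> permutes ?D'" by (rule permutes_subset[OF \<phi>']) auto
    have "?\<alpha>' ` ?D1 \<subseteq> ?D1"
    proof (rule image_subsetI)
      fix x assume x: "x \<in> ?D1"
      then have "?\<alpha>' x = \<alpha> x" using cl1(3) \<alpha>eq by blast
      then show "?\<alpha>' x \<in> ?D1" using x cl1(1) by (metis image_subset_iff)
    qed
    then have a2: "?\<alpha>' ` (?D' - ?D1) \<subseteq> ?D' - ?D1"
      by (rule closed_complement[OF \<alpha>' fin'(1) cl1(3)])
    have a3: "\<alpha> x \<in> ?D' - ?D1" if "x \<in> ?D' - ?D1" for x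
      using a2 that \<alpha>eq[of x] by (metis DiffD1 image_subset_iff)
    have p2: "\<phi> ` (?D' - ?D1) \<subseteq> ?D' - ?D1"
      by (rule closed_complement[OF \<phi>D' fin'(1) cl1(3) \<phi>cl[OF cl1(2,3)]])
    show ?thesis
    proof (rule that[of ?D1 "?D' - ?D1"])
      show "D = insert r (insert r' (?D1 \<union> (?D' - ?D1)))" using D cl1(3) by auto
      show "\<alpha> x \<in> ?D1 \<and> \<phi> x \<in> ?D1" if "x \<in> ?D1" for x
        using cl1(1) \<phi>cl[OF cl1(2,3)] that by auto
      show "\<alpha> x \<in> ?D' - ?D1 \<and> \<phi> x \<in> ?D' - ?D1" if "x \<in> ?D' - ?D1" for x
        using a3[OF that] p2 that by blast
    qed (use bD1 cD2 cl1(3) in auto)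
  qed
qed

text \<open>A boundary dart has the colour opposite to the dart across its edge. A black one
  therefore faces white, which is what the letter B requires.\<close>

definition col :: "nat set \<Rightarrow> nat \<Rightarrow> letter" where
  "col \<chi> x = (if x \<in> \<chi> then LetB else LetA)"

fun opp :: "letter \<Rightarrow> letter" where "opp LetA = LetB" | "opp LetB = LetA"

section \<open>Weighted sums over labelled maps\<close>

type_synonym lmap = "(nat \<Rightarrow> nat) \<times> (nat \<Rightarrow> nat) \<times> nat set \<times> nat list"

definition lmaps :: "nat \<Rightarrow> nat set \<Rightarrow> letter list \<Rightarrow> nat \<Rightarrow> lmap set" where
  "lmaps d D P v = {(\<alpha>, \<phi>, \<chi>, bs). bmap d D \<alpha> \<phi> \<chi> bs \<and> map (col \<chi>) bs = P \<and> nverts D \<alpha> \<phi> bs = v}"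

fun lweight :: "(nat \<Rightarrow> 'a) \<Rightarrow> nat set \<Rightarrow> lmap \<Rightarrow> 'a::comm_monoid_mult" where
  "lweight w D (\<alpha>, \<phi>, \<chi>, bs) = (\<Prod>F\<in>orbit \<phi> ` (D - set bs). w (card F))"

definition lcount :: "nat \<Rightarrow> (nat \<Rightarrow> 'a) \<Rightarrow> nat set \<Rightarrow> letter list \<Rightarrow> nat \<Rightarrow> 'a::comm_ring_1" where
  "lcount d w D P v = sum (lweight w D) (lmaps d D P v)"

lemma finite_lmaps: "finite D \<Longrightarrow> finite (lmaps d D P v)"
proof -
  assume fin: "finite D"
  have "lmaps d D P v \<subseteq> {f. f permutes D} \<times> {f. f permutes D} \<times> Pow D \<times> {xs. set xs \<subseteq> D \<and> distinct xs}"
    by (auto simp: lmaps_def bmap_def bpre_def intro: permutes_subset)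
  moreover have "finite \<dots>" using fin
    by (intro finite_cartesian_product finite_permutations finite_subset_distinct) auto
  ultimately show ?thesis by (rule finite_subset)
qed

text \<open>A cycle determines its list as soon as the first entry is known. Boundaries and peeled
  faces are recovered from the permutations in this way.\<close>

lemma cycle_list_unique:
  assumes "distinct cs" "cs \<noteq> []" "\<And>x. x \<in> set cs \<Longrightarrow> f x = cycle_of_list cs x"
  shows "cs = map (\<lambda>i. (f ^^ i) (hd cs)) [0..<length cs]"
proof (rule nth_equalityI)
  fix i assume i: "i < length cs"
  have "(f ^^ i) (hd cs) = (cycle_of_list cs ^^ i) (hd cs) \<and> (cycle_of_list cs ^^ i) (hd cs) \<in> set cs" for i
  proof (induction i)
    case (Suc i)
    then show ?case using assms(3) permutes_in_image[OF cycle_permutes, of cs] by simp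
  qed (use assms in auto)
  then have "(f ^^ i) (hd cs) = hd (map (cycle_of_list cs ^^ i) cs)" using assms(2) by (simp add: hd_map)
  also have "\<dots> = hd (rotate i cs)" using cyclic_rotation[OF assms(1)] by simp
  also have "\<dots> = cs ! i" using hd_rotate_conv_nth[OF assms(2)] i by simp
  finally show "cs ! i = map (\<lambda>i. (f ^^ i) (hd cs)) [0..<length cs] ! i" using i by simp
qed simp

section \<open>Peeling the root edge\<close>

definition pairs :: "nat set \<Rightarrow> (nat \<times> nat) set" where
  "pairs D = {(r, r'). r \<in> D \<and> r' \<in> D \<and> r \<noteq> r'}"

text \<open>The root dart takes the colour coded by its own letter, its partner the other
  one.\<close>

definition root_black :: "letter \<Rightarrow> nat \<Rightarrow> nat \<Rightarrow> nat set" where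
  "root_black L r r' = (if L = LetB then {r} else {r'})"

fun on_face :: "lmap \<Rightarrow> bool" where
  "on_face (\<alpha>, \<phi>, \<chi>, bs) \<longleftrightarrow> \<alpha> (hd bs) \<notin> set bs"

text \<open>\<open>j\<close> is the degree of the new face. One of its darts is \<open>r'\<close>,
  so it covers \<open>j - 1\<close> darts of the old boundary.\<close>

fun glue_face :: "letter \<Rightarrow> (nat \<times> nat) \<times> nat \<times> lmap \<Rightarrow> lmap" where
  "glue_face L ((r, r'), j, (\<alpha>, \<psi>, \<chi>, bs)) =
     (\<alpha> \<circ> transpose r r', \<psi> \<circ> cycle_of_list (r' # take (j - 1) bs), \<chi> \<union> root_black L r r', r # drop (j - 1) bs)"

text \<open>The map is built from the other arguments; \<open>i\<close>, \<open>D1\<close> and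
  \<open>v1\<close> record how the word, the darts and the vertices are shared between the two
  sides, for the purpose of counting.\<close>

fun glue_bridge :: "letter \<Rightarrow> (nat \<times> nat) \<times> nat \<times> nat set \<times> nat \<times> lmap \<times> lmap \<Rightarrow> lmap" where
  "glue_bridge L ((r, r'), i, D1, v1, (\<alpha>1, \<phi>1, \<chi>1, b), (\<alpha>2, \<phi>2, \<chi>2, c)) =
     (\<alpha>1 \<circ> \<alpha>2 \<circ> transpose r r', \<phi>1 \<circ> \<phi>2, \<chi>1 \<union> \<chi>2 \<union> root_black L r r', r # b @ r' # c)"

lemma col_eq_iff: "col \<chi> x = LetB \<longleftrightarrow> x \<in> \<chi>" "col \<chi> x = LetA \<longleftrightarrow> x \<notin> \<chi>"
  by (auto simp: col_def)

lemma root_black_cases: "root_black L r r' = {r} \<or> root_black L r r' = {r'}"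
  by (simp add: root_black_def)

lemma col_root_black:
  assumes "r \<noteq> r'" "r \<notin> D" "r' \<notin> D" "\<chi> \<subseteq> D"
  shows "col (\<chi> \<union> root_black L r r') r = L" "col (\<chi> \<union> root_black L r r') r' = opp L"
    "x \<in> D \<Longrightarrow> col (\<chi> \<union> root_black L r r') x = col \<chi> x"
    "(\<chi> \<union> root_black L r r') - {r, r'} = \<chi>"
  using assms by (cases L; auto simp: col_def root_black_def)+

lemma root_black_unique:
  assumes "col \<chi> r = L" "col \<chi> r' = opp L"
  shows "\<chi> = (\<chi> - {r, r'}) \<union> root_black L r r'"
  using assms by (cases L) (auto simp: root_black_def col_eq_iff)

lemma lmapsD:
  assumes "(\<alpha>, \<phi>, \<chi>, bs) \<in> lmaps d D P v"
  shows "bmap d D \<alpha> \<phi> \<chi> bs" "map (col \<chi>) bs = P" "nverts D \<alpha> \<phi> bs = v" "length bs = length P"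
    "finite D" "\<alpha> permutes D" "\<And>x. x \<in> D \<Longrightarrow> \<alpha> x \<noteq> x" "\<And>x. x \<in> D \<Longrightarrow> \<alpha> (\<alpha> x) = x"
    "distinct bs" "set bs \<subseteq> D" "\<phi> permutes D - set bs" "\<chi> \<subseteq> D" "\<And>x. x \<in> D \<Longrightarrow> \<alpha> x \<in> \<chi> \<longleftrightarrow> x \<notin> \<chi>"
    "\<And>F. F \<in> orbit \<phi> ` (D - set bs) \<Longrightarrow> card F \<in> {2..d}"
    "\<And>S. S \<subseteq> D - set bs \<Longrightarrow> \<alpha> ` S \<subseteq> S \<Longrightarrow> \<phi> ` S \<subseteq> S \<Longrightarrow> S = {}"
  using assms by (auto simp: lmaps_def bmap_def bpre_def bconn_def)

lemma glue_face_mem: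
  assumes p: "(r, r') \<in> pairs D" and fin: "finite D" and j: "j \<in> {2..d}"
    and M: "M \<in> lmaps d (D - {r, r'}) (replicate (j - 1) (opp L) @ P) v"
  shows "glue_face L ((r, r'), j, M) \<in> lmaps d D (L # P) v" "on_face (glue_face L ((r, r'), j, M))"
    "lweight w D (glue_face L ((r, r'), j, M)) = w j * lweight w (D - {r, r'}) M"
proof -
  obtain \<alpha> \<psi> \<chi> bs1 where Me: "M = (\<alpha>, \<psi>, \<chi>, bs1)" by (metis prod_cases4)
  note m = lmapsD[OF M[unfolded Me]]
  define fs where "fs = take (j - 1) bs1"
  define bs where "bs = drop (j - 1) bs1"
  have bs1: "bs1 = fs @ bs" by (simp add: fs_def bs_def)
  have lf: "length fs = j - 1" using m(4) by (simp add: fs_def)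
  have cf: "map (col \<chi>) fs = replicate (j - 1) (opp L)" and cb: "map (col \<chi>) bs = P"
    using m(2) lf unfolding bs1 by (auto simp: append_eq_append_conv)
  have fsne: "fs \<noteq> []" using lf j by auto
  let ?D' = "D - {r, r'}" and ?K = "root_black L r r'"
  have rr: "r \<in> D" "r' \<in> D" "r \<noteq> r'" using p by (auto simp: pairs_def)
  have D: "D = insert r (insert r' ?D')" using rr by auto
  note g = bmap_glue_face[OF m(5) _ _ rr(3) m(6) m(11)[unfolded bs1] m(9)[unfolded bs1] m(10)[unfolded bs1]
      fsne m(12) root_black_cases[of L], folded D]
  have fsc: "\<forall>x\<in>set fs. x \<in> \<chi> \<longleftrightarrow> r' \<in> ?K"
  proof
    fix x assume "x \<in> set fs"
    then have "col \<chi> x \<in> set (map (col \<chi>) fs)" by simp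
    then have "col \<chi> x = opp L" unfolding cf by (simp split: if_splits)
    then show "x \<in> \<chi> \<longleftrightarrow> r' \<in> ?K" using rr(3) by (cases L) (auto simp: col_eq_iff root_black_def)
  qed
  have Ge: "glue_face L ((r, r'), j, M) =
    (\<alpha> \<circ> transpose r r', \<psi> \<circ> cycle_of_list (r' # fs), \<chi> \<union> ?K, r # bs)"
    by (simp add: Me fs_def bs_def)
  have b: "bmap d D (\<alpha> \<circ> transpose r r') (\<psi> \<circ> cycle_of_list (r' # fs)) (\<chi> \<union> ?K) (r # bs)"
    using g(1)[of d] m(1) fsc lf j unfolding bs1 by auto
  note c = col_root_black[OF rr(3) _ _ m(12), where L=L]
  have "map (col (\<chi> \<union> ?K)) bs = P"
    unfolding cb[symmetric] by (rule map_cong[OF refl]) (use c(3) m(10) bs1 in auto)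
  then have "map (col (\<chi> \<union> ?K)) (r # bs) = L # P" using c(1) by simp
  then show "glue_face L ((r, r'), j, M) \<in> lmaps d D (L # P) v"
    unfolding Ge lmaps_def using b g(2) m(3) bs1 by simp
  have "r' \<notin> set (r # bs)" "\<alpha> r' = r'"
    using m(10) rr bs1 permutes_not_in[OF m(6), of r'] by auto
  then show "on_face (glue_face L ((r, r'), j, M))" unfolding Ge by simp
  have fin': "finite (orbit \<psi> ` (?D' - set (fs @ bs)))" using fin by simp
  have cF: "card (set (r' # fs)) = j"
    using m(9,10) bs1 lf j rr by (subst distinct_card) auto
  have "lweight w D (glue_face L ((r, r'), j, M)) =
      (\<Prod>F\<in>insert (set (r' # fs)) (orbit \<psi> ` (?D' - set (fs @ bs))). w (card F))"
    unfolding Ge lweight.simps by (subst g(3)) auto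
  also have "\<dots> = w j * (\<Prod>F\<in>orbit \<psi> ` (?D' - set (fs @ bs)). w (card F))"
    using g(4) fin' cF by (subst prod.insert) auto
  also have "(\<Prod>F\<in>orbit \<psi> ` (?D' - set (fs @ bs)). w (card F)) = lweight w ?D' M"
    by (simp only: Me lweight.simps bs1)
  finally show "lweight w D (glue_face L ((r, r'), j, M)) = w j * lweight w ?D' M" .
qed

text \<open>All data can be read off the result: \<open>r'\<close> is the partner of the root, and
  \<open>r' # fs\<close> is the cycle through \<open>r'\<close> of the glued face permutation,
  listed from \<open>r'\<close> on.\<close>

lemma glue_face_inj:
  "inj_on (glue_face L) (SIGMA p:pairs D. SIGMA j:{2..d}. lmaps d (D - {fst p, snd p}) (replicate (j - 1) (opp L) @ P) v)"
proof (rule inj_onI)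
  fix x y
  assume X: "x \<in> (SIGMA p:pairs D. SIGMA j:{2..d}. lmaps d (D - {fst p, snd p}) (replicate (j - 1) (opp L) @ P) v)"
    and Y: "y \<in> (SIGMA p:pairs D. SIGMA j:{2..d}. lmaps d (D - {fst p, snd p}) (replicate (j - 1) (opp L) @ P) v)"
    and eq: "glue_face L x = glue_face L y"
  obtain r r' j \<alpha> \<psi> \<chi> bs where x: "x = ((r, r'), j, (\<alpha>, \<psi>, \<chi>, bs))" by (metis prod_cases4 surj_pair)
  obtain s s' k \<beta> \<xi> \<kappa> cs where y: "y = ((s, s'), k, (\<beta>, \<xi>, \<kappa>, cs))" by (metis prod_cases4 surj_pair)
  have mx: "(\<alpha>, \<psi>, \<chi>, bs) \<in> lmaps d (D - {r, r'}) (replicate (j - 1) (opp L) @ P) v"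
    and jx: "j \<in> {2..d}" "(r, r') \<in> pairs D" using X x by auto
  have my: "(\<beta>, \<xi>, \<kappa>, cs) \<in> lmaps d (D - {s, s'}) (replicate (k - 1) (opp L) @ P) v"
    and jy: "k \<in> {2..d}" "(s, s') \<in> pairs D" using Y y by auto
  note m = lmapsD[OF mx] and n = lmapsD[OF my]
  note eqs = eq[unfolded x y glue_face.simps prod.inject list.inject]
  have rs: "r = s" and aeq: "\<alpha> \<circ> transpose r r' = \<beta> \<circ> transpose s s'" using eqs by blast+
  have "(\<alpha> \<circ> transpose r r') r = r'" "(\<beta> \<circ> transpose s s') s = s'"
    using permutes_not_in[OF m(6), of r'] permutes_not_in[OF n(6), of s'] by auto
  then have rs': "r' = s'" using aeq rs by metis
  have aeq': "\<alpha> \<circ> transpose r r' = \<beta> \<circ> transpose r r'" using aeq unfolding rs rs' .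
  have "\<alpha> = (\<alpha> \<circ> transpose r r') \<circ> transpose r r'" by (simp add: comp_assoc)
  also have "\<dots> = \<beta>" unfolding aeq' by (simp add: comp_assoc)
  finally have ab: "\<alpha> = \<beta>" .
  have rn: "r \<noteq> r'" "r \<in> D" "r' \<in> D" using jx by (auto simp: pairs_def)
  have "\<chi> \<union> root_black L r r' = \<kappa> \<union> root_black L r r'" using eqs rs rs' by simp
  then have ck: "\<chi> = \<kappa>"
    using col_root_black(4)[OF rn(1) _ _ m(12), where L=L] col_root_black(4)[OF rn(1) _ _ n(12), where L=L] rs rs' by simp
  define fs where "fs = take (j - 1) bs"
  define gs where "gs = take (k - 1) cs"
  have bsd: "bs = fs @ drop (j - 1) bs" "cs = gs @ drop (k - 1) cs" by (simp_all add: fs_def gs_def)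
  have len: "length fs = j - 1" "length gs = k - 1" using m(4) n(4) by (auto simp: fs_def gs_def)
  let ?c = "cycle_of_list (r' # fs)" and ?e = "cycle_of_list (r' # gs)"
  have feq: "\<psi> \<circ> ?c = \<xi> \<circ> ?e" using eqs rs rs' by (simp add: fs_def gs_def del: cycle_of_list.simps)
  have subs: "set fs \<subseteq> set bs" "set gs \<subseteq> set cs" by (simp_all add: fs_def gs_def set_take_subset)
  have dist: "distinct (r' # fs)" "distinct (r' # gs)"
    using m(9,10) n(9,10) rs rs' subs by (auto simp: fs_def gs_def)
  have fc: "(\<psi> \<circ> ?c) z = ?c z" if "z \<in> set (r' # fs)" for z
  proof -
    have "?c z \<in> set (r' # fs)" using that permutes_in_image[OF cycle_permutes] by metis
    then show ?thesis using permutes_not_in[OF m(11), of "?c z"] subs by auto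
  qed
  have ge: "(\<psi> \<circ> ?c) z = ?e z" if "z \<in> set (r' # gs)" for z
  proof -
    have "?e z \<in> set (r' # gs)" using that permutes_in_image[OF cycle_permutes] by metis
    then show ?thesis unfolding feq using permutes_not_in[OF n(11), of "?e z"] subs rs' by auto
  qed
  have "orbit (\<psi> \<circ> ?c) r' = set (r' # fs)"
  proof -
    have "orbit ?c r' = set (r' # fs)" by (rule orbit_cycle_of_list[OF dist(1)]) simp
    then show ?thesis using orbit_cong[of r' ?c "\<psi> \<circ> ?c"] fc by simp
  qed
  moreover have "orbit (\<psi> \<circ> ?c) r' = set (r' # gs)"
  proof -
    have "orbit ?e r' = set (r' # gs)" by (rule orbit_cycle_of_list[OF dist(2)]) simp
    then show ?thesis using orbit_cong[of r' ?e "\<psi> \<circ> ?c"] ge by simp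
  qed
  ultimately have "set (r' # fs) = set (r' # gs)" by simp
  then have l: "length (r' # fs) = length (r' # gs)" using dist by (metis distinct_card)
  have "r' # fs = map (\<lambda>i. ((\<psi> \<circ> ?c) ^^ i) r') [0..<length (r' # fs)]"
    by (rule cycle_list_unique[OF dist(1), of "\<psi> \<circ> ?c", unfolded list.sel]) (simp, rule fc)
  moreover have "r' # gs = map (\<lambda>i. ((\<psi> \<circ> ?c) ^^ i) r') [0..<length (r' # gs)]"
    by (rule cycle_list_unique[OF dist(2), of "\<psi> \<circ> ?c", unfolded list.sel]) (simp, rule ge)
  ultimately have fg: "fs = gs" using l by (metis list.inject)
  have jk: "j = k" using l len jx jy by auto
  have sj: "surj ?c" using permutes_surj[OF cycle_permutes] .
  have px: "\<psi> = \<xi>"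
  proof
    fix z
    obtain u where u: "z = ?c u" using sj by (auto elim: surjE)
    show "\<psi> z = \<xi> z" using fun_cong[OF feq[folded fg], of u] unfolding u comp_apply .
  qed
  have "drop (j - 1) bs = drop (k - 1) cs" using eqs by blast
  then have "bs = cs" using bsd(1)[unfolded fg] bsd(2) by simp
  then show "x = y" using x y rs rs' ab ck jk px by simp
qed

text \<open>The inverse operation: the face of \<open>r'\<close> is listed from \<open>r'\<close>
  on, its cycle is taken out of \<open>\<phi>\<close>, and its remaining darts are put in front of
  the boundary.\<close>

lemma glue_face_surj:
  assumes M: "M \<in> lmaps d D (L # P) v" and f: "on_face M"
  shows "M \<in> glue_face L ` (SIGMA p:pairs D. SIGMA j:{2..d}. lmaps d (D - {fst p, snd p}) (replicate (j - 1) (opp L) @ P) v)"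
proof -
  obtain \<alpha> \<phi> \<chi> bs0 where Me: "M = (\<alpha>, \<phi>, \<chi>, bs0)" by (metis prod_cases4)
  note m0 = lmapsD[OF M[unfolded Me]]
  obtain r bs where bs0: "bs0 = r # bs" using m0(4) by (cases bs0) auto
  note m = m0[unfolded bs0]
  define r' where "r' = \<alpha> r"
  have rD: "r \<in> D" using m(10) by auto
  have rr: "r' \<in> D" "r \<noteq> r'" "\<alpha> r' = r"
    using m(7,8)[OF rD] rD permutes_in_image[OF m(6), of r] by (auto simp: r'_def)
  have r'C: "r' \<in> D - set (r # bs)" using f rr(1) by (simp add: Me bs0 r'_def)
  let ?C = "D - set (r # bs)"
  have perm: "permutation \<phi>" using m(5,11) permutation_permutes by blast
  define cs where "cs = support \<phi> r'"
  have cs: "distinct cs" unfolding cs_def by (rule cycle_of_permutation[OF perm])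
  have scs: "set cs = orbit \<phi> r'"
    unfolding cs_def support_set[OF perm] orbit_altdef_self_in[OF permutation_self_in_orbit[OF perm]] by auto
  have "least_power \<phi> r' > 0" using least_power_of_permutation(2)[OF perm] .
  then have "cs \<noteq> []" "hd cs = r'" unfolding cs_def by (auto simp: hd_map)
  then obtain fs where csf: "cs = r' # fs" by (cases cs) auto
  have cyc: "\<phi> x = cycle_of_list (r' # fs) x" if "x \<in> set (r' # fs)" for x
    using cycle_restrict[OF perm] that unfolding csf[symmetric] cs_def by blast
  define j where "j = card (orbit \<phi> r')"
  have j: "j \<in> {2..d}" unfolding j_def using m(14) r'C by blast
  have lf: "length fs = j - 1" "fs \<noteq> []"
    using j distinct_card[OF cs] scs unfolding j_def csf by (auto simp: csf)
  have cyo: "cyclic_on \<phi> (orbit \<phi> r')" by (rule cyclic_on_orbit'[OF perm])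
  define \<psi> where "\<psi> = perm_restrict \<phi> (?C - orbit \<phi> r')"
  have orC: "orbit \<phi> r' \<subseteq> ?C" using permutes_orbit_subset[OF m(11) r'C] .
  have \<psi>p: "\<psi> permutes ?C - orbit \<phi> r'" unfolding \<psi>_def by (rule perm_restrict_diff_cyclic[OF m(11) cyo])
  have \<phi>e: "\<phi> = \<psi> \<circ> cycle_of_list (r' # fs)"
  proof
    fix x
    have sf: "set (r' # fs) = orbit \<phi> r'" using scs csf by simp
    show "\<phi> x = (\<psi> \<circ> cycle_of_list (r' # fs)) x"
    proof (cases "x \<in> orbit \<phi> r'")
      case True
      then have "\<phi> x \<in> orbit \<phi> r'" by (rule orbit.step)
      then have "\<psi> (\<phi> x) = \<phi> x" unfolding \<psi>_def by (simp add: perm_restrict_def)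
      then show ?thesis using cyc True unfolding sf by simp
    next
      case False
      then have "cycle_of_list (r' # fs) x = x" using sf by (intro id_outside_supp) auto
      moreover have "\<psi> x = \<phi> x"
        using False permutes_not_in[OF m(11), of x] by (auto simp: \<psi>_def perm_restrict_def)
      ultimately show ?thesis by simp
    qed
  qed
  let ?D' = "D - {r, r'}"
  have D: "D = insert r (insert r' ?D')" using rD rr by auto
  define \<alpha>' where "\<alpha>' = \<alpha> \<circ> transpose r r'"
  have \<alpha>': "\<alpha>' permutes ?D'" unfolding \<alpha>'_def
  proof (rule permutes_superset)
    show "\<alpha> \<circ> transpose r r' permutes D" by (rule permutes_compose[OF permutes_swap_id[OF rD rr(1)] m(6)])
  qed (use rr in \<open>auto simp: r'_def\<close>)
  have \<alpha>e: "\<alpha> = \<alpha>' \<circ> transpose r r'" by (simp add: \<alpha>'_def comp_assoc)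
  have Ce: "?C - orbit \<phi> r' = ?D' - set (fs @ bs)"
    using scs unfolding csf by auto
  have fsD: "distinct (fs @ bs)" "set (fs @ bs) \<subseteq> ?D'"
    using cs m(9,10) orC scs r'C unfolding csf by auto
  define \<chi>' where "\<chi>' = \<chi> - {r, r'}"
  have colr: "col \<chi> r = L" using m(2) by simp
  have colr': "col \<chi> r' = opp L"
    using colr m(13)[OF rD] by (cases L) (auto simp: col_eq_iff r'_def[symmetric])
  have \<chi>e: "\<chi> = \<chi>' \<union> root_black L r r'" unfolding \<chi>'_def by (rule root_black_unique[OF colr colr'])
  have \<chi>D: "\<chi>' \<subseteq> ?D'" using m(12) by (auto simp: \<chi>'_def)
  have fD: "finite ?D'" using m(5) by simp
  note g = bmap_glue_face[OF fD _ _ rr(2) \<alpha>' \<psi>p[unfolded Ce] fsD lf(2) \<chi>D root_black_cases[of L],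
      folded D \<alpha>e \<phi>e \<chi>e]
  have b: "bmap d ?D' \<alpha>' \<psi> \<chi>' (fs @ bs)" and fc: "\<forall>x\<in>set fs. x \<in> \<chi>' \<longleftrightarrow> r' \<in> root_black L r r'"
    using g(1)[of d] m(1) by auto
  have "map (col \<chi>') fs = replicate (j - 1) (opp L)"
  proof -
    have "col \<chi>' x = opp L" if "x \<in> set fs" for x
      using fc that rr(2) by (cases L) (auto simp: col_eq_iff root_black_def)
    then have "map (col \<chi>') fs = map (\<lambda>_. opp L) fs" by simp
    then show ?thesis using lf(1) by (simp add: map_replicate_const)
  qed
  moreover have "map (col \<chi>') bs = P"
  proof -
    have "map (col \<chi>') bs = map (col \<chi>) bs"
      by (rule map_cong[OF refl]) (use fsD(2) in \<open>auto simp: col_def \<chi>'_def\<close>)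
    moreover have "map (col \<chi>) bs = P" using m(2) by simp
    ultimately show ?thesis by (rule trans)
  qed
  ultimately have "(\<alpha>', \<psi>, \<chi>', fs @ bs) \<in> lmaps d ?D' (replicate (j - 1) (opp L) @ P) v"
    using b g(2) m(3) by (simp add: lmaps_def)
  moreover have "M = glue_face L ((r, r'), j, (\<alpha>', \<psi>, \<chi>', fs @ bs))"
    using lf(1) by (simp add: Me bs0 \<alpha>e[symmetric] \<chi>e[symmetric] \<phi>e[symmetric] del: cycle_of_list.simps)
  moreover have "(r, r') \<in> pairs D" using rD rr by (simp add: pairs_def)
  ultimately show ?thesis using j by (intro image_eqI[of _ _ "((r, r'), j, (\<alpha>', \<psi>, \<chi>', fs @ bs))"]) auto
qed

lemma lcount_on_face:
  fixes w :: "nat \<Rightarrow> 'a::comm_ring_1"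
  assumes fin: "finite D"
  shows "sum (lweight w D) {M \<in> lmaps d D (L # P) v. on_face M} =
    (\<Sum>p\<in>pairs D. \<Sum>j=2..d. w j * lcount d w (D - {fst p, snd p}) (replicate (j - 1) (opp L) @ P) v)"
proof -
  let ?T = "SIGMA p:pairs D. SIGMA j:{2..d}. lmaps d (D - {fst p, snd p}) (replicate (j - 1) (opp L) @ P) v"
  have mem: "glue_face L x \<in> lmaps d D (L # P) v \<and> on_face (glue_face L x) \<and>
      lweight w D (glue_face L x) = w (fst (snd x)) * lweight w (D - {fst (fst x), snd (fst x)}) (snd (snd x))"
    if "x \<in> ?T" for x
  proof -
    obtain r r' j M where x: "x = ((r, r'), j, M)" by (metis surj_pair)
    show ?thesis using that glue_face_mem[OF _ fin, of r r' j d M L P v] by (auto simp: x simp del: glue_face.simps)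
  qed
  have bij: "bij_betw (glue_face L) ?T {M \<in> lmaps d D (L # P) v. on_face M}"
    unfolding bij_betw_def using glue_face_inj mem glue_face_surj by blast
  have fp: "finite (pairs D)"
    by (rule finite_subset[of _ "D \<times> D"]) (use fin in \<open>auto simp: pairs_def\<close>)
  have "sum (lweight w D) {M \<in> lmaps d D (L # P) v. on_face M} = (\<Sum>x\<in>?T. lweight w D (glue_face L x))"
    by (rule sum.reindex_bij_betw[OF bij, symmetric])
  also have "\<dots> = (\<Sum>x\<in>?T. w (fst (snd x)) * lweight w (D - {fst (fst x), snd (fst x)}) (snd (snd x)))"
    using mem by (intro sum.cong) auto
  also have "\<dots> = (\<Sum>(p, j, M)\<in>?T. w j * lweight w (D - {fst p, snd p}) M)"
    by (intro sum.cong) auto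
  also have "\<dots> = (\<Sum>p\<in>pairs D. \<Sum>j=2..d. \<Sum>M\<in>lmaps d (D - {fst p, snd p}) (replicate (j - 1) (opp L) @ P) v. w j * lweight w (D - {fst p, snd p}) M)"
  proof -
    have "(\<Sum>p\<in>pairs D. \<Sum>j=2..d. \<Sum>M\<in>lmaps d (D - {fst p, snd p}) (replicate (j - 1) (opp L) @ P) v. w j * lweight w (D - {fst p, snd p}) M)
      = (\<Sum>p\<in>pairs D. \<Sum>(j, M)\<in>(SIGMA j:{2..d}. lmaps d (D - {fst p, snd p}) (replicate (j - 1) (opp L) @ P) v). w j * lweight w (D - {fst p, snd p}) M)"
      by (intro sum.cong refl sum.Sigma) (use fin in \<open>auto intro: finite_lmaps\<close>)
    also have "\<dots> = (\<Sum>(p, j, M)\<in>?T. w j * lweight w (D - {fst p, snd p}) M)"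
      using fp fin by (subst sum.Sigma) (auto intro!: finite_SigmaI finite_lmaps sum.cong)
    finally show ?thesis by simp
  qed
  finally show ?thesis by (simp add: lcount_def sum_distrib_left)
qed

section \<open>Peeling a bridge\<close>

lemma glue_bridge_mem:
  assumes p: "(r, r') \<in> pairs D" and fin: "finite D" and i: "i < length P" "P ! i = opp L"
    and D1: "D1 \<subseteq> D - {r, r'}" and v1: "v1 \<le> v"
    and M1: "M1 \<in> lmaps d D1 (take i P) v1" and M2: "M2 \<in> lmaps d (D - {r, r'} - D1) (drop (Suc i) P) (v - v1)"
  shows "glue_bridge L ((r, r'), i, D1, v1, M1, M2) \<in> lmaps d D (L # P) v"
    "\<not> on_face (glue_bridge L ((r, r'), i, D1, v1, M1, M2))"
    "lweight w D (glue_bridge L ((r, r'), i, D1, v1, M1, M2)) = lweight w D1 M1 * lweight w (D - {r, r'} - D1) M2"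
proof -
  obtain \<alpha>1 \<phi>1 \<chi>1 b where M1e: "M1 = (\<alpha>1, \<phi>1, \<chi>1, b)" by (metis prod_cases4)
  obtain \<alpha>2 \<phi>2 \<chi>2 c where M2e: "M2 = (\<alpha>2, \<phi>2, \<chi>2, c)" by (metis prod_cases4)
  note m = lmapsD[OF M1[unfolded M1e]] and n = lmapsD[OF M2[unfolded M2e]]
  let ?D2 = "D - {r, r'} - D1" and ?K = "root_black L r r'"
  have rr: "r \<in> D" "r' \<in> D" "r \<noteq> r'" using p by (auto simp: pairs_def)
  have D: "insert r (insert r' (D1 \<union> ?D2)) = D" using rr D1 by auto
  have disj: "D1 \<inter> ?D2 = {}" and rn: "r \<notin> D1 \<union> ?D2" "r' \<notin> D1 \<union> ?D2" using D1 by auto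
  note g = bmap_glue_bridge[OF m(5) n(5) disj rn rr(3) m(6) n(6) m(11) n(11) m(9,10) n(9,10) m(12) n(12)
      root_black_cases[of L], unfolded D]
  let ?M = "(\<alpha>1 \<circ> \<alpha>2 \<circ> transpose r r', \<phi>1 \<circ> \<phi>2, \<chi>1 \<union> \<chi>2 \<union> ?K, r # b @ r' # c)"
  have Ge: "glue_bridge L ((r, r'), i, D1, v1, M1, M2) = ?M" by (simp add: M1e M2e)
  have b: "bmap d D (\<alpha>1 \<circ> \<alpha>2 \<circ> transpose r r') (\<phi>1 \<circ> \<phi>2) (\<chi>1 \<union> \<chi>2 \<union> ?K) (r # b @ r' # c)"
    using g(1) m(1) n(1) by blast
  have \<chi>12: "\<chi>1 \<union> \<chi>2 \<subseteq> D1 \<union> ?D2" using m(12) n(12) by auto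
  note c = col_root_black[OF rr(3) rn \<chi>12, where L=L]
  have "map (col (\<chi>1 \<union> \<chi>2 \<union> ?K)) b = map (col \<chi>1) b"
  proof (rule map_cong[OF refl])
    fix x assume "x \<in> set b"
    then have "x \<in> D1" using m(10) by blast
    then show "col (\<chi>1 \<union> \<chi>2 \<union> ?K) x = col \<chi>1 x" using c(3)[of x] n(12) by (auto simp: col_def)
  qed
  moreover have "map (col (\<chi>1 \<union> \<chi>2 \<union> ?K)) c = map (col \<chi>2) c"
  proof (rule map_cong[OF refl])
    fix x assume "x \<in> set c"
    then have "x \<in> ?D2" using n(10) by blast
    then show "col (\<chi>1 \<union> \<chi>2 \<union> ?K) x = col \<chi>2 x" using c(3)[of x] m(12) by (auto simp: col_def)
  qed
  ultimately have "map (col (\<chi>1 \<union> \<chi>2 \<union> ?K)) (r # b @ r' # c) = L # take i P @ opp L # drop (Suc i) P"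
    using c(1,2) m(2) n(2) by simp
  also have "\<dots> = L # P" using i id_take_nth_drop[of i P] by simp
  finally show "glue_bridge L ((r, r'), i, D1, v1, M1, M2) \<in> lmaps d D (L # P) v"
    unfolding Ge lmaps_def using b g(2)[OF b] m(3) n(3) v1 by simp
  have "\<alpha>2 r' = r'" "\<alpha>1 r' = r'" using permutes_not_in[OF m(6), of r'] permutes_not_in[OF n(6), of r'] rn by auto
  then show "\<not> on_face (glue_bridge L ((r, r'), i, D1, v1, M1, M2))" unfolding Ge by simp
  have "finite D1" "finite ?D2" using m(5) n(5) .
  then have "(\<Prod>F\<in>orbit \<phi>1 ` (D1 - set b) \<union> orbit \<phi>2 ` (?D2 - set c). w (card F)) =
    (\<Prod>F\<in>orbit \<phi>1 ` (D1 - set b). w (card F)) * (\<Prod>F\<in>orbit \<phi>2 ` (?D2 - set c). w (card F))"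
    using g(4) by (intro prod.union_disjoint) auto
  moreover have "lweight w D ?M = (\<Prod>F\<in>orbit \<phi>1 ` (D1 - set b) \<union> orbit \<phi>2 ` (?D2 - set c). w (card F))"
    unfolding lweight.simps g(3) ..
  moreover have "lweight w D1 M1 = (\<Prod>F\<in>orbit \<phi>1 ` (D1 - set b). w (card F))"
    "lweight w ?D2 M2 = (\<Prod>F\<in>orbit \<phi>2 ` (?D2 - set c). w (card F))"
    unfolding M1e M2e lweight.simps by (rule refl)+
  ultimately show "lweight w D (glue_bridge L ((r, r'), i, D1, v1, M1, M2)) = lweight w D1 M1 * lweight w ?D2 M2"
    unfolding Ge by (simp only:)
qed

abbreviation bridge_data where
  "bridge_data d D L P v \<equiv>
    (SIGMA p:pairs D. SIGMA i:{i. i < length P \<and> P ! i = opp L}. SIGMA D1:Pow (D - {fst p, snd p}). SIGMA v1:{..v}.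
      lmaps d D1 (take i P) v1 \<times> lmaps d (D - {fst p, snd p} - D1) (drop (Suc i) P) (v - v1))"

text \<open>The delicate point is that the result determines \<open>D1\<close>. If two
  decompositions had different first sides, the darts of one first side lying in the other second
  side would form a closed set avoiding the boundary, which connectedness forbids. The permutations
  and colours then follow by restriction.\<close>

lemma glue_bridge_inj: "inj_on (glue_bridge L) (bridge_data d D L P v)"
proof (rule inj_onI)
  fix x y
  assume X: "x \<in> bridge_data d D L P v" and Y: "y \<in> bridge_data d D L P v"
    and eq: "glue_bridge L x = glue_bridge L y"
  obtain r r' i D1 v1 \<alpha>1 \<phi>1 \<chi>1 b \<alpha>2 \<phi>2 \<chi>2 c
    where x: "x = ((r, r'), i, D1, v1, (\<alpha>1, \<phi>1, \<chi>1, b), (\<alpha>2, \<phi>2, \<chi>2, c))" by (metis prod_cases4 surj_pair)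
  obtain s s' k E1 u1 \<beta>1 \<xi>1 \<kappa>1 b' \<beta>2 \<xi>2 \<kappa>2 c'
    where y: "y = ((s, s'), k, E1, u1, (\<beta>1, \<xi>1, \<kappa>1, b'), (\<beta>2, \<xi>2, \<kappa>2, c'))" by (metis prod_cases4 surj_pair)
  let ?D2 = "D - {r, r'} - D1" and ?E2 = "D - {s, s'} - E1"
  have mx: "(\<alpha>1, \<phi>1, \<chi>1, b) \<in> lmaps d D1 (take i P) v1" "(\<alpha>2, \<phi>2, \<chi>2, c) \<in> lmaps d ?D2 (drop (Suc i) P) (v - v1)"
    "(r, r') \<in> pairs D" "i < length P" "D1 \<subseteq> D - {r, r'}" using X x by auto
  have my: "(\<beta>1, \<xi>1, \<kappa>1, b') \<in> lmaps d E1 (take k P) u1" "(\<beta>2, \<xi>2, \<kappa>2, c') \<in> lmaps d ?E2 (drop (Suc k) P) (v - u1)"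
    "(s, s') \<in> pairs D" "k < length P" "E1 \<subseteq> D - {s, s'}" using Y y by auto
  note m1 = lmapsD[OF mx(1)] and m2 = lmapsD[OF mx(2)] and n1 = lmapsD[OF my(1)] and n2 = lmapsD[OF my(2)]
  note eqs = eq[unfolded x y glue_bridge.simps prod.inject list.inject]
  have rs: "r = s" and aeq0: "\<alpha>1 \<circ> \<alpha>2 \<circ> transpose r r' = \<beta>1 \<circ> \<beta>2 \<circ> transpose s s'"
    and feq: "\<phi>1 \<circ> \<phi>2 = \<xi>1 \<circ> \<xi>2" and beq: "b @ r' # c = b' @ s' # c'"
    and ceq0: "\<chi>1 \<union> \<chi>2 \<union> root_black L r r' = \<kappa>1 \<union> \<kappa>2 \<union> root_black L s s'"
    using eqs by blast+
  have rn: "r \<noteq> r'" "r \<in> D" "r' \<in> D" using mx(3) by (auto simp: pairs_def)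
  have "(\<alpha>1 \<circ> \<alpha>2 \<circ> transpose r r') r = r'"
    using permutes_not_in[OF m1(6), of r'] permutes_not_in[OF m2(6), of r'] mx(5) by auto
  moreover have "(\<beta>1 \<circ> \<beta>2 \<circ> transpose s s') s = s'"
    using permutes_not_in[OF n1(6), of s'] permutes_not_in[OF n2(6), of s'] my(5) by auto
  ultimately have rs': "r' = s'" using aeq0 rs by metis
  have aeq1: "\<alpha>1 \<circ> \<alpha>2 \<circ> transpose r r' = \<beta>1 \<circ> \<beta>2 \<circ> transpose r r'" using aeq0 unfolding rs rs' .
  have "\<alpha>1 \<circ> \<alpha>2 = (\<alpha>1 \<circ> \<alpha>2 \<circ> transpose r r') \<circ> transpose r r'" by (simp add: comp_assoc)
  also have "\<dots> = \<beta>1 \<circ> \<beta>2" unfolding aeq1 by (simp add: comp_assoc)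
  finally have aeq: "\<alpha>1 \<circ> \<alpha>2 = \<beta>1 \<circ> \<beta>2" .
  have "r' \<notin> set b" "s' \<notin> set b'" "r' \<notin> set c" "s' \<notin> set c'"
    using m1(10) n1(10) m2(10) n2(10) mx(5) my(5) by auto
  then have bb: "b = b'" "c = c'" using beq rs' by (auto simp: append_Cons_eq_iff)
  have ik: "i = k" using m1(4) n1(4) bb mx(4) my(4) by simp
  note y' = n1[unfolded rs[symmetric] rs'[symmetric] bb[symmetric]] and y2' = n2[unfolded rs[symmetric] rs'[symmetric] bb[symmetric]]
  let ?E2' = "D - {r, r'} - E1"
  have E1: "E1 \<subseteq> D - {r, r'}" using my(5) rs rs' by simp
  have d1: "D1 \<inter> ?D2 = {}" and e1: "E1 \<inter> ?E2' = {}" by auto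
  have dC: "(D1 - set b) \<inter> (?D2 - set c) = {}" and eC: "(E1 - set b) \<inter> (?E2' - set c) = {}" by auto
  have aD1: "\<And>z. z \<in> D1 \<Longrightarrow> (\<alpha>1 \<circ> \<alpha>2) z = \<alpha>1 z"
    using perm_comp_disjoint_apply(1)[OF m1(6) m2(6) d1] by simp
  have aD2: "\<And>z. z \<in> ?D2 \<Longrightarrow> (\<alpha>1 \<circ> \<alpha>2) z = \<alpha>2 z"
    using perm_comp_disjoint_apply(2)[OF m1(6) m2(6) d1] by simp
  have aE1: "\<And>z. z \<in> E1 \<Longrightarrow> (\<alpha>1 \<circ> \<alpha>2) z = \<beta>1 z" unfolding aeq
    using perm_comp_disjoint_apply(1)[OF y'(6) y2'(6) e1] by simp
  have aE2: "\<And>z. z \<in> ?E2' \<Longrightarrow> (\<alpha>1 \<circ> \<alpha>2) z = \<beta>2 z" unfolding aeq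
    using perm_comp_disjoint_apply(2)[OF y'(6) y2'(6) e1] by simp
  have fD1: "(\<phi>1 \<circ> \<phi>2) z = \<phi>1 z" if "z \<in> D1" for z
    using perm_comp_disjoint_apply(1)[OF m1(11) m2(11) dC, of z] that
      permutes_not_in[OF m1(11), of z] permutes_not_in[OF m2(11), of z] by (cases "z \<in> set b") auto
  have fD2: "(\<phi>1 \<circ> \<phi>2) z = \<phi>2 z" if "z \<in> ?D2" for z
    using perm_comp_disjoint_apply(3)[OF m1(11) m2(11) dC, of z] that by auto
  have fE1: "(\<phi>1 \<circ> \<phi>2) z = \<xi>1 z" if "z \<in> E1" for z unfolding feq
    using perm_comp_disjoint_apply(1)[OF y'(11) y2'(11) eC, of z] that
      permutes_not_in[OF y'(11), of z] permutes_not_in[OF y2'(11), of z] by (cases "z \<in> set b") auto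
  have fE2: "(\<phi>1 \<circ> \<phi>2) z = \<xi>2 z" if "z \<in> ?E2'" for z unfolding feq
    using perm_comp_disjoint_apply(3)[OF y'(11) y2'(11) eC, of z] that by auto
  have "D1 \<inter> ?E2' = {}"
  proof (rule m1(15))
    show "D1 \<inter> ?E2' \<subseteq> D1 - set b" using y'(10) by auto
    show "\<alpha>1 ` (D1 \<inter> ?E2') \<subseteq> D1 \<inter> ?E2'"
    proof (rule image_subsetI)
      fix z assume z: "z \<in> D1 \<inter> ?E2'"
      then have "\<alpha>1 z = \<beta>2 z" using aD1[of z] aE2[of z] by auto
      then show "\<alpha>1 z \<in> D1 \<inter> ?E2'"
        using z permutes_in_image[OF m1(6), of z] permutes_in_image[OF y2'(6), of z] by simp
    qed
    show "\<phi>1 ` (D1 \<inter> ?E2') \<subseteq> D1 \<inter> ?E2'"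
    proof (rule image_subsetI)
      fix z assume z: "z \<in> D1 \<inter> ?E2'"
      then have 1: "\<phi>1 z = \<xi>2 z" using fD1[of z] fE2[of z] by auto
      have "\<phi>1 z \<in> D1" using z permutes_in_image[OF m1(11), of z] permutes_not_in[OF m1(11), of z]
        by (cases "z \<in> set b") auto
      moreover have "\<xi>2 z \<in> ?E2'" using z permutes_in_image[OF y2'(11), of z] permutes_not_in[OF y2'(11), of z]
        by (cases "z \<in> set c") auto
      ultimately show "\<phi>1 z \<in> D1 \<inter> ?E2'" using 1 by simp
    qed
  qed
  moreover have "E1 \<inter> ?D2 = {}"
  proof (rule y'(15))
    show "E1 \<inter> ?D2 \<subseteq> E1 - set b" using m1(10) by auto
    show "\<beta>1 ` (E1 \<inter> ?D2) \<subseteq> E1 \<inter> ?D2"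
    proof (rule image_subsetI)
      fix z assume z: "z \<in> E1 \<inter> ?D2"
      then have "\<beta>1 z = \<alpha>2 z" using aE1[of z] aD2[of z] by auto
      then show "\<beta>1 z \<in> E1 \<inter> ?D2"
        using z permutes_in_image[OF m2(6), of z] permutes_in_image[OF y'(6), of z] by simp
    qed
    show "\<xi>1 ` (E1 \<inter> ?D2) \<subseteq> E1 \<inter> ?D2"
    proof (rule image_subsetI)
      fix z assume z: "z \<in> E1 \<inter> ?D2"
      then have 1: "\<xi>1 z = \<phi>2 z" using fE1[of z] fD2[of z] by auto
      have "\<xi>1 z \<in> E1" using z permutes_in_image[OF y'(11), of z] permutes_not_in[OF y'(11), of z]
        by (cases "z \<in> set b") auto
      moreover have "\<phi>2 z \<in> ?D2" using z permutes_in_image[OF m2(11), of z] permutes_not_in[OF m2(11), of z]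
        by (cases "z \<in> set c") auto
      ultimately show "\<xi>1 z \<in> E1 \<inter> ?D2" using 1 by simp
    qed
  qed
  ultimately have DE: "D1 = E1" using mx(5) E1 by blast
  have exteq: "f = g" if "f permutes A" "g permutes A" "\<And>z. z \<in> A \<Longrightarrow> f z = g z" for f g :: "nat \<Rightarrow> nat" and A
    using that permutes_not_in[of f A] permutes_not_in[of g A] by (metis ext)
  have a: "\<alpha>1 = \<beta>1" by (rule exteq[OF m1(6) n1(6)[folded DE]]) (use aD1 aE1 DE in metis)
  have a2: "\<alpha>2 = \<beta>2" by (rule exteq[OF m2(6) y2'(6)[folded DE]]) (use aD2 aE2 DE in metis)
  have f: "\<phi>1 = \<xi>1" by (rule exteq[OF m1(11) y'(11)[folded DE]]) (use fD1 fE1 DE in auto)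
  have f2: "\<phi>2 = \<xi>2" by (rule exteq[OF m2(11) y2'(11)[folded DE]]) (use fD2 fE2 DE in auto)
  have ceq: "\<chi>1 \<union> \<chi>2 \<union> root_black L r r' = \<kappa>1 \<union> \<kappa>2 \<union> root_black L r r'" using ceq0 rs rs' by simp
  have "\<chi>1 = (\<chi>1 \<union> \<chi>2 \<union> root_black L r r') \<inter> D1"
    using m1(12) m2(12) mx(5) by (auto simp: root_black_def)
  also have "\<dots> = \<kappa>1" unfolding ceq using y'(12) y2'(12) mx(5) DE by (auto simp: root_black_def)
  finally have k1: "\<chi>1 = \<kappa>1" .
  have "\<chi>2 = (\<chi>1 \<union> \<chi>2 \<union> root_black L r r') \<inter> ?D2"
    using m1(12) m2(12) mx(5) by (auto simp: root_black_def)
  also have "\<dots> = \<kappa>2" unfolding ceq using y'(12) y2'(12) mx(5) DE by (auto simp: root_black_def)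
  finally have k2: "\<chi>2 = \<kappa>2" .
  have "v1 = u1" using m1(3) y'(3) a f DE by simp
  then show "x = y" unfolding x y using rs rs' ik DE a a2 f f2 k1 k2 bb by simp
qed

lemma glue_bridge_surj:
  assumes M: "M \<in> lmaps d D (L # P) v" and f: "\<not> on_face M"
  shows "M \<in> glue_bridge L ` bridge_data d D L P v"
proof -
  obtain \<alpha> \<phi> \<chi> bs0 where Me: "M = (\<alpha>, \<phi>, \<chi>, bs0)" by (metis prod_cases4)
  note m0 = lmapsD[OF M[unfolded Me]]
  obtain r bs where bs0: "bs0 = r # bs" using m0(4) by (cases bs0) auto
  define r' where "r' = \<alpha> r"
  have rD: "r \<in> D" using m0(10) bs0 by auto
  have rr: "r' \<in> D" "r \<noteq> r'" "\<alpha> r' = r"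
    using m0(7,8)[OF rD] rD permutes_in_image[OF m0(6), of r] by (auto simp: r'_def)
  have "r' \<in> set bs" using f rr(2) by (simp add: Me bs0 r'_def)
  then obtain b c where bs: "bs = b @ r' # c" by (metis split_list)
  note m = m0[unfolded bs0 bs]
  obtain D1 D2 where S: "D1 \<inter> D2 = {}" "D = insert r (insert r' (D1 \<union> D2))" "r \<notin> D1 \<union> D2" "r' \<notin> D1 \<union> D2"
    "set b \<subseteq> D1" "set c \<subseteq> D2"
    and cl1: "\<And>x. x \<in> D1 \<Longrightarrow> \<alpha> x \<in> D1 \<and> \<phi> x \<in> D1" and cl2: "\<And>x. x \<in> D2 \<Longrightarrow> \<alpha> x \<in> D2 \<and> \<phi> x \<in> D2"
    using bridge_split[OF m(1) r'_def[symmetric]] by blast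
  have D2: "D2 = D - {r, r'} - D1" using S by auto
  have fin: "finite D1" "finite D2" using m(5) S(2) by auto
  let ?bs = "r # b @ r' # c"
  define \<alpha>1 where "\<alpha>1 = perm_restrict \<alpha> D1"
  define \<alpha>2 where "\<alpha>2 = perm_restrict \<alpha> D2"
  define \<phi>1 where "\<phi>1 = perm_restrict \<phi> (D1 - set b)"
  define \<phi>2 where "\<phi>2 = perm_restrict \<phi> (D2 - set c)"
  have p\<alpha>: "\<alpha>1 permutes D1" "\<alpha>2 permutes D2" unfolding \<alpha>1_def \<alpha>2_def
    using S(2) cl1 cl2 fin by (auto intro!: perm_restrict_closed_permutes[OF m(6)])
  have C: "D - set ?bs = (D1 - set b) \<union> (D2 - set c)" using S by auto
  have pin: "\<phi> x \<in> D - set ?bs \<longleftrightarrow> x \<in> D - set ?bs" for x using permutes_in_image[OF m(11)] .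
  have c1: "\<phi> x \<in> D1 - set b" if "x \<in> D1 - set b" for x
    using that pin[of x] cl1[of x] S(1) unfolding C by blast
  have c2: "\<phi> x \<in> D2 - set c" if "x \<in> D2 - set c" for x
    using that pin[of x] cl2[of x] S(1) unfolding C by blast
  have p\<phi>: "\<phi>1 permutes D1 - set b" "\<phi>2 permutes D2 - set c" unfolding \<phi>1_def \<phi>2_def
    by (rule perm_restrict_closed_permutes[OF m(11)], use fin C c1 c2 in auto)+
  have \<phi>e: "\<phi> = \<phi>1 \<circ> \<phi>2"
  proof -
    have "\<phi>1 \<circ> \<phi>2 = perm_restrict \<phi> ((D1 - set b) \<union> (D2 - set c))" unfolding \<phi>1_def \<phi>2_def
      by (rule perm_restrict_union) (use p\<phi> S(1) in \<open>auto simp: \<phi>1_def \<phi>2_def\<close>)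
    then show ?thesis unfolding C[symmetric] using perm_restrict_id[OF m(11)] by simp
  qed
  have \<alpha>e: "\<alpha> = \<alpha>1 \<circ> \<alpha>2 \<circ> transpose r r'"
  proof -
    have "\<alpha>1 \<circ> \<alpha>2 = perm_restrict \<alpha> (D1 \<union> D2)" unfolding \<alpha>1_def \<alpha>2_def
      by (rule perm_restrict_union) (use p\<alpha> S(1) in \<open>auto simp: \<alpha>1_def \<alpha>2_def\<close>)
    moreover have "perm_restrict \<alpha> (D1 \<union> D2) \<circ> transpose r r' = \<alpha>"
    proof
      fix x
      show "(perm_restrict \<alpha> (D1 \<union> D2) \<circ> transpose r r') x = \<alpha> x"
        using S(2,3,4) rr r'_def permutes_not_in[OF m(6), of x]
        by (cases "x = r"; cases "x = r'"; auto simp: perm_restrict_def)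
    qed
    ultimately show ?thesis by simp
  qed
  have colr: "col \<chi> r = L" using m(2) by simp
  have colr': "col \<chi> r' = opp L"
    using colr m(13)[OF rD] by (cases L) (auto simp: col_eq_iff r'_def[symmetric])
  have \<chi>e: "\<chi> = (\<chi> \<inter> D1) \<union> (\<chi> \<inter> D2) \<union> root_black L r r'"
  proof -
    have "\<chi> - {r, r'} = (\<chi> \<inter> D1) \<union> (\<chi> \<inter> D2)" using m(12) S(2,3,4) by auto
    then show ?thesis using root_black_unique[OF colr colr'] by simp
  qed
  have dist: "distinct b" "distinct c" using m(9) by auto
  have "\<chi> \<inter> D1 \<subseteq> D1" "\<chi> \<inter> D2 \<subseteq> D2" by auto
  note g = bmap_glue_bridge[OF fin S(1,3,4) rr(2) p\<alpha> p\<phi> dist(1) S(5) dist(2) S(6) this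
      root_black_cases[of L], folded S(2) \<chi>e \<alpha>e \<phi>e]
  have b12: "bmap d D1 \<alpha>1 \<phi>1 (\<chi> \<inter> D1) b" "bmap d D2 \<alpha>2 \<phi>2 (\<chi> \<inter> D2) c" using g(1) m(1) by blast+
  have v: "v = nverts D1 \<alpha>1 \<phi>1 b + nverts D2 \<alpha>2 \<phi>2 c" using g(2)[OF m(1)] m(3) by simp
  have mb: "map (col (\<chi> \<inter> D1)) b = map (col \<chi>) b" "map (col (\<chi> \<inter> D2)) c = map (col \<chi>) c"
    by (rule map_cong[OF refl], use S(5,6) in \<open>auto simp: col_def\<close>)+
  have P: "P = map (col \<chi>) b @ opp L # map (col \<chi>) c" using m(2) colr' by simp
  define i where "i = length b"
  have i: "i < length P" "P ! i = opp L" "take i P = map (col \<chi>) b" "drop (Suc i) P = map (col \<chi>) c"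
    unfolding P i_def by (auto simp: nth_append)
  define v1 where "v1 = nverts D1 \<alpha>1 \<phi>1 b"
  let ?x = "((r, r'), i, D1, v1, (\<alpha>1, \<phi>1, \<chi> \<inter> D1, b), (\<alpha>2, \<phi>2, \<chi> \<inter> D2, c))"
  have "(\<alpha>1, \<phi>1, \<chi> \<inter> D1, b) \<in> lmaps d D1 (take i P) v1"
    "(\<alpha>2, \<phi>2, \<chi> \<inter> D2, c) \<in> lmaps d (D - {r, r'} - D1) (drop (Suc i) P) (v - v1)"
    using b12 mb i v D2 by (auto simp: lmaps_def v1_def)
  moreover have "(r, r') \<in> pairs D" "D1 \<subseteq> D - {r, r'}" "v1 \<le> v"
    using rD rr S v by (auto simp: pairs_def v1_def)
  ultimately have "?x \<in> bridge_data d D L P v" using i by simp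
  moreover have "M = glue_bridge L ?x" using \<phi>e \<alpha>e \<chi>e by (simp add: Me bs0 bs)
  ultimately show ?thesis by blast
qed

lemma sum_Sigma_pair:
  assumes "finite A" "\<And>a. a \<in> A \<Longrightarrow> finite (B a)"
  shows "(\<Sum>x\<in>Sigma A B. h x) = (\<Sum>a\<in>A. \<Sum>b\<in>B a. h (a, b))"
  using assms by (subst sum.Sigma) (auto simp: split_def)

lemma lcount_on_bridge:
  fixes w :: "nat \<Rightarrow> 'a::comm_ring_1"
  assumes fin: "finite D"
  shows "sum (lweight w D) {M \<in> lmaps d D (L # P) v. \<not> on_face M} =
    (\<Sum>p\<in>pairs D. \<Sum>i | i < length P \<and> P ! i = opp L. \<Sum>D1\<in>Pow (D - {fst p, snd p}). \<Sum>v1\<le>v.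
      lcount d w D1 (take i P) v1 * lcount d w (D - {fst p, snd p} - D1) (drop (Suc i) P) (v - v1))"
proof -
  let ?T = "bridge_data d D L P v"
  let ?w = "\<lambda>(p, i, D1, v1, M1, M2). lweight w D1 M1 * lweight w (D - {fst p, snd p} - D1) M2"
  have mem: "glue_bridge L x \<in> lmaps d D (L # P) v \<and> \<not> on_face (glue_bridge L x) \<and>
      lweight w D (glue_bridge L x) = ?w x"
    if "x \<in> ?T" for x
  proof -
    obtain r r' i D1 v1 M1 M2 where x: "x = ((r, r'), i, D1, v1, M1, M2)" by (metis surj_pair)
    have h: "(r, r') \<in> pairs D" "i < length P" "P ! i = opp L" "D1 \<subseteq> D - {r, r'}" "v1 \<le> v"
      "M1 \<in> lmaps d D1 (take i P) v1" "M2 \<in> lmaps d (D - {r, r'} - D1) (drop (Suc i) P) (v - v1)"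
      using that by (auto simp: x)
    show ?thesis using glue_bridge_mem(1,2)[OF h(1) fin h(2-7)] glue_bridge_mem(3)[OF h(1) fin h(2-7), of w] by (simp add: x del: glue_bridge.simps)
  qed
  have bij: "bij_betw (glue_bridge L) ?T {M \<in> lmaps d D (L # P) v. \<not> on_face M}"
    unfolding bij_betw_def using glue_bridge_inj mem glue_bridge_surj by blast
  have fp: "finite (pairs D)"
    by (rule finite_subset[of _ "D \<times> D"]) (use fin in \<open>auto simp: pairs_def\<close>)
  have fl: "finite (lmaps d D1 Q u)" if "D1 \<subseteq> D" for D1 Q u
    using that fin finite_lmaps finite_subset by blast
  have fl2: "finite (lmaps d (D - X - Y) Q u)" for X Y Q u by (rule fl) auto
  have f1: "finite (lmaps d D1 Q u \<times> lmaps d (D - X - D1) Q' u')" if "D1 \<in> Pow (D - X)" for D1 X Q Q' u u'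
    using that by (intro finite_cartesian_product fl fl2) auto
  have f2: "finite (SIGMA v1:{..v}. lmaps d D1 Q v1 \<times> lmaps d (D - X - D1) Q' (v - v1))" if "D1 \<in> Pow (D - X)" for D1 X Q Q'
    using that by (intro finite_SigmaI f1) auto
  have f3: "finite (SIGMA D1:Pow (D - X). SIGMA v1:{..v}. lmaps d D1 Q v1 \<times> lmaps d (D - X - D1) Q' (v - v1))" for X Q Q'
    using fin by (intro finite_SigmaI f2) auto
  have f4: "finite (SIGMA i:{i. i < length P \<and> P ! i = opp L}. SIGMA D1:Pow (D - X). SIGMA v1:{..v}. lmaps d D1 (take i P) v1 \<times> lmaps d (D - X - D1) (drop (Suc i) P) (v - v1))" for X
    by (intro finite_SigmaI f3) auto
  have "sum (lweight w D) {M \<in> lmaps d D (L # P) v. \<not> on_face M} = (\<Sum>x\<in>?T. lweight w D (glue_bridge L x))"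
    by (rule sum.reindex_bij_betw[OF bij, symmetric])
  also have "\<dots> = (\<Sum>x\<in>?T. ?w x)"
    using mem by (intro sum.cong) auto
  also have "\<dots> = (\<Sum>p\<in>pairs D. \<Sum>i | i < length P \<and> P ! i = opp L. \<Sum>D1\<in>Pow (D - {fst p, snd p}). \<Sum>v1\<le>v.
      \<Sum>(M1, M2)\<in>lmaps d D1 (take i P) v1 \<times> lmaps d (D - {fst p, snd p} - D1) (drop (Suc i) P) (v - v1).
        lweight w D1 M1 * lweight w (D - {fst p, snd p} - D1) M2)"
  proof -
    have 2: "(\<Sum>x\<in>?T. ?w x) = (\<Sum>p\<in>pairs D. \<Sum>y\<in>(SIGMA i:{i. i < length P \<and> P ! i = opp L}. SIGMA D1:Pow (D - {fst p, snd p}). SIGMA v1:{..v}. lmaps d D1 (take i P) v1 \<times> lmaps d (D - {fst p, snd p} - D1) (drop (Suc i) P) (v - v1)). ?w (p, y))"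
      by (rule sum_Sigma_pair[OF fp f4])
    show ?thesis unfolding 2
    proof (intro sum.cong refl)
      fix p :: "nat \<times> nat"
      let ?X = "{fst p, snd p}"
      have "(\<Sum>y\<in>(SIGMA i:{i. i < length P \<and> P ! i = opp L}. SIGMA D1:Pow (D - ?X). SIGMA v1:{..v}. lmaps d D1 (take i P) v1 \<times> lmaps d (D - ?X - D1) (drop (Suc i) P) (v - v1)). ?w (p, y))
        = (\<Sum>i | i < length P \<and> P ! i = opp L. \<Sum>y\<in>(SIGMA D1:Pow (D - ?X). SIGMA v1:{..v}. lmaps d D1 (take i P) v1 \<times> lmaps d (D - ?X - D1) (drop (Suc i) P) (v - v1)). ?w (p, i, y))"
        by (rule sum_Sigma_pair[OF _ f3]) simp
      also have "\<dots> = (\<Sum>i | i < length P \<and> P ! i = opp L. \<Sum>D1\<in>Pow (D - ?X). \<Sum>y\<in>(SIGMA v1:{..v}. lmaps d D1 (take i P) v1 \<times> lmaps d (D - ?X - D1) (drop (Suc i) P) (v - v1)). ?w (p, i, D1, y))"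
        using fin by (intro sum.cong refl, intro sum_Sigma_pair[OF _ f2]) auto
      also have "\<dots> = (\<Sum>i | i < length P \<and> P ! i = opp L. \<Sum>D1\<in>Pow (D - ?X). \<Sum>v1\<le>v. \<Sum>y\<in>lmaps d D1 (take i P) v1 \<times> lmaps d (D - ?X - D1) (drop (Suc i) P) (v - v1). ?w (p, i, D1, v1, y))"
        by (intro sum.cong refl, intro sum_Sigma_pair[OF _ f1]) auto
      finally show "(\<Sum>y\<in>(SIGMA i:{i. i < length P \<and> P ! i = opp L}. SIGMA D1:Pow (D - ?X). SIGMA v1:{..v}. lmaps d D1 (take i P) v1 \<times> lmaps d (D - ?X - D1) (drop (Suc i) P) (v - v1)). ?w (p, y))
        = (\<Sum>i | i < length P \<and> P ! i = opp L. \<Sum>D1\<in>Pow (D - ?X). \<Sum>v1\<le>v. \<Sum>(M1, M2)\<in>lmaps d D1 (take i P) v1 \<times> lmaps d (D - ?X - D1) (drop (Suc i) P) (v - v1). lweight w D1 M1 * lweight w (D - ?X - D1) M2)"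
        by (simp add: split_def)
    qed
  qed
  finally show ?thesis by (simp add: lcount_def sum_product sum.cartesian_product)
qed

section \<open>Relabelling the darts and moving the root\<close>

definition conj_by :: "('a \<Rightarrow> 'a) \<Rightarrow> ('a \<Rightarrow> 'a) \<Rightarrow> 'a \<Rightarrow> 'a" where
  "conj_by p f = p \<circ> f \<circ> inv p"

fun relabel :: "(nat \<Rightarrow> nat) \<Rightarrow> lmap \<Rightarrow> lmap" where
  "relabel p (\<alpha>, \<phi>, \<chi>, bs) = (conj_by p \<alpha>, conj_by p \<phi>, p ` \<chi>, map p bs)"

lemma conj_by_apply: "bij p \<Longrightarrow> conj_by p f (p x) = p (f x)"
  by (simp add: conj_by_def bij_is_inj)

lemma conj_by_comp: "bij p \<Longrightarrow> conj_by p f \<circ> conj_by p g = conj_by p (f \<circ> g)"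
  by (auto simp: conj_by_def fun_eq_iff bij_is_inj)

lemma conj_by_inv: "bij p \<Longrightarrow> conj_by (inv p) (conj_by p f) = f"
  by (simp add: conj_by_def fun_eq_iff bij_is_inj inv_inv_eq)

lemma conj_by_permutes:
  assumes "bij p" "f permutes D" shows "conj_by p f permutes p ` D"
proof (rule bij_imp_permutes)
  have "bij_betw p D (p ` D)" using assms(1) by (meson bij_betw_subset subset_UNIV bij_betw_def inj_on_subset)
  moreover have "bij_betw f D D" using assms(2) by (rule permutes_imp_bij)
  moreover have "bij_betw (inv p) (p ` D) D"
    using assms(1) by (metis bij_betw_inv_into_subset bij_is_inj subset_UNIV)
  ultimately show "bij_betw (conj_by p f) (p ` D) (p ` D)"
    unfolding conj_by_def by (meson bij_betw_trans)
next
  fix x assume "x \<notin> p ` D"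
  then have "inv p x \<notin> D" using assms(1) by (metis bij_inv_eq_iff imageI)
  then show "conj_by p f x = x"
    using assms by (simp add: conj_by_def permutes_not_in bij_is_surj surj_f_inv_f)
qed

lemma orbit_conj_by:
  assumes "bij p" shows "orbit (conj_by p f) (p x) = p ` orbit f x"
proof (intro antisym subsetI)
  fix y assume "y \<in> orbit (conj_by p f) (p x)"
  then show "y \<in> p ` orbit f x"
    by induction (auto simp: conj_by_apply[OF assms] intro: orbit.intros)
next
  fix y assume "y \<in> p ` orbit f x"
  then obtain z where "y = p z" "z \<in> orbit f x" by blast
  from this(2) have "p z \<in> orbit (conj_by p f) (p x)"
  proof induction
    case base then show ?case by (metis assms conj_by_apply orbit.base)
  next
    case (step z) then show ?case by (metis assms conj_by_apply orbit.step)
  qed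
  then show "y \<in> orbit (conj_by p f) (p x)" using \<open>y = p z\<close> by simp
qed

lemma orbits_conj_by:
  assumes "bij p" shows "orbit (conj_by p f) ` (p ` A) = (`) p ` (orbit f ` A)"
  by (simp add: image_image orbit_conj_by[OF assms])

lemma inj_image_bij: "bij p \<Longrightarrow> inj_on ((`) p) A"
  by (meson bij_is_inj inj_image_eq_iff inj_onI)

lemma ncyc_conj_by:
  assumes "bij p" shows "ncyc (conj_by p f) (p ` A) = ncyc f A"
  unfolding ncyc_def orbits_conj_by[OF assms] by (rule card_image[OF inj_image_bij[OF assms]])

lemma card_image_bij: "bij p \<Longrightarrow> card (p ` F) = card F"
  by (meson bij_is_inj card_image inj_on_subset subset_UNIV)

lemma relabel_mem:
  assumes p: "bij p" and M: "M \<in> lmaps d D P v"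
  shows "relabel p M \<in> lmaps d (p ` D) P v" "lweight w (p ` D) (relabel p M) = lweight w D M"
proof -
  obtain \<alpha> \<phi> \<chi> bs where Me: "M = (\<alpha>, \<phi>, \<chi>, bs)" by (metis prod_cases4)
  note m = lmapsD[OF M[unfolded Me]]
  have inj: "inj p" using p bij_is_inj by blast
  have col: "\<And>x. x \<in> D - set bs \<Longrightarrow> \<phi> x \<in> \<chi> \<longleftrightarrow> x \<in> \<chi>"
    and eul: "2 * (nverts D \<alpha> \<phi> bs + ncyc \<phi> (D - set bs)) = card D + 2"
    using m(1) by (auto simp: bmap_def bpre_def)
  have C: "p ` D - set (map p bs) = p ` (D - set bs)" using inj by (auto simp: inj_image_mem_iff dest: injD)
  have "conj_by p \<phi> \<circ> cycle_of_list (map p bs) \<circ> conj_by p \<alpha> = conj_by p (\<phi> \<circ> cycle_of_list bs \<circ> \<alpha>)"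
  proof -
    have "cycle_of_list (map p bs) = conj_by p (cycle_of_list bs)"
      unfolding conj_by_def by (rule conjugation_of_cycle[OF m(9) p, symmetric])
    then show ?thesis by (simp only: conj_by_comp[OF p])
  qed
  then have nv: "nverts (p ` D) (conj_by p \<alpha>) (conj_by p \<phi>) (map p bs) = nverts D \<alpha> \<phi> bs"
    by (simp add: nverts_def ncyc_conj_by[OF p])
  have pre: "bpre d (p ` D) (conj_by p \<alpha>) (conj_by p \<phi>) (p ` \<chi>) (map p bs)"
    unfolding bpre_def C orbits_conj_by[OF p]
  proof (intro conjI)
    show "conj_by p \<alpha> permutes p ` D" by (rule conj_by_permutes[OF p m(6)])
    show "conj_by p \<phi> permutes p ` (D - set bs)" by (rule conj_by_permutes[OF p m(11)])
    show "\<forall>x\<in>p ` D. conj_by p \<alpha> x \<noteq> x \<and> conj_by p \<alpha> (conj_by p \<alpha> x) = x"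
      using m(7,8) inj by (auto simp: conj_by_apply[OF p] dest: injD)
    show "\<forall>x\<in>p ` D. conj_by p \<alpha> x \<in> p ` \<chi> \<longleftrightarrow> x \<notin> p ` \<chi>"
      using m(13) inj by (auto simp: conj_by_apply[OF p] inj_image_mem_iff)
    show "\<forall>x\<in>p ` (D - set bs). conj_by p \<phi> x \<in> p ` \<chi> \<longleftrightarrow> x \<in> p ` \<chi>"
      using col inj by (auto simp: conj_by_apply[OF p] inj_image_mem_iff)
    show "\<forall>F\<in>(`) p ` orbit \<phi> ` (D - set bs). card F \<in> {2..d}"
      using m(14) by (auto simp: card_image_bij[OF p])
    show "distinct (map p bs)" using m(9) inj_on_subset[OF inj subset_UNIV] by (simp add: distinct_map)
  qed (use m(5,10,12) in auto)
  have con: "bconn (p ` D) (conj_by p \<alpha>) (conj_by p \<phi>) (map p bs)"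
    unfolding bconn_def C
  proof (intro allI impI)
    fix S assume S: "S \<subseteq> p ` (D - set bs)" "conj_by p \<alpha> ` S \<subseteq> S" "conj_by p \<phi> ` S \<subseteq> S"
    then obtain S0 where S0: "S0 \<subseteq> D - set bs" "S = p ` S0" by (metis subset_imageE)
    have "p (\<alpha> x) \<in> p ` S0" if "x \<in> S0" for x
    proof -
      have "conj_by p \<alpha> (p x) \<in> p ` S0" using S(2) that unfolding S0(2) by blast
      then show ?thesis by (simp only: conj_by_apply[OF p])
    qed
    moreover have "p (\<phi> x) \<in> p ` S0" if "x \<in> S0" for x
    proof -
      have "conj_by p \<phi> (p x) \<in> p ` S0" using S(3) that unfolding S0(2) by blast
      then show ?thesis by (simp only: conj_by_apply[OF p])
    qed
    ultimately have "\<alpha> ` S0 \<subseteq> S0" "\<phi> ` S0 \<subseteq> S0" using inj by (auto simp: inj_image_mem_iff)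
    then have "S0 = {}" using m(15)[OF S0(1)] by blast
    then show "S = {}" using S0 by simp
  qed
  have "map (col (p ` \<chi>)) (map p bs) = map (col \<chi>) bs"
    using inj by (simp add: col_def inj_image_mem_iff)
  then have "map (col (p ` \<chi>)) (map p bs) = P" using m(2) by simp
  moreover have "bmap d (p ` D) (conj_by p \<alpha>) (conj_by p \<phi>) (p ` \<chi>) (map p bs)"
    unfolding bmap_def C ncyc_conj_by[OF p] nv card_image_bij[OF p] using pre con eul by blast
  ultimately show "relabel p M \<in> lmaps d (p ` D) P v"
    using nv m(3) by (simp add: Me lmaps_def)
  show "lweight w (p ` D) (relabel p M) = lweight w D M"
    unfolding Me relabel.simps lweight.simps C orbits_conj_by[OF p]
    by (subst prod.reindex[OF inj_image_bij[OF p]]) (simp add: card_image_bij[OF p])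
qed

lemma relabel_inv: "bij p \<Longrightarrow> relabel (inv p) (relabel p M) = M"
  by (cases M) (simp add: conj_by_inv image_comp bij_is_inj comp_def)

lemma lcount_relabel:
  assumes p: "bij p" shows "lcount d w (p ` D) P v = lcount d w D P v"
proof -
  have ip: "bij (inv p)" and ii: "inv (inv p) = p" using p by (auto simp: bij_imp_bij_inv inv_inv_eq)
  have b: "inv p ` (p ` D) = D" using p by (simp add: bij_is_inj image_comp)
  have "bij_betw (relabel p) (lmaps d D P v) (lmaps d (p ` D) P v)"
  proof (rule bij_betw_byWitness[of _ "relabel (inv p)"])
    show "\<forall>M\<in>lmaps d D P v. relabel (inv p) (relabel p M) = M" using relabel_inv[OF p] by blast
    show "\<forall>M\<in>lmaps d (p ` D) P v. relabel p (relabel (inv p) M) = M" using relabel_inv[OF ip] ii by simp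
    show "relabel p ` lmaps d D P v \<subseteq> lmaps d (p ` D) P v" using relabel_mem(1)[OF p] by blast
    show "relabel (inv p) ` lmaps d (p ` D) P v \<subseteq> lmaps d D P v" using relabel_mem(1)[OF ip, of _ d "p ` D"] b by auto
  qed
  then show ?thesis
    unfolding lcount_def using relabel_mem(2)[OF p]
    by (subst sum.reindex_bij_betw[symmetric]) (auto intro!: sum.cong)
qed

text \<open>Relabelling requires a bijection of all natural numbers. The one used exchanges
  \<open>D - E\<close> with \<open>E - D\<close> and fixes everything else.\<close>

lemma lcount_card:
  assumes "finite D" "finite E" "card D = card E" shows "lcount d w D P v = lcount d w E P v"
proof -
  have "card (E - D) = card (D - E)"
    using assms card_Diff_subset_Int[of E D] card_Diff_subset_Int[of D E] by (simp add: Int_commute)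
  then obtain f where f: "bij_betw f (D - E) (E - D)"
    using assms by (metis finite_Diff finite_same_card_bij)
  define g where "g = inv_into (D - E) f"
  have g: "bij_betw g (E - D) (D - E)" unfolding g_def by (rule bij_betw_inv_into[OF f])
  define p where "p = (\<lambda>x. if x \<in> D - E then f x else if x \<in> E - D then g x else x)"
  have fin: "f x \<in> E - D" if "x \<in> D - E" for x using f that by (meson bij_betwE)
  have gin: "g x \<in> D - E" if "x \<in> E - D" for x using g that by (meson bij_betwE)
  have fg: "f (g x) = x" if "x \<in> E - D" for x using f that by (simp add: g_def bij_betw_inv_into_right)
  have gf: "g (f x) = x" if "x \<in> D - E" for x using f that by (simp add: g_def bij_betw_inv_into_left)
  have pp: "p (p x) = x" for x
    using fin[of x] gin[of x] fg[of x] gf[of x] by (auto simp: p_def)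
  have "bij p" by (rule o_bij[of p p]) (auto simp: fun_eq_iff pp)
  moreover have "p ` D = E"
  proof
    show "p ` D \<subseteq> E" using fin by (auto simp: p_def)
    show "E \<subseteq> p ` D"
    proof
      fix x assume x: "x \<in> E"
      have "p x \<in> D" using x gin by (auto simp: p_def)
      then show "x \<in> p ` D" using pp[of x] by (metis imageI)
    qed
  qed
  ultimately show ?thesis using lcount_relabel[of p d w D P v] by simp
qed

text \<open>Rotating the word moves the root along the boundary. The boundary cycle as a permutation
  is unchanged, and with it everything except the list \<open>bs\<close>.\<close>

lemma lcount_rotate1: "lcount d w D (rotate1 P) v = lcount d w D P v"
proof -
  let ?f = "\<lambda>(\<alpha>, \<phi>, \<chi>, bs). (\<alpha>, \<phi>, \<chi>, rotate1 bs) :: lmap"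
  have iff: "(\<alpha>, \<phi>, \<chi>, rotate1 bs) \<in> lmaps d D (rotate1 P) v \<longleftrightarrow> (\<alpha>, \<phi>, \<chi>, bs) \<in> lmaps d D P v" for \<alpha> \<phi> \<chi> bs
  proof (cases "distinct bs")
    case True
    have "map (col \<chi>) (rotate1 bs) = rotate1 P \<longleftrightarrow> map (col \<chi>) bs = P"
      by (simp add: rotate1_map[symmetric] inj_eq[OF inj_rotate1])
    moreover have "bmap d D \<alpha> \<phi> \<chi> (rotate1 bs) \<longleftrightarrow> bmap d D \<alpha> \<phi> \<chi> bs"
      "nverts D \<alpha> \<phi> (rotate1 bs) = nverts D \<alpha> \<phi> bs"
      using True by (simp_all add: bmap_def bpre_def bconn_def nverts_def cycle_of_list_rotate1)
    ultimately show ?thesis by (simp add: lmaps_def)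
  next
    case False
    then show ?thesis by (auto simp: lmaps_def bmap_def bpre_def)
  qed
  have bij: "bij_betw ?f (lmaps d D P v) (lmaps d D (rotate1 P) v)"
    unfolding bij_betw_def
  proof
    show "inj_on ?f (lmaps d D P v)" by (auto simp: inj_on_def inj_eq[OF inj_rotate1])
    show "?f ` lmaps d D P v = lmaps d D (rotate1 P) v"
    proof (intro antisym subsetI)
      fix M assume "M \<in> ?f ` lmaps d D P v"
      then show "M \<in> lmaps d D (rotate1 P) v" using iff by auto
    next
      fix M assume M: "M \<in> lmaps d D (rotate1 P) v"
      obtain \<alpha> \<phi> \<chi> bs where Me: "M = (\<alpha>, \<phi>, \<chi>, bs)" by (metis prod_cases4)
      obtain cs where cs: "bs = rotate1 cs" using surj_rotate1 by (metis surjE)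
      then have "(\<alpha>, \<phi>, \<chi>, cs) \<in> lmaps d D P v" using M iff Me by simp
      then show "M \<in> ?f ` lmaps d D P v" using Me cs by (intro image_eqI[of _ _ "(\<alpha>, \<phi>, \<chi>, cs)"]) auto
    qed
  qed
  have "sum (lweight w D) (lmaps d D (rotate1 P) v) = (\<Sum>M\<in>lmaps d D P v. lweight w D (?f M))"
    by (rule sum.reindex_bij_betw[OF bij, symmetric])
  then show ?thesis unfolding lcount_def by (auto intro!: sum.cong)
qed

lemma lcount_rotate: "lcount d w D (Q @ P) v = lcount d w D (P @ Q) v"
proof -
  have "lcount d w D (rotate n P) v = lcount d w D P v" for n P
    by (induction n) (simp_all add: lcount_rotate1)
  then show ?thesis by (metis rotate_append)
qed

lemma lcount_Nil:
  assumes "finite D" shows "lcount d w D [] v = of_bool (D = {} \<and> v = 1)"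
proof -
  have "lmaps d D [] v = (if D = {} \<and> v = 1 then {(id, id, {}, [])} else {})"
  proof (cases "D = {} \<and> v = 1")
    case True
    then show ?thesis by (auto simp: lmaps_def bmap_def bpre_def bconn_def nverts_def ncyc_def fun_eq_iff)
  next
    case False
    have "D = {} \<and> v = 1" if "(\<alpha>, \<phi>, \<chi>, bs) \<in> lmaps d D [] v" for \<alpha> \<phi> \<chi> bs
    proof -
      have "bs = []" using lmapsD(2)[OF that] by simp
      then have "D = {}" using that bconn_empty_iff[of d D \<alpha> \<phi> \<chi> bs] by (auto simp: lmaps_def bmap_def)
      then show ?thesis using lmapsD(3)[OF that] by (simp add: nverts_def)
    qed
    then show ?thesis using False by (auto simp: split_paired_all)
  qed
  then show ?thesis by (auto simp: lcount_def)
qed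

lemma lcount_small:
  assumes "finite D" "card D < 2" shows "lcount d w D (L # P) v = 0"
proof -
  have "lmaps d D (L # P) v = {}"
  proof (rule ccontr)
    assume "lmaps d D (L # P) v \<noteq> {}"
    then obtain \<alpha> \<phi> \<chi> bs where M: "(\<alpha>, \<phi>, \<chi>, bs) \<in> lmaps d D (L # P) v" by (metis ex_in_conv prod_cases4)
    note m = lmapsD[OF M]
    obtain r where r: "r \<in> D" using m(4,10) by (cases bs) auto
    then have "{r, \<alpha> r} \<subseteq> D" "card {r, \<alpha> r} = 2"
      using m(7)[OF r] permutes_in_image[OF m(6), of r] by auto
    then show False using assms card_mono by (metis linorder_not_le)
  qed
  then show ?thesis by (simp add: lcount_def)
qed

section \<open>Exponential generating functions in the number of darts\<close>

definition lnum :: "nat \<Rightarrow> (nat \<Rightarrow> 'a) \<Rightarrow> letter list \<Rightarrow> nat \<Rightarrow> nat \<Rightarrow> 'a::field_char_0" where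
  "lnum d w P v n = lcount d w {..<n} P v / fact n"

lemma card_pairs: "finite D \<Longrightarrow> card (pairs D) = card D * (card D - 1)"
proof -
  assume fin: "finite D"
  have "pairs D = (SIGMA r:D. D - {r})" by (auto simp: pairs_def)
  then show ?thesis using fin by (simp add: card_SigmaI)
qed

text \<open>There are \<open>(n + 2) * (n + 1)\<close> ordered pairs of root darts, exactly the
  quotient of \<open>fact (n + 2)\<close> by \<open>fact n\<close>. In the bridge term the
  \<open>n choose k\<close> ways of giving labels to the first side turn the sum over subsets into a
  convolution of normalised counts.\<close>

lemma lnum_Cons:
  fixes w :: "nat \<Rightarrow> 'a::field_char_0"
  shows "lnum d w (L # P) v (Suc (Suc n)) =
    (\<Sum>j=2..d. w j * lnum d w (replicate (j - 1) (opp L) @ P) v n) +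
    (\<Sum>i | i < length P \<and> P ! i = opp L. \<Sum>v1\<le>v. \<Sum>k\<le>n.
       lnum d w (take i P) v1 k * lnum d w (drop (Suc i) P) (v - v1) (n - k))"
proof -
  let ?D = "{..<Suc (Suc n)}"
  let ?N = "\<lambda>k P v. lcount d w {..<k} P v"
  let ?I = "{i. i < length P \<and> P ! i = opp L}"
  have Nn: "?N k P v = fact k * lnum d w P v k" for k P v by (simp add: lnum_def)
  have "lcount d w ?D (L # P) v = sum (lweight w ?D) {M \<in> lmaps d ?D (L # P) v. on_face M} +
      sum (lweight w ?D) {M \<in> lmaps d ?D (L # P) v. \<not> on_face M}"
    unfolding lcount_def
    by (subst sum.union_disjoint[symmetric]) (auto intro!: sum.cong finite_subset[OF _ finite_lmaps])
  also have "sum (lweight w ?D) {M \<in> lmaps d ?D (L # P) v. on_face M} =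
      of_nat (card (pairs ?D)) * (\<Sum>j=2..d. w j * ?N n (replicate (j - 1) (opp L) @ P) v)"
  proof -
    have "(\<Sum>j=2..d. w j * lcount d w (?D - {fst p, snd p}) (replicate (j - 1) (opp L) @ P) v) =
        (\<Sum>j=2..d. w j * ?N n (replicate (j - 1) (opp L) @ P) v)" if "p \<in> pairs ?D" for p
    proof -
      have "card (?D - {fst p, snd p}) = n" using that by (subst card_Diff_subset) (auto simp: pairs_def)
      then show ?thesis using lcount_card[of "?D - {fst p, snd p}" "{..<n}" d w] by simp
    qed
    then show ?thesis by (subst lcount_on_face) auto
  qed
  also have "sum (lweight w ?D) {M \<in> lmaps d ?D (L # P) v. \<not> on_face M} =
      of_nat (card (pairs ?D)) * (\<Sum>i\<in>?I. \<Sum>v1\<le>v. \<Sum>k\<le>n. of_nat (n choose k) * (?N k (take i P) v1 * ?N (n - k) (drop (Suc i) P) (v - v1)))"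
  proof -
    have "(\<Sum>i\<in>?I. \<Sum>D1\<in>Pow (?D - {fst p, snd p}). \<Sum>v1\<le>v.
        lcount d w D1 (take i P) v1 * lcount d w (?D - {fst p, snd p} - D1) (drop (Suc i) P) (v - v1)) =
      (\<Sum>i\<in>?I. \<Sum>v1\<le>v. \<Sum>k\<le>n. of_nat (n choose k) * (?N k (take i P) v1 * ?N (n - k) (drop (Suc i) P) (v - v1)))"
      if "p \<in> pairs ?D" for p
    proof (rule sum.cong[OF refl])
      fix i
      let ?E = "?D - {fst p, snd p}"
      have cE: "card ?E = n" "finite ?E" using that by (subst card_Diff_subset, auto simp: pairs_def)
      let ?g = "\<lambda>v1 k. ?N k (take i P) v1 * ?N (n - k) (drop (Suc i) P) (v - v1)"
      have eq: "lcount d w D1 (take i P) v1 * lcount d w (?E - D1) (drop (Suc i) P) (v - v1) = ?g v1 (card D1)"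
        if "D1 \<in> Pow ?E" for D1 v1
      proof -
        have f: "finite D1" "D1 \<subseteq> ?E" using that cE(2) finite_subset by auto
        have "card (?E - D1) = n - card D1" using f cE by (simp add: card_Diff_subset)
        then show ?thesis
          using lcount_card[of D1 "{..<card D1}" d w] lcount_card[of "?E - D1" "{..<n - card D1}" d w] f cE by simp
      qed
      have "(\<Sum>D1\<in>Pow ?E. h (card D1)) = (\<Sum>k\<le>n. of_nat (n choose k) * h k)" for h :: "nat \<Rightarrow> 'a"
      proof -
        have "(\<Sum>D1\<in>Pow ?E. h (card D1)) = (\<Sum>k\<le>n. \<Sum>D1 | D1 \<in> Pow ?E \<and> card D1 = k. h (card D1))"
          using cE by (intro sum.group[symmetric]) (auto intro: card_mono[of ?E, unfolded cE])
        also have "\<dots> = (\<Sum>k\<le>n. of_nat (n choose k) * h k)"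
          using cE n_subsets[OF cE(2)] by (intro sum.cong refl) simp
        finally show ?thesis .
      qed
      note S = this
      have "(\<Sum>D1\<in>Pow ?E. \<Sum>v1\<le>v. lcount d w D1 (take i P) v1 * lcount d w (?E - D1) (drop (Suc i) P) (v - v1))
        = (\<Sum>v1\<le>v. \<Sum>D1\<in>Pow ?E. ?g v1 (card D1))"
        using eq by (subst sum.swap) (intro sum.cong refl, auto)
      also have "\<dots> = (\<Sum>v1\<le>v. \<Sum>k\<le>n. of_nat (n choose k) * ?g v1 k)" by (intro sum.cong refl S)
      finally show "(\<Sum>D1\<in>Pow ?E. \<Sum>v1\<le>v. lcount d w D1 (take i P) v1 * lcount d w (?E - D1) (drop (Suc i) P) (v - v1)) = (\<Sum>v1\<le>v. \<Sum>k\<le>n. of_nat (n choose k) * ?g v1 k)" .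
    qed
    then show ?thesis by (subst lcount_on_bridge) auto
  qed
  also have "card (pairs ?D) = Suc (Suc n) * Suc n" by (subst card_pairs) auto
  finally have tot: "lcount d w ?D (L # P) v = of_nat (Suc (Suc n) * Suc n) *
     ((\<Sum>j=2..d. w j * ?N n (replicate (j - 1) (opp L) @ P) v) +
      (\<Sum>i\<in>?I. \<Sum>v1\<le>v. \<Sum>k\<le>n. of_nat (n choose k) * (?N k (take i P) v1 * ?N (n - k) (drop (Suc i) P) (v - v1))))"
    by (simp only: distrib_left)
  have b: "of_nat (n choose k) * (?N k Q v1 * ?N (n - k) Q' v2) = fact n * (lnum d w Q v1 k * lnum d w Q' v2 (n - k))"
    if "k \<le> n" for k Q Q' v1 v2
  proof -
    have "fact k * fact (n - k) * (of_nat (n choose k) :: 'a) = fact n"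
      using binomial_fact_lemma[OF that] by (metis of_nat_fact of_nat_mult)
    moreover have "of_nat (n choose k) * (?N k Q v1 * ?N (n - k) Q' v2) =
        (fact k * fact (n - k) * of_nat (n choose k)) * (lnum d w Q v1 k * lnum d w Q' v2 (n - k))"
      unfolding Nn by (simp only: mult_ac)
    ultimately show ?thesis by (simp only:)
  qed
  have "(\<Sum>i\<in>?I. \<Sum>v1\<le>v. \<Sum>k\<le>n. of_nat (n choose k) * (?N k (take i P) v1 * ?N (n - k) (drop (Suc i) P) (v - v1)))
    = fact n * (\<Sum>i\<in>?I. \<Sum>v1\<le>v. \<Sum>k\<le>n. lnum d w (take i P) v1 k * lnum d w (drop (Suc i) P) (v - v1) (n - k))"
    unfolding sum_distrib_left by (intro sum.cong refl b) simp
  moreover have "(\<Sum>j=2..d. w j * ?N n (replicate (j - 1) (opp L) @ P) v)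
    = fact n * (\<Sum>j=2..d. w j * lnum d w (replicate (j - 1) (opp L) @ P) v n)"
    unfolding sum_distrib_left Nn by (intro sum.cong refl) simp
  ultimately have "lcount d w ?D (L # P) v = fact (Suc (Suc n)) *
    ((\<Sum>j=2..d. w j * lnum d w (replicate (j - 1) (opp L) @ P) v n) +
    (\<Sum>i\<in>?I. \<Sum>v1\<le>v. \<Sum>k\<le>n. lnum d w (take i P) v1 k * lnum d w (drop (Suc i) P) (v - v1) (n - k)))"
    unfolding tot by (simp add: algebra_simps)
  then show ?thesis unfolding lnum_def[of d w "L # P"]
    by (simp only: nonzero_mult_div_cancel_left[OF fact_nonzero])
qed

section \<open>Labelled and unlabelled hypermaps\<close>

text \<open>An inner face has darts of one colour only, so the black faces are the cycles contained
  in \<open>\<chi>\<close>.\<close>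

fun to_hypermap :: "nat \<Rightarrow> lmap \<Rightarrow> hypermap" where
  "to_hypermap e (\<alpha>, \<phi>, \<chi>, bs) =
     \<lparr>num_edges = e, edge_inv = \<alpha>, face_perm = \<phi> \<circ> cycle_of_list bs, root_dart = hd bs,
      black_faces = {F \<in> orbit \<phi> ` ({..<2 * e} - set bs). F \<subseteq> \<chi>}\<rparr>"

lemma funpow_boundary:
  assumes "\<phi> permutes D - set bs" "distinct bs" "i < length bs"
  shows "((\<phi> \<circ> cycle_of_list bs) ^^ i) (hd bs) = bs ! i"
proof -
  have ne: "bs \<noteq> []" using assms(3) by auto
  have e: "(\<phi> \<circ> cycle_of_list bs) x = cycle_of_list bs x" if "x \<in> set bs" for x
  proof -
    have "cycle_of_list bs x \<in> set bs" using that permutes_in_image[OF cycle_permutes, of bs x] by simp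
    then show ?thesis using permutes_not_in[OF assms(1), of "cycle_of_list bs x"] by simp
  qed
  have "bs = map (\<lambda>i. ((\<phi> \<circ> cycle_of_list bs) ^^ i) (hd bs)) [0..<length bs]"
    by (rule cycle_list_unique[OF assms(2) ne]) (rule e)
  then have "bs ! i = map (\<lambda>i. ((\<phi> \<circ> cycle_of_list bs) ^^ i) (hd bs)) [0..<length bs] ! i"
    by (rule arg_cong)
  then show ?thesis using assms(3) by simp
qed

text \<open>The single rule that \<open>\<alpha>\<close> reverses colours unites three conditions:
  proper colouring when both sides of the edge are inner, the letter of the boundary word when one
  side is, and the bridge condition when none is.\<close>

lemma to_hypermap_iff:
  assumes D: "D = {..<2 * e}" and \<alpha>: "\<alpha> permutes D" "\<And>x. x \<in> D \<Longrightarrow> \<alpha> x \<noteq> x \<and> \<alpha> (\<alpha> x) = x"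
    and bs: "distinct bs" "bs \<noteq> []" "set bs \<subseteq> D" and \<phi>: "\<phi> permutes D - set bs"
    and \<chi>: "\<chi> \<subseteq> D" "\<And>x. x \<in> D - set bs \<Longrightarrow> \<phi> x \<in> \<chi> \<longleftrightarrow> x \<in> \<chi>" and P: "map (col \<chi>) bs = P"
  defines "M \<equiv> to_hypermap e (\<alpha>, \<phi>, \<chi>, bs)"
  shows "M \<in> hypermaps d d P \<longleftrightarrow> bmap d D \<alpha> \<phi> \<chi> bs"
    "card (vertices_of M) = nverts D \<alpha> \<phi> bs"
    "black_faces M \<union> white_faces M = orbit \<phi> ` (D - set bs)" "black_faces M \<inter> white_faces M = {}"
proof -
  let ?\<Phi> = "\<phi> \<circ> cycle_of_list bs" and ?C = "D - set bs"
  let ?B = "{F \<in> orbit \<phi> ` ?C. F \<subseteq> \<chi>}"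
  have fin: "finite D" and cD: "card D = 2 * e" by (simp_all add: D)
  have sel: "darts M = D" "num_edges M = e" "edge_inv M = \<alpha>" "face_perm M = ?\<Phi>" "root_dart M = hd bs"
    "black_faces M = ?B"
    by (simp_all add: M_def darts_def D)
  have hd: "hd bs \<in> set bs" using bs by simp
  have Dne: "D \<noteq> {}" using hd bs by auto
  note ab = ncyc_add_boundary[OF fin \<phi> bs(1,3)]
  have \<Phi>C: "?\<Phi> x = \<phi> x" if "x \<in> ?C" for x using that by (simp add: id_outside_supp)
  have orbC: "orbit ?\<Phi> x = orbit \<phi> x" if "x \<in> ?C" for x
    by (rule orbit_cong0[symmetric, OF that]) (use \<Phi>C permutes_in_image[OF \<phi>] in auto)
  have bnd: "boundary M = set bs"
  proof -
    have "orbit ?\<Phi> (hd bs) = orbit (cycle_of_list bs) (hd bs)"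
    proof (rule orbit_cong0[symmetric, OF hd])
      show "cycle_of_list bs \<in> set bs \<rightarrow> set bs" using permutes_in_image[OF cycle_permutes, of bs] by auto
      show "cycle_of_list bs y = ?\<Phi> y" if "y \<in> set bs" for y
        using that permutes_in_image[OF cycle_permutes, of bs y] permutes_not_in[OF \<phi>, of "cycle_of_list bs y"] by simp
    qed
    then show ?thesis using orbit_cycle_of_list[OF bs(1) hd] by (simp add: boundary_def sel)
  qed
  have U: "?C \<union> set bs = D" "?C \<inter> set bs = {}" using bs by auto
  have finC: "finite ?C" using fin by simp
  note dc = ncyc_disjoint_comp[OF \<phi> finC cycle_permutes _ U(2), unfolded U(1) ncyc_cycle_of_list(1)[OF bs(1,2)]]
  have faces: "faces_of M = insert (set bs) (orbit \<phi> ` ?C)"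
    unfolding faces_of_def sel using dc(1) by simp
  have nin: "set bs \<notin> orbit \<phi> ` ?C" using dc(2) by simp
  have white: "white_faces M = {F \<in> orbit \<phi> ` ?C. \<not> F \<subseteq> \<chi>}"
    unfolding white_faces_def faces bnd sel using nin by auto
  show "black_faces M \<union> white_faces M = orbit \<phi> ` ?C" "black_faces M \<inter> white_faces M = {}"
    unfolding white sel by auto
  show V: "card (vertices_of M) = nverts D \<alpha> \<phi> bs"
    using Dne by (simp add: vertices_of_def sel nverts_def ncyc_def)
  have F: "card (faces_of M) = ncyc \<phi> ?C + 1"
    unfolding faces ncyc_def using nin finC by simp
  have orb\<chi>: "y \<in> \<chi> \<longleftrightarrow> x \<in> \<chi>" if "x \<in> ?C" "y \<in> orbit \<phi> x" for x y
  proof -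
    have "y \<in> ?C \<and> (y \<in> \<chi> \<longleftrightarrow> x \<in> \<chi>)" using that(2)
    proof induction
      case base
      then show ?case using \<chi>(2)[OF that(1)] permutes_in_image[OF \<phi>, of x] that(1) by simp
    next
      case (step y)
      then show ?case using \<chi>(2)[of y] permutes_in_image[OF \<phi>, of y] by simp
    qed
    then show ?thesis by simp
  qed
  have self: "x \<in> orbit \<phi> x" for x using perm_self_in_orbit[OF \<phi> finC] .
  have isB: "orbit ?\<Phi> x \<in> ?B \<longleftrightarrow> x \<in> \<chi>" if x: "x \<in> ?C" for x
    unfolding orbC[OF x] using orb\<chi>[OF x] self[of x] x by blast
  have isW: "orbit ?\<Phi> x \<in> white_faces M \<longleftrightarrow> x \<notin> \<chi>" if x: "x \<in> ?C" for x
    unfolding white orbC[OF x] using orb\<chi>[OF x] self[of x] x by blast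
  have bd: "boundary_dart M i = bs ! i" if "i < length bs" for i
    unfolding boundary_dart_def sel using funpow_boundary[OF \<phi> bs(1) that] .
  have len: "length P = length bs" using P by auto
  have Pi: "P ! i = col \<chi> (bs ! i)" if "i < length bs" for i using that P by auto
  have cb: "card (boundary M) = length P" using bnd bs(1) len by (simp add: distinct_card)
  have colour: "properly_coloured M \<and> has_boundary_condition M P \<longleftrightarrow> (\<forall>x\<in>D. \<alpha> x \<in> \<chi> \<longleftrightarrow> x \<notin> \<chi>)"
  proof -
    have pc: "properly_coloured M \<longleftrightarrow> (\<forall>x\<in>?C. \<alpha> x \<in> ?C \<longrightarrow> (\<alpha> x \<in> \<chi> \<longleftrightarrow> x \<notin> \<chi>))"
    proof -
      have sub: "?B \<subseteq> faces_of M - {set bs}" unfolding faces using nin by auto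
      have eq: "properly_coloured M \<longleftrightarrow> (\<forall>x\<in>D. x \<notin> set bs \<longrightarrow> \<alpha> x \<notin> set bs \<longrightarrow>
          (orbit ?\<Phi> x \<in> ?B) \<noteq> (orbit ?\<Phi> (\<alpha> x) \<in> ?B))"
        unfolding properly_coloured_def sel bnd using sub by (simp only: simp_thms)
      have ain: "\<alpha> x \<in> D \<longleftrightarrow> x \<in> D" for x using permutes_in_image[OF \<alpha>(1)] .
      show ?thesis unfolding eq
      proof (rule iffI; intro ballI impI)
        fix x assume l: "\<forall>x\<in>D. x \<notin> set bs \<longrightarrow> \<alpha> x \<notin> set bs \<longrightarrow>
          (orbit ?\<Phi> x \<in> ?B) \<noteq> (orbit ?\<Phi> (\<alpha> x) \<in> ?B)" and x: "x \<in> ?C" "\<alpha> x \<in> ?C"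
        have "(orbit ?\<Phi> x \<in> ?B) \<noteq> (orbit ?\<Phi> (\<alpha> x) \<in> ?B)" using l[rule_format, of x] x by simp
        then show "\<alpha> x \<in> \<chi> \<longleftrightarrow> x \<notin> \<chi>" unfolding isB[OF x(1)] isB[OF x(2)] by simp
      next
        fix x assume l: "\<forall>x\<in>?C. \<alpha> x \<in> ?C \<longrightarrow> (\<alpha> x \<in> \<chi> \<longleftrightarrow> x \<notin> \<chi>)"
          and "x \<in> D" "x \<notin> set bs" "\<alpha> x \<notin> set bs"
        then have x: "x \<in> ?C" "\<alpha> x \<in> ?C" using ain[of x] by simp_all
        then have "\<alpha> x \<in> \<chi> \<longleftrightarrow> x \<notin> \<chi>" using l by blast
        then show "(orbit ?\<Phi> x \<in> ?B) \<noteq> (orbit ?\<Phi> (\<alpha> x) \<in> ?B)" unfolding isB[OF x(1)] isB[OF x(2)] by simp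
      qed
    qed
    have one: "(let y = \<alpha> (boundary_dart M i) in
        if y \<in> boundary M then \<exists>j<length P. y = boundary_dart M j \<and> {P ! i, P ! j} = {LetA, LetB}
        else orbit ?\<Phi> y \<in> (case P ! i of LetA \<Rightarrow> ?B | LetB \<Rightarrow> white_faces M)) \<longleftrightarrow>
        (\<alpha> (bs ! i) \<in> \<chi> \<longleftrightarrow> bs ! i \<notin> \<chi>)" if i: "i < length bs" for i
    proof (cases "\<alpha> (bs ! i) \<in> set bs")
      case True
      obtain j where j: "j < length bs" "\<alpha> (bs ! i) = bs ! j" using True by (metis in_set_conv_nth)
      have "(\<exists>j<length P. \<alpha> (bs ! i) = boundary_dart M j \<and> {P ! i, P ! j} = {LetA, LetB}) \<longleftrightarrow>
          {P ! i, P ! j} = {LetA, LetB}" (is "?l \<longleftrightarrow> ?r")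
      proof
        assume ?l
        then obtain k where k: "k < length bs" "\<alpha> (bs ! i) = boundary_dart M k" "{P ! i, P ! k} = {LetA, LetB}"
          unfolding len by blast
        then have "k = j" using j bs(1) bd[OF k(1)] by (simp add: nth_eq_iff_index_eq)
        then show ?r using k by simp
      next
        assume ?r then show ?l using j bd[OF j(1)] unfolding len by auto
      qed
      also have "\<dots> \<longleftrightarrow> (\<alpha> (bs ! i) \<in> \<chi> \<longleftrightarrow> bs ! i \<notin> \<chi>)"
        unfolding Pi[OF i] Pi[OF j(1)] j(2) by (auto simp: col_def doubleton_eq_iff)
      finally show ?thesis using True i by (simp add: Let_def bnd bd)
    next
      case False
      then have y: "\<alpha> (bs ! i) \<in> ?C" using i bs(3) permutes_in_image[OF \<alpha>(1), of "bs ! i"] by auto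
      show ?thesis using False isB[OF y] isW[OF y] i unfolding Let_def bnd bd[OF i] Pi[OF i]
        by (cases "bs ! i \<in> \<chi>") (auto simp: col_def)
    qed
    have bc: "has_boundary_condition M P \<longleftrightarrow> (\<forall>x\<in>set bs. \<alpha> x \<in> \<chi> \<longleftrightarrow> x \<notin> \<chi>)"
    proof -
      have "has_boundary_condition M P \<longleftrightarrow> (\<forall>i<length bs. \<alpha> (bs ! i) \<in> \<chi> \<longleftrightarrow> bs ! i \<notin> \<chi>)"
        unfolding has_boundary_condition_def sel using cb one len by simp
      then show ?thesis by (simp only: all_set_conv_all_nth)
    qed
    show ?thesis unfolding pc bc
    proof
      assume h: "(\<forall>x\<in>?C. \<alpha> x \<in> ?C \<longrightarrow> (\<alpha> x \<in> \<chi> \<longleftrightarrow> x \<notin> \<chi>)) \<and> (\<forall>x\<in>set bs. \<alpha> x \<in> \<chi> \<longleftrightarrow> x \<notin> \<chi>)"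
      show "\<forall>x\<in>D. \<alpha> x \<in> \<chi> \<longleftrightarrow> x \<notin> \<chi>"
      proof
        fix x assume x: "x \<in> D"
        consider "x \<in> set bs" | "x \<in> ?C" "\<alpha> x \<in> ?C" | "\<alpha> x \<in> set bs"
          using x permutes_in_image[OF \<alpha>(1), of x] by blast
        then show "\<alpha> x \<in> \<chi> \<longleftrightarrow> x \<notin> \<chi>"
        proof cases
          case 3
          then have "\<alpha> (\<alpha> x) \<in> \<chi> \<longleftrightarrow> \<alpha> x \<notin> \<chi>" using h by blast
          then show ?thesis using \<alpha>(2)[OF x] by simp
        qed (use h in blast)+
      qed
    qed (use bs in auto)
  qed
  have deg: "(\<forall>F\<in>white_faces M. card F \<in> {2..d}) \<and> (\<forall>F\<in>black_faces M. card F \<in> {2..d}) \<longleftrightarrow>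
      (\<forall>F\<in>orbit \<phi> ` ?C. card F \<in> {2..d})"
    unfolding white sel by blast
  define R where "R = {(z, \<alpha> z) | z. z \<in> D} \<union> {(z, ?\<Phi> z) | z. z \<in> D}"
  \<comment> \<open>In one direction, a closed set of inner darts cannot reach the root. In the
    other, the set of darts reachable from \<open>x\<close> contains the boundary; its complement is
    closed too, since the maps are permutations of a finite set, and is therefore empty.\<close>
  have conn: "(\<forall>x\<in>D. \<forall>y\<in>D. (x, y) \<in> R\<^sup>*) \<longleftrightarrow> bconn D \<alpha> \<phi> bs"
  proof
    assume l: "\<forall>x\<in>D. \<forall>y\<in>D. (x, y) \<in> R\<^sup>*"
    show "bconn D \<alpha> \<phi> bs" unfolding bconn_def
    proof (intro allI impI)
      fix S assume S: "S \<subseteq> ?C" "\<alpha> ` S \<subseteq> S" "\<phi> ` S \<subseteq> S"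
      show "S = {}"
      proof (rule ccontr)
        assume "S \<noteq> {}"
        then obtain x where x: "x \<in> S" by blast
        have "(x, hd bs) \<in> R\<^sup>*" using l x S(1) hd bs(3) by blast
        then have "hd bs \<in> S"
        proof (induction rule: rtrancl_induct)
          case base then show ?case using x by simp
        next
          case (step y z)
          then consider "z = \<alpha> y" | "z = ?\<Phi> y" unfolding R_def by blast
          then show ?case
          proof cases
            case 1 then show ?thesis using step.IH S(2) by blast
          next
            case 2
            then have "z = \<phi> y" using \<Phi>C[of y] step.IH S(1) by blast
            then show ?thesis using step.IH S(3) by blast
          qed
        qed
        then show False using S(1) hd by blast
      qed
    qed
  next
    assume con: "bconn D \<alpha> \<phi> bs"
    show "\<forall>x\<in>D. \<forall>y\<in>D. (x, y) \<in> R\<^sup>*"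
    proof
      fix x assume x: "x \<in> D"
      let ?T = "{y \<in> D. (x, y) \<in> R\<^sup>*}"
      have T: "?T \<subseteq> D" by auto
      have stepR1: "(y, \<alpha> y) \<in> R" if "y \<in> D" for y using that unfolding R_def by blast
      have stepR2: "(y, ?\<Phi> y) \<in> R" if "y \<in> D" for y using that unfolding R_def by blast
      have step: "f ` ?T \<subseteq> ?T" if f: "f permutes D" "\<And>y. y \<in> D \<Longrightarrow> (y, f y) \<in> R" for f
      proof (rule image_subsetI)
        fix y assume y: "y \<in> ?T"
        then have yD: "y \<in> D" and yr: "(x, y) \<in> R\<^sup>*" by simp_all
        have "(x, f y) \<in> R\<^sup>*" by (rule rtrancl_into_rtrancl[OF yr f(2)[OF yD]])
        moreover have "f y \<in> D" using yD permutes_in_image[OF f(1), of y] by simp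
        ultimately show "f y \<in> ?T" by simp
      qed
      have cl: "\<alpha> ` ?T \<subseteq> ?T" "?\<Phi> ` ?T \<subseteq> ?T"
        by (rule step[OF \<alpha>(1) stepR1], assumption, rule step[OF ab(1) stepR2], assumption)
      have none: "S = {}" if "S \<subseteq> D" "\<alpha> ` S \<subseteq> S" "?\<Phi> ` S \<subseteq> S" "\<not> set bs \<subseteq> S" for S
      proof -
        have n: "set bs \<inter> S = {}" "\<phi> ` S \<subseteq> S"
          using boundary_all_or_none[OF \<phi> bs(1,3) that(3,1)] that(4) by blast+
        then have "S \<subseteq> D - set bs" using that(1) by blast
        then show ?thesis using con[unfolded bconn_def, rule_format, of S] that(2) n(2) by simp
      qed
      have "x \<in> ?T" using x by simp
      then have bT: "set bs \<subseteq> ?T" using none[OF T cl] by blast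
      have "D - ?T = {}"
        by (rule none[OF _ closed_complement[OF \<alpha>(1) fin T cl(1)] closed_complement[OF ab(1) fin T cl(2)]])
           (use bT hd in \<open>blast+\<close>)
      then show "\<forall>y\<in>D. (x, y) \<in> R\<^sup>*" by blast
    qed
  qed
  have planar: "planar_rooted_map M \<longleftrightarrow> bconn D \<alpha> \<phi> bs \<and> 2 * (nverts D \<alpha> \<phi> bs + ncyc \<phi> ?C) = card D + 2"
    unfolding planar_rooted_map_def sel conn[unfolded R_def] V F cD using \<alpha> ab(1) hd bs(3) by auto
  have "M \<in> hypermaps d d P \<longleftrightarrow> planar_rooted_map M \<and> (\<forall>F\<in>orbit \<phi> ` ?C. card F \<in> {2..d}) \<and> (\<forall>x\<in>D. \<alpha> x \<in> \<chi> \<longleftrightarrow> x \<notin> \<chi>)"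
    unfolding hypermaps_def using deg colour by blast
  also have "\<dots> \<longleftrightarrow> bmap d D \<alpha> \<phi> \<chi> bs"
    unfolding planar bmap_def bpre_def using fin \<alpha> bs \<phi> \<chi> by blast
  finally show "M \<in> hypermaps d d P \<longleftrightarrow> bmap d D \<alpha> \<phi> \<chi> bs" .
qed

abbreviation hypermaps_with where
  "hypermaps_with d P v e \<equiv> {M \<in> hypermaps d d P. card (vertices_of M) = v \<and> num_edges M = e}"

lemma to_hypermap_mem:
  assumes m: "m \<in> lmaps d {..<2 * e} P v" and P: "P \<noteq> []"
  shows "to_hypermap e m \<in> hypermaps_with d P v e"
    "face_weight d d w w (to_hypermap e m) = lweight w {..<2 * e} m"
proof -
  let ?D = "{..<2 * e}"
  obtain \<alpha> \<phi> \<chi> bs where me: "m = (\<alpha>, \<phi>, \<chi>, bs)" by (metis prod_cases4)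
  note l = lmapsD[OF m[unfolded me]]
  have ne: "bs \<noteq> []" using l(2) P by auto
  have col: "\<And>x. x \<in> ?D - set bs \<Longrightarrow> \<phi> x \<in> \<chi> \<longleftrightarrow> x \<in> \<chi>" using l(1) by (auto simp: bmap_def bpre_def)
  have inv: "\<And>x. x \<in> ?D \<Longrightarrow> \<alpha> x \<noteq> x \<and> \<alpha> (\<alpha> x) = x" using l(7,8) by blast
  note t = to_hypermap_iff[OF refl l(6) inv l(9) ne l(10,11,12) col l(2)]
  show "to_hypermap e m \<in> hypermaps_with d P v e" using t(1,2) l(1,3) by (simp add: me)
  let ?O = "orbit \<phi> ` (?D - set bs)" and ?M = "to_hypermap e m"
  have grp: "(\<Prod>F\<in>A. w (card F)) = (\<Prod>i=2..d. w i ^ card {F \<in> A. card F = i})" if "A \<subseteq> ?O" for A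
  proof -
    have fin: "finite A" using that by (rule finite_subset) simp
    have "(\<Prod>F\<in>A. w (card F)) = (\<Prod>i=2..d. \<Prod>F | F \<in> A \<and> card F = i. w (card F))"
      using fin l(14) that by (intro prod.group[symmetric]) auto
    also have "\<dots> = (\<Prod>i=2..d. w i ^ card {F \<in> A. card F = i})"
      by (intro prod.cong refl) simp
    finally show ?thesis .
  qed
  have bw: "black_faces ?M \<union> white_faces ?M = ?O" "black_faces ?M \<inter> white_faces ?M = {}"
    using t(3,4) by (simp_all only: me)
  have f: "finite (black_faces ?M)" "finite (white_faces ?M)"
    by (rule finite_subset[of _ ?O], use bw(1) in blast, simp)+
  have "lweight w ?D m = (\<Prod>F\<in>?O. w (card F))" by (simp add: me)
  also have "\<dots> = (\<Prod>F\<in>black_faces ?M \<union> white_faces ?M. w (card F))"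
    unfolding bw(1) ..
  also have "\<dots> = (\<Prod>F\<in>black_faces ?M. w (card F)) * (\<Prod>F\<in>white_faces ?M. w (card F))"
    by (rule prod.union_disjoint[OF f bw(2)])
  also have "\<dots> = face_weight d d w w ?M"
  proof -
    have "black_faces ?M \<subseteq> ?O" "white_faces ?M \<subseteq> ?O" using bw(1) by blast+
    then show ?thesis unfolding face_weight_def by (simp only: grp mult.commute)
  qed
  finally show "face_weight d d w w ?M = lweight w ?D m" by simp
qed

text \<open>The colour of an inner dart is visible in the black faces, that of a boundary dart in
  the word \<open>P\<close>; the boundary list is found by following the face permutation from the
  root.\<close>

lemma to_hypermap_inj:
  assumes m: "m \<in> lmaps d {..<2 * e} P v" and n: "n \<in> lmaps d {..<2 * e} P u" and P: "P \<noteq> []"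
    and eq: "to_hypermap e m = to_hypermap e n"
  shows "m = n"
proof -
  let ?D = "{..<2 * e}"
  obtain \<alpha> \<phi> \<chi> bs where me: "m = (\<alpha>, \<phi>, \<chi>, bs)" by (metis prod_cases4)
  obtain \<beta> \<psi> \<kappa> cs where ne: "n = (\<beta>, \<psi>, \<kappa>, cs)" by (metis prod_cases4)
  note l = lmapsD[OF m[unfolded me]] and k = lmapsD[OF n[unfolded ne]]
  have ab: "\<alpha> = \<beta>" and fe: "\<phi> \<circ> cycle_of_list bs = \<psi> \<circ> cycle_of_list cs" and he: "hd bs = hd cs"
    and be: "{F \<in> orbit \<phi> ` (?D - set bs). F \<subseteq> \<chi>} = {F \<in> orbit \<psi> ` (?D - set cs). F \<subseteq> \<kappa>}"
    using eq by (simp_all add: me ne)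
  have len: "length bs = length cs" using l(4) k(4) by simp
  have bc: "bs = cs"
  proof (rule nth_equalityI[OF len])
    fix i assume i: "i < length bs"
    show "bs ! i = cs ! i"
      using funpow_boundary[OF l(11,9) i] funpow_boundary[OF k(11,9), of i] i len fe he by simp
  qed
  have surj: "surj (cycle_of_list bs)" using permutes_surj[OF cycle_permutes] .
  have fp: "\<phi> = \<psi>"
  proof
    fix z
    obtain u where u: "z = cycle_of_list bs u" using surj by (auto elim: surjE)
    show "\<phi> z = \<psi> z" using fun_cong[OF fe[folded bc], of u] unfolding u comp_apply .
  qed
  have inner: "x \<in> \<xi> \<longleftrightarrow> x \<in> \<Union>{F \<in> orbit \<phi> ` (?D - set bs). F \<subseteq> \<xi>}"
    if b: "bmap d ?D \<alpha> \<phi> \<xi> bs" and x: "x \<in> ?D - set bs" for x \<xi>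
  proof
    assume xi: "x \<in> \<xi>"
    have col: "\<And>x. x \<in> ?D - set bs \<Longrightarrow> \<phi> x \<in> \<xi> \<longleftrightarrow> x \<in> \<xi>" using b by (auto simp: bmap_def bpre_def)
    have "orbit \<phi> x \<subseteq> \<xi> \<inter> (?D - set bs)"
      by (rule orbit_subset_closed) (use col permutes_in_image[OF l(11)] x xi in auto)
    moreover have "x \<in> orbit \<phi> x" using perm_self_in_orbit[OF l(11)] by simp
    ultimately show "x \<in> \<Union>{F \<in> orbit \<phi> ` (?D - set bs). F \<subseteq> \<xi>}" using x by blast
  qed blast
  have kb: "bmap d ?D \<alpha> \<phi> \<kappa> bs" using k(1) ab fp bc by simp
  have "x \<in> \<chi> \<longleftrightarrow> x \<in> \<kappa>" for x
  proof (cases "x \<in> ?D")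
    case xD: True
    show ?thesis
    proof (cases "x \<in> set bs")
      case True
      then obtain i where "i < length bs" "x = bs ! i" by (metis in_set_conv_nth)
      then have "col \<chi> x = col \<kappa> x"
        using arg_cong[OF l(2)[folded k(2)], of "\<lambda>l. l ! i"] bc by simp
      then show ?thesis by (simp add: col_def split: if_splits)
    next
      case False
      then have "x \<in> ?D - set bs" using xD by simp
      then show ?thesis using inner[OF l(1), of x] inner[OF kb, of x] be[folded fp bc] by simp
    qed
  qed (use l(12) k(12) in blast)
  then show ?thesis using me ne ab fp bc by auto
qed

lemma to_hypermap_surj:
  assumes M: "M \<in> hypermaps_with d P v e" and P: "P \<noteq> []"
  shows "M \<in> to_hypermap e ` lmaps d {..<2 * e} P v"
proof -
  let ?D = "{..<2 * e}"
  define \<Phi> where "\<Phi> = face_perm M"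
  define \<alpha> where "\<alpha> = edge_inv M"
  have H: "planar_rooted_map M" "properly_coloured M" "has_boundary_condition M P" "num_edges M = e"
    using M by (auto simp: hypermaps_def)
  have D: "darts M = ?D" using H(4) by (simp add: darts_def)
  have \<alpha>: "\<alpha> permutes ?D" "\<And>x. x \<in> ?D \<Longrightarrow> \<alpha> x \<noteq> x \<and> \<alpha> (\<alpha> x) = x" and \<Phi>: "\<Phi> permutes ?D"
    and r: "root_dart M \<in> ?D"
    using H(1) by (auto simp: planar_rooted_map_def D \<alpha>_def \<Phi>_def)
  have perm: "permutation \<Phi>" using \<Phi> permutation_permutes by blast
  define bs where "bs = support \<Phi> (root_dart M)"
  have bs: "distinct bs" unfolding bs_def by (rule cycle_of_permutation[OF perm])
  have sbs: "set bs = boundary M"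
    unfolding bs_def support_set[OF perm] boundary_def \<Phi>_def[symmetric]
      orbit_altdef_self_in[OF permutation_self_in_orbit[OF perm]] by auto
  have lp: "least_power \<Phi> (root_dart M) > 0" using least_power_of_permutation(2)[OF perm] .
  then have hd: "bs \<noteq> []" "hd bs = root_dart M" unfolding bs_def by (auto simp: hd_map)
  have len: "length bs = length P"
    using H(3) distinct_card[OF bs] sbs by (simp add: has_boundary_condition_def)
  have sub: "set bs \<subseteq> ?D"
    unfolding sbs boundary_def \<Phi>_def[symmetric] by (rule permutes_orbit_subset[OF \<Phi> r])
  have cyc: "\<Phi> x = cycle_of_list bs x" if "x \<in> set bs" for x
    using cycle_restrict[OF perm] that unfolding bs_def by blast
  define \<phi> where "\<phi> = perm_restrict \<Phi> (?D - set bs)"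
  have cyo: "cyclic_on \<Phi> (set bs)"
    unfolding sbs boundary_def \<Phi>_def[symmetric] by (rule cyclic_on_orbit'[OF perm])
  have \<phi>: "\<phi> permutes ?D - set bs" unfolding \<phi>_def by (rule perm_restrict_diff_cyclic[OF \<Phi> cyo])
  have \<Phi>e: "\<Phi> = \<phi> \<circ> cycle_of_list bs"
  proof
    fix x
    show "\<Phi> x = (\<phi> \<circ> cycle_of_list bs) x"
    proof (cases "x \<in> set bs")
      case True
      then have "\<Phi> x \<in> set bs" unfolding cyc[OF True] using permutes_in_image[OF cycle_permutes, of bs x] by simp
      then have "\<phi> (\<Phi> x) = \<Phi> x" unfolding \<phi>_def by (simp add: perm_restrict_def)
      then show ?thesis using cyc True by simp
    next
      case False
      then have "cycle_of_list bs x = x" by (intro id_outside_supp) auto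
      moreover have "\<phi> x = \<Phi> x"
        using False permutes_not_in[OF \<Phi>, of x] by (auto simp: \<phi>_def perm_restrict_def)
      ultimately show ?thesis by simp
    qed
  qed
  have orbC: "orbit \<Phi> x = orbit \<phi> x" if "x \<in> ?D - set bs" for x
  proof (rule orbit_cong0[symmetric, OF that])
    show "\<phi> \<in> (?D - set bs) \<rightarrow> (?D - set bs)" using permutes_in_image[OF \<phi>] by blast
    show "\<phi> y = \<Phi> y" if "y \<in> ?D - set bs" for y using that by (simp add: \<phi>_def perm_restrict_def)
  qed
  \<comment> \<open>A hypermap gives no colour to its boundary darts; here they receive the one
    prescribed by the word.\<close>
  define \<chi> where "\<chi> = \<Union>(black_faces M) \<union> {bs ! i | i. i < length bs \<and> P ! i = LetB}"
  have bsub: "black_faces M \<subseteq> faces_of M - {boundary M}" using H(2) by (simp add: properly_coloured_def)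
  have bf: "F \<in> orbit \<phi> ` (?D - set bs)" if F: "F \<in> black_faces M" for F
  proof -
    obtain x where x: "x \<in> ?D" "F = orbit \<Phi> x" "F \<noteq> boundary M"
      using F bsub unfolding faces_of_def D \<Phi>_def by blast
    have "x \<notin> set bs"
      using x(2,3) orbit_cyclic_eq3[OF cyo, of x] sbs by auto
    then show ?thesis using x(1,2) orbC[of x] by auto
  qed
  have oC: "orbit \<phi> x \<subseteq> ?D - set bs" if "x \<in> ?D - set bs" for x
    using permutes_orbit_subset[OF \<phi> that] .
  have \<chi>D: "\<chi> \<subseteq> ?D"
  proof -
    have "F \<subseteq> ?D" if F: "F \<in> black_faces M" for F
    proof -
      obtain x where "x \<in> ?D - set bs" "F = orbit \<phi> x" using bf[OF F] by blast
      then show ?thesis using oC[of x] by blast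
    qed
    moreover have "{bs ! i | i. i < length bs \<and> P ! i = LetB} \<subseteq> set bs" by auto
    ultimately show ?thesis unfolding \<chi>_def using sub by blast
  qed
  have fC: "finite (?D - set bs)" by simp
  note self = perm_self_in_orbit[OF \<phi> fC] and oeq = perm_orbit_eq[OF \<phi> fC]
  have \<chi>C: "x \<in> \<chi> \<longleftrightarrow> orbit \<phi> x \<in> black_faces M" if x: "x \<in> ?D - set bs" for x
  proof
    assume "x \<in> \<chi>"
    then have "x \<in> \<Union>(black_faces M)" using x unfolding \<chi>_def by auto
    then obtain F where F: "F \<in> black_faces M" "x \<in> F" by blast
    then obtain y where "F = orbit \<phi> y" using bf by blast
    then have "F = orbit \<phi> x" using oeq F(2) by simp
    then show "orbit \<phi> x \<in> black_faces M" using F by simp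
  qed (use self in \<open>auto simp: \<chi>_def\<close>)
  have \<chi>cl: "\<phi> x \<in> \<chi> \<longleftrightarrow> x \<in> \<chi>" if x: "x \<in> ?D - set bs" for x
  proof -
    have "\<phi> x \<in> ?D - set bs" using x permutes_in_image[OF \<phi>, of x] by simp
    moreover have "orbit \<phi> (\<phi> x) = orbit \<phi> x" by (rule oeq) (rule orbit.base)
    ultimately show ?thesis using \<chi>C[OF x] \<chi>C[of "\<phi> x"] by simp
  qed
  have wP: "map (col \<chi>) bs = P"
  proof (rule nth_equalityI)
    fix i assume i0: "i < length (map (col \<chi>) bs)"
    then have i: "i < length bs" by simp
    have "bs ! i \<in> \<chi> \<longleftrightarrow> P ! i = LetB"
    proof
      assume "bs ! i \<in> \<chi>"
      moreover have "bs ! i \<notin> \<Union>(black_faces M)"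
      proof
        assume "bs ! i \<in> \<Union>(black_faces M)"
        then obtain F where "F \<in> black_faces M" "bs ! i \<in> F" by blast
        then have "bs ! i \<in> ?D - set bs" using bf oC by blast
        then show False using i by simp
      qed
      ultimately obtain k where "k < length bs" "bs ! i = bs ! k" "P ! k = LetB" unfolding \<chi>_def by auto
      then show "P ! i = LetB" using i bs by (simp add: nth_eq_iff_index_eq)
    qed (use i in \<open>auto simp: \<chi>_def\<close>)
    then show "map (col \<chi>) bs ! i = P ! i" using i by (cases "P ! i") (auto simp: col_def)
  qed (use len in simp)
  let ?m = "(\<alpha>, \<phi>, \<chi>, bs)"
  have black: "black_faces M = {F \<in> orbit \<phi> ` (?D - set bs). F \<subseteq> \<chi>}"
  proof (intro antisym subsetI)
    fix F assume "F \<in> black_faces M"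
    then show "F \<in> {F \<in> orbit \<phi> ` (?D - set bs). F \<subseteq> \<chi>}" using bf by (auto simp: \<chi>_def)
  next
    fix F assume "F \<in> {F \<in> orbit \<phi> ` (?D - set bs). F \<subseteq> \<chi>}"
    then obtain x where x: "x \<in> ?D - set bs" "F = orbit \<phi> x" "F \<subseteq> \<chi>" by blast
    then have "x \<in> \<chi>" using self[of x] by blast
    then show "F \<in> black_faces M" using \<chi>C[OF x(1)] x(2) by simp
  qed
  have Me: "M = to_hypermap e ?m"
    using H(4) hd(2) black \<Phi>e by (simp add: \<alpha>_def \<Phi>_def)
  note t = to_hypermap_iff[OF refl \<alpha> bs hd(1) sub \<phi> \<chi>D \<chi>cl wP, folded Me]
  have "?m \<in> lmaps d ?D P v" unfolding lmaps_def using t(1,2) M wP by simp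
  then show ?thesis using Me by blast
qed

section \<open>Isomorphism classes\<close>

lemma relabel_comp: "bij p \<Longrightarrow> bij q \<Longrightarrow> relabel p (relabel q m) = relabel (p \<circ> q) m"
  by (cases m) (auto simp: conj_by_def o_inv_distrib comp_assoc image_comp)

lemma hypermap_iso_class:
  assumes m: "m \<in> lmaps d {..<2 * e} P v" and P: "P \<noteq> []"
  shows "hypermap_iso `` {to_hypermap e m} = (\<lambda>p. to_hypermap e (relabel p m)) ` {p. p permutes {..<2 * e}}"
proof -
  let ?D = "{..<2 * e}"
  obtain \<alpha> \<phi> \<chi> bs where me: "m = (\<alpha>, \<phi>, \<chi>, bs)" by (metis prod_cases4)
  note l = lmapsD[OF m[unfolded me]]
  have ne: "bs \<noteq> []" using l(2) P by auto
  have fields: "num_edges N = num_edges (to_hypermap e m) \<and>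
      edge_inv N = p \<circ> edge_inv (to_hypermap e m) \<circ> inv p \<and>
      face_perm N = p \<circ> face_perm (to_hypermap e m) \<circ> inv p \<and>
      root_dart N = p (root_dart (to_hypermap e m)) \<and>
      black_faces N = (`) p ` black_faces (to_hypermap e m) \<longleftrightarrow> N = to_hypermap e (relabel p m)"
    if p: "p permutes ?D" for p N
  proof -
    have b: "bij p" using p permutes_bij by blast
    have inj: "inj p" using b bij_is_inj by blast
    have "conj_by p \<phi> \<circ> cycle_of_list (map p bs) = conj_by p (\<phi> \<circ> cycle_of_list bs)"
    proof -
      have "cycle_of_list (map p bs) = conj_by p (cycle_of_list bs)"
        unfolding conj_by_def by (rule conjugation_of_cycle[OF l(9) b, symmetric])
      then show ?thesis by (simp only: conj_by_comp[OF b])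
    qed
    then have 1: "face_perm (to_hypermap e (relabel p m)) = p \<circ> face_perm (to_hypermap e m) \<circ> inv p"
      by (simp add: me conj_by_def)
    have C: "?D - set (map p bs) = p ` (?D - set bs)"
      using inj permutes_image[OF p] by (metis image_set image_set_diff)
    have "{F \<in> orbit (conj_by p \<phi>) ` (?D - set (map p bs)). F \<subseteq> p ` \<chi>} = (`) p ` {F \<in> orbit \<phi> ` (?D - set bs). F \<subseteq> \<chi>}"
      unfolding C orbits_conj_by[OF b] using inj by (auto simp: inj_image_subset_iff)
    then have 2: "black_faces (to_hypermap e (relabel p m)) = (`) p ` black_faces (to_hypermap e m)"
      by (simp add: me)
    have 3: "edge_inv (to_hypermap e (relabel p m)) = p \<circ> edge_inv (to_hypermap e m) \<circ> inv p"
      "root_dart (to_hypermap e (relabel p m)) = p (root_dart (to_hypermap e m))"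
      "num_edges (to_hypermap e (relabel p m)) = num_edges (to_hypermap e m)"
      using ne by (simp_all add: me conj_by_def hd_map)
    have eqI: "N = N'" if "num_edges N = num_edges N'" "edge_inv N = edge_inv N'" "face_perm N = face_perm N'"
      "root_dart N = root_dart N'" "black_faces N = black_faces N'" for N N' :: hypermap
      using that by simp
    show ?thesis using 1 2 3 eqI[of N "to_hypermap e (relabel p m)"] by auto
  qed
  have D: "darts (to_hypermap e m) = ?D" by (simp add: me darts_def)
  have "N \<in> hypermap_iso `` {to_hypermap e m} \<longleftrightarrow> (\<exists>p. p permutes ?D \<and>
     (num_edges N = num_edges (to_hypermap e m) \<and>
      edge_inv N = p \<circ> edge_inv (to_hypermap e m) \<circ> inv p \<and>
      face_perm N = p \<circ> face_perm (to_hypermap e m) \<circ> inv p \<and>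
      root_dart N = p (root_dart (to_hypermap e m)) \<and>
      black_faces N = (`) p ` black_faces (to_hypermap e m)))" for N
    unfolding hypermap_iso_def Image_singleton_iff mem_Collect_eq split_conv D by blast
  then have "N \<in> hypermap_iso `` {to_hypermap e m} \<longleftrightarrow> (\<exists>p. p permutes ?D \<and> N = to_hypermap e (relabel p m))" for N
    using fields by (simp only: cong: conj_cong)
  then show ?thesis by (intro set_eqI) (simp only: image_iff Bex_def mem_Collect_eq)
qed

text \<open>The darts on which \<open>p\<close> and \<open>q\<close> differ form a set closed under
  \<open>\<alpha>\<close> and \<open>\<phi>\<close> that avoids the boundary, so connectedness makes
  it empty.\<close>

lemma relabel_inj:
  assumes m: "m \<in> lmaps d D P v" and p: "p permutes D" "q permutes D" and eq: "relabel p m = relabel q m"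
  shows "p = q"
proof -
  obtain \<alpha> \<phi> \<chi> bs where me: "m = (\<alpha>, \<phi>, \<chi>, bs)" by (metis prod_cases4)
  note l = lmapsD[OF m[unfolded me]]
  have b: "bij p" "bij q" using p permutes_bij by blast+
  have e: "conj_by p \<alpha> = conj_by q \<alpha>" "conj_by p \<phi> = conj_by q \<phi>" "map p bs = map q bs"
    using eq by (simp_all add: me)
  let ?S = "{x \<in> D. p x \<noteq> q x}"
  have cl: "f ` ?S \<subseteq> ?S" if f: "f permutes D" "conj_by p f = conj_by q f" for f
  proof (rule image_subsetI)
    fix x assume x: "x \<in> ?S"
    have "p x = q x" if "p (f x) = q (f x)"
    proof -
      have "conj_by p f (p x) = conj_by p f (q x)"
        using that conj_by_apply[OF b(1), of f x] conj_by_apply[OF b(2), of f x] f(2) by simp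
      moreover have "inj (conj_by p f)" using conj_by_permutes[OF b(1) f(1)] permutes_inj by blast
      ultimately show ?thesis by (rule injD[rotated])
    qed
    then show "f x \<in> ?S" using x permutes_in_image[OF f(1), of x] by auto
  qed
  have "\<phi> permutes D" by (rule permutes_subset[OF l(11)]) auto
  then have "?S = {}" using e l(6) cl by (intro l(15)) auto
  then have "p x = q x" if "x \<in> D" for x using that by blast
  moreover have "p x = q x" if "x \<notin> D" for x using that permutes_not_in[OF p(1)] permutes_not_in[OF p(2)] by simp
  ultimately show ?thesis by blast
qed

text \<open>Each isomorphism class contains exactly \<open>fact (2 * e)\<close> labelled maps, one
  for every permutation of the labels, all with the same weight. The factorial in
  \<open>lnum\<close> divides this number out, so the chosen representative of a class does not
  matter.\<close>

lemma bracket_coeff_lnum: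
  fixes w :: "nat \<Rightarrow> 'a::field_char_0"
  assumes P: "P \<noteq> []"
  shows "bracket_coeff d d w w P v e = lnum d w P v (2 * e)"
proof -
  let ?D = "{..<2 * e}"
  let ?H = "hypermaps_with d P v e" and ?L = "lmaps d ?D P v"
  let ?cls = "\<lambda>m. (\<lambda>p. to_hypermap e (relabel p m)) ` {p. p permutes ?D}"
  have perm: "bij p" "p ` ?D = ?D" if "p permutes ?D" for p
    using that permutes_bij permutes_image by blast+
  have rm: "relabel p m \<in> ?L" "lweight w ?D (relabel p m) = lweight w ?D m" if "m \<in> ?L" "p permutes ?D" for m p
    using relabel_mem(1)[OF perm(1)[OF that(2)] that(1)] relabel_mem(2)[OF perm(1)[OF that(2)] that(1), of w]
    unfolding perm(2)[OF that(2)] by auto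
  have HL: "?H = to_hypermap e ` ?L" using to_hypermap_mem(1)[OF _ P] to_hypermap_surj[OF _ P] by blast
  have finH: "finite ?H" unfolding HL using finite_lmaps[of ?D d P v] by simp
  have quo: "?H // hypermap_iso = ?cls ` ?L"
    unfolding quotient_def HL using hypermap_iso_class[OF _ P] by auto
  have clsH: "?cls m \<subseteq> ?H" if "m \<in> ?L" for m unfolding HL using rm(1)[OF that] by blast
  have clseq: "?cls n = ?cls m" if m: "m \<in> ?L" and q: "q permutes ?D" and n: "n = relabel q m" for m n q
  proof -
    have "?cls n = (\<lambda>p. to_hypermap e (relabel (p \<circ> q) m)) ` {p. p permutes ?D}"
      unfolding n using relabel_comp[OF perm(1) perm(1)[OF q]] by (intro image_cong) auto
    also have "\<dots> = (\<lambda>p. to_hypermap e (relabel p m)) ` ((\<lambda>p. p \<circ> q) ` {p. p permutes ?D})"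
      by (simp add: image_image)
    also have "(\<lambda>p. p \<circ> q) ` {p. p permutes ?D} = {p. p permutes ?D}"
    proof (intro antisym subsetI)
      fix f assume "f \<in> {p. p permutes ?D}"
      then have "f \<circ> inv q permutes ?D" using q by (simp add: permutes_compose permutes_inv)
      moreover have "f = (f \<circ> inv q) \<circ> q" using q by (simp add: comp_assoc permutes_inv_o)
      ultimately show "f \<in> (\<lambda>p. p \<circ> q) ` {p. p permutes ?D}" by blast
    qed (use q permutes_compose in blast)
    finally show ?thesis .
  qed
  have wt: "face_weight d d w w N = lweight w ?D m" if "m \<in> ?L" "N \<in> ?cls m" for m N
    using that rm to_hypermap_mem(2)[OF rm(1) P, of m _ w] by auto
  have cardc: "card (?cls m) = fact (2 * e)" if m: "m \<in> ?L" for m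
  proof -
    have "inj_on (\<lambda>p. to_hypermap e (relabel p m)) {p. p permutes ?D}"
    proof (rule inj_onI)
      fix p q assume pq: "p \<in> {p. p permutes ?D}" "q \<in> {p. p permutes ?D}"
        "to_hypermap e (relabel p m) = to_hypermap e (relabel q m)"
      then have "relabel p m = relabel q m"
        using to_hypermap_inj[OF rm(1)[OF m] rm(1)[OF m] P] by blast
      then show "p = q" using relabel_inj[OF m] pq by blast
    qed
    then show ?thesis by (simp add: card_image card_permutations)
  qed
  have disj: "A \<inter> B = {}" if AB: "A \<in> ?cls ` ?L" "B \<in> ?cls ` ?L" "A \<noteq> B" for A B
  proof (rule ccontr)
    assume "A \<inter> B \<noteq> {}"
    then obtain N where N: "N \<in> A" "N \<in> B" by blast
    obtain m where m': "A = ?cls m" "m \<in> ?L" using AB(1) by (rule imageE)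
    obtain n where n': "B = ?cls n" "n \<in> ?L" using AB(2) by (rule imageE)
    note m = m'(2,1) and n = n'(2,1)
    obtain p where p': "N = to_hypermap e (relabel p m)" "p \<in> {p. p permutes ?D}"
      using N(1) unfolding m(2) by (rule imageE)
    obtain q where q': "N = to_hypermap e (relabel q n)" "q \<in> {p. p permutes ?D}"
      using N(2) unfolding n(2) by (rule imageE)
    have p: "p permutes ?D" "N = to_hypermap e (relabel p m)" and q: "q permutes ?D" "N = to_hypermap e (relabel q n)"
      using p' q' by auto
    have "relabel p m = relabel q n"
      by (rule to_hypermap_inj[OF rm(1)[OF m(1) p(1)] rm(1)[OF n(1) q(1)] P]) (use p q in simp)
    then have "?cls m = ?cls n"
      using clseq[OF m(1) p(1) refl] clseq[OF n(1) q(1) refl] by simp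
    then show False using AB(3) m n by simp
  qed
  have cov: "?H = \<Union>(?cls ` ?L)"
  proof
    show "\<Union>(?cls ` ?L) \<subseteq> ?H" using clsH by blast
    show "?H \<subseteq> \<Union>(?cls ` ?L)"
    proof
      fix N assume "N \<in> ?H"
      then obtain m where m: "m \<in> ?L" "N = to_hypermap e m" unfolding HL by blast
      have "relabel id m = m" by (cases m) (simp add: conj_by_def)
      then have "N \<in> ?cls m" using m permutes_id by (intro image_eqI[of _ _ id]) auto
      then show "N \<in> \<Union>(?cls ` ?L)" using m by blast
    qed
  qed
  have cls: "sum (face_weight d d w w) A = fact (2 * e) * face_weight d d w w (SOME M. M \<in> A)"
    if A: "A \<in> ?cls ` ?L" for A
  proof -
    obtain m where m': "A = ?cls m" "m \<in> ?L" using A by (rule imageE)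
    note m = m'(2,1)
    have "to_hypermap e (relabel id m) \<in> A" unfolding m(2) using permutes_id by blast
    then have "A \<noteq> {}" by blast
    then have "(SOME M. M \<in> A) \<in> A" by (metis ex_in_conv someI_ex)
    then have s: "face_weight d d w w (SOME M. M \<in> A) = lweight w ?D m" using wt[OF m(1)] m(2) by blast
    have "sum (face_weight d d w w) A = sum (\<lambda>_. lweight w ?D m) A"
      by (rule sum.cong[OF refl]) (use wt[OF m(1)] m(2) in blast)
    also have "\<dots> = of_nat (card A) * lweight w ?D m" by simp
    finally show ?thesis unfolding s using cardc[OF m(1)] m(2) by simp
  qed
  have "lcount d w ?D P v = (\<Sum>m\<in>?L. face_weight d d w w (to_hypermap e m))"
    unfolding lcount_def by (intro sum.cong refl to_hypermap_mem(2)[OF _ P, symmetric])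
  also have "\<dots> = sum (face_weight d d w w) ?H"
  proof -
    have "inj_on (to_hypermap e) ?L" by (rule inj_onI) (rule to_hypermap_inj[OF _ _ P])
    then show ?thesis unfolding HL by (simp only: sum.reindex comp_def)
  qed
  also have "\<dots> = (\<Sum>A\<in>?cls ` ?L. sum (face_weight d d w w) A)"
    unfolding cov
  proof (subst sum.Union_disjoint)
    show "\<forall>A\<in>?cls ` ?L. finite A" using clsH finH finite_subset by blast
    show "\<forall>A\<in>?cls ` ?L. \<forall>B\<in>?cls ` ?L. A \<noteq> B \<longrightarrow> A \<inter> B = {}" using disj by blast
  qed simp
  also have "\<dots> = fact (2 * e) * (\<Sum>A\<in>?cls ` ?L. face_weight d d w w (SOME M. M \<in> A))"
    unfolding sum_distrib_left by (intro sum.cong refl cls)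
  finally have "lcount d w ?D P v = fact (2 * e) * bracket_coeff d d w w P v e"
    unfolding bracket_coeff_def quo .
  then show ?thesis unfolding lnum_def by (simp only: nonzero_mult_div_cancel_left[OF fact_nonzero])
qed

section \<open>Generating functions\<close>

text \<open>The generating function of a word, as a series in the inverse of \<open>c\<close> whose coefficients are
  series in \<open>t\<close>; this order makes the peeling recursion a contraction.\<close>

definition gf :: "nat \<Rightarrow> (nat \<Rightarrow> 'a) \<Rightarrow> letter list \<Rightarrow> 'a::field_char_0 fps fps" where
  "gf d w P = Abs_fps (\<lambda>e. Abs_fps (\<lambda>v. lnum d w P v (2 * e)))"

lemma gf_nth: "gf d w P $ e $ v = lnum d w P v (2 * e)"
  by (simp add: gf_def)

lemma lnum_odd: "odd n \<Longrightarrow> lnum d w P v n = 0"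
proof -
  assume n: "odd n"
  have "lmaps d {..<n} P v = {}"
  proof (rule ccontr)
    assume "lmaps d {..<n} P v \<noteq> {}"
    then obtain \<alpha> \<phi> \<chi> bs where "(\<alpha>, \<phi>, \<chi>, bs) \<in> lmaps d {..<n} P v" by (metis ex_in_conv prod_cases4)
    then have "2 * (nverts {..<n} \<alpha> \<phi> bs + ncyc \<phi> ({..<n} - set bs)) = n + 2"
      by (simp add: lmaps_def bmap_def)
    then have "even (n + 2)" by (metis dvd_triv_left)
    then show False using n by simp
  qed
  then show ?thesis by (simp add: lnum_def lcount_def)
qed

lemma gf_Nil: "gf d w [] = fps_const fps_X"
proof (intro fps_ext)
  fix e v
  show "gf d w [] $ e $ v = fps_const fps_X $ e $ v"
    by (simp add: gf_nth lnum_def lcount_Nil fps_X_def lessThan_empty_iff)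
qed

lemma gf_rotate: "gf d w (P @ Q) = gf d w (Q @ P)"
  by (simp add: gf_def lnum_def lcount_rotate[of d w _ P Q])

section \<open>Splitting a word at the occurrences of a letter\<close>

fun splits :: "letter \<Rightarrow> (letter list \<Rightarrow> letter list \<Rightarrow> 'b) \<Rightarrow> letter list \<Rightarrow> 'b::comm_monoid_add" where
  "splits L f [] = 0"
| "splits L f (x # xs) = (if x = L then f [] xs else 0) + splits L (\<lambda>u v. f (x # u) v) xs"

lemma splits_sum: "(\<Sum>i | i < length P \<and> P ! i = L. f (take i P) (drop (Suc i) P)) = splits L f P"
proof (induction P arbitrary: f)
  case (Cons x xs)
  let ?I = "{i. i < length xs \<and> xs ! i = L}"
  have fin: "finite ?I" by simp
  have "{i. i < length (x # xs) \<and> (x # xs) ! i = L} = (if x = L then {0} else {}) \<union> Suc ` ?I"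
  proof (rule set_eqI)
    fix i
    show "i \<in> {i. i < length (x # xs) \<and> (x # xs) ! i = L} \<longleftrightarrow> i \<in> (if x = L then {0} else {}) \<union> Suc ` ?I"
      by (cases i) auto
  qed
  then have "(\<Sum>i | i < length (x # xs) \<and> (x # xs) ! i = L. f (take i (x # xs)) (drop (Suc i) (x # xs))) =
     (\<Sum>i\<in>(if x = L then {0} else {}). f (take i (x # xs)) (drop (Suc i) (x # xs))) +
     (\<Sum>i\<in>Suc ` ?I. f (take i (x # xs)) (drop (Suc i) (x # xs)))"
    using fin by (simp only:) (intro sum.union_disjoint, auto)
  also have "(\<Sum>i\<in>Suc ` ?I. f (take i (x # xs)) (drop (Suc i) (x # xs))) = (\<Sum>i\<in>?I. f (x # take i xs) (drop (Suc i) xs))"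
    by (subst sum.reindex) auto
  also have "\<dots> = splits L (\<lambda>u v. f (x # u) v) xs" using Cons.IH[of "\<lambda>u v. f (x # u) v"] by simp
  finally show ?case by simp
qed simp

lemma splits_append:
  "splits L f (U @ V) = splits L (\<lambda>u v. f u (v @ V)) U + splits L (\<lambda>u v. f (U @ u) v) V"
  by (induction U arbitrary: f) (simp_all add: add.assoc)

lemma splits_replicate:
  "splits L f (replicate p L) = (\<Sum>a<p. f (replicate a L) (replicate (p - 1 - a) L))"
proof (induction p arbitrary: f)
  case (Suc p)
  have "(\<Sum>a<p. f (L # replicate a L) (replicate (p - 1 - a) L)) = (\<Sum>a<p. f (replicate (Suc a) L) (replicate (p - Suc a) L))"
    by (intro sum.cong) auto
  then show ?case by (simp only: sum.lessThan_Suc_shift) (simp add: Suc)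
qed simp

lemma splits_replicate_neq: "x \<noteq> L \<Longrightarrow> splits L f (replicate p x) = 0"
  by (induction p arbitrary: f) auto

definition alt :: "letter \<Rightarrow> letter \<Rightarrow> nat \<Rightarrow> letter list" where
  "alt x y k = concat (replicate k [x, y])"

lemma alt_simps: "alt x y 0 = []" "alt x y (Suc k) = x # y # alt x y k"
  by (simp_all add: alt_def)

lemma alt_shift: "x # alt y x k = alt x y k @ [x]"
  by (induction k) (simp_all add: alt_simps)

lemma splits_alt:
  "x \<noteq> y \<Longrightarrow> splits x f (alt x y k) = (\<Sum>a<k. f (alt x y a) (y # alt x y (k - 1 - a)))"
proof (induction k arbitrary: f)
  case (Suc k)
  have "(\<Sum>a<k. f (x # y # alt x y a) (y # alt x y (k - 1 - a))) = (\<Sum>a<k. f (alt x y (Suc a)) (y # alt x y (k - Suc a)))"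
    by (intro sum.cong) (auto simp: alt_simps)
  then show ?case using Suc by (simp only: sum.lessThan_Suc_shift) (simp add: alt_simps)
qed (simp add: alt_simps)

text \<open>\<open>lnum_Cons\<close> counts darts and \<open>gf\<close> counts edges: the two peeled
  darts give the factor \<open>fps_X\<close>, and in the convolution the terms with an odd number of
  darts vanish.\<close>

lemma gf_Cons:
  "gf d w (L # P) = fps_X * ((\<Sum>j=2..d. fps_const (fps_const (w j)) * gf d w (replicate (j - 1) (opp L) @ P)) +
     splits (opp L) (\<lambda>Q R. gf d w Q * gf d w R) P)"
proof (rule fps_ext)
  fix e
  let ?S = "(\<Sum>j=2..d. fps_const (fps_const (w j)) * gf d w (replicate (j - 1) (opp L) @ P)) +
     splits (opp L) (\<lambda>Q R. gf d w Q * gf d w R) P"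
  show "gf d w (L # P) $ e = (fps_X * ?S) $ e"
  proof (cases e)
    case 0
    then show ?thesis by (simp add: gf_def lnum_def lcount_small fps_zero_def)
  next
    case (Suc n)
    have even: "(\<Sum>k\<le>2 * n. lnum d w Q v1 k * lnum d w R v2 (2 * n - k)) =
        (\<Sum>a\<le>n. lnum d w Q v1 (2 * a) * lnum d w R v2 (2 * (n - a)))" for Q R v1 v2
    proof -
      have "(\<Sum>k\<le>2 * n. lnum d w Q v1 k * lnum d w R v2 (2 * n - k)) =
        (\<Sum>k\<in>(\<lambda>a. 2 * a) ` {..n}. lnum d w Q v1 k * lnum d w R v2 (2 * n - k))"
      proof (rule sum.mono_neutral_right)
        show "\<forall>k\<in>{..2 * n} - (\<lambda>a. 2 * a) ` {..n}. lnum d w Q v1 k * lnum d w R v2 (2 * n - k) = 0"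
        proof
          fix k assume k: "k \<in> {..2 * n} - (\<lambda>a. 2 * a) ` {..n}"
          have "odd k"
          proof
            assume "even k"
            then obtain a where "k = 2 * a" by blast
            then show False using k by auto
          qed
          then show "lnum d w Q v1 k * lnum d w R v2 (2 * n - k) = 0" by (simp add: lnum_odd)
        qed
      qed auto
      also have "\<dots> = (\<Sum>a\<le>n. lnum d w Q v1 (2 * a) * lnum d w R v2 (2 * (n - a)))"
        by (subst sum.reindex) (auto intro!: inj_onI simp: diff_mult_distrib2)
      finally show ?thesis .
    qed
    have prod: "(gf d w Q * gf d w R) $ n $ v = (\<Sum>v1\<le>v. \<Sum>k\<le>2 * n. lnum d w Q v1 k * lnum d w R (v - v1) (2 * n - k))" for Q R v
    proof -
      have "(gf d w Q * gf d w R) $ n $ v = (\<Sum>a\<le>n. \<Sum>v1\<le>v. lnum d w Q v1 (2 * a) * lnum d w R (v - v1) (2 * (n - a)))"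
        by (simp add: fps_mult_nth fps_sum_nth gf_nth atLeast0AtMost)
      also have "\<dots> = (\<Sum>v1\<le>v. \<Sum>a\<le>n. lnum d w Q v1 (2 * a) * lnum d w R (v - v1) (2 * (n - a)))"
        by (rule sum.swap)
      finally show ?thesis using even by simp
    qed
    have spl: "splits (opp L) (\<lambda>Q R. gf d w Q * gf d w R) P $ n $ v =
       (\<Sum>i | i < length P \<and> P ! i = opp L. \<Sum>v1\<le>v. \<Sum>k\<le>2 * n.
          lnum d w (take i P) v1 k * lnum d w (drop (Suc i) P) (v - v1) (2 * n - k))" for v
      unfolding splits_sum[symmetric] fps_sum_nth prod ..
    have "gf d w (L # P) $ Suc n $ v = ?S $ n $ v" for v
      using lnum_Cons[of d w L P v "2 * n"] by (simp add: gf_nth spl fps_sum_nth)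
    then show ?thesis unfolding Suc by (simp add: fps_eq_iff)
  qed
qed

section \<open>Words that occur in the symmetric Ising case\<close>

locale ising =
  fixes t2 t4 :: "'a::field_char_0"
begin

abbreviation K :: "'a \<Rightarrow> 'a fps fps" where "K a \<equiv> fps_const (fps_const a)"
abbreviation \<epsilon> :: "'a fps fps" where "\<epsilon> \<equiv> fps_X"
abbreviation tt :: "'a fps fps" where "tt \<equiv> fps_const fps_X"
abbreviation br :: "letter list \<Rightarrow> 'a fps fps" where "br P \<equiv> gf 4 (ising_weights t2 t4) P"

lemma br_Cons:
  "br (L # P) = \<epsilon> * (K t2 * br (opp L # P) + K t4 * br (opp L # opp L # opp L # P) +
     splits (opp L) (\<lambda>Q R. br Q * br R) P)"
proof -
  have "{2..4} = {2, 3, 4::nat}" by auto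
  then show ?thesis by (subst gf_Cons) (simp add: ising_weights_def numeral_eq_Suc algebra_simps)
qed

lemma splits_eq_0:
  assumes "\<And>u v. length u + length v + 1 = length P \<Longrightarrow> f u v = 0"
  shows "splits L f P = 0"
proof -
  have "(\<Sum>i | i < length P \<and> P ! i = L. f (take i P) (drop (Suc i) P)) = 0"
    by (rule sum.neutral) (auto intro!: assms)
  then show ?thesis by (simp add: splits_sum)
qed

text \<open>Removing a face of degree 2 or 4 keeps the parity of the word, and cutting an odd word
  at a bridge leaves one factor of odd length. Induction on the power of \<open>\<epsilon>\<close>
  concludes.\<close>

lemma br_odd: "odd (length P) \<Longrightarrow> br P = 0"
proof -
  have "\<forall>k<n. \<forall>P. odd (length P) \<longrightarrow> br P $ k = 0" for n
  proof (induction n)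
    case (Suc n)
    have "br P $ n = 0" if P: "odd (length P)" for P
    proof -
      obtain L Q where PL: "P = L # Q" using P by (cases P) auto
      have prod: "(br U * br V) $ k = 0" if "odd (length U + length V)" "k < n" for U V k
        unfolding fps_mult_nth
      proof (rule sum.neutral, rule ballI)
        fix i assume i: "i \<in> {0..k}"
        then have "i < n" "k - i < n" using that by auto
        then show "br U $ i * br V $ (k - i) = 0" using Suc.IH that(1) by (cases "odd (length U)") auto
      qed
      have spl: "splits (opp L) (\<lambda>Q R. br Q * br R) Q $ k = 0" if "k < n" for k
      proof -
        have "splits (opp L) (\<lambda>Q R. br Q * br R) Q $ k = splits (opp L) (\<lambda>Q R. (br Q * br R) $ k) Q"
          unfolding splits_sum[symmetric] fps_sum_nth ..
        also have "\<dots> = 0"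
        proof (rule splits_eq_0)
          fix u v :: "letter list" assume l: "length u + length v + 1 = length Q"
          have "even (length Q)" using P PL by simp
          then have "odd (length u + length v)" using l by presburger
          then show "(br u * br v) $ k = 0" using that by (rule prod)
        qed
        finally show ?thesis .
      qed
      have "br (opp L # Q) $ k = 0" "br (opp L # opp L # opp L # Q) $ k = 0" if "k < n" for k
        using Suc.IH that P PL by auto
      then show ?thesis unfolding PL using spl by (subst br_Cons) (cases n; simp)
    qed
    then show ?case using Suc.IH less_Suc_eq by auto
  qed simp
  then show "odd (length P) \<Longrightarrow> br P = 0" by (auto simp: fps_eq_iff)
qed

definition T :: "nat \<Rightarrow> nat \<Rightarrow> 'a fps fps" where
  "T p q = br (replicate q LetB @ replicate p LetA)"

lemma br_A_B_A: "br (replicate a LetA @ replicate q LetB @ replicate p LetA) = T (p + a) q"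
  unfolding T_def by (subst gf_rotate) (simp add: replicate_add)

lemma T_00: "T 0 0 = tt"
  by (simp add: T_def gf_Nil)

text \<open>A word without the letter B admits no bridge at a root A, hence the absence of a
  quadratic term.\<close>

lemma T_Suc_left: "T (Suc p) 0 = \<epsilon> * (K t2 * T p 1 + K t4 * T p 3)"
  unfolding T_def by (simp add: br_Cons[of LetA] splits_replicate_neq numeral_3_eq_3)

lemma T_Suc_right:
  "T p (Suc q) = \<epsilon> * (K t2 * T (Suc p) q + K t4 * T (p + 3) q + (\<Sum>a<p. T a q * T (p - 1 - a) 0))"
proof -
  have 1: "br (LetA # replicate q LetB @ replicate p LetA) = T (Suc p) q"
    "br (LetA # LetA # LetA # replicate q LetB @ replicate p LetA) = T (p + 3) q"
    using br_A_B_A[of 1 q p] br_A_B_A[of 3 q p] by (simp_all add: numeral_3_eq_3)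
  have 2: "splits LetA (\<lambda>Q R. br Q * br R) (replicate q LetB @ replicate p LetA) = (\<Sum>a<p. T a q * T (p - 1 - a) 0)"
    by (simp add: splits_append splits_replicate_neq splits_replicate T_def)
  show ?thesis unfolding T_def[of p "Suc q"] by (simp add: br_Cons[of LetB] 1 2)
qed

lemma T_odd: "odd (p + q) \<Longrightarrow> T p q = 0"
  unfolding T_def by (rule br_odd) simp

definition M :: "nat \<Rightarrow> nat \<Rightarrow> 'a fps fps" where
  "M k p = br (alt LetB LetA k @ replicate p LetA)"

lemma M_0: "M 0 p = T p 0"
  by (simp add: M_def T_def alt_simps)

lemma br_alt_AB: "br (alt LetA LetB k) = M k 0"
proof (cases k)
  case (Suc n)
  have "alt LetA LetB k = [LetA] @ (LetB # alt LetA LetB n)" by (simp add: Suc alt_simps)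
  then have "br (alt LetA LetB k) = br ((LetB # alt LetA LetB n) @ [LetA])" by (metis gf_rotate)
  also have "(LetB # alt LetA LetB n) @ [LetA] = alt LetB LetA k"
    by (simp add: alt_shift Suc alt_simps flip: alt_shift)
  finally show ?thesis by (simp add: M_def)
qed (simp add: M_def alt_simps)

text \<open>\<open>(AB)^k A\<close> is the same word as \<open>A (BA)^k\<close>, after which the
  leading letters A can be rotated to the end.\<close>

lemma br_A_alt: "br (replicate a LetA @ alt LetA LetB k @ replicate (Suc p) LetA) = M k (Suc p + a)"
proof -
  have "alt LetA LetB k @ replicate (Suc p) LetA = [LetA] @ alt LetB LetA k @ replicate p LetA"
    using alt_shift[of LetA LetB k] by simp
  then have "br (replicate a LetA @ alt LetA LetB k @ replicate (Suc p) LetA) =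
      br ((replicate a LetA @ [LetA]) @ alt LetB LetA k @ replicate p LetA)" by (simp only: append_assoc)
  also have "\<dots> = br ((alt LetB LetA k @ replicate p LetA) @ replicate a LetA @ [LetA])" by (rule gf_rotate)
  also have "replicate a LetA @ [LetA] = replicate (Suc a) LetA" by (simp add: replicate_append_same)
  finally show ?thesis by (simp add: M_def replicate_add[symmetric] add.commute del: replicate_Suc)
qed

text \<open>Behind the first B the word reads \<open>(AB)^k A^(p+1)\<close>. A bridge to a letter A
  of the alternating part leaves two words of the family, after rotation; a bridge into the tail
  gives the second sum. The term \<open>a = k\<close> of the first sum is the bridge to the first
  letter of the tail.\<close>

lemma M_Suc:
  "M (Suc k) p = \<epsilon> * (K t2 * M k (p + 2) + K t4 * M k (p + 4) + (\<Sum>a\<le>k. M a 0 * M (k - a) p) +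
     (\<Sum>b=1..p. M k b * M 0 (p - b)))"
proof -
  let ?W = "alt LetA LetB k @ replicate (Suc p) LetA"
  have W: "alt LetB LetA (Suc k) @ replicate p LetA = LetB # ?W"
    using alt_shift[of LetA LetB k] by (simp add: alt_simps)
  have 1: "br (LetA # ?W) = M k (p + 2)" "br (LetA # LetA # LetA # ?W) = M k (p + 4)"
    using br_A_alt[of 1 k p] br_A_alt[of 3 k p] by (simp_all add: numeral_eq_Suc)
  have s1: "splits LetA (\<lambda>Q R. br Q * br (R @ replicate (Suc p) LetA)) (alt LetA LetB k) = (\<Sum>a<k. M a 0 * M (k - a) p)"
  proof -
    have "(LetB # alt LetA LetB (k - 1 - a)) @ replicate (Suc p) LetA = alt LetB LetA (k - a) @ replicate p LetA"
      if "a < k" for a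
    proof -
      have "k - a = Suc (k - 1 - a)" using that by simp
      then show ?thesis using alt_shift[of LetA LetB "k - 1 - a"] by (simp add: alt_simps)
    qed
    then show ?thesis
      by (subst splits_alt) (auto intro!: sum.cong simp: br_alt_AB M_def simp del: replicate_Suc append_Cons)
  qed
  have s2: "splits LetA (\<lambda>Q R. br (alt LetA LetB k @ Q) * br R) (replicate (Suc p) LetA) =
     M k 0 * M 0 p + (\<Sum>b=1..p. M k b * M 0 (p - b))"
  proof -
    have "br (alt LetA LetB k @ replicate b LetA) = M k b" if "b \<ge> 1" for b
      using that br_A_alt[of 0 k "b - 1"] by simp
    then have "(\<Sum>b<p. br (alt LetA LetB k @ replicate (Suc b) LetA) * br (replicate (p - Suc b) LetA)) =
       (\<Sum>b<p. M k (Suc b) * M 0 (p - Suc b))"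
      by (simp add: M_0 T_def del: replicate_Suc)
    also have "\<dots> = (\<Sum>b=1..p. M k b * M 0 (p - b))"
      by (rule sum.reindex_bij_witness[of _ "\<lambda>b. b - 1" Suc]) auto
    finally show ?thesis
      unfolding splits_replicate sum.lessThan_Suc_shift by (simp add: br_alt_AB M_0 T_def del: replicate_Suc)
  qed
  have "splits LetA (\<lambda>Q R. br Q * br R) ?W = (\<Sum>a\<le>k. M a 0 * M (k - a) p) + (\<Sum>b=1..p. M k b * M 0 (p - b))"
    unfolding splits_append s1 s2 lessThan_Suc_atMost[symmetric] by (simp add: add.assoc)
  then show ?thesis unfolding M_def[of "Suc k" p] W by (subst br_Cons) (simp add: 1 add.assoc del: replicate_Suc)
qed

end

section \<open>The disk function\<close>

lemma fps_mult_nth_cong: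
  fixes f g :: "'r::comm_ring_1 fps"
  assumes "\<And>k. k \<le> m \<Longrightarrow> f $ k = f' $ k" "\<And>k. k \<le> m \<Longrightarrow> g $ k = g' $ k" "k \<le> m"
  shows "(f * g) $ k = (f' * g') $ k"
  unfolding fps_mult_nth using assms by (intro sum.cong) auto

lemma fps_family_eqI:
  fixes f g :: "'i \<Rightarrow> 'r::comm_ring_1 fps"
  assumes "\<And>n i. (\<And>i k. k < n \<Longrightarrow> f i $ k = g i $ k) \<Longrightarrow> f i $ n = g i $ n"
  shows "f i = g i"
proof -
  have "f i $ n = g i $ n" for i n
  proof (induction n arbitrary: i rule: less_induct)
    case (less n) then show ?case by (rule assms)
  qed
  then show ?thesis by (simp add: fps_eq_iff)
qed

text \<open>Since order \<open>n\<close> of \<open>\<Psi> f\<close> depends only on the lower orders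
  of \<open>f\<close>, the iterates from 0 are stationary up to order \<open>n\<close> after
  \<open>n + 1\<close> steps, and the fixed point is read off the diagonal.\<close>

lemma fps_family_fixpoint:
  fixes \<Psi> :: "('i \<Rightarrow> 'r::comm_ring_1 fps) \<Rightarrow> 'i \<Rightarrow> 'r fps"
  assumes contr: "\<And>n f g i. (\<And>i k. k < n \<Longrightarrow> f i $ k = g i $ k) \<Longrightarrow> \<Psi> f i $ n = \<Psi> g i $ n"
  obtains f where "\<And>i. f i = \<Psi> f i"
proof -
  define h where "h n = (\<Psi> ^^ n) (\<lambda>_. 0)" for n
  have hS: "h (Suc n) = \<Psi> (h n)" for n by (simp add: h_def)
  have st: "h n i $ k = h m i $ k" if "k < n" "k < m" for k n m i
    using that
  proof (induction k arbitrary: n m i rule: less_induct)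
    case (less k)
    obtain n' m' where "n = Suc n'" "m = Suc m'" using less.prems by (metis less_imp_Suc_add)
    moreover have "\<Psi> (h n') i $ k = \<Psi> (h m') i $ k"
      by (rule contr, rule less.IH) (use less.prems calculation in auto)
    ultimately show ?case by (simp only: hS)
  qed
  define f where "f i = Abs_fps (\<lambda>k. h (Suc k) i $ k)" for i
  have fh: "f i $ k = h n i $ k" if "k < n" for i k n
    unfolding f_def using st[of k "Suc k" n i] that by simp
  have "f i = \<Psi> f i" for i
  proof (rule fps_ext)
    fix n
    have "f i $ n = \<Psi> (h n) i $ n" using fh[of n "Suc n" i] by (simp add: hS)
    also have "\<dots> = \<Psi> f i $ n" by (rule contr) (simp add: fh)
    finally show "f i $ n = \<Psi> f i $ n" .
  qed
  then show ?thesis by (rule that)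
qed

text \<open>The coefficients of the series whose composition with \<open>\<psi>\<close> is
  \<open>w\<close>, provided that \<open>\<psi>\<close> begins with the variable itself: a
  triangular system with ones on the diagonal.\<close>

fun decompose :: "'r::comm_ring_1 fps \<Rightarrow> 'r fps \<Rightarrow> nat \<Rightarrow> 'r" where
  "decompose \<psi> w k = w $ k - (\<Sum>i<k. decompose \<psi> w i * (\<psi> ^ i) $ k)"

declare decompose.simps [simp del]

lemma compose_decompose:
  fixes \<psi> w :: "'r::idom fps"
  assumes "\<psi> $ 0 = 0" "\<psi> $ 1 = 1"
  shows "Abs_fps (decompose \<psi> w) oo \<psi> = w"
proof (rule fps_ext)
  fix k
  have d: "(\<psi> ^ k) $ k = 1" using startsby_zero_power_nth_same[OF assms(1), of k] assms(2) by simp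
  have "(Abs_fps (decompose \<psi> w) oo \<psi>) $ k = (\<Sum>i<Suc k. decompose \<psi> w i * (\<psi> ^ i) $ k)"
    by (simp only: fps_compose_nth atLeast0AtMost lessThan_Suc_atMost fps_nth_Abs_fps)
  also have "\<dots> = w $ k" using decompose.simps[of \<psi> w k] d by simp
  finally show "(Abs_fps (decompose \<psi> w) oo \<psi>) $ k = w $ k" .
qed

lemma fps_compose_inj:
  fixes \<psi> f g :: "'r::idom fps"
  assumes "\<psi> $ 0 = 0" "\<psi> $ 1 = 1" "f oo \<psi> = g oo \<psi>"
  shows "f = g"
proof (rule fps_ext)
  fix n show "f $ n = g $ n"
  proof (induction n rule: less_induct)
    case (less n)
    have d: "(\<psi> ^ n) $ n = 1" using startsby_zero_power_nth_same[OF assms(1), of n] assms(2) by simp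
    have e: "(h oo \<psi>) $ n = (\<Sum>i<n. h $ i * (\<psi> ^ i) $ n) + h $ n" for h :: "'r fps"
      using d by (simp add: fps_compose_nth atLeast0AtMost flip: lessThan_Suc_atMost)
    have "(\<Sum>i<n. f $ i * (\<psi> ^ i) $ n) = (\<Sum>i<n. g $ i * (\<psi> ^ i) $ n)" using less by simp
    then show ?case using e[of f] e[of g] assms(3) by simp
  qed
qed

text \<open>A shift is the division by the variable after dropping the constant term; under the
  substitution the divisor becomes \<open>\<psi>\<close>.\<close>

lemma fps_compose_shift1:
  fixes \<psi> f :: "'r::idom fps"
  assumes "\<psi> $ 0 = 0"
  shows "\<psi> * (fps_shift 1 f oo \<psi>) = (f oo \<psi>) - fps_const (f $ 0)"
proof -
  have "f = fps_const (f $ 0) + fps_X * fps_shift 1 f"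
  proof (rule fps_ext)
    fix n show "f $ n = (fps_const (f $ 0) + fps_X * fps_shift 1 f) $ n" by (cases n) auto
  qed
  then have "f oo \<psi> = (fps_const (f $ 0) + fps_X * fps_shift 1 f) oo \<psi>" by simp
  then show ?thesis using assms
    by (simp add: fps_compose_add_distrib fps_compose_mult_distrib)
qed

lemma fps_compose_shift2:
  fixes \<psi> f :: "'r::idom fps"
  assumes "\<psi> $ 0 = 0"
  shows "\<psi>\<^sup>2 * (fps_shift 2 f oo \<psi>) = (f oo \<psi>) - fps_const (f $ 0) - fps_const (f $ 1) * \<psi>"
proof -
  have "fps_shift 2 f = fps_shift 1 (fps_shift 1 f)" by (simp add: fps_eq_iff)
  then have "\<psi> * (fps_shift 2 f oo \<psi>) = (fps_shift 1 f oo \<psi>) - fps_const (f $ 1)"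
    using fps_compose_shift1[OF assms, of "fps_shift 1 f"] by simp
  then have "\<psi> * (\<psi> * (fps_shift 2 f oo \<psi>)) = \<psi> * (fps_shift 1 f oo \<psi>) - fps_const (f $ 1) * \<psi>"
    by (simp only: right_diff_distrib mult.commute)
  then show ?thesis unfolding fps_compose_shift1[OF assms, of f] by (simp only: power2_eq_square mult.assoc)
qed

text \<open>In the normalisation \<open>x = z + \<eta> / z + \<rho> / z^3\<close>, \<open>y = 1 / z + \<eta> z + \<rho> z^3\<close> and \<open>V = 1 / z^2\<close>, the
  polynomials \<open>pol0\<close> to \<open>pol3\<close> are the disk function and its first three images under
  multiplication by \<open>y\<close> followed by the removal of the part polynomial in \<open>x\<close>, each divided by the
  power of \<open>x\<close> that occurs as a factor.\<close>

definition pol0 :: "'r::comm_ring_1 \<Rightarrow> 'r \<Rightarrow> 'r \<Rightarrow> 'r" where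
  "pol0 \<eta> \<rho> V = (1 - 3 * \<rho>^2 - \<eta>^2) + V * ((- \<eta> * \<rho> - 3 * \<eta> * \<rho>^2 - \<eta>^3 * \<rho>) + V * ((- 3 * \<rho>^3 - 3 * \<eta>^2 * \<rho>^2) + V * ((- 3 * \<eta> * \<rho>^3) + V * (- (\<rho>^4)))))"

definition pol1 :: "'r::comm_ring_1 \<Rightarrow> 'r \<Rightarrow> 'r \<Rightarrow> 'r" where
  "pol1 \<eta> \<rho> V = (1 - 5 * \<rho>^2 + 3 * \<rho>^4 - \<eta>^2 - 2 * \<eta>^2 * \<rho> - \<eta>^2 * \<rho>^2) + V * ((- \<eta> * \<rho> - 5 * \<eta> * \<rho>^2 - 3 * \<eta> * \<rho>^3 + 3 * \<eta> * \<rho>^4 - \<eta>^3 * \<rho> - \<eta>^3 * \<rho>^2) + V * ((- 4 * \<rho>^3 + 2 * \<rho>^5 - 3 * \<eta>^2 * \<rho>^2 - 2 * \<eta>^2 * \<rho>^3) + V * ((- 3 * \<eta> * \<rho>^3 - \<eta> * \<rho>^4) + V * (- (\<rho>^4)))))"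

definition pol2 :: "'r::comm_ring_1 \<Rightarrow> 'r \<Rightarrow> 'r \<Rightarrow> 'r" where
  "pol2 \<eta> \<rho> V = (\<eta> - \<eta> * \<rho> - 6 * \<eta> * \<rho>^2 - \<eta>^3 - \<eta>^3 * \<rho>) + V * ((1 - 6 * \<rho>^2 + 4 * \<rho>^4 - \<rho>^6 - \<eta>^2 - 3 * \<eta>^2 * \<rho> - 5 * \<eta>^2 * \<rho>^2 - 4 * \<eta>^2 * \<rho>^3 + 2 * \<eta>^2 * \<rho>^4 - \<eta>^4 * \<rho> - \<eta>^4 * \<rho>^2) + V * ((- \<eta> * \<rho> - 5 * \<eta> * \<rho>^2 - 7 * \<eta> * \<rho>^3 + \<eta> * \<rho>^5 - \<eta>^3 * \<rho> - 4 * \<eta>^3 * \<rho>^2 - 2 * \<eta>^3 * \<rho>^3) + V * ((- 4 * \<rho>^3 + \<rho>^5 - 3 * \<eta>^2 * \<rho>^2 - 5 * \<eta>^2 * \<rho>^3 - \<eta>^2 * \<rho>^4) + V * ((- 3 * \<eta> * \<rho>^3 - 2 * \<eta> * \<rho>^4) + V * (- (\<rho>^4))))))"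

definition pol3 :: "'r::comm_ring_1 \<Rightarrow> 'r \<Rightarrow> 'r \<Rightarrow> 'r" where
  "pol3 \<eta> \<rho> V = (2 * \<eta> - \<eta> * \<rho> - 15 * \<eta> * \<rho>^2 - 3 * \<eta> * \<rho>^3 + 9 * \<eta> * \<rho>^4 - 2 * \<eta>^3 - 5 * \<eta>^3 * \<rho> - 3 * \<eta>^3 * \<rho>^2) + V * ((1 - 6 * \<rho>^2 - \<eta>^2 - 4 * \<eta>^2 * \<rho> - 12 * \<eta>^2 * \<rho>^2 - 12 * \<eta>^2 * \<rho>^3 + 9 * \<eta>^2 * \<rho>^4 - 2 * \<eta>^4 * \<rho> - 3 * \<eta>^4 * \<rho>^2) + V * ((- \<eta> * \<rho> - 5 * \<eta> * \<rho>^2 - 12 * \<eta> * \<rho>^3 - 2 * \<eta> * \<rho>^4 + 6 * \<eta> * \<rho>^5 - \<eta>^3 * \<rho> - 7 * \<eta>^3 * \<rho>^2 - 6 * \<eta>^3 * \<rho>^3) + V * ((- 4 * \<rho>^3 - 3 * \<eta>^2 * \<rho>^2 - 8 * \<eta>^2 * \<rho>^3 - 3 * \<eta>^2 * \<rho>^4) + V * ((- 3 * \<eta> * \<rho>^3 - 3 * \<eta> * \<rho>^4) + V * (- (\<rho>^4))))))"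

text \<open>The removal of the polynomial part in \<open>x\<close> also needs the coefficients that
  follow the leading ones. In the normalised variables \<open>mom0\<close> and \<open>mom2\<close>
  are the coefficients of \<open>V\<close> in \<open>A * pol0\<close> and \<open>A * pol2\<close>,
  where \<open>A = 1 + \<eta> * V + \<rho> * V^2\<close>.\<close>

definition mom0 :: "'r::comm_ring_1 \<Rightarrow> 'r \<Rightarrow> 'r" where
  "mom0 \<eta> \<rho> = \<eta> - \<eta> * \<rho> - 6 * \<eta> * \<rho>^2 - \<eta>^3 - \<eta>^3 * \<rho>"

definition mom2 :: "'r::comm_ring_1 \<Rightarrow> 'r \<Rightarrow> 'r" where
  "mom2 \<eta> \<rho> = 1 - 6 * \<rho>^2 + 4 * \<rho>^4 - \<rho>^6 - 4 * \<eta>^2 * \<rho> - 11 * \<eta>^2 * \<rho>^2 - 4 * \<eta>^2 * \<rho>^3 + 2 * \<eta>^2 * \<rho>^4 - \<eta>^4 - 2 * \<eta>^4 * \<rho> - \<eta>^4 * \<rho>^2"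

text \<open>For \<open>V = 1 / z^2\<close> one has \<open>x = z A\<close> and
  \<open>y = z^3 B\<close>, and \<open>q\<close> is chosen so that
  \<open>y - \<rho> x^3 - q x\<close> has only negative powers of \<open>z\<close>. The next three
  identities multiply by \<open>y\<close> and take away the polynomial part, as peeling a B does.
  The last one corresponds to peeling an A from a monochromatic boundary and closes the
  system.\<close>

lemma pol_identities:
  fixes \<eta> \<rho> V :: "'r::idom"
  defines "A \<equiv> 1 + \<eta> * V + \<rho> * V^2" and "B \<equiv> \<rho> + \<eta> * V + V^2" and "q \<equiv> \<eta> * (1 - 3 * \<rho>)"
  shows "V^2 * pol0 \<eta> \<rho> V = B - \<rho> * A^3 - q * V * A"
    "V^2 * pol1 \<eta> \<rho> V = B * pol0 \<eta> \<rho> V - \<rho> * pol0 \<eta> \<rho> 0 * A^2 - (q * pol0 \<eta> \<rho> 0 + \<rho> * mom0 \<eta> \<rho>) * V"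
    "V * pol2 \<eta> \<rho> V = B * pol1 \<eta> \<rho> V - \<rho> * pol1 \<eta> \<rho> 0 * A"
    "V^2 * pol3 \<eta> \<rho> V = B * pol2 \<eta> \<rho> V - \<rho> * pol2 \<eta> \<rho> 0 * A^2 - (q * pol2 \<eta> \<rho> 0 + \<rho> * mom2 \<eta> \<rho>) * V"
    "A * pol0 \<eta> \<rho> V = pol0 \<eta> \<rho> 0 + V * (q * pol1 \<eta> \<rho> V + \<rho> * pol3 \<eta> \<rho> V)"
  subgoal unfolding A_def B_def q_def pol0_def by algebra
  subgoal unfolding A_def B_def q_def pol0_def pol1_def mom0_def by algebra
  subgoal unfolding A_def B_def q_def pol1_def pol2_def by algebra
  subgoal unfolding A_def B_def q_def pol2_def pol3_def mom2_def by algebra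
  subgoal unfolding A_def B_def q_def pol0_def pol1_def pol3_def by algebra
  done

lemma pol_const:
  "pol0 (fps_const a) (fps_const b) 0 = fps_const (pol0 a b 0)"
  "pol1 (fps_const a) (fps_const b) 0 = fps_const (pol1 a b 0)"
  "pol2 (fps_const a) (fps_const b) 0 = fps_const (pol2 a b 0)"
  "mom0 (fps_const a) (fps_const b) = fps_const (mom0 a b)"
  "mom2 (fps_const a) (fps_const b) = fps_const (mom2 a b)"
  by (simp_all only: pol0_def pol1_def pol2_def mom0_def mom2_def mult_zero_left add_0_right
      fps_const_add[symmetric] fps_const_sub[symmetric] fps_const_mult[symmetric] fps_const_power[symmetric]
      fps_const_neg[symmetric] fps_const_1_eq_1 numeral_fps_const[symmetric] fps_const_0_eq_0)

context ising
begin

text \<open>The equations for \<open>T p q\<close> with \<open>q \<le> 3\<close>, indexed by half of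
  \<open>p\<close>: the entries with \<open>p + q\<close> odd vanish, so the parity of
  \<open>p\<close> is dictated by \<open>q\<close>.\<close>

definition disk_system :: "(nat \<Rightarrow> 'a fps fps) \<Rightarrow> (nat \<Rightarrow> 'a fps fps) \<Rightarrow> (nat \<Rightarrow> 'a fps fps) \<Rightarrow> (nat \<Rightarrow> 'a fps fps) \<Rightarrow> bool" where
  "disk_system f0 f1 f2 f3 \<longleftrightarrow> f0 0 = tt \<and> (\<forall>r.
     f0 (Suc r) = \<epsilon> * (K t2 * f1 r + K t4 * f3 r) \<and>
     f1 r = \<epsilon> * (K t2 * f0 (r + 1) + K t4 * f0 (r + 2) + (\<Sum>i\<le>r. f0 i * f0 (r - i))) \<and>
     f2 r = \<epsilon> * (K t2 * f1 r + K t4 * f1 (r + 1) + (\<Sum>i<r. f1 i * f0 (r - 1 - i))) \<and>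
     f3 r = \<epsilon> * (K t2 * f2 (r + 1) + K t4 * f2 (r + 2) + (\<Sum>i\<le>r. f2 i * f0 (r - i))))"

text \<open>Apart from the prescribed initial value every equation carries a factor
  \<open>\<epsilon>\<close>, so each coefficient is expressed by coefficients of lower order. The
  four families are packed into one in order to apply \<open>fps_family_eqI\<close>.\<close>

lemma disk_system_unique:
  assumes "disk_system f0 f1 f2 f3" "disk_system g0 g1 g2 g3"
  shows "f0 = g0"
proof -
  note ef = assms(1)[unfolded disk_system_def, THEN conjunct1]
    assms(1)[unfolded disk_system_def, THEN conjunct2, rule_format, THEN conjunct1]
    assms(1)[unfolded disk_system_def, THEN conjunct2, rule_format, THEN conjunct2, THEN conjunct1]
    assms(1)[unfolded disk_system_def, THEN conjunct2, rule_format, THEN conjunct2, THEN conjunct2, THEN conjunct1]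
    assms(1)[unfolded disk_system_def, THEN conjunct2, rule_format, THEN conjunct2, THEN conjunct2, THEN conjunct2]
  note eg = assms(2)[unfolded disk_system_def, THEN conjunct1]
    assms(2)[unfolded disk_system_def, THEN conjunct2, rule_format, THEN conjunct1]
    assms(2)[unfolded disk_system_def, THEN conjunct2, rule_format, THEN conjunct2, THEN conjunct1]
    assms(2)[unfolded disk_system_def, THEN conjunct2, rule_format, THEN conjunct2, THEN conjunct2, THEN conjunct1]
    assms(2)[unfolded disk_system_def, THEN conjunct2, rule_format, THEN conjunct2, THEN conjunct2, THEN conjunct2]
  define F where "F = (\<lambda>(i::nat, r). if i = 0 then f0 r else if i = 1 then f1 r else if i = 2 then f2 r else f3 r)"
  define G where "G = (\<lambda>(i::nat, r). if i = 0 then g0 r else if i = 1 then g1 r else if i = 2 then g2 r else g3 r)"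
  have "F i = G i" for i
  proof (rule fps_family_eqI[of F G])
    fix n i assume IH: "\<And>i k. k < n \<Longrightarrow> F i $ k = G i $ k"
    have IH': "f0 r $ k = g0 r $ k" "f1 r $ k = g1 r $ k" "f2 r $ k = g2 r $ k" "f3 r $ k = g3 r $ k" if "k < n" for r k
      using IH[OF that, of "(0, r)"] IH[OF that, of "(1, r)"] IH[OF that, of "(2, r)"] IH[OF that, of "(3, r)"]
      by (simp_all add: F_def G_def)
    have prod: "(u * v) $ m = (u' * v') $ m" if "m < n" "\<And>k. k < n \<Longrightarrow> u $ k = u' $ k" "\<And>k. k < n \<Longrightarrow> v $ k = v' $ k"
      for u v u' v' :: "'a fps fps" and m
      using fps_mult_nth_cong[of m u u' v v' m] that by simp
    have e0: "(\<epsilon> * Y) $ 0 = 0" for Y :: "'a fps fps" by simp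
    show "F i $ n = G i $ n"
    proof (cases n)
      case 0
      have "f0 r $ 0 = g0 r $ 0" for r
      proof (cases r)
        case 0 then show ?thesis using ef(1) eg(1) by simp
      next
        case (Suc r') then show ?thesis by (simp only: ef(2) eg(2) e0)
      qed
      moreover have "f1 r $ 0 = 0" "f2 r $ 0 = 0" "f3 r $ 0 = 0" "g1 r $ 0 = 0" "g2 r $ 0 = 0" "g3 r $ 0 = 0" for r
        by (subst ef(3) ef(4) ef(5) eg(3) eg(4) eg(5), rule e0)+
      ultimately show ?thesis unfolding 0 by (cases i) (simp add: F_def G_def)
    next
      case (Suc m)
      have mn: "m < n" by (simp add: Suc)
      have e: "(\<epsilon> * Y) $ n = Y $ m" for Y :: "'a fps fps" by (simp add: Suc)
      have s: "(\<Sum>i\<in>I. u i * v i) $ m = (\<Sum>i\<in>I. u' i * v' i) $ m"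
        if "\<And>i k. k < n \<Longrightarrow> u i $ k = u' i $ k" "\<And>i k. k < n \<Longrightarrow> v i $ k = v' i $ k"
        for I :: "nat set" and u v u' v' :: "nat \<Rightarrow> 'a fps fps"
        unfolding fps_sum_nth by (intro sum.cong refl prod[OF mn]) (use that in auto)
      have "f0 r $ n = g0 r $ n" for r
      proof (cases r)
        case 0 then show ?thesis using ef(1) eg(1) by simp
      next
        case (Suc r')
        show ?thesis unfolding Suc ef(2)[of r'] eg(2)[of r'] e using IH'[OF mn] by simp
      qed
      moreover have "f1 r $ n = g1 r $ n" for r
      proof -
        have "(\<Sum>i\<le>r. f0 i * f0 (r - i)) $ m = (\<Sum>i\<le>r. g0 i * g0 (r - i)) $ m"
          by (rule s) (use IH' in auto)
        then show ?thesis unfolding ef(3)[of r] eg(3)[of r] e using IH'[OF mn] by simp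
      qed
      moreover have "f2 r $ n = g2 r $ n" for r
      proof -
        have "(\<Sum>i<r. f1 i * f0 (r - 1 - i)) $ m = (\<Sum>i<r. g1 i * g0 (r - 1 - i)) $ m"
          by (rule s) (use IH' in auto)
        then show ?thesis unfolding ef(4)[of r] eg(4)[of r] e using IH'[OF mn] by simp
      qed
      moreover have "f3 r $ n = g3 r $ n" for r
      proof -
        have "(\<Sum>i\<le>r. f2 i * f0 (r - i)) $ m = (\<Sum>i\<le>r. g2 i * g0 (r - i)) $ m"
          by (rule s) (use IH' in auto)
        then show ?thesis unfolding ef(5)[of r] eg(5)[of r] e using IH'[OF mn] by simp
      qed
      ultimately show ?thesis by (cases i) (simp add: F_def G_def)
    qed
  qed
  then have "F (0, r) = G (0, r)" for r by blast
  then show ?thesis by (auto simp: F_def G_def)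
qed

lemma sum_even_lessThan:
  fixes h :: "nat \<Rightarrow> 'b::comm_monoid_add"
  assumes "\<And>i. odd i \<Longrightarrow> h i = 0"
  shows "(\<Sum>i<2 * r + 1. h i) = (\<Sum>i\<le>r. h (2 * i))"
  using assms by (induction r) simp_all

lemma sum_odd_lessThan:
  fixes h :: "nat \<Rightarrow> 'b::comm_monoid_add"
  assumes "\<And>i. even i \<Longrightarrow> h i = 0"
  shows "(\<Sum>i<2 * r. h i) = (\<Sum>i<r. h (2 * i + 1))"
  using assms by (induction r) simp_all

lemma T_disk_system:
  "disk_system (\<lambda>r. T (2 * r) 0) (\<lambda>r. T (2 * r + 1) 1) (\<lambda>r. T (2 * r) 2) (\<lambda>r. T (2 * r + 1) 3)"
  unfolding disk_system_def
proof (intro conjI allI)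
  fix r
  show "T (2 * 0) 0 = tt" by (simp add: T_00)
  show "T (2 * Suc r) 0 = \<epsilon> * (K t2 * T (2 * r + 1) 1 + K t4 * T (2 * r + 1) 3)"
    using T_Suc_left[of "2 * r + 1"] by simp
  have "(\<Sum>a<2 * r + 1. T a 0 * T (2 * r + 1 - 1 - a) 0) = (\<Sum>i\<le>r. T (2 * i) 0 * T (2 * r + 1 - 1 - 2 * i) 0)"
    by (rule sum_even_lessThan) (simp add: T_odd)
  then show "T (2 * r + 1) 1 = \<epsilon> * (K t2 * T (2 * (r + 1)) 0 + K t4 * T (2 * (r + 2)) 0 + (\<Sum>i\<le>r. T (2 * i) 0 * T (2 * (r - i)) 0))"
    using T_Suc_right[of "2 * r + 1" 0] by (simp add: diff_mult_distrib2 numeral_eq_Suc)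
  have "(\<Sum>a<2 * r. T a 1 * T (2 * r - 1 - a) 0) = (\<Sum>i<r. T (2 * i + 1) 1 * T (2 * r - 1 - (2 * i + 1)) 0)"
    by (rule sum_odd_lessThan) (simp add: T_odd)
  moreover have "2 * r - 1 - (2 * i + 1) = 2 * (r - 1 - i)" for i by simp
  moreover have "2 * r + 3 = 2 * (r + 1) + 1" by simp
  ultimately show "T (2 * r) 2 = \<epsilon> * (K t2 * T (2 * r + 1) 1 + K t4 * T (2 * (r + 1) + 1) 1 + (\<Sum>i<r. T (2 * i + 1) 1 * T (2 * (r - 1 - i)) 0))"
    using T_Suc_right[of "2 * r" 1] by (simp only: Suc_eq_plus1 one_add_one)
  have "(\<Sum>a<2 * r + 1. T a 2 * T (2 * r + 1 - 1 - a) 0) = (\<Sum>i\<le>r. T (2 * i) 2 * T (2 * r + 1 - 1 - 2 * i) 0)"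
    by (rule sum_even_lessThan) (simp add: T_odd)
  moreover have "2 * r + 1 - 1 - 2 * i = 2 * (r - i)" for i by simp
  moreover have "2 * r + 1 + 1 = 2 * (r + 1)" "2 * r + 1 + 3 = 2 * (r + 2)" "2 + 1 = (3::nat)" by simp_all
  ultimately show "T (2 * r + 1) 3 = \<epsilon> * (K t2 * T (2 * (r + 1)) 2 + K t4 * T (2 * (r + 2)) 2 + (\<Sum>i\<le>r. T (2 * i) 2 * T (2 * (r - i)) 0))"
    using T_Suc_right[of "2 * r + 1" 2] by (simp only: Suc_eq_plus1)
qed

end

text \<open>The identities rewritten without square roots. With \<open>\<gamma>^2\<close> replaced
  by \<open>\<epsilon> * g\<close>, only integral powers of \<open>t\<close> and \<open>1/c\<close>
  remain, and the normalised quantities become \<open>\<eta> = \<epsilon> * e\<close>,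
  \<open>\<rho> = t4 * \<epsilon>^2 * g\<close> and \<open>V = \<epsilon> * g * X\<close>.\<close>

lemma disk_identities:
  fixes \<epsilon> g e t2 t4 X :: "'r::idom"
  assumes nz: "\<epsilon> \<noteq> 0" "g \<noteq> 0" and t2: "t2 = e - 3 * t4 * \<epsilon>^2 * g * e"
  defines "\<eta> \<equiv> \<epsilon> * e" and "\<rho> \<equiv> t4 * \<epsilon>^2 * g" and "V \<equiv> \<epsilon> * g * X"
  defines "A \<equiv> 1 + \<epsilon>^2 * g * e * X + t4 * \<epsilon>^4 * g^3 * X^2" and "B \<equiv> t4 + e * X + g * X^2"
  defines "d0 \<equiv> g * pol0 \<eta> \<rho> V" and "d1 \<equiv> \<epsilon> * g^2 * pol1 \<eta> \<rho> V" and "d2 \<equiv> \<epsilon> * g^2 * pol2 \<eta> \<rho> V"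
    and "d3 \<equiv> \<epsilon>^2 * g^3 * pol3 \<eta> \<rho> V"
  shows "X^2 * d0 = B - t4 * A^3 - t2 * X * A"
    "X^2 * d1 = \<epsilon> * (B * d0 - t4 * (g * pol0 \<eta> \<rho> 0) * A^2
       - (t2 * (g * pol0 \<eta> \<rho> 0) + t4 * (\<epsilon> * g^2 * mom0 \<eta> \<rho>)) * X)"
    "X * d2 = \<epsilon> * (B * d1 - t4 * (\<epsilon> * g^2 * pol1 \<eta> \<rho> 0) * A)"
    "X^2 * d3 = \<epsilon> * (B * d2 - t4 * (\<epsilon> * g^2 * pol2 \<eta> \<rho> 0) * A^2
       - (t2 * (\<epsilon> * g^2 * pol2 \<eta> \<rho> 0) + t4 * (\<epsilon>^2 * g^3 * mom2 \<eta> \<rho>)) * X)"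
    "A * d0 = g * pol0 \<eta> \<rho> 0 + \<epsilon> * X * (t2 * d1 + t4 * d3)"
proof -
  have A: "1 + \<eta> * V + \<rho> * V^2 = A" unfolding A_def \<eta>_def \<rho>_def V_def by algebra
  have B: "\<rho> + \<eta> * V + V^2 = \<epsilon>^2 * g * B" unfolding B_def \<eta>_def \<rho>_def V_def by algebra
  have q: "\<eta> * (1 - 3 * \<rho>) = \<epsilon> * t2" unfolding t2 \<eta>_def \<rho>_def by algebra
  note p = pol_identities[where V = V and \<eta> = \<eta> and \<rho> = \<rho>, unfolded A B q]
  have c: "x = y" if "(\<epsilon>^2 * g) * x = (\<epsilon>^2 * g) * y" for x y using that nz by simp
  have V: "V = \<epsilon> * g * X" and \<rho>: "\<rho> = t4 * \<epsilon>^2 * g" by (simp_all add: V_def \<rho>_def)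
  show "X^2 * d0 = B - t4 * A^3 - t2 * X * A"
    by (rule c) (use p(1) V \<rho> d0_def in algebra)
  show "X^2 * d1 = \<epsilon> * (B * d0 - t4 * (g * pol0 \<eta> \<rho> 0) * A^2
       - (t2 * (g * pol0 \<eta> \<rho> 0) + t4 * (\<epsilon> * g^2 * mom0 \<eta> \<rho>)) * X)"
    by (rule c) (use p(2) V \<rho> d0_def d1_def in algebra)
  show "X * d2 = \<epsilon> * (B * d1 - t4 * (\<epsilon> * g^2 * pol1 \<eta> \<rho> 0) * A)"
    by (rule c) (use p(3) V \<rho> d1_def d2_def in algebra)
  show "X^2 * d3 = \<epsilon> * (B * d2 - t4 * (\<epsilon> * g^2 * pol2 \<eta> \<rho> 0) * A^2
       - (t2 * (\<epsilon> * g^2 * pol2 \<eta> \<rho> 0) + t4 * (\<epsilon>^2 * g^3 * mom2 \<eta> \<rho>)) * X)"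
    by (rule c) (use p(4) V \<rho> d2_def d3_def in algebra)
  show "A * d0 = g * pol0 \<eta> \<rho> 0 + \<epsilon> * X * (t2 * d1 + t4 * d3)"
  proof -
    have 1: "g * (z + V * (\<epsilon> * t2 * u + \<rho> * v)) = g * z + \<epsilon> * X * (t2 * (\<epsilon> * g^2 * u) + t4 * (\<epsilon>^2 * g^3 * v))" for z u v
      unfolding V_def \<rho>_def by algebra
    have "A * d0 = g * (A * pol0 \<eta> \<rho> V)" by (simp only: d0_def mult_ac)
    also have "A * pol0 \<eta> \<rho> V = pol0 \<eta> \<rho> 0 + V * (\<epsilon> * t2 * pol1 \<eta> \<rho> V + \<rho> * pol3 \<eta> \<rho> V)"
      by (rule p(5))
    finally show ?thesis unfolding 1 d1_def d3_def .
  qed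
qed

text \<open>Here \<open>x\<close> and \<open>y\<close> stand for the errors in two low coefficients
  and \<open>D\<close> for the resulting error of a series. The left side has no terms of order 0
  and 1; since \<open>A\<close> begins with 1, order 0 yields \<open>x = 0\<close>, then order 1
  yields \<open>y = 0\<close>.\<close>

lemma fps_X2_eq_moments:
  fixes A D :: "'r::idom fps"
  assumes "A $ 0 = 1" "\<epsilon> \<noteq> 0" "t4 \<noteq> 0"
    and eq: "fps_X^2 * D = fps_const \<epsilon> * A^2 * (fps_const (t4 * x) * A^2 + fps_const (t2 * x + t4 * y) * fps_X)"
  shows "x = 0" "y = 0" "D = 0"
proof -
  have "(fps_X^2 * D) $ 0 = (fps_const \<epsilon> * A^2 * (fps_const (t4 * x) * A^2 + fps_const (t2 * x + t4 * y) * fps_X)) $ 0"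
    by (simp only: eq)
  then show x: "x = 0" using assms(1-3) by (simp add: fps_power_zeroth)
  have eq': "fps_X^2 * D = fps_X * (fps_const (\<epsilon> * t4 * y) * A^2)"
    unfolding eq x by (simp add: mult_ac)
  have "(fps_X^2 * D) $ 1 = (fps_X * (fps_const (\<epsilon> * t4 * y) * A^2)) $ 1" by (simp only: eq')
  moreover have "(fps_X^2 * D) $ 1 = 0" by (simp add: fps_X_power_mult_nth)
  ultimately show y: "y = 0" using assms(1-3) by (simp add: fps_power_zeroth)
  show "D = 0" using eq' y by simp
qed

context ising
begin

text \<open>The variable is a rescaled \<open>1 / z^2\<close>, and \<open>\<psi>\<close>, which is
  the variable divided by \<open>A^2\<close>, is \<open>1 / x^2\<close>. The candidate
  \<open>f0\<close> comes from \<open>pol0\<close>, while \<open>f1\<close>, \<open>f2\<close> and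
  \<open>f3\<close> are defined by the recursion. What has to be proved is the initial value and the
  one equation that leads back to \<open>f0\<close>.\<close>

lemma disk_param:
  fixes G e :: "'a fps fps"
  assumes t4: "t4 \<noteq> 0"
    and G: "G = tt + \<epsilon>^2 * G * e^2 + 3 * K t4^2 * \<epsilon>^4 * G^3" and e: "e = K t2 + 3 * K t4 * \<epsilon>^2 * G * e"
  defines "A \<equiv> 1 + fps_const (\<epsilon>^2 * G * e) * fps_X + fps_const (K t4 * \<epsilon>^4 * G^3) * fps_X^2"
    and "B \<equiv> fps_const (K t4) + fps_const e * fps_X + fps_const G * fps_X^2"
  assumes \<psi>: "A^2 * \<psi> = fps_X"
  shows "fps_X^2 * (Abs_fps (\<lambda>r. T (2 * r) 0) oo \<psi>) = A * B - fps_const (K t4) * A^4 - fps_const (K t2) * fps_X * A^2"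
proof -
  let ?c = "fps_const :: 'a fps fps \<Rightarrow> 'a fps fps fps"
  let ?X = "fps_X :: 'a fps fps fps"
  define E g s2 s4 where "E = ?c \<epsilon>" and "g = ?c G" and "s2 = ?c (K t2)" and "s4 = ?c (K t4)"
  define \<eta> \<rho> V where "\<eta> = E * ?c e" and "\<rho> = s4 * E^2 * g" and "V = E * g * ?X"
  have G0: "G \<noteq> 0"
  proof
    assume "G = 0"
    then have "tt = 0" using G by simp
    then show False by simp
  qed
  have nz: "E \<noteq> 0" "g \<noteq> 0" using G0 by (simp_all add: E_def g_def)
  have cp: "?c (x^n) = ?c x ^ n" for x n by (simp add: fps_const_power)
  have c3: "?c 3 = 3" by (simp add: numeral_fps_const)
  have s2: "s2 = ?c e - 3 * s4 * E^2 * g * ?c e"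
  proof -
    have "K t2 = e - 3 * K t4 * \<epsilon>^2 * G * e" using e by (simp add: algebra_simps)
    then have "s2 = ?c (e - 3 * K t4 * \<epsilon>^2 * G * e)" by (simp only: s2_def)
    then show ?thesis
      by (simp only: E_def g_def s4_def fps_const_mult[symmetric] fps_const_sub[symmetric] cp c3)
  qed
  have A': "1 + E^2 * g * ?c e * ?X + s4 * E^4 * g^3 * ?X^2 = A"
    unfolding A_def E_def g_def s4_def by (simp only: fps_const_mult[symmetric] cp)
  have B': "s4 + ?c e * ?X + g * ?X^2 = B" by (simp only: B_def s4_def g_def)
  define d0 d1 d2 d3 where "d0 = g * pol0 \<eta> \<rho> V" and "d1 = E * g^2 * pol1 \<eta> \<rho> V"
    and "d2 = E * g^2 * pol2 \<eta> \<rho> V" and "d3 = E^2 * g^3 * pol3 \<eta> \<rho> V"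
  define a b where "a = \<epsilon> * e" and "b = K t4 * \<epsilon>^2 * G"
  have ab: "\<eta> = ?c a" "\<rho> = ?c b"
    unfolding \<eta>_def \<rho>_def a_def b_def E_def g_def s4_def by (simp_all only: fps_const_mult[symmetric] cp)
  define m0 m1 M1 M2 N2 where "m0 = G * pol0 a b 0" and "m1 = \<epsilon> * G^2 * mom0 a b" and "M1 = \<epsilon> * G^2 * pol1 a b 0"
    and "M2 = \<epsilon> * G^2 * pol2 a b 0" and "N2 = \<epsilon>^2 * G^3 * mom2 a b"
  have ms: "g * pol0 \<eta> \<rho> 0 = ?c m0" "E * g^2 * mom0 \<eta> \<rho> = ?c m1" "E * g^2 * pol1 \<eta> \<rho> 0 = ?c M1"
    "E * g^2 * pol2 \<eta> \<rho> 0 = ?c M2" "E^2 * g^3 * mom2 \<eta> \<rho> = ?c N2"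
    unfolding ab pol_const m0_def m1_def M1_def M2_def N2_def E_def g_def by (simp_all only: fps_const_mult[symmetric] cp)
  note I = disk_identities[OF nz s2, of ?X, folded \<eta>_def \<rho>_def V_def, folded d0_def d1_def d2_def d3_def,
      unfolded A' B' ms]
  have m0tt: "m0 = tt"
  proof -
    have "m0 = G * (1 - 3 * b^2 - a^2)" unfolding m0_def pol0_def by simp
    also have "\<dots> = G - \<epsilon>^2 * G * e^2 - 3 * K t4^2 * \<epsilon>^4 * G^3" unfolding a_def b_def by algebra
    also have "\<dots> = tt" by (subst (1) G) simp
    finally show ?thesis .
  qed
  have A0: "A $ 0 = 1" by (simp add: A_def)
  have A20: "(A^2) $ 0 = 1" using A0 by (simp add: fps_power_zeroth)
  have \<psi>0: "\<psi> $ 0 = 0"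
  proof -
    have "(A^2 * \<psi>) $ 0 = ?X $ 0" by (simp only: \<psi>)
    then show ?thesis using A20 by simp
  qed
  have \<psi>1: "\<psi> $ 1 = 1"
  proof -
    have "(A^2 * \<psi>) $ 1 = ?X $ 1" by (simp only: \<psi>)
    then show ?thesis using A20 \<psi>0 by (simp add: fps_mult_nth_1)
  qed
  have cps: "(f + h) oo \<psi> = (f oo \<psi>) + (h oo \<psi>)" "(f * h) oo \<psi> = (f oo \<psi>) * (h oo \<psi>)" "?c z oo \<psi> = ?c z"
    "?X oo \<psi> = \<psi>" for f h z
    using \<psi>0 by (simp_all add: fps_compose_add_distrib fps_compose_mult_distrib)
  note sh1 = fps_compose_shift1[OF \<psi>0] and sh2 = fps_compose_shift2[OF \<psi>0]
  have coef: "f $ 0 = (f oo \<psi>) $ 0" "f $ 1 = (f oo \<psi>) $ 1" for f using \<psi>1 \<psi>0 by (simp_all add: fps_compose_nth)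
  have K4: "K t4 \<noteq> 0" using t4 by simp
  define f0 where "f0 = Abs_fps (decompose \<psi> (A * d0))"
  have f0: "f0 oo \<psi> = A * d0" unfolding f0_def by (rule compose_decompose[OF \<psi>0 \<psi>1])
  define f1 where "f1 = E * (s2 * fps_shift 1 f0 + s4 * fps_shift 2 f0 + f0 * f0)"
  define f2 where "f2 = E * (s2 * f1 + s4 * fps_shift 1 f1 + ?X * (f1 * f0))"
  define f3 where "f3 = E * (s2 * fps_shift 1 f2 + s4 * fps_shift 2 f2 + f2 * f0)"
  have cE: "E oo \<psi> = E" "s2 oo \<psi> = s2" "s4 oo \<psi> = s4" unfolding E_def s2_def s4_def by (rule cps)+
  \<comment> \<open>After the substitution the shifts become divisions by \<open>\<psi>\<close>. The
    formula for \<open>d0\<close> then combines the terms with \<open>t2\<close>, \<open>t4\<close>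
    and the product with \<open>f0\<close> into a multiplication by \<open>B\<close>, that is, by
    \<open>y\<close>.\<close>
  have quad: "?X^2 * (f' oo \<psi>) = E * (A^2 * B * d - s4 * ?c (f $ 0) * A^4 - (s2 * ?c (f $ 0) + s4 * ?c (f $ 1)) * ?X * A^2)"
    if f': "f' = E * (s2 * fps_shift 1 f + s4 * fps_shift 2 f + f * f0)" and f: "f oo \<psi> = A * d" for f f' d
  proof -
    have "\<psi>^2 * (f' oo \<psi>) = E * (s2 * \<psi> * (\<psi> * (fps_shift 1 f oo \<psi>)) + s4 * (\<psi>^2 * (fps_shift 2 f oo \<psi>)) + \<psi>^2 * ((A * d) * (A * d0)))"
      unfolding f' cps cE f f0 by algebra
    then have "\<psi>^2 * (f' oo \<psi>) = E * (s2 * \<psi> * (A * d - ?c (f $ 0)) + s4 * (A * d - ?c (f $ 0) - ?c (f $ 1) * \<psi>) + \<psi>^2 * ((A * d) * (A * d0)))"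
      unfolding sh1 sh2 f .
    then show ?thesis using \<psi> I(1) by algebra
  qed
  have q1: "?X^2 * (f1 oo \<psi>) = E * (A^2 * B * d0 - s4 * ?c (f0 $ 0) * A^4 - (s2 * ?c (f0 $ 0) + s4 * ?c (f0 $ 1)) * ?X * A^2)"
    by (rule quad[OF f1_def f0])
  \<comment> \<open>Subtracting the identity for \<open>d1\<close> leaves only the differences
    between the first two coefficients of \<open>f0\<close> and their expected values
    \<open>m0\<close> and \<open>m1\<close>.\<close>
  have "?X^2 * (A^2 * d1 - (f1 oo \<psi>)) = ?c \<epsilon> * A^2 * (?c (K t4 * (f0 $ 0 - m0)) * A^2 + ?c (K t2 * (f0 $ 0 - m0) + K t4 * (f0 $ 1 - m1)) * ?X)"
    unfolding fps_const_mult[symmetric] fps_const_add[symmetric] fps_const_sub[symmetric]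
      E_def[symmetric] s2_def[symmetric] s4_def[symmetric]
    using q1 I(2) by algebra
  note z1 = fps_X2_eq_moments[OF A0 _ K4 this]
  have f1: "f1 oo \<psi> = A^2 * d1" and f00: "f0 $ 0 = tt" using z1 m0tt by simp_all
  have l2: "?X * (f2 oo \<psi>) = E * (A * B * d1 - s4 * ?c (f1 $ 0) * A^2)"
  proof -
    have "\<psi> * (f2 oo \<psi>) = E * (s2 * \<psi> * (f1 oo \<psi>) + s4 * (\<psi> * (fps_shift 1 f1 oo \<psi>)) + \<psi>^2 * ((f1 oo \<psi>) * (f0 oo \<psi>)))"
      unfolding f2_def cps cE by algebra
    then have "\<psi> * (f2 oo \<psi>) = E * (s2 * \<psi> * (A^2 * d1) + s4 * (A^2 * d1 - ?c (f1 $ 0)) + \<psi>^2 * ((A^2 * d1) * (A * d0)))"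
      unfolding sh1 f1 f0 .
    then have "A^2 * (\<psi> * (f2 oo \<psi>)) = A^2 * (E * (s2 * \<psi> * (A^2 * d1) + s4 * (A^2 * d1 - ?c (f1 $ 0)) + \<psi>^2 * ((A^2 * d1) * (A * d0))))"
      by (rule arg_cong)
    then show ?thesis using \<psi> I(1) by algebra
  qed
  have "?X * (A * d2 - (f2 oo \<psi>)) = E * s4 * (?c (f1 $ 0 - M1)) * A^2"
    unfolding fps_const_sub[symmetric] using l2 I(3) by algebra
  then have x2: "?X * (A * d2 - (f2 oo \<psi>)) = ?c (\<epsilon> * K t4 * (f1 $ 0 - M1)) * A^2"
    unfolding E_def s4_def by (simp only: fps_const_mult)
  then have "(?X * (A * d2 - (f2 oo \<psi>))) $ 0 = (?c (\<epsilon> * K t4 * (f1 $ 0 - M1)) * A^2) $ 0" by (rule arg_cong)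
  then have "f1 $ 0 = M1" using K4 A20 by simp
  then have f2: "f2 oo \<psi> = A * d2" using x2 by simp
  have q3: "?X^2 * (f3 oo \<psi>) = E * (A^2 * B * d2 - s4 * ?c (f2 $ 0) * A^4 - (s2 * ?c (f2 $ 0) + s4 * ?c (f2 $ 1)) * ?X * A^2)"
    by (rule quad[OF f3_def f2])
  have "?X^2 * (A^2 * d3 - (f3 oo \<psi>)) = ?c \<epsilon> * A^2 * (?c (K t4 * (f2 $ 0 - M2)) * A^2 + ?c (K t2 * (f2 $ 0 - M2) + K t4 * (f2 $ 1 - N2)) * ?X)"
    unfolding fps_const_mult[symmetric] fps_const_add[symmetric] fps_const_sub[symmetric]
      E_def[symmetric] s2_def[symmetric] s4_def[symmetric]
    using q3 I(4) by algebra
  note z3 = fps_X2_eq_moments[OF A0 _ K4 this]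
  have f3: "f3 oo \<psi> = A^2 * d3" using z3 by simp
  have r0: "fps_shift 1 f0 = E * (s2 * f1 + s4 * f3)"
  proof (rule fps_compose_inj[OF \<psi>0 \<psi>1])
    have "\<psi> * (fps_shift 1 f0 oo \<psi>) = A * d0 - ?c m0" unfolding sh1 f0 f00 m0tt ..
    also have "\<dots> = \<psi> * ((E * (s2 * f1 + s4 * f3)) oo \<psi>)"
    proof -
      have "\<psi> * ((E * (s2 * f1 + s4 * f3)) oo \<psi>) = E * (A^2 * \<psi>) * (s2 * d1 + s4 * d3)"
        unfolding cps cE f1 f3 by algebra
      then show ?thesis unfolding \<psi> I(5) by (simp add: mult_ac)
    qed
    finally show "fps_shift 1 f0 oo \<psi> = (E * (s2 * f1 + s4 * f3)) oo \<psi>" using \<psi>1 by auto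
  qed
  have ds: "disk_system (fps_nth f0) (fps_nth f1) (fps_nth f2) (fps_nth f3)"
    unfolding disk_system_def
  proof (intro conjI allI)
    fix r
    show "f0 $ 0 = tt" by (rule f00)
    have "f0 $ Suc r = fps_shift 1 f0 $ r" by simp
    then show "f0 $ Suc r = \<epsilon> * (K t2 * f1 $ r + K t4 * f3 $ r)"
      unfolding r0 E_def s2_def s4_def by simp
    have sq: "(f * h) $ r = (\<Sum>i\<le>r. f $ i * h $ (r - i))" for f h :: "'a fps fps fps"
      by (simp add: fps_mult_nth atLeast0AtMost)
    show "f1 $ r = \<epsilon> * (K t2 * f0 $ (r + 1) + K t4 * f0 $ (r + 2) + (\<Sum>i\<le>r. f0 $ i * f0 $ (r - i)))"
      unfolding f1_def E_def s2_def s4_def by (simp add: sq[of f0 f0])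
    show "f3 $ r = \<epsilon> * (K t2 * f2 $ (r + 1) + K t4 * f2 $ (r + 2) + (\<Sum>i\<le>r. f2 $ i * f0 $ (r - i)))"
      unfolding f3_def E_def s2_def s4_def by (simp add: sq[of f2 f0])
    have "(?X * (f1 * f0)) $ r = (\<Sum>i<r. f1 $ i * f0 $ (r - 1 - i))"
      by (cases r) (simp_all add: fps_mult_nth[of f1 f0] atLeast0AtMost lessThan_Suc_atMost)
    then show "f2 $ r = \<epsilon> * (K t2 * f1 $ r + K t4 * f1 $ (r + 1) + (\<Sum>i<r. f1 $ i * f0 $ (r - 1 - i)))"
      unfolding f2_def E_def s2_def s4_def by simp
  qed
  have "(\<lambda>r. T (2 * r) 0) = fps_nth f0" by (rule disk_system_unique[OF T_disk_system ds])
  then have "Abs_fps (\<lambda>r. T (2 * r) 0) = f0" by (simp add: fps_nth_inverse)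
  then have F: "Abs_fps (\<lambda>r. T (2 * r) 0) oo \<psi> = A * d0" using f0 by simp
  show ?thesis unfolding F s2_def[symmetric] s4_def[symmetric] using I(1) by algebra
qed

lemma disk_solution_exists:
  obtains G e :: "'a fps fps" where
    "G = tt + \<epsilon>^2 * G * e^2 + 3 * K t4^2 * \<epsilon>^4 * G^3" "e = K t2 + 3 * K t4 * \<epsilon>^2 * G * e"
proof -
  \<comment> \<open>The two unknowns are indexed by a boolean, and a factor
    \<open>\<epsilon>\<close> is pulled out of all terms containing them so that the contraction is
    visible.\<close>
  define \<Psi> :: "(bool \<Rightarrow> 'a fps fps) \<Rightarrow> bool \<Rightarrow> 'a fps fps" where
    "\<Psi> f i = (if i then tt + \<epsilon> * (\<epsilon> * (f True * (f False * f False)) + 3 * K t4^2 * \<epsilon>^3 * (f True * (f True * f True)))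
      else K t2 + \<epsilon> * (3 * K t4 * \<epsilon> * (f True * f False)))" for f i
  obtain f where f: "\<And>i. f i = \<Psi> f i"
  proof (rule fps_family_fixpoint[of \<Psi>])
    fix n i and f h :: "bool \<Rightarrow> 'a fps fps"
    assume IH: "\<And>i k. k < n \<Longrightarrow> f i $ k = h i $ k"
    show "\<Psi> f i $ n = \<Psi> h i $ n"
    proof (cases n)
      case 0
      then show ?thesis by (simp add: \<Psi>_def)
    next
      case (Suc m)
      have m: "(u * v) $ k = (u' * v') $ k"
        if "\<And>k. k \<le> m \<Longrightarrow> u $ k = u' $ k" "\<And>k. k \<le> m \<Longrightarrow> v $ k = v' $ k" "k \<le> m" for u v u' v' :: "'a fps fps" and k
        by (rule fps_mult_nth_cong[OF that])
      have b: "f i $ k = h i $ k" if "k \<le> m" for i k using IH that Suc by simp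
      have b2: "(f i * f j) $ k = (h i * h j) $ k" if "k \<le> m" for i j k by (rule m[OF b b that])
      have b3: "(f i * (f j * f l)) $ k = (h i * (h j * h l)) $ k" if "k \<le> m" for i j l k by (rule m[OF b b2 that])
      have b4: "(z * (f i * f j)) $ m = (z * (h i * h j)) $ m" "(z * (f i * (f j * f l))) $ m = (z * (h i * (h j * h l))) $ m"
        for i j l and z :: "'a fps fps"
        using m[of z z "f i * f j" "h i * h j" m] m[of z z "f i * (f j * f l)" "h i * (h j * h l)" m] b2 b3 by simp_all
      have "\<Psi> f i $ n = \<Psi> h i $ n" if i
        unfolding Suc \<Psi>_def using that b4(2)[of \<epsilon>] b4(2)[of "3 * K t4^2 * \<epsilon>^3"] by simp
      moreover have "\<Psi> f i $ n = \<Psi> h i $ n" if "\<not> i"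
        unfolding Suc \<Psi>_def using that b4(1)[of "3 * K t4 * \<epsilon>"] by simp
      ultimately show ?thesis by blast
    qed
  qed (rule that)
  show ?thesis
  proof (rule that[of "f True" "f False"])
    show "f True = tt + \<epsilon>^2 * f True * (f False)^2 + 3 * K t4^2 * \<epsilon>^4 * (f True)^3"
      by (subst (1) f) (simp add: \<Psi>_def algebra_simps power2_eq_square power3_eq_cube power4_eq_xxxx)
    show "f False = K t2 + 3 * K t4 * \<epsilon>^2 * f True * f False"
      by (subst (1) f) (simp add: \<Psi>_def algebra_simps power2_eq_square)
  qed
qed

end

section \<open>The field of coefficients\<close>

definition fps_map :: "('r \<Rightarrow> 's) \<Rightarrow> 'r::zero fps \<Rightarrow> 's::zero fps" where
  "fps_map h f = Abs_fps (\<lambda>n. h (f $ n))"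

lemma fps_map_nth [simp]: "fps_map h f $ n = h (f $ n)"
  by (simp add: fps_map_def)

locale ring_map =
  fixes h :: "'r::comm_ring_1 \<Rightarrow> 's::comm_ring_1"
  assumes add: "h (x + y) = h x + h y" and mult: "h (x * y) = h x * h y" and one: "h 1 = 1"
begin

lemma zero: "h 0 = 0"
  using add[of 0 0] by simp

lemma diff: "h (x - y) = h x - h y"
  using add[of "x - y" y] by simp

lemma power: "h (x ^ n) = h x ^ n"
  by (induction n) (simp_all add: one mult)

lemma sum: "h (sum f A) = (\<Sum>i\<in>A. h (f i))"
  by (induction A rule: infinite_finite_induct) (simp_all add: zero add)

lemma numeral: "h (numeral k) = numeral k"
proof -
  have "h (of_nat n) = of_nat n" for n by (induction n) (simp_all add: zero one add)
  then show ?thesis by (metis of_nat_numeral)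
qed

lemma fps_map: "ring_map (fps_map h)"
proof
  show "fps_map h (x + y) = fps_map h x + fps_map h y" for x y by (simp add: fps_eq_iff add)
  show "fps_map h (x * y) = fps_map h x * fps_map h y" for x y by (simp add: fps_eq_iff fps_mult_nth sum mult)
  show "fps_map h 1 = 1" by (simp add: fps_eq_iff one zero)
qed

lemma fps_map_const: "fps_map h (fps_const a) = fps_const (h a)"
  by (simp add: fps_eq_iff zero)

lemma fps_map_X: "fps_map h fps_X = fps_X"
  by (simp add: fps_eq_iff zero one fps_X_def)

lemma fps_map_compose: "fps_map h (f oo g) = fps_map h f oo fps_map h g"
proof -
  interpret F: ring_map "fps_map h" by (rule fps_map)
  have "h ((g ^ i) $ n) = (fps_map h g ^ i) $ n" for i n using F.power[of g i] by (metis fps_map_nth)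
  then show ?thesis by (simp add: fps_eq_iff fps_compose_nth sum mult)
qed

end

lemma ring_map_comp:
  assumes "ring_map f" "ring_map g" shows "ring_map (\<lambda>x. f (g x))"
proof -
  interpret f: ring_map f by (rule assms)
  interpret g: ring_map g by (rule assms)
  show ?thesis by standard (simp_all add: f.add g.add f.mult g.mult f.one g.one)
qed

lemma ring_map_fps_const: "ring_map (fps_const :: 'r::comm_ring_1 \<Rightarrow> 'r fps)"
  by standard simp_all

text \<open>Substitution of the square of the variable, because the variables of the coefficient
  field are the square roots of \<open>t\<close> and of \<open>1/c\<close>.\<close>

definition square_var :: "'r::idom fps \<Rightarrow> 'r fls" where
  "square_var f = fls_compose_power (fps_to_fls f) 2"

lemma ring_map_square_var: "ring_map (square_var :: 'r::idom fps \<Rightarrow> 'r fls)"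
  by standard (simp_all add: square_var_def fps_to_fls_plus fls_times_fps_to_fls)

lemma square_var_const: "square_var (fps_const a) = fls_const a"
  by (simp add: square_var_def fps_const_to_fls)

lemma square_var_X: "square_var fps_X = fls_X ^ 2"
  by (auto simp: square_var_def fls_eq_iff fls_nth_compose_power elim!: dvdE)

text \<open>In \<open>gf\<close> the outer variable is \<open>1/c\<close> and the inner one
  \<open>t\<close>; the coefficient field has the opposite order.\<close>

definition swap_vars :: "'a::zero fps fps \<Rightarrow> 'a fps fps" where
  "swap_vars f = Abs_fps (\<lambda>v. Abs_fps (\<lambda>e. f $ e $ v))"

lemma ring_map_swap_vars: "ring_map (swap_vars :: 'a::comm_ring_1 fps fps \<Rightarrow> 'a fps fps)"
proof
  show "swap_vars (x + y) = swap_vars x + swap_vars y" for x y :: "'a fps fps"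
    by (simp add: swap_vars_def fps_eq_iff)
  show "swap_vars 1 = (1 :: 'a fps fps)"
    by (simp add: swap_vars_def fps_eq_iff)
  show "swap_vars (x * y) = swap_vars x * swap_vars y" for x y :: "'a fps fps"
  proof (intro fps_ext)
    fix v e
    show "swap_vars (x * y) $ v $ e = (swap_vars x * swap_vars y) $ v $ e"
      by (simp add: swap_vars_def fps_mult_nth fps_sum_nth) (rule sum.swap)
  qed
qed

definition emb :: "'a::field_char_0 fps fps \<Rightarrow> 'a fls fls" where
  "emb f = square_var (fps_map square_var (swap_vars f))"

lemma ring_map_emb: "ring_map (emb :: 'a::field_char_0 fps fps \<Rightarrow> 'a fls fls)"
  unfolding emb_def
  by (intro ring_map_comp[OF ring_map_square_var] ring_map_comp[OF ring_map.fps_map[OF ring_map_square_var]] ring_map_swap_vars)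

interpretation emb: ring_map "emb :: 'a::field_char_0 fps fps \<Rightarrow> 'a fls fls"
  by (rule ring_map_emb)

lemma emb_K: "emb (fps_const (fps_const a)) = scal a"
proof -
  have "swap_vars (fps_const (fps_const a)) = fps_const (fps_const a)" by (auto simp: swap_vars_def fps_eq_iff)
  then show ?thesis
    by (simp add: emb_def scal_def ring_map.fps_map_const[OF ring_map_square_var] square_var_const)
qed

lemma emb_tt: "emb (fps_const fps_X) = (t_var :: 'a::field_char_0 fls fls)"
proof -
  have "swap_vars (fps_const fps_X) = (fps_X :: 'a fps fps)" by (auto simp: swap_vars_def fps_eq_iff fps_X_def)
  then show ?thesis by (simp add: emb_def t_var_def ring_map.fps_map_X[OF ring_map_square_var] square_var_X)
qed

lemma emb_eps: "emb fps_X * c_var = (1 :: 'a::field_char_0 fls fls)"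
proof -
  have "swap_vars fps_X = (fps_const fps_X :: 'a fps fps)" by (auto simp: swap_vars_def fps_eq_iff fps_X_def)
  then have "emb fps_X = (fls_const (fls_X ^ 2) :: 'a fls fls)"
    by (simp add: emb_def ring_map.fps_map_const[OF ring_map_square_var] square_var_const square_var_X)
  moreover have "fls_X ^ 2 * fls_X_inv ^ 2 = (1 :: 'a fls)"
    by (simp add: fls_X_power_times_conv_shift fls_X_inv_power_conv_shift_1)
  ultimately show ?thesis by (simp add: c_var_def)
qed

lemma c_var_nz: "c_var \<noteq> (0 :: 'a::field_char_0 fls fls)"
  using emb_eps by (metis mult_zero_right zero_neq_one)

lemma bracket_emb:
  fixes w :: "nat \<Rightarrow> 'a::field_char_0"
  shows "bracket d d w w P = emb (gf d w P)"
proof (cases "P = []")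
  case True
  then show ?thesis by (simp add: bracket_def gf_Nil emb_tt)
next
  case False
  have "swap_vars (gf d w P) = Abs_fps (\<lambda>v. Abs_fps (bracket_coeff d d w w P v))"
    by (simp add: fps_eq_iff swap_vars_def gf_nth bracket_coeff_lnum[OF False])
  then show ?thesis using False by (simp add: bracket_def emb_def square_var_def fps_map_def)
qed

lemma fps_to_flsI:
  fixes x :: "'k::comm_ring_1 fls"
  assumes "\<And>n. n \<le> 0 \<Longrightarrow> fls_nth x n = 0"
  obtains y where "x = fls_X * fps_to_fls y"
proof -
  have "x = fls_X * fps_to_fls (Abs_fps (\<lambda>n. fls_nth x (int n + 1)))"
  proof (rule fls_eqI)
    fix n
    show "fls_nth x n = fls_nth (fls_X * fps_to_fls (Abs_fps (\<lambda>n. fls_nth x (int n + 1)))) n"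
      using assms[of n] by (cases "n \<le> 0") (auto simp: fls_X_times_conv_shift)
  qed
  then show ?thesis by (rule that)
qed

text \<open>The two roots agree to first order, where the equation for the square of \<open>\<gamma>\<close> is linear
  and nondegenerate.\<close>

lemma root_unique:
  fixes c k t u g g0 :: "'k::field fls"
  assumes P: "c * g * (1 - 3 * k * g)^2 * (1 - 3 * k^2 * g^2) - u * g = t * (1 - 3 * k * g)^2"
    "c * g0 * (1 - 3 * k * g0)^2 * (1 - 3 * k^2 * g0^2) - u * g0 = t * (1 - 3 * k * g0)^2"
    and const: "c = fls_const c'" "k = fls_const k'" "u = fls_const u'" "c' \<noteq> u'"
    and small: "\<And>n. n \<le> 0 \<Longrightarrow> fls_nth g n = 0" "\<And>n. n \<le> 0 \<Longrightarrow> fls_nth g0 n = 0" "\<And>n. n \<le> 0 \<Longrightarrow> fls_nth t n = 0"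
  shows "g = g0"
proof -
  obtain y y0 s where y: "g = fls_X * fps_to_fls y" "g0 = fls_X * fps_to_fls y0" "t = fls_X * fps_to_fls s"
    using fps_to_flsI[of g] fps_to_flsI[of g0] fps_to_flsI[of t] small by metis
  \<comment> \<open>Dividing the difference of the two equations by \<open>g - g0\<close> leaves
    \<open>c - u\<close> plus the variable times \<open>W\<close>. Writing all small series as
    multiples of the variable makes \<open>W\<close> a power series, so the cofactor has the nonzero
    constant term \<open>c - u\<close>.\<close>
  define W where "W y y0 s = c * (- 6 * k * (y + y0) + 6 * k^2 * fls_X * (y^2 + y * y0 + y0^2)
      + 18 * k^3 * fls_X^2 * (y^3 + y^2 * y0 + y * y0^2 + y0^3)
      - 27 * k^4 * fls_X^3 * (y^4 + y^3 * y0 + y^2 * y0^2 + y * y0^3 + y0^4)) + s * (6 * k - 9 * k^2 * fls_X * (y + y0))"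
    for y y0 s
  have WI: "W (fps_to_fls y) (fps_to_fls y0) (fps_to_fls s) = fps_to_fls v" if "v = fps_const c' * (- 6 * fps_const k' * (y + y0) + 6 * fps_const k'^2 * fps_X * (y^2 + y * y0 + y0^2)
      + 18 * fps_const k'^3 * fps_X^2 * (y^3 + y^2 * y0 + y * y0^2 + y0^3)
      - 27 * fps_const k'^4 * fps_X^3 * (y^4 + y^3 * y0 + y^2 * y0^2 + y * y0^3 + y0^4)) + s * (6 * fps_const k' - 9 * fps_const k'^2 * fps_X * (y + y0))" for v
    unfolding that W_def const
    by (simp add: fls_times_fps_to_fls fps_to_fls_plus fps_to_fls_minus fps_to_fls_power fps_const_to_fls fls_const_power)
  have "(g - g0) * (c - u + fls_X * W (fps_to_fls y) (fps_to_fls y0) (fps_to_fls s)) = 0"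
    unfolding W_def using P unfolding y by algebra
  moreover have "c - u + fls_X * W (fps_to_fls y) (fps_to_fls y0) (fps_to_fls s) \<noteq> 0"
  proof
    assume "c - u + fls_X * W (fps_to_fls y) (fps_to_fls y0) (fps_to_fls s) = 0"
    then have "fls_nth (c - u + fls_X * W (fps_to_fls y) (fps_to_fls y0) (fps_to_fls s)) 0 = 0" by simp
    then show False using const(4) unfolding WI[OF refl] const by (simp add: fls_X_times_conv_shift)
  qed
  ultimately show ?thesis by simp
qed

lemma ring_map_fps_nth_0: "ring_map (\<lambda>f :: 'r::comm_ring_1 fps. f $ 0)"
  by standard simp_all

lemma scal_eq_0_iff: "scal a = 0 \<longleftrightarrow> a = 0"
  by (simp add: scal_def)

context ising
begin

lemma emb_small:
  fixes f :: "'a fps fps"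
  assumes "\<And>e. f $ e $ 0 = 0" "n \<le> 0"
  shows "fls_nth (emb f) n = 0"
proof -
  have 0: "swap_vars f $ 0 = 0" using assms(1) by (simp add: swap_vars_def fps_eq_iff)
  have "square_var 0 = (0 :: 'a fls)" by (simp add: square_var_def)
  then show ?thesis using assms(2) 0
    by (cases "n = 0") (auto simp: emb_def square_var_def[of "fps_map _ _"] fls_nth_compose_power)
qed

text \<open>At \<open>t = 0\<close> the equation becomes \<open>G\<close> times a series with
  constant term 1 equal to 0.\<close>

lemma disk_param_const_coeff:
  assumes "G = tt + \<epsilon>^2 * G * e^2 + 3 * (K t4)^2 * \<epsilon>^4 * G^3"
  shows "G $ n $ 0 = 0"
proof -
  define z :: "'a fps fps \<Rightarrow> 'a fps" where "z = fps_map (\<lambda>f. f $ 0)"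
  interpret z: ring_map z unfolding z_def by (rule ring_map.fps_map[OF ring_map_fps_nth_0])
  have ze: "z \<epsilon> = fps_X" and zt: "z tt = 0" by (auto simp: z_def fps_eq_iff fps_X_def)
  have "z G = fps_X^2 * z G * z e^2 + 3 * z (K t4)^2 * fps_X^4 * z G^3"
    using arg_cong[OF assms, of z] by (simp add: z.add z.mult z.power z.numeral ze zt del: fps_const_power)
  then have "z G * (1 - fps_X * (fps_X * z e^2 + 3 * z (K t4)^2 * fps_X^3 * z G^2)) = 0" by algebra
  moreover have "1 - fps_X * (fps_X * z e^2 + 3 * z (K t4)^2 * fps_X^3 * z G^2) \<noteq> 0"
    by (metis diff_zero fps_X_mult_nth fps_nonzero_nth fps_one_nth fps_sub_nth zero_neq_one)
  ultimately have "z G = 0" by simp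
  then have "z G $ n = 0" by simp
  then show ?thesis by (simp add: z_def)
qed

text \<open>Eliminating \<open>\<rho> = \<alpha>3 / \<gamma>\<close> and
  \<open>\<eta> = \<alpha>1 / \<gamma>\<close> leaves one polynomial equation for
  \<open>\<gamma>^2\<close>, which \<open>emb (\<epsilon> * G)\<close> satisfies too. The branch
  condition gives \<open>\<gamma>^2\<close> positive order in \<open>t\<close>, and among such
  series the root is unique.\<close>

lemma parameters_emb:
  fixes \<gamma> \<alpha>1 \<alpha>3 :: "'a fls fls"
  assumes G: "G = tt + \<epsilon>^2 * G * e^2 + 3 * (K t4)^2 * \<epsilon>^4 * G^3"
    and e: "e = K t2 + 3 * K t4 * \<epsilon>^2 * G * e"
    and t4: "t4 \<noteq> 0"
    and par4: "scal t4 = c_var * \<alpha>3 / \<gamma>^3"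
    and par2: "scal t2 = c_var * \<alpha>1 * ((\<gamma> - 3 * \<alpha>3) / \<gamma>^2)"
    and par: "t_var = c_var * (\<gamma>^2 - \<alpha>1^2 - 3 * \<alpha>3^2)"
    and branch: "\<forall>n<4. fls_nth (\<gamma>^2 - c_var * t_var / (c_var^2 - (scal t2)^2)) n = 0"
  shows "\<gamma> \<noteq> 0" "\<gamma>^2 = emb (\<epsilon> * G)" "\<alpha>1 = \<gamma> * emb (\<epsilon> * e)" "\<alpha>3 = \<gamma> * emb (K t4 * \<epsilon>^2 * G)"
proof -
  have s4: "scal t4 \<noteq> 0" using t4 by (simp add: scal_eq_0_iff)
  show \<gamma>: "\<gamma> \<noteq> 0" using par4 s4 by auto
  define \<rho> \<eta> where "\<rho> = \<alpha>3 / \<gamma>" and "\<eta> = \<alpha>1 / \<gamma>"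
  have \<alpha>: "\<alpha>3 = \<gamma> * \<rho>" "\<alpha>1 = \<gamma> * \<eta>" using \<gamma> by (simp_all add: \<rho>_def \<eta>_def)
  define \<delta> where "\<delta> = (emb \<epsilon> :: 'a fls fls)"
  have \<delta>: "c_var * \<delta> = 1" using emb_eps[where 'a='a] by (simp add: \<delta>_def mult.commute)
  have "\<gamma>^3 * scal t4 = c_var * (\<gamma> * \<rho>)" using par4 \<gamma> by (simp add: \<alpha>)
  then have "\<gamma> * (c_var * \<rho>) = \<gamma> * (scal t4 * \<gamma>^2)" by algebra
  then have "c_var * \<rho> = scal t4 * \<gamma>^2" using \<gamma> by simp
  then have \<rho>: "\<rho> = (scal t4 * \<delta>) * \<gamma>^2" using \<delta> by algebra
  have "\<gamma>^2 * scal t2 = c_var * (\<gamma> * \<eta>) * (\<gamma> - 3 * (\<gamma> * \<rho>))" using par2 \<gamma> by (simp add: \<alpha>)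
  then have "\<gamma>^2 * (c_var * \<eta> * (1 - 3 * \<rho>)) = \<gamma>^2 * scal t2" by algebra
  then have \<eta>: "c_var * \<eta> * (1 - 3 * \<rho>) = scal t2" using \<gamma> by simp
  have t: "t_var = c_var * \<gamma>^2 * (1 - \<eta>^2 - 3 * \<rho>^2)" using par unfolding \<alpha> by algebra
  define g0 \<eta>0 \<rho>0 where "g0 = emb (\<epsilon> * G)" and "\<eta>0 = emb (\<epsilon> * e)" and "\<rho>0 = emb (K t4 * \<epsilon>^2 * G)"
  note em = emb.mult emb.power emb.add emb.numeral emb_K emb_tt
  have \<rho>0: "\<rho>0 = (scal t4 * \<delta>) * g0"
    by (simp add: \<rho>0_def g0_def em \<delta>_def power2_eq_square ac_simps)
  have "emb e = scal t2 + 3 * scal t4 * \<delta>^2 * emb G * emb e"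
    using arg_cong[OF e, of emb] by (simp add: em \<delta>_def del: fps_const_power)
  then have \<eta>0: "c_var * \<eta>0 * (1 - 3 * \<rho>0) = scal t2"
    unfolding \<rho>0_def \<eta>0_def em \<delta>_def[symmetric] using \<delta> by algebra
  have "emb G = t_var + \<delta>^2 * emb G * emb e^2 + 3 * scal t4^2 * \<delta>^4 * emb G^3"
    using arg_cong[OF G, of emb] by (simp add: em \<delta>_def del: fps_const_power)
  then have t0: "t_var = c_var * g0 * (1 - \<eta>0^2 - 3 * \<rho>0^2)"
    unfolding \<rho>0_def \<eta>0_def g0_def em \<delta>_def[symmetric] using \<delta> by algebra
  define k u where "k = scal t4 * \<delta>" and "u = (scal t2)^2 * \<delta>"
  \<comment> \<open>The elimination of \<open>r\<close> and \<open>y\<close>: the factor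
    \<open>(1 - 3 * k * g)^2\<close> clears the denominator that arises from solving for
    \<open>y\<close>.\<close>
  have P: "c_var * g * (1 - 3 * k * g)^2 * (1 - 3 * k^2 * g^2) - u * g = t_var * (1 - 3 * k * g)^2"
    if "r = k * g" "c_var * y * (1 - 3 * r) = scal t2" "t_var = c_var * g * (1 - y^2 - 3 * r^2)" for g y r
    unfolding u_def using that \<delta> by algebra
  have P1: "c_var * \<gamma>^2 * (1 - 3 * k * \<gamma>^2)^2 * (1 - 3 * k^2 * (\<gamma>^2)^2) - u * \<gamma>^2 = t_var * (1 - 3 * k * \<gamma>^2)^2"
    by (rule P[OF _ \<eta> t]) (simp add: \<rho> k_def)
  have P2: "c_var * g0 * (1 - 3 * k * g0)^2 * (1 - 3 * k^2 * g0^2) - u * g0 = t_var * (1 - 3 * k * g0)^2"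
    by (rule P[OF _ \<eta>0 t0]) (simp add: \<rho>0 k_def)
  have \<delta>c: "\<delta> = fls_const (fls_X ^ 2)"
  proof -
    have "fls_X ^ 2 * fls_X_inv ^ 2 = (1 :: 'a fls)"
      by (simp add: fls_X_power_times_conv_shift fls_X_inv_power_conv_shift_1)
    then have "c_var * fls_const (fls_X ^ 2) = (1 :: 'a fls fls)"
      by (simp add: c_var_def fls_const_mult_const[symmetric] mult.commute)
    then show ?thesis using \<delta> by algebra
  qed
  define c' k' u' where "c' = (fls_X_inv ^ 2 :: 'a fls)" and "k' = fls_const t4 * fls_X ^ 2"
    and "u' = (fls_const t2)^2 * fls_X ^ 2"
  have cc: "c_var = fls_const c'" by (simp add: c_var_def c'_def)
  have kc: "k = fls_const k'" by (simp add: k_def k'_def \<delta>c scal_def fls_const_mult_const)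
  have uc: "u = fls_const u'" by (simp add: u_def u'_def \<delta>c scal_def fls_const_power[symmetric])
  \<comment> \<open>The linear coefficient to be excluded is \<open>c - t2^2 / c\<close>; only its
    first term contains a positive power of \<open>c\<close>.\<close>
  have cu: "c' \<noteq> u'"
  proof
    assume "c' = u'"
    then have "fls_nth c' (-2) = fls_nth u' (-2)" by simp
    then show False
      by (simp add: c'_def u'_def fls_X_inv_power_nth fls_X_power_times_conv_shift mult.commute[of _ "fls_X ^ 2"] fls_const_power[symmetric])
  qed
  have small: "fls_nth (\<gamma>^2) n = 0" if "n \<le> 0" for n
  proof -
    define D where "D = c'^2 - (fls_const t2)^2"
    have "c_var^2 - (scal t2)^2 = fls_const D"
      by (simp add: cc scal_def D_def fls_const_power[symmetric] fls_minus_const)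
    then have "c_var * t_var / (c_var^2 - (scal t2)^2) = fls_const c' * fls_X ^ 2 * fls_const (inverse D)"
      by (simp only: cc t_var_def divide_inverse fls_inverse_const)
    also have "\<dots> = fls_const (c' * inverse D) * fls_X ^ 2"
      by (simp only: fls_const_mult_const[symmetric] ac_simps)
    finally have "c_var * t_var / (c_var^2 - (scal t2)^2) = fls_const (c' * inverse D) * fls_X ^ 2" .
    then have "fls_nth (c_var * t_var / (c_var^2 - (scal t2)^2)) n = 0"
      using that by (simp add: fls_X_power_times_conv_shift mult.commute[of _ "fls_X ^ 2"])
    then show ?thesis using branch[rule_format, of n] that by simp
  qed
  have small0: "fls_nth g0 n = 0" if "n \<le> 0" for n
    unfolding g0_def by (rule emb_small[OF _ that]) (simp add: disk_param_const_coeff[OF G])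
  have "\<gamma>^2 = g0"
    by (rule root_unique[OF P1 P2 cc kc uc cu small small0]) (simp_all add: t_var_def fls_X_power_nth)
  then show "\<gamma>^2 = emb (\<epsilon> * G)" by (simp add: g0_def)
  have r: "\<rho> = \<rho>0" using \<rho> \<rho>0 \<open>\<gamma>^2 = g0\<close> by simp
  then show "\<alpha>3 = \<gamma> * emb (K t4 * \<epsilon>^2 * G)" by (simp add: \<alpha> \<rho>0_def)
  \<comment> \<open>\<open>\<rho>0\<close> has no term of order 0 in \<open>t\<close>, so this
    factor cannot vanish, and the equation for \<open>\<eta>\<close> can be divided by it.\<close>
  have "1 - 3 * \<rho>0 \<noteq> 0"
  proof
    assume "1 - 3 * \<rho>0 = 0"
    then have "1 = k * g0 + k * g0 + k * g0" by (simp add: \<rho>0 k_def ac_simps)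
    then have "fls_nth 1 0 = fls_nth (k * g0 + k * g0 + k * g0) 0" by simp
    moreover have "fls_nth (k * g0) 0 = 0" using small0[of 0] unfolding kc by simp
    ultimately show False by (simp add: mult.commute)
  qed
  then have "\<eta> = \<eta>0" using \<eta> \<eta>0 c_var_nz[where 'a='a] unfolding r by (metis mult_cancel_left mult_cancel_right)
  then show "\<alpha>1 = \<gamma> * emb (\<epsilon> * e)" by (simp add: \<alpha> \<eta>0_def)
qed

end

section \<open>Alternating boundaries\<close>

text \<open>This is the equation \<open>\<omega> = omega_sym\<close> at
  \<open>h = 1 / (r * j)\<close> with denominators cleared, where \<open>fps_X\<close> is
  \<open>1/\<omega>\<close> and \<open>g\<close> is \<open>\<gamma>^2\<close>. The solution is the
  compositional inverse of \<open>j (1 + r^2 j)^2 / (g (1 + j)^2)\<close>.\<close>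

lemma alternating_param_exists:
  fixes g r :: "'k::field"
  assumes "g \<noteq> 0"
  obtains j :: "'k fps" where "j $ 0 = 0" "j $ 1 = g"
    "fps_X * fps_const g * (1 + j)^2 = j * (1 + (fps_const r)^2 * j)^2"
proof -
  define D where "D = fps_const g * (1 + fps_X)^2"
  define m where "m = (1 + (fps_const r)^2 * fps_X)^2"
  define \<phi> where "\<phi> = fps_X * (m * inverse D)"
  have D0: "D $ 0 = g" by (simp add: D_def power2_eq_square)
  have m0: "m $ 0 = 1" by (simp add: m_def power2_eq_square)
  have \<phi>: "\<phi> $ 0 = 0" "\<phi> $ 1 = inverse g" by (simp_all add: \<phi>_def D0 m0)
  define j where "j = fps_inv \<phi>"
  have inv: "\<phi> oo j = fps_X" unfolding j_def by (rule fps_inv_right) (use \<phi> assms in auto)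
  have j0: "j $ 0 = 0" by (simp add: j_def fps_inv_def)
  have "\<phi> * D = fps_X * m" using D0 assms by (simp add: \<phi>_def inverse_mult_eq_1 mult.assoc)
  then have "(\<phi> oo j) * (D oo j) = (fps_X oo j) * (m oo j)"
    by (metis fps_compose_mult_distrib j0)
  then have eq: "fps_X * fps_const g * (1 + j)^2 = j * (1 + (fps_const r)^2 * j)^2"
    using j0 unfolding inv D_def m_def
    by (simp add: fps_compose_mult_distrib fps_compose_add_distrib fps_compose_power[symmetric] mult.assoc del: fps_const_power)
  have "(fps_X * fps_const g * (1 + j)^2) $ 1 = g" using j0 by (simp add: mult.assoc power2_eq_square)
  moreover have "(j * (1 + (fps_const r)^2 * j)^2) $ 1 = j $ 1" using j0 by (simp add: fps_mult_nth_1 power2_eq_square)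
  ultimately have "j $ 1 = g" using eq by simp
  then show ?thesis using that j0 eq by blast
qed

text \<open>The polynomial \<open>Qs\<close> divides the right-hand side of the kernel equation because
  \<open>A^2 = p + q V\<close> modulo \<open>Qs\<close>, and \<open>N\<close> is the norm of \<open>m + n V\<close> modulo \<open>Qs\<close>.\<close>

lemma alternating_identity:
  fixes C g \<rho> y o1 j i1 \<sigma> B t4 \<Gamma> f :: "'r::idom"
  defines "m \<equiv> 1 + \<rho>^2 * j" and "\<eta> \<equiv> y * (1 - \<rho> * j)" and "l \<equiv> j * (y * (1 + \<rho>))" and "V \<equiv> g * \<sigma>"
  defines "n \<equiv> y * m"
  defines "p \<equiv> m^2 + n^2 * \<rho> * j" and "q \<equiv> 2 * m * n + n^2 * l" and "N \<equiv> m^2 * (1 + y^2 * j)"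
    and "A \<equiv> 1 + \<eta> * V + \<rho> * V^2" and "Q \<equiv> 1 - l * V - \<rho> * j * V^2" and "Qs \<equiv> V^2 - l * V - \<rho> * j"
  defines "b \<equiv> n^2 + 2 * \<rho> * (m + n * V) + \<rho>^2 * Qs"
  defines "r \<equiv> p^2 - j * \<rho> * (2 * (p + q * V) * b + Qs * b^2) - (l * p - 2 * \<rho> * j * q) * V * b"
  assumes i1: "(1 + j) * i1 = 1" and o1: "o1 * g * (1 + j)^2 = j * m^2" and t4: "g * t4 = C * \<rho>"
    and B: "g * B = C * (\<rho> + \<eta> * V + V^2)" and \<Gamma>: "\<Gamma> * Q = C * r" and g: "g \<noteq> 0" and f: "f = - C * m * N * i1"
  shows "\<Gamma> * (o1 * A * B + \<sigma>^2 * f) =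
    o1 * C * t4 * A^4 + o1 * (C^2 * (y * (1 + \<rho>) * p - 2 * \<rho> * q)) * \<sigma> * A^2 - \<sigma>^2 * f^2"
proof -
  have og: "o1 * g = j * m^2 * i1^2" using o1 i1 by algebra
  have N: "N = m^2 + m * n * l - \<rho> * j * n^2" unfolding N_def n_def l_def by algebra
  have "A = m + n * V + \<rho> * Qs" unfolding A_def m_def n_def Qs_def l_def \<eta>_def by algebra
  then have A2: "A^2 = p + q * V + Qs * b" unfolding p_def q_def b_def Qs_def by algebra
  have norm: "N^2 = p^2 + l * p * q - \<rho> * j * q^2" unfolding N p_def q_def by algebra
  \<comment> \<open>With \<open>A^2\<close> replaced by \<open>p + q * V\<close> the right-hand side
    is quadratic in \<open>V\<close>. For it to be a multiple of \<open>Qs\<close>, its constant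
    term forces the multiplier \<open>p^2\<close>, its middle term the coefficient
    \<open>l * p - 2 * \<rho> * j * q\<close>, and its top term the norm \<open>N^2\<close>. This is
    where the coefficient of \<open>A^2\<close> in the conclusion comes from.\<close>
  have "Qs * p^2 = - (j * \<rho> * (p + q * V)^2) - (l * p - 2 * \<rho> * j * q) * V * (p + q * V) + N^2 * V^2"
    unfolding norm Qs_def by algebra
  then have b: "Qs * r = - (j * \<rho> * (A^2)^2) - (l * p - 2 * \<rho> * j * q) * V * A^2 + N^2 * V^2"
    unfolding A2 r_def by algebra
  \<comment> \<open>The factorization of the kernel. At \<open>V = 0\<close> the factor
    \<open>Q\<close> equals 1 and can be inverted as a series; \<open>Qs\<close> starts with
    \<open>- \<rho> * j\<close> and has to be cancelled by the right-hand side.\<close>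
  have "j * A * (\<rho> + \<eta> * V + V^2) - (1 + j) * m * (1 + y^2 * j) * V^2 = - (Qs * Q)"
    unfolding A_def \<eta>_def m_def Qs_def Q_def l_def by algebra
  then have "i1^2 * m^2 * (j * A * (\<rho> + \<eta> * V + V^2)) - i1 * m * N * V^2 = - (i1^2 * m^2 * Qs * Q)"
    unfolding N_def using i1 by algebra
  then have a: "o1 * g * A * (g * B) + V^2 * f = - (C * m^2 * i1^2 * Qs * Q)"
    unfolding og B f by algebra
  have "g^2 * (\<Gamma> * (o1 * A * B + \<sigma>^2 * f)) = \<Gamma> * (o1 * g * A * (g * B) + V^2 * f)"
    unfolding V_def by algebra
  also have "\<dots> = - (C * m^2 * i1^2 * Qs * (\<Gamma> * Q))" unfolding a by algebra
  also have "\<dots> = - (C^2 * m^2 * i1^2 * (Qs * r))" unfolding \<Gamma> by algebra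
  also have "\<dots> = (o1 * g) * C * (g * t4) * A^4 + (o1 * g) * (C^2 * (y * (1 + \<rho>) * p - 2 * \<rho> * q)) * V * A^2 - V^2 * f^2"
    unfolding b og t4 f l_def by algebra
  also have "\<dots> = g^2 * (o1 * C * t4 * A^4 + o1 * (C^2 * (y * (1 + \<rho>) * p - 2 * \<rho> * q)) * \<sigma> * A^2 - \<sigma>^2 * f^2)"
    unfolding V_def by algebra
  finally show ?thesis using g by simp
qed

lemma fps_inverse_exists:
  fixes Q :: "'r::comm_ring_1 fps"
  assumes "Q $ 0 = 1" obtains I where "Q * I = 1"
  using fps_right_inverse[of Q 1] assms that by auto

lemma square_mult_eq_X_nth:
  fixes A \<psi> :: "'r::comm_ring_1 fps"
  assumes "A^2 * \<psi> = fps_X" "A $ 0 = 1" shows "\<psi> $ 0 = 0" "\<psi> $ 1 = 1"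
proof -
  have A2: "(A^2) $ 0 = 1" using assms(2) by (simp add: power2_eq_square)
  have "(A^2 * \<psi>) $ 0 = 0" using assms(1) by simp
  then show 0: "\<psi> $ 0 = 0" using A2 by (simp only: fps_mult_nth_0) simp
  have "(A^2 * \<psi>) $ 1 = 1" using assms(1) by simp
  then show "\<psi> $ 1 = 1" using A2 0 by (simp only: fps_mult_nth_1) simp
qed

text \<open>The linear terms carry a factor \<open>fps_X\<close>. In the quadratic term the two
  extreme products vanish because every member of the family starts at order 1, so it too involves
  only lower orders; division by \<open>c\<close> then determines order \<open>n\<close>.\<close>

lemma alternating_family_unique:
  fixes H H' :: "nat \<Rightarrow> 'k::field fps"
  assumes c: "c \<noteq> 0"
    and H: "\<And>r. fps_const c * H r = H 0 * H r + fps_X * (a * H (r+1) + b * H (r+2) + fps_const c * w r + (\<Sum>i=1..r. H i * w (r - i)))"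
    and H0: "\<And>r. H r $ 0 = 0"
    and H': "\<And>r. fps_const c * H' r = H' 0 * H' r + fps_X * (a * H' (r+1) + b * H' (r+2) + fps_const c * w r + (\<Sum>i=1..r. H' i * w (r - i)))"
    and H'0: "\<And>r. H' r $ 0 = 0"
  shows "H r = H' r"
proof (rule fps_family_eqI[of H H'])
  fix n r
  assume IH: "\<And>i k. k < n \<Longrightarrow> H i $ k = H' i $ k"
  show "H r $ n = H' r $ n"
  proof (cases n)
    case 0
    then show ?thesis using H0 H'0 by simp
  next
    case (Suc m)
    have le: "H i $ k = H' i $ k" if "k \<le> m" for i k using IH that Suc by simp
    have 1: "(H 0 * H r) $ n = (H' 0 * H' r) $ n"
      unfolding fps_mult_nth
    proof (rule sum.cong[OF refl])
      fix k assume "k \<in> {0..n}"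
      then show "H 0 $ k * H r $ (n - k) = H' 0 $ k * H' r $ (n - k)"
        using H0 H'0 IH[of k 0] IH[of "n - k" r] by (cases "k = 0 \<or> k = n") auto
    qed
    have 2: "(x * H i) $ m = (x * H' i) $ m" "(H i * x) $ m = (H' i * x) $ m" for x i
      by (rule fps_mult_nth_cong[of m], simp_all add: le)+
    have "c * H r $ n = (fps_const c * H r) $ n" by simp
    also have "\<dots> = (fps_const c * H' r) $ n"
      unfolding H[of r] H'[of r] by (simp add: 1[unfolded Suc] Suc 2 fps_sum_nth)
    also have "\<dots> = c * H' r $ n" by simp
    finally show ?thesis using c by simp
  qed
qed

context ising
begin

text \<open>The generating function of the words \<open>(BA)^k A^(2r)\<close> with
  \<open>fps_X\<close> in the role of \<open>1/\<omega>\<close>; for \<open>r = 0\<close> it is the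
  main series before the shift by \<open>- c\<close>.\<close>

definition alternating_family :: "nat \<Rightarrow> 'a fls fls fps" where
  "alternating_family r = fps_X * Abs_fps (\<lambda>k. emb (M k (2 * r)))"

lemma alternating_family_eq:
  "fps_const c_var * alternating_family r = alternating_family 0 * alternating_family r +
     fps_X * (fps_const (scal t2) * alternating_family (r+1) + fps_const (scal t4) * alternating_family (r+2) +
       fps_const c_var * fps_const (emb (T (2 * r) 0)) +
       (\<Sum>i=1..r. alternating_family i * fps_const (emb (T (2 * (r - i)) 0))))"
proof -
  define U where "U r = Abs_fps (\<lambda>k. emb (M k (2 * r)))" for r
  have c: "c_var * emb \<epsilon> = (1 :: 'a fls fls)" using emb_eps[where 'a='a] by (simp add: mult.commute)
  have odd: "(\<Sum>b=1..2*r. M k b * M 0 (2 * r - b)) = (\<Sum>i=1..r. M k (2 * i) * T (2 * (r - i)) 0)" for k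
  proof -
    have "(\<Sum>i=1..r. M k (2 * i) * T (2 * (r - i)) 0) = (\<Sum>b\<in>{b\<in>{1..2*r}. even b}. M k b * M 0 (2 * r - b))"
      by (rule sum.reindex_bij_witness[of _ "\<lambda>b. b div 2" "\<lambda>i. 2 * i"]) (auto simp: M_0 right_diff_distrib' elim!: evenE)
    also have "\<dots> = (\<Sum>b=1..2*r. M k b * M 0 (2 * r - b))"
      by (rule sum.mono_neutral_left) (auto simp: M_0 T_odd)
    finally show ?thesis by simp
  qed
  have rec: "c_var * emb (M (Suc k) (2 * r)) = scal t2 * emb (M k (2 * (r + 1))) + scal t4 * emb (M k (2 * (r + 2))) +
      (\<Sum>a\<le>k. emb (M a 0) * emb (M (k - a) (2 * r))) + (\<Sum>i=1..r. emb (M k (2 * i)) * emb (T (2 * (r - i)) 0))" for k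
  proof -
    have "c_var * emb (M (Suc k) (2 * r)) = (c_var * emb \<epsilon>) * (scal t2 * emb (M k (2 * r + 2)) + scal t4 * emb (M k (2 * r + 4)) +
      (\<Sum>a\<le>k. emb (M a 0) * emb (M (k - a) (2 * r))) + (\<Sum>i=1..r. emb (M k (2 * i)) * emb (T (2 * (r - i)) 0)))"
      unfolding M_Suc odd by (simp add: emb.mult emb.add emb.sum emb_K mult.assoc)
    moreover have "2 * r + 2 = 2 * (r + 1)" "2 * r + 4 = 2 * (r + 2)" by simp_all
    ultimately show ?thesis by (simp only: c mult_1)
  qed
  have "fps_const c_var * U r = fps_X * (U 0 * U r) + fps_X * (fps_const (scal t2) * U (r+1) + fps_const (scal t4) * U (r+2) +
      (\<Sum>i=1..r. U i * fps_const (emb (T (2 * (r - i)) 0)))) + fps_const c_var * fps_const (emb (T (2 * r) 0))"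
    (is "?L = ?R")
  proof (rule fps_ext)
    fix k show "?L $ k = ?R $ k"
    proof (cases k)
      case 0 then show ?thesis by (simp add: U_def M_0)
    next
      case (Suc k')
      have "(U 0 * U r) $ k' = (\<Sum>a\<le>k'. emb (M a 0) * emb (M (k' - a) (2 * r)))"
        by (simp add: fps_mult_nth U_def atLeast0AtMost)
      then show ?thesis using rec[of k'] Suc by (simp add: fps_sum_nth U_def)
    qed
  qed
  then have "fps_X * ?L = fps_X * ?R" by simp
  moreover have "alternating_family r = fps_X * U r" for r by (simp add: alternating_family_def U_def)
  ultimately show ?thesis by (simp add: algebra_simps sum_distrib_left)
qed

text \<open>The kernel method run backwards: the candidate \<open>f\<close> makes the kernel
  equation solvable by a series \<open>\<Gamma>\<close> in \<open>1 / x^2\<close>. The coefficients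
  of \<open>\<Gamma>\<close>, with the one of order 0 replaced by \<open>f + C\<close>, satisfy the
  equations of the alternating family and are identified by uniqueness.\<close>

lemma alternating_gf:
  fixes G e :: "'a fps fps" and j y f :: "'a fls fls fps"
  assumes t4: "t4 \<noteq> 0"
    and G: "G = tt + \<epsilon>^2 * G * e^2 + 3 * K t4^2 * \<epsilon>^4 * G^3" and e: "e = K t2 + 3 * K t4 * \<epsilon>^2 * G * e"
  defines "g \<equiv> fps_const (emb (\<epsilon> * G))" and "\<rho> \<equiv> fps_const (emb (K t4 * \<epsilon>^2 * G))" and "\<eta> \<equiv> fps_const (emb (\<epsilon> * e))"
    and "C \<equiv> fps_const c_var"
  assumes g0: "g \<noteq> 0"
    and j0: "j $ 0 = 0" and j: "fps_X * g * (1 + j)^2 = j * (1 + \<rho>^2 * j)^2"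
    and y: "y * (1 - \<rho> * j) = \<eta>"
    and f: "f * (1 + j) = - C * (1 + \<rho>^2 * j)^3 * (1 + y^2 * j)"
  shows "f = fps_X * Abs_fps (\<lambda>k. emb (M k 0)) - C"
proof -
  define em :: "'a fps fps \<Rightarrow> 'a fls fls fps" where "em x = fps_const (emb x)" for x
  interpret em: ring_map em unfolding em_def by (rule ring_map_comp[OF ring_map_fps_const ring_map_emb])
  interpret F: ring_map "fps_map em" by (rule em.fps_map)
  let ?c = "fps_const :: 'a fls fls fps \<Rightarrow> 'a fls fls fps fps"
  let ?X = "fps_X :: 'a fls fls fps fps"
  have cC: "C * em \<epsilon> = 1"
    using emb_eps[where 'a='a] by (simp add: C_def em_def mult.commute)
  have gE: "g = em \<epsilon> * em G" and rE: "\<rho> = em (K t4) * em \<epsilon>^2 * em G" and yE: "\<eta> = em \<epsilon> * em e"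
    by (simp_all only: g_def \<rho>_def \<eta>_def em_def[symmetric] em.mult em.power)
  define A B where "A = 1 + fps_const (\<epsilon>^2 * G * e) * fps_X + fps_const (K t4 * \<epsilon>^4 * G^3) * fps_X^2"
    and "B = fps_const (K t4) + fps_const e * fps_X + fps_const G * fps_X^2"
  have A0: "A $ 0 = 1" by (simp add: A_def power2_eq_square)
  obtain I where I: "A * I = 1" using fps_inverse_exists[OF A0] .
  define \<psi> where "\<psi> = fps_X * I^2"
  have \<psi>: "A^2 * \<psi> = fps_X" unfolding \<psi>_def using I by algebra
  note disk = disk_param[OF t4 G e, of \<psi>, folded A_def B_def, OF \<psi>]
  define A' B' \<psi>' where "A' = fps_map em A" and "B' = fps_map em B" and "\<psi>' = fps_map em \<psi>"
  define W where "W = Abs_fps (\<lambda>r. em (T (2 * r) 0))"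
  have A'\<psi>: "A'^2 * \<psi>' = ?X"
    using arg_cong[OF \<psi>, of "fps_map em"] unfolding A'_def \<psi>'_def by (simp only: F.mult F.power em.fps_map_X)
  have A'0: "A' $ 0 = 1" by (simp add: A'_def A0 em.one)
  note \<psi>' = square_mult_eq_X_nth[OF A'\<psi> A'0]
  have W: "fps_map em (Abs_fps (\<lambda>r. T (2 * r) 0)) = W" by (simp add: W_def fps_eq_iff)
  have disk': "?X^2 * (W oo \<psi>') = A' * B' - ?c (em (K t4)) * A'^4 - ?c (em (K t2)) * ?X * A'^2"
    using arg_cong[OF disk, of "fps_map em"] unfolding A'_def[symmetric] B'_def[symmetric]
    by (simp only: F.mult F.power F.diff em.fps_map_X em.fps_map_const em.fps_map_compose W A'_def[symmetric] B'_def[symmetric] \<psi>'_def[symmetric])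
  define V where "V = ?c g * ?X"
  have cp: "?c (x * y) = ?c x * ?c y" "?c (x ^ n) = ?c x ^ n" "?c (x + y) = ?c x + ?c y"
    "?c (x - y) = ?c x - ?c y" "?c 1 = 1" "?c (numeral N) = numeral N" "?c (- x) = - ?c x" for x y n N
    by (simp_all add: fps_const_power numeral_fps_const)
  have A'E: "A' = 1 + ?c \<eta> * V + ?c \<rho> * V^2"
    unfolding A'_def A_def F.add F.mult F.one F.power em.fps_map_const em.fps_map_X em.mult em.power V_def gE rE yE cp
    by algebra
  have t4E: "?c g * ?c (em (K t4)) = ?c C * ?c \<rho>"
  proof -
    have "g * em (K t4) = C * \<rho>" unfolding gE rE using cC by algebra
    then show ?thesis by (simp only: cp(1)[symmetric])
  qed
  have BE: "?c g * B' = ?c C * (?c \<rho> + ?c \<eta> * V + V^2)"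
  proof -
    have "?c C * ?c (em \<epsilon>) = 1" using cC by (simp only: cp(1,5)[symmetric])
    then show ?thesis
      unfolding B'_def B_def F.add F.mult F.one F.power em.fps_map_const em.fps_map_X em.mult em.power V_def gE rE yE cp
      by algebra
  qed
  obtain i1 where i1: "(1 + j) * i1 = 1" using fps_inverse_exists[of "1 + j"] j0 by auto
  define m l where "m = 1 + \<rho>^2 * j" and "l = j * (y * (1 + \<rho>))"
  define n where "n = y * m"
  define p q N where "p = m^2 + n^2 * \<rho> * j" and "q = 2 * m * n + n^2 * l" and "N = m^2 * (1 + y^2 * j)"
  define Q Qs where "Q = 1 - ?c l * V - ?c \<rho> * ?c j * V^2" and "Qs = V^2 - ?c l * V - ?c \<rho> * ?c j"
  define b where "b = ?c n^2 + 2 * ?c \<rho> * (?c m + ?c n * V) + ?c \<rho>^2 * Qs"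
  define r where "r = ?c p^2 - ?c j * ?c \<rho> * (2 * (?c p + ?c q * V) * b + Qs * b^2)
    - (?c l * ?c p - 2 * ?c \<rho> * ?c j * ?c q) * V * b"
  have Q0: "Q $ 0 = 1" by (simp add: Q_def V_def power2_eq_square)
  obtain J where J: "Q * J = 1" using fps_inverse_exists[OF Q0] .
  define \<Gamma>0 where "\<Gamma>0 = ?c C * r * J"
  have \<Gamma>Q: "\<Gamma>0 * Q = ?c C * r" unfolding \<Gamma>0_def using J by algebra
  have fE: "f = - C * m * N * i1" unfolding N_def m_def using f i1 by algebra
  \<comment> \<open>The value forced by divisibility for the coefficient of order 1 in the kernel
    equation, where the unknown \<open>\<Gamma> $ 1\<close> enters.\<close>
  define \<kappa> where "\<kappa> = C^2 * (y * (1 + \<rho>) * p - 2 * \<rho> * q)"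
  have \<eta>y: "\<eta> = y * (1 - \<rho> * j)" using y by simp
  have main0: "\<Gamma>0 * (?c fps_X * A' * B' + ?X^2 * ?c f) =
     ?c fps_X * ?c C * ?c (em (K t4)) * A'^4 + ?c fps_X * ?c \<kappa> * ?X * A'^2 - ?X^2 * ?c f^2"
  proof -
    have 1: "(1 + ?c j) * ?c i1 = 1" using i1 by (simp only: cp(1,3,5)[symmetric])
    have 2: "?c fps_X * ?c g * (1 + ?c j)^2 = ?c j * (1 + ?c \<rho>^2 * ?c j)^2"
      using j by (simp only: cp(1,2,3,5)[symmetric])
    have 3: "?c f = - ?c C * (1 + ?c \<rho>^2 * ?c j) * ((1 + ?c \<rho>^2 * ?c j)^2 * (1 + ?c y^2 * ?c j)) * ?c i1"
      unfolding fE m_def N_def by (simp only: cp)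
    have 4: "?c g \<noteq> 0" using g0 by simp
    have 5: "?c g * B' = ?c C * (?c \<rho> + ?c y * (1 - ?c \<rho> * ?c j) * (?c g * ?X) + (?c g * ?X)^2)"
      using BE unfolding \<eta>y V_def cp .
    have 6: "\<Gamma>0 * Q = ?c C * r" by (rule \<Gamma>Q)
    show ?thesis
      using alternating_identity[OF 1 2 t4E 5 6[unfolded r_def b_def Q_def Qs_def p_def q_def l_def n_def m_def V_def cp] 4 3]
      unfolding A'E \<kappa>_def \<eta>y V_def p_def q_def l_def n_def m_def cp .
  qed
  define \<Gamma> where "\<Gamma> = Abs_fps (decompose \<psi>' \<Gamma>0)"
  have \<Gamma>: "\<Gamma> oo \<psi>' = \<Gamma>0" unfolding \<Gamma>_def by (rule compose_decompose[OF \<psi>'])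
  define E where "E = \<Gamma> * (?X^2 * (?c f + ?c fps_X * W) + ?c fps_X * (?c (em (K t4)) + ?c (em (K t2)) * ?X))"
  define E' where "E' = ?c fps_X * ?c C * ?c (em (K t4)) + ?c fps_X * ?c \<kappa> * ?X - ?X^2 * ?c f^2"
  have "E = E'"
  proof (rule fps_compose_inj[OF \<psi>'])
    have "A'^4 * (\<Gamma>0 * (\<psi>'^2 * (?c f + ?c fps_X * (W oo \<psi>')) + ?c fps_X * (?c (em (K t4)) + ?c (em (K t2)) * \<psi>')))
      = A'^4 * (?c fps_X * ?c C * ?c (em (K t4)) + ?c fps_X * ?c \<kappa> * \<psi>' - \<psi>'^2 * ?c f^2)"
      using main0 disk' A'\<psi> by algebra
    moreover have "A' \<noteq> 0" using A'0 by auto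
    ultimately have "\<Gamma>0 * (\<psi>'^2 * (?c f + ?c fps_X * (W oo \<psi>')) + ?c fps_X * (?c (em (K t4)) + ?c (em (K t2)) * \<psi>'))
      = ?c fps_X * ?c C * ?c (em (K t4)) + ?c fps_X * ?c \<kappa> * \<psi>' - \<psi>'^2 * ?c f^2" by simp
    then show "E oo \<psi>' = E' oo \<psi>'"
      unfolding E_def E'_def using \<psi>'(1)
      by (simp add: fps_compose_mult_distrib fps_compose_add_distrib fps_compose_sub_distrib \<Gamma> fps_compose_power[symmetric] del: fps_const_power fps_const_mult)
  qed
  define s2 s4 where "s2 = fps_const (scal t2)" and "s4 = fps_const (scal t4)"
  have s: "em (K t2) = s2" "em (K t4) = s4" by (simp_all add: em_def emb_K s2_def s4_def)
  have s4nz: "s4 \<noteq> 0" using t4 by (simp add: s4_def scal_eq_0_iff)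
  \<comment> \<open>The constant term \<open>- c\<close> of \<open>f\<close> makes
    \<open>H 0 = f + C\<close> start at order 1, as uniqueness requires; for the other members it
    allows a division by \<open>c\<close> at order 0.\<close>
  have f0: "f $ 0 = - c_var"
    using arg_cong[OF f, of "\<lambda>u. u $ 0"] j0 by (simp add: C_def power2_eq_square power3_eq_cube)
  have \<Gamma>c: "\<Gamma> $ 0 = C"
  proof -
    have "E $ 0 = fps_X * s4 * (\<Gamma> $ 0)" "E' $ 0 = fps_X * s4 * C"
      by (simp_all add: E_def E'_def s power2_eq_square)
    then have "fps_X * s4 * (\<Gamma> $ 0) = fps_X * s4 * C" using \<open>E = E'\<close> by metis
    then show ?thesis using s4nz by auto
  qed
  \<comment> \<open>The coefficient of order \<open>r + 2\<close> in the kernel equation. Orders 0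
    and 1 concern only the initial value \<open>\<Gamma> $ 0\<close> and the constant
    \<open>\<kappa>\<close>.\<close>
  have rec: "\<Gamma> $ r * f + fps_X * ((\<Sum>i=0..r. \<Gamma> $ i * em (T (2 * (r - i)) 0)) + s4 * \<Gamma> $ (r+2) + s2 * \<Gamma> $ (r+1)) = (if r = 0 then - (f^2) else 0)" for r
  proof -
    have "E = ?X * (?X * (\<Gamma> * ?c f + ?c fps_X * (\<Gamma> * W))) + ?c fps_X * (?c s4 * \<Gamma> + ?X * (?c s2 * \<Gamma>))"
      unfolding E_def s by algebra
    then have "E $ Suc (Suc r) = \<Gamma> $ r * f + fps_X * (\<Gamma> * W) $ r + fps_X * (s4 * \<Gamma> $ (r+2) + s2 * \<Gamma> $ (r+1))"
      by simp
    moreover have "E' = ?c (fps_X * C * s4) + ?X * ?c (fps_X * \<kappa>) - ?X * (?X * ?c (f^2))"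
      unfolding E'_def s cp by algebra
    then have "E' $ Suc (Suc r) = (if r = 0 then - (f^2) else 0)" by simp
    moreover have "(\<Gamma> * W) $ r = (\<Sum>i=0..r. \<Gamma> $ i * em (T (2 * (r - i)) 0))"
      by (simp add: fps_mult_nth W_def)
    ultimately show ?thesis using \<open>E = E'\<close> by (simp add: distrib_left)
  qed
  \<comment> \<open>Replacing \<open>\<Gamma> $ 0 = C\<close> by \<open>f + C\<close> absorbs the
    exceptional term \<open>- f^2\<close>: the equation \<open>C * f + Y = - f^2\<close> is
    \<open>C * (f + C) = (f + C)^2 + Y\<close>.\<close>
  define H where "H r = (if r = 0 then f + C else \<Gamma> $ r)" for r
  have H0: "H r $ 0 = 0" for r
    using arg_cong[OF rec[of r], of "\<lambda>u. u $ 0"] f0 c_var_nz[where 'a='a] by (auto simp: H_def C_def)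
  have Heq: "C * H r = H 0 * H r + fps_X * (s2 * H (r+1) + s4 * H (r+2) + C * em (T (2 * r) 0) + (\<Sum>i=1..r. H i * em (T (2 * (r - i)) 0)))" for r
  proof -
    have "(\<Sum>i=0..r. \<Gamma> $ i * em (T (2 * (r - i)) 0)) = C * em (T (2 * r) 0) + (\<Sum>i=1..r. H i * em (T (2 * (r - i)) 0))"
      by (simp add: sum.atLeast_Suc_atMost \<Gamma>c H_def)
    moreover have "\<Gamma> $ (r+2) = H (r+2)" "\<Gamma> $ (r+1) = H (r+1)" by (simp_all add: H_def)
    moreover define Y where "Y = fps_X * (s2 * H (r+1) + s4 * H (r+2) + C * em (T (2 * r) 0) + (\<Sum>i=1..r. H i * em (T (2 * (r - i)) 0)))"
    ultimately have 1: "\<Gamma> $ r * f + Y = (if r = 0 then - (f^2) else 0)"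
      using rec[of r] by (simp add: ac_simps)
    have "C * H r = H 0 * H r + Y"
    proof (cases "r = 0")
      case True
      then have "C * f + Y = - (f^2)" using 1 \<Gamma>c by simp
      then have "C * (f + C) = (f + C) * (f + C) + Y" by algebra
      then show ?thesis using True by (simp add: H_def)
    next
      case False
      then have "\<Gamma> $ r * f + Y = 0" using 1 by simp
      then have "C * \<Gamma> $ r = (f + C) * \<Gamma> $ r + Y" by algebra
      then show ?thesis using False by (simp add: H_def)
    qed
    then show ?thesis unfolding Y_def .
  qed
  have "H 0 = alternating_family 0"
  proof (rule alternating_family_unique[where c=c_var and a=s2 and b=s4 and w="\<lambda>r. em (T (2 * r) 0)"])
    show "c_var \<noteq> (0 :: 'a fls fls)" by (rule c_var_nz)
    show "alternating_family r $ 0 = 0" for r by (simp add: alternating_family_def)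
  qed (use Heq H0 alternating_family_eq in \<open>simp_all add: C_def s2_def s4_def em_def\<close>)
  then show ?thesis by (simp add: H_def alternating_family_def algebra_simps)
qed

end

section \<open>The rational parametrization\<close>

text \<open>Since \<open>r * J * h = 1\<close>, the factors simplify to
  \<open>h + r = h * (1 + r^2 * J)\<close> and \<open>r * h + 1 = r * h * (1 + J)\<close>. All
  powers of \<open>\<gamma>\<close> except \<open>\<gamma>^2\<close> cancel.\<close>

lemma omega_sym_param:
  fixes \<gamma> r J h w :: "'k::field"
  assumes h: "r * J * h = 1" and "J \<noteq> 0" and r: "r \<noteq> 0" and \<gamma>: "\<gamma> \<noteq> 0"
    and "1 + J \<noteq> 0" "1 - r * J \<noteq> 0" and m: "1 + r^2 * J \<noteq> 0"
    and w: "w * (J * (1 + r^2 * J)^2) = \<gamma>^2 * (1 + J)^2"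
  shows "omega_sym \<gamma> (\<gamma> * r) h = w"
proof -
  have h0: "h \<noteq> 0" using h by auto
  have hr: "h + r = h * (1 + r^2 * J)" using h by algebra
  have D: "(\<gamma> * h + \<gamma> * r)^2 * (\<gamma> * r) \<noteq> 0"
  proof -
    have "\<gamma> * h + \<gamma> * r = \<gamma> * (h + r)" by (simp add: distrib_left)
    then show ?thesis using hr h0 m \<gamma> r by simp
  qed
  have "(\<gamma> * r * h + \<gamma>)^2 * \<gamma>^3 * h * r^2 * J^2 = \<gamma>^5 * h * r^2 * (1 + J)^2 * (r * J * h)^2"
  proof -
    have "(r * h + 1) = r * h * (1 + J)" using h by algebra
    then show ?thesis by algebra
  qed
  then have N: "(\<gamma> * r * h + \<gamma>)^2 * \<gamma>^3 * h * r^2 * J^2 = \<gamma>^5 * h * r^2 * (1 + J)^2" using h by simp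
  have "w * ((\<gamma> * h + \<gamma> * r)^2 * (\<gamma> * r)) * (r * J)^2 = \<gamma>^3 * r * (w * (J * (1 + r^2 * J)^2)) * J * (r * h)^2"
    using hr by algebra
  also have "\<dots> = \<gamma>^5 * h * r^2 * (1 + J)^2" unfolding w using h by algebra
  finally have "w * ((\<gamma> * h + \<gamma> * r)^2 * (\<gamma> * r)) * (r * J)^2 = ((\<gamma> * r * h + \<gamma>)^2 * \<gamma>^3 * h) * (r * J)^2"
    using N by algebra
  then have "w * ((\<gamma> * h + \<gamma> * r)^2 * (\<gamma> * r)) = (\<gamma> * r * h + \<gamma>)^2 * \<gamma>^3 * h"
    using h by auto
  then show ?thesis using D by (simp add: omega_sym_def divide_eq_eq)
qed

text \<open>Beside the linear factors, the quadratic one in the numerator becomes a multiple of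
  \<open>(1 - r * J)^2 * (1 + y^2 * J)\<close>, by \<open>\<eta> = y * (1 - r * J)\<close>. Its
  square factor cancels against \<open>(h - 1)^2 = h^2 * (1 - r * J)^2\<close>.\<close>

lemma fhat_sym_param:
  fixes c \<gamma> \<eta> r J h y f :: "'k::field"
  assumes h: "r * J * h = 1" and "J \<noteq> 0" and r: "r \<noteq> 0" and \<gamma>: "\<gamma> \<noteq> 0"
    and u: "1 + J \<noteq> 0" "1 - r * J \<noteq> 0" "1 + r^2 * J \<noteq> 0"
    and f: "f * (1 + J) = - c * (1 + r^2 * J)^3 * (1 + y^2 * J)" and y: "y * (1 - r * J) = \<eta>"
  shows "fhat_sym c \<gamma> (\<gamma> * \<eta>) (\<gamma> * r) h = f"
proof -
  have h0: "h \<noteq> 0" using h by auto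
  define m where "m = 1 + r^2 * J"
  have 1: "\<gamma> * h + \<gamma> * r = \<gamma> * h * m" unfolding m_def using h by algebra
  have 2: "\<gamma> * r * h + \<gamma> = \<gamma> * r * h * (1 + J)" using h by algebra
  have 3: "h - 1 = h * (1 - r * J)" using h by algebra
  have 4: "\<gamma> * r * \<gamma> * h^2 + h * ((\<gamma> * \<eta>)^2 - 2 * (\<gamma> * r) * \<gamma>) + \<gamma> * r * \<gamma> = \<gamma>^2 * r * h^2 * ((1 - r * J)^2 * (1 + y^2 * J))"
    using h y by algebra
  have D: "\<gamma> * r * h * (1 + J) * \<gamma>^4 * (h * (1 - r * J))^2 * h^2 \<noteq> 0" using \<gamma> r h0 u by simp
  have "f * (\<gamma> * r * h * (1 + J) * \<gamma>^4 * (h * (1 - r * J))^2 * h^2) = f * (1 + J) * (\<gamma>^5 * r * h^5 * (1 - r * J)^2)"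
    by algebra
  also have "\<dots> = - c * ((\<gamma>^2 * r * h^2 * ((1 - r * J)^2 * (1 + y^2 * J))) * (\<gamma> * h * m)^3)"
    unfolding f m_def by algebra
  finally show ?thesis using D unfolding fhat_sym_def 1 2 3 4
    by (simp only: times_divide_eq_right divide_eq_eq if_True not_False_eq_True)
qed

text \<open>As \<open>h\<close> has a simple pole in the variable, its powers have distinct orders,
  so the leading term of a polynomial in \<open>h\<close> with constant coefficients cannot be
  cancelled. This is what makes \<open>h\<close> transcendental.\<close>

lemma fls_subdegree_poly_negative:
  fixes h :: "'k::field fls"
  assumes "fls_subdegree h = - 1"
  shows "p \<noteq> 0 \<Longrightarrow> poly (map_poly fls_const p) h \<noteq> 0 \<and> fls_subdegree (poly (map_poly fls_const p) h) = - int (degree p)"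
proof (induction p)
  case (pCons a p)
  have h: "h \<noteq> 0" using assms by auto
  show ?case
  proof (cases "p = 0")
    case True
    then show ?thesis using pCons by (simp add: map_poly_pCons)
  next
    case False
    then have p: "poly (map_poly fls_const p) h \<noteq> 0" "fls_subdegree (poly (map_poly fls_const p) h) = - int (degree p)"
      using pCons.IH by auto
    let ?q = "h * poly (map_poly fls_const p) h"
    have q: "?q \<noteq> 0" "fls_subdegree ?q = - int (degree (pCons a p))"
      using p h False assms by simp_all
    have "fls_subdegree (fls_const a + ?q) = fls_subdegree ?q"
      by (rule fls_subdegree_add_eq2) (use q False in auto)
    moreover from this have "fls_const a + ?q \<noteq> 0" using q False by auto
    ultimately show ?thesis using q by (simp add: map_poly_pCons)
  qed
qed simp

section \<open>Specialization of rational functions at a transcendental point\<close>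

locale transcendental_point = ring_map \<phi>
  for \<phi> :: "'k::field \<Rightarrow> 'l::field" +
  fixes h :: 'l
  assumes transcendental: "p \<noteq> 0 \<Longrightarrow> poly (map_poly \<phi> p) h \<noteq> 0"
begin

definition ev :: "'k poly \<Rightarrow> 'l" where "ev p = poly (map_poly \<phi> p) h"

lemma ev_0: "ev 0 = 0"
  by (simp add: ev_def)

lemma ev_pCons: "ev (pCons a p) = \<phi> a + h * ev p"
  by (simp add: ev_def map_poly_pCons zero)

lemma ev_add: "ev (p + q) = ev p + ev q"
  by (induction p q rule: poly_induct2) (simp_all add: ev_0 ev_pCons add algebra_simps)

lemma ev_smult: "ev (smult a p) = \<phi> a * ev p"
  by (induction p) (simp_all add: ev_0 ev_pCons mult algebra_simps)

lemma ev_mult: "ev (p * q) = ev p * ev q"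
  by (induction p) (simp_all add: ev_0 ev_pCons ev_add ev_smult zero algebra_simps)

lemma ev_eq_0_iff: "ev p = 0 \<longleftrightarrow> p = 0"
  using transcendental by (auto simp: ev_def)

text \<open>The graph of the field embedding that sends \<open>h_var\<close> to \<open>h\<close>; a relation avoids choosing
  representatives of fractions.\<close>

definition spec :: "'k poly fract \<Rightarrow> 'l \<Rightarrow> bool" where
  "spec u U \<longleftrightarrow> (\<exists>p q. q \<noteq> 0 \<and> u = to_fract p / to_fract q \<and> U = ev p / ev q)"

lemma specI: "q \<noteq> 0 \<Longrightarrow> u = to_fract p / to_fract q \<Longrightarrow> U = ev p / ev q \<Longrightarrow> spec u U"
  unfolding spec_def by blast

lemma spec_eq_0: "spec u U \<Longrightarrow> u = 0 \<longleftrightarrow> U = 0"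
  unfolding spec_def by (auto simp: ev_eq_0_iff)

lemma ev_1: "ev 1 = 1"
  by (simp add: one_pCons ev_pCons ev_0 one)

lemma spec_const: "spec (const_ratfun a) (\<phi> a)"
  by (rule specI[of 1 _ "[:a:]"]) (simp_all add: const_ratfun_def ev_pCons ev_0 ev_1)

lemma spec_0: "spec 0 0"
  by (rule specI[of 1 _ 0]) (simp_all add: ev_0)

lemma spec_1: "spec 1 1"
  using spec_const[of 1] by (simp add: one const_ratfun_def one_pCons[symmetric])

lemma spec_h_var: "spec h_var h"
  by (rule specI[of 1 _ "[:0,1:]"]) (simp_all add: h_var_def ev_pCons ev_0 ev_1 one zero)

lemma spec_add:
  assumes "spec u U" "spec v V" shows "spec (u + v) (U + V)"
proof -
  obtain p q p' q' where *: "q \<noteq> 0" "q' \<noteq> 0" "u = to_fract p / to_fract q" "U = ev p / ev q"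
    "v = to_fract p' / to_fract q'" "V = ev p' / ev q'" using assms unfolding spec_def by blast
  then show ?thesis
    by (intro specI[of "q * q'" _ "p * q' + p' * q"]) (simp_all add: ev_mult ev_add ev_eq_0_iff add_frac_eq)
qed

lemma spec_mult:
  assumes "spec u U" "spec v V" shows "spec (u * v) (U * V)"
proof -
  obtain p q p' q' where *: "q \<noteq> 0" "q' \<noteq> 0" "u = to_fract p / to_fract q" "U = ev p / ev q"
    "v = to_fract p' / to_fract q'" "V = ev p' / ev q'" using assms unfolding spec_def by blast
  then show ?thesis
    by (intro specI[of "q * q'" _ "p * p'"]) (simp_all add: ev_mult)
qed

lemma spec_divide:
  assumes "spec u U" "spec v V" shows "spec (u / v) (U / V)"
proof -
  obtain p q where *: "q \<noteq> 0" "v = to_fract p / to_fract q" "V = ev p / ev q"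
    using assms unfolding spec_def by blast
  have "spec (inverse v) (inverse V)"
  proof (cases "p = 0")
    \<comment> \<open>If the numerator is 0, both inverses are 0 by convention, so the relation
      survives division by zero.\<close>
    case True then show ?thesis using * spec_0 by (simp add: ev_0)
  next
    case False then show ?thesis using * by (intro specI[of p _ q]) simp_all
  qed
  then show ?thesis unfolding divide_inverse using assms(1) by (rule spec_mult[rotated])
qed

lemma spec_uminus:
  assumes "spec u U" shows "spec (- u) (- U)"
proof -
  have "[:- 1:] = - (1 :: 'k poly)" by (simp add: one_pCons)
  then have "const_ratfun (- 1 :: 'k) = - 1" by (simp only: const_ratfun_def to_fract_uminus to_fract_1)
  moreover have "\<phi> (- 1) = - 1" using diff[of 0 1] by (simp add: one zero)
  ultimately show ?thesis using spec_mult[OF spec_const[of "- 1"] assms] by simp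
qed

lemma spec_diff: "spec u U \<Longrightarrow> spec v V \<Longrightarrow> spec (u - v) (U - V)"
  using spec_add[OF _ spec_uminus, of u U v V] by simp

lemma spec_power: "spec u U \<Longrightarrow> spec (u ^ n) (U ^ n)"
  by (induction n) (simp_all add: spec_1 spec_mult)

lemma spec_2: "spec 2 2"
  using spec_add[OF spec_1 spec_1] by simp

lemmas spec_intros = spec_const spec_1 spec_2 spec_add spec_mult spec_divide spec_uminus spec_diff spec_power

lemma spec_omega_sym:
  "spec a A \<Longrightarrow> spec b B \<Longrightarrow> spec u U \<Longrightarrow> spec (omega_sym a b u) (omega_sym A B U)"
  unfolding omega_sym_def by (intro spec_intros)

lemma spec_fhat_sym:
  "spec c C \<Longrightarrow> spec a A \<Longrightarrow> spec b B \<Longrightarrow> spec d D \<Longrightarrow> spec u U \<Longrightarrow> spec (fhat_sym c a b d u) (fhat_sym C A B D U)"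
  unfolding fhat_sym_def by (intro spec_intros)

lemma spec_poly:
  assumes "\<And>a. spec (f a) (F a)" "f 0 = 0" "F 0 = 0" "spec u U"
  shows "spec (poly (map_poly f p) u) (poly (map_poly F p) U)"
  by (induction p) (simp_all add: spec_0 map_poly_pCons assms spec_add spec_mult)

text \<open>Polynomial expressions in related points are related, first in the inner variable and
  then in the outer one, and related elements vanish together.\<close>

lemma vanishing_ideal_eq:
  assumes "spec u U" "spec v V"
  shows "vanishing_ideal \<phi> U V = vanishing_ideal const_ratfun u v"
proof -
  have "spec (poly (map_poly const_ratfun q) u) (poly (map_poly \<phi> q) U)" for q
    by (intro spec_poly assms spec_const) (simp_all add: const_ratfun_def zero)
  then have "spec (poly (map_poly (\<lambda>q. poly (map_poly const_ratfun q) u) Q) v) (poly (map_poly (\<lambda>q. poly (map_poly \<phi> q) U) Q) V)" for Q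
    by (intro spec_poly[where f="\<lambda>q. poly (map_poly const_ratfun q) u" and F="\<lambda>q. poly (map_poly \<phi> q) U"] assms) simp_all
  then show ?thesis unfolding vanishing_ideal_def using spec_eq_0 by blast
qed

end

theorem theorem1p2:
  fixes t2 t4 :: "'a::field_char_0"
    and \<gamma> \<alpha>1 \<alpha>3 :: "'a fls fls"
  assumes "t4 \<noteq> 0"
    and "scal t4 = c_var * \<alpha>3 / \<gamma>^3"
    and "scal t2 = c_var * \<alpha>1 * ((\<gamma> - 3 * \<alpha>3) / \<gamma>^2)"
    and "t_var = c_var * (\<gamma>^2 - \<alpha>1^2 - 3 * \<alpha>3^2)"
    and "\<forall>n<4. fls_nth (\<gamma>^2 - c_var * t_var / (c_var^2 - (scal t2)^2)) n = 0"
  shows "(\<exists>h :: 'a fls fls fls.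
            omega_sym (fls_const \<gamma>) (fls_const \<alpha>3) h = omega_var \<and>
            fhat_sym (fls_const c_var) (fls_const \<gamma>) (fls_const \<alpha>1) (fls_const \<alpha>3) h
              = fhat 4 4 (ising_weights t2 t4) (ising_weights t2 t4)) \<and>
         vanishing_ideal fls_const omega_var
             (fhat 4 4 (ising_weights t2 t4) (ising_weights t2 t4))
           = vanishing_ideal const_ratfun
               (omega_sym (const_ratfun \<gamma>) (const_ratfun \<alpha>3) h_var)
               (fhat_sym (const_ratfun c_var) (const_ratfun \<gamma>) (const_ratfun \<alpha>1)
                  (const_ratfun \<alpha>3) h_var)"
proof -
  interpret ising t2 t4 .
  obtain G e where G: "G = tt + \<epsilon>^2 * G * e^2 + 3 * K t4^2 * \<epsilon>^4 * G^3" and e: "e = K t2 + 3 * K t4 * \<epsilon>^2 * G * e"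
    by (rule disk_solution_exists)
  define g \<rho> \<eta> where "g = emb (\<epsilon> * G)" and "\<rho> = emb (K t4 * \<epsilon>^2 * G)" and "\<eta> = emb (\<epsilon> * e)"
  note par = parameters_emb[OF G e assms, folded g_def \<rho>_def \<eta>_def]
  have g0: "g \<noteq> 0" using par(1,2) by auto
  have \<rho>0: "\<rho> \<noteq> 0"
  proof
    assume "\<rho> = 0"
    then have "scal t4 = 0" using assms(2) by (simp add: par(4))
    then show False using assms(1) by (simp add: scal_eq_0_iff)
  qed
  obtain j where j: "j $ 0 = 0" "j $ 1 = g" "fps_X * fps_const g * (1 + j)^2 = j * (1 + (fps_const \<rho>)^2 * j)^2"
    using alternating_param_exists[OF g0] .
  \<comment> \<open>Both inverses exist as power series in \<open>1/\<omega>\<close> because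
    \<open>j\<close> has constant term 0. The product with \<open>1 - \<rho> * j\<close> and the
    power of \<open>1 + \<rho>^2 * j\<close> are those that \<open>fhat_sym_param\<close> turns into
    the stated formula.\<close>
  define y where "y = fps_const \<eta> * inverse (1 - fps_const \<rho> * j)"
  define f where "f = - fps_const c_var * (1 + (fps_const \<rho>)^2 * j)^3 * (1 + y^2 * j) * inverse (1 + j)"
  have y: "y * (1 - fps_const \<rho> * j) = fps_const \<eta>"
    using j(1) by (simp add: y_def mult.assoc inverse_mult_eq_1)
  have f: "f * (1 + j) = - fps_const c_var * (1 + (fps_const \<rho>)^2 * j)^3 * (1 + y^2 * j)"
    using j(1) by (simp add: f_def mult.assoc inverse_mult_eq_1)
  have "f = fps_X * Abs_fps (\<lambda>k. emb (M k 0)) - fps_const c_var"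
    by (rule alternating_gf[OF assms(1) G e, folded g_def \<rho>_def \<eta>_def, OF _ j(1,3) y f]) (simp add: g0)
  then have fhat: "fhat 4 4 (ising_weights t2 t4) (ising_weights t2 t4) = fps_to_fls f"
    by (simp add: fhat_def bracket_emb M_def alt_def fls_times_fps_to_fls)
  define J where "J = fps_to_fls j"
  define r where "r = fls_const \<rho>"
  define h where "h = inverse (r * J)"
  note hom = fls_times_fps_to_fls fps_to_fls_plus fps_to_fls_minus fps_to_fls_power fps_const_to_fls
    fps_X_to_fls fps_one_to_fls fps_to_fls_uminus
  have j0: "j \<noteq> 0" using j(2) g0 by auto
  have nz: "J \<noteq> 0" "r \<noteq> 0" using j0 \<rho>0 by (simp_all add: J_def r_def)
  have unit: "1 + J \<noteq> 0" "1 - r * J \<noteq> 0" "1 + r^2 * J \<noteq> 0"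
  proof -
    have "1 + j \<noteq> 0" "1 - fps_const \<rho> * j \<noteq> 0" "1 + (fps_const \<rho>)^2 * j \<noteq> 0"
      using j(1) by (auto simp: fps_eq_iff intro!: exI[of _ 0] simp del: fps_const_power)
    then have "fps_to_fls (1 + j) \<noteq> 0" "fps_to_fls (1 - fps_const \<rho> * j) \<noteq> 0" "fps_to_fls (1 + (fps_const \<rho>)^2 * j) \<noteq> 0"
      by (simp_all only: fps_to_fls_eq_0_iff not_False_eq_True)
    then show "1 + J \<noteq> 0" "1 - r * J \<noteq> 0" "1 + r^2 * J \<noteq> 0"
      unfolding hom J_def r_def by simp_all
  qed
  have \<alpha>: "fls_const \<alpha>3 = fls_const \<gamma> * r" "fls_const \<alpha>1 = fls_const \<gamma> * fls_const \<eta>" "fls_const \<gamma> \<noteq> 0"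
    "fls_const g = (fls_const \<gamma>)^2"
    using par by (simp_all add: r_def fls_const_power[symmetric])
  have h: "r * J * h = 1" unfolding h_def using nz by (intro right_inverse) simp
  have X: "fls_X_inv * fls_X = (1 :: 'a fls fls fls)" by (simp flip: fls_inverse_X)
  have "fls_X * (fls_const \<gamma>)^2 * (1 + J)^2 = J * (1 + r^2 * J)^2"
    using arg_cong[OF j(3), of fps_to_fls] unfolding hom J_def[symmetric] r_def[symmetric] \<alpha>(4) .
  then have "fls_X_inv * (J * (1 + r^2 * J)^2) = (fls_const \<gamma>)^2 * (1 + J)^2" using X by algebra
  then have omega: "omega_sym (fls_const \<gamma>) (fls_const \<alpha>3) h = omega_var"
    unfolding \<alpha> omega_var_def by (intro omega_sym_param[OF h nz \<alpha>(3) unit])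
  have "fps_to_fls f * (1 + J) = - fls_const c_var * (1 + r^2 * J)^3 * (1 + (fps_to_fls y)^2 * J)"
    using arg_cong[OF f, of fps_to_fls] unfolding hom J_def[symmetric] r_def[symmetric] .
  moreover have "fps_to_fls y * (1 - r * J) = fls_const \<eta>"
    using arg_cong[OF y, of fps_to_fls] unfolding hom J_def[symmetric] r_def[symmetric] .
  ultimately have fsym: "fhat_sym (fls_const c_var) (fls_const \<gamma>) (fls_const \<alpha>1) (fls_const \<alpha>3) h
      = fhat 4 4 (ising_weights t2 t4) (ising_weights t2 t4)"
    unfolding \<alpha> fhat by (intro fhat_sym_param[OF h nz \<alpha>(3) unit])
  \<comment> \<open>\<open>j\<close> vanishes to order exactly 1 in \<open>1/\<omega>\<close> and
    \<open>\<rho>\<close> is a nonzero constant, so \<open>h = 1 / (\<rho> * j)\<close> has a simple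
    pole there.\<close>
  have "subdegree j = 1" by (rule subdegreeI) (use j(1,2) g0 in auto)
  then have "fls_subdegree J = 1" by (simp add: J_def fls_subdegree_fls_to_fps)
  moreover have "fls_subdegree r = 0" by (simp add: r_def)
  moreover have "h \<noteq> 0" using h by auto
  ultimately have "fls_subdegree h = - 1"
    using arg_cong[OF h, of fls_subdegree] nz by simp
  then have "poly (map_poly fls_const p) h \<noteq> 0" if "p \<noteq> 0" for p
    using fls_subdegree_poly_negative[of h p] that by simp
  then interpret transcendental_point fls_const h
    by unfold_locales (simp_all add: fls_plus_const)
  have "vanishing_ideal fls_const (omega_sym (fls_const \<gamma>) (fls_const \<alpha>3) h)
        (fhat_sym (fls_const c_var) (fls_const \<gamma>) (fls_const \<alpha>1) (fls_const \<alpha>3) h)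
      = vanishing_ideal const_ratfun
               (omega_sym (const_ratfun \<gamma>) (const_ratfun \<alpha>3) h_var)
               (fhat_sym (const_ratfun c_var) (const_ratfun \<gamma>) (const_ratfun \<alpha>1)
                  (const_ratfun \<alpha>3) h_var)"
    by (intro vanishing_ideal_eq spec_omega_sym spec_fhat_sym spec_const spec_h_var)
  then show ?thesis using omega fsym by auto
qed

end
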